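(* Let $a(z)$ be a rational function, and let $P(z,f)$ and $Q(z,f)$ be coprime polynomials in $f$ with coefficients that are rational functions of $z$. Let $f(z)$ be a subnormal transcendental meromorphic solution of $$f(z+1)f(z-1)+a(z)S(f,z)=R(z,f(z))=\frac{P(z,f(z))}{Q(z,f(z))}.$$ Let $Q(z,f)$ be of the form $$Q(z,f)=(f-b_1(z))^2\,\hat{Q}(z,f),$$ where $b_1(z)$ is a rational function and $\hat{Q}(z,f)$ is a polynomial in $f$ with rational coefficients such that $\hat{Q}(z,f)$ and $f-b_1$ are coprime. If either (i) $\deg_f P=\deg_f Q+1$ and $f-b_1$ has only finitely many double zeros, or (ii) $\deg_f P=\deg_f Q+2$, then $f-b_1$ has infinitely many simple zeros.
   Context: Meromorphic means meromorphic in the whole complex plane $\mathbb{C}$; transcendental means not rational. The Schwarzian derivative is $S(f,z):=\frac{f'''(z)}{f'(z)}-\frac32\left(\frac{f''(z)}{f'(z)}\right)^2$. $T(r,f)$ is the Nevanlinna characteristic function. A transcendental meromorphic function $f$ is called subnormal if $\sigma_f:=\limsup_{r\to\infty}\frac{\log T(r,f)}{r}=0$. $\deg_f P$ and $\deg_f Q$ are the degrees in the variable $f$. Zeros of $f-b_1$ are the zeros $z\in\mathbb{C}$ of the meromorphic function $f(z)-b_1(z)$; a double zero is a zero of multiplicity exactly $2$. *)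

theory Defs
  imports
    "HOL-Complex_Analysis.Complex_Analysis"
    "HOL-Computational_Algebra.Computational_Algebra"
    "HOL-Computational_Algebra.Field_as_Ring"
begin

text \<open>
  Meromorphic functions are total functions \<open>complex \<Rightarrow> complex\<close> that are
  \<open>meromorphic_on UNIV\<close>. Their values at the points of a discrete closed set carry no information,
  so identities between them are stated on \<open>cosparse UNIV\<close>, and zeros and poles are read off from
  the local behaviour on a punctured neighbourhood (\<open>zorder\<close>, \<open>is_pole\<close>).
\<close>

type_synonym ratfun = "complex poly fract"

text \<open>
  \<open>quot_of_fract\<close> yields the reduced fraction, so this is the value of the rational function
  wherever it is finite; at its poles the value is \<open>0\<close>.
\<close>
definition ratfun_eval :: "ratfun \<Rightarrow> complex \<Rightarrow> complex" where
  "ratfun_eval q z = poly (fst (quot_of_fract q)) z / poly (snd (quot_of_fract q)) z"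

lemma ratfun_eval_0 [simp]: "ratfun_eval 0 z = 0"
  by (simp add: ratfun_eval_def)

lemma ratfun_eval_Fract:
  assumes "poly q z \<noteq> 0"
  shows "ratfun_eval (Fract p q) z = poly p z / poly q z"
proof -
  define a b where "a = fst (quot_of_fract (Fract p q))" and "b = snd (quot_of_fract (Fract p q))"
  have q: "q \<noteq> 0" using assms by auto
  have b: "b \<noteq> 0" by (simp add: b_def)
  have "Fract a b = Fract p q"
    unfolding a_def b_def by (rule Fract_quot_of_fract)
  hence eq: "a * q = p * b" using q b by (simp add: eq_fract)
  have cop: "coprime a b" unfolding a_def b_def by (rule coprime_quot_of_fract)
  have "b dvd a * q" by (simp add: eq)
  hence "b dvd q" using cop by (simp add: coprime_commute coprime_dvd_mult_right_iff)
  hence "poly b z \<noteq> 0" using assms by (auto elim!: dvdE)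
  moreover have "poly a z * poly q z = poly p z * poly b z"
    using arg_cong[OF eq, of "\<lambda>r. poly r z"] by simp
  ultimately show ?thesis
    using assms by (simp add: ratfun_eval_def a_def b_def field_simps)
qed

text \<open>
  A polynomial \<open>P(z,f)\<close> in \<open>f\<close> over the rational functions of \<open>z\<close> is an element of
  \<open>ratfun poly\<close>; \<open>degree\<close> and \<open>coprime\<close> on this type refer to the variable \<open>f\<close>.
\<close>
definition ratpoly_eval :: "ratfun poly \<Rightarrow> complex \<Rightarrow> complex \<Rightarrow> complex" where
  "ratpoly_eval P z w = poly (map_poly (\<lambda>c. ratfun_eval c z) P) w"

definition transcendental_meromorphic :: "(complex \<Rightarrow> complex) \<Rightarrow> bool" where
  "transcendental_meromorphic f \<longleftrightarrow>
     f meromorphic_on UNIV \<and> \<not> (\<exists>q. \<forall>\<^sub>\<approx>z\<in>UNIV. f z = ratfun_eval q z)"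

definition schwarzian :: "(complex \<Rightarrow> complex) \<Rightarrow> complex \<Rightarrow> complex" where
  "schwarzian f z =
     (deriv ^^ 3) f z / deriv f z - 3 / 2 * ((deriv ^^ 2) f z / deriv f z)\<^sup>2"

text \<open>
  The Nevanlinna characteristic \<open>T(r,f) = m(r,f) + N(r,f)\<close>; here
  \<open>log\<^sup>+ x = max(0, log x) = log(max(1, x))\<close>.
\<close>
definition log_plus :: "real \<Rightarrow> real" where
  "log_plus x = ln (max 1 x)"

definition nev_proximity :: "(complex \<Rightarrow> complex) \<Rightarrow> real \<Rightarrow> real" where
  "nev_proximity f r = 1 / (2 * pi) * integral {0..2 * pi} (\<lambda>t. log_plus (cmod (f (of_real r * cis t))))"

definition pole_count :: "(complex \<Rightarrow> complex) \<Rightarrow> real \<Rightarrow> real" where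
  "pole_count f r = (\<Sum>z | cmod z \<le> r \<and> is_pole f z. - of_int (zorder f z))"

definition nev_counting :: "(complex \<Rightarrow> complex) \<Rightarrow> real \<Rightarrow> real" where
  "nev_counting f r =
     integral {0..r} (\<lambda>t. (pole_count f t - pole_count f 0) / t) + pole_count f 0 * ln r"

definition nev_characteristic :: "(complex \<Rightarrow> complex) \<Rightarrow> real \<Rightarrow> real" where
  "nev_characteristic f r = nev_proximity f r + nev_counting f r"

definition subnormal :: "(complex \<Rightarrow> complex) \<Rightarrow> bool" where
  "subnormal f \<longleftrightarrow> Limsup at_top (\<lambda>r. ereal (ln (nev_characteristic f r) / r)) = 0"

text \<open>
  With \<open>m > 0\<close> these are the zeros of multiplicity exactly \<open>m\<close>; \<open>zorder g z\<close> is meaningful only if \<open>g\<close> does not vanish identically near \<open>z\<close>.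
\<close>
definition zeros_of_mult :: "nat \<Rightarrow> (complex \<Rightarrow> complex) \<Rightarrow> complex set" where
  "zeros_of_mult m g = {z. m > 0 \<and> (\<exists>\<^sub>F w in at z. g w \<noteq> 0) \<and> zorder g z = int m}"

end

theory Submission
  imports Defs "HOL-Real_Asymp.Real_Asymp"
begin

text \<open>
  Suppose that \<open>g = f - b1\<close> has only finitely many simple zeros (and double zeros in case (i)). If
  \<open>g\<close> is small at \<open>z\<close>, the right-hand side of the equation is of size \<open>1 / g\<^sup>2\<close>, so
  \<open>f (z + 1)\<close> or \<open>f (z - 1)\<close> is large; if \<open>f z\<close> is large, so is one of these neighbours, and hence no
  value can serve two small values of \<open>g\<close>. The zeros of \<open>g\<close> and the poles of \<open>f\<close> obey the same
  rule up to the poles of the Schwarzian derivative, and this is where the absence of zeros of low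
  multiplicity enters. With weights \<open>(4 / 5) ^ \<bar>k\<bar>\<close> over the translates of a disc by the
  integers \<open>k\<close>, the characteristics of \<open>f\<close> (from above) and of \<open>1 / g\<close> (from below, by Jensen's
  formula at the translated centre) then satisfy an inequality with constants \<open>4 / 3\<close> and
  \<open>5 / 4\<close>, which forces the characteristic to be bounded by the error terms. The latter are
  only logarithms of the quantities that bound \<open>f'' / f'\<close> pointwise, so subnormal growth improves to
  \<open>T(r, f) = O(r)\<close>, and a second pass yields \<open>T(r, f) = O(log r)\<close>. Thus \<open>f\<close> would be rational.
\<close>

section \<open>Circle means\<close>

text \<open>Shifting one disc by 1 would force a comparison of characteristics on different discs.
  Summed over all integer translates of a disc, a shift only permutes the summands. Passing to a
  neighbour changes a weight by a factor of at most 5 / 4, which is less than the gain 4 / 3, so the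
  weighted sum absorbs itself with the margin 1 / 12. What remains are error terms and the two ends
  of the sum. At the ends the weight is exponentially small in the radius, and this is where
  subnormal growth is spent: a fixed power of the bound known on a disc of about twice the radius
  has to lose against that weight. Jensen's formula at a translated centre brings in the value of
  \<open>g\<close> there, and the end terms bring in its distance from the poles of
  \<open>f\<close>. Hence a shift \<open>s\<close> has to be found for which all the points
  \<open>s + k\<close> are good at once. All bounds are pointwise, away from small neighbourhoods of
  the zeros and poles, and enter only through their logarithms; this is why crude polynomial bounds
  suffice.\<close>

definition cmean :: "complex \<Rightarrow> real \<Rightarrow> (complex \<Rightarrow> 'a::euclidean_space) \<Rightarrow> 'a" where
  "cmean c r u = (1 / (2 * pi)) *\<^sub>R integral {0..2 * pi} (\<lambda>t. u (c + of_real r * cis t))"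

lemma ball_radius_pos: "w \<in> ball c r \<Longrightarrow> r > 0"
  for w :: "'a::metric_space"
  by (metis ball_eq_empty empty_iff not_less)

lemma circle_in_sphere: "0 \<le> r \<Longrightarrow> c + of_real r * cis t \<in> sphere c r"
  by (simp add: dist_norm norm_mult)

lemma cmean_integrable:
  fixes u :: "complex \<Rightarrow> 'a::euclidean_space"
  assumes "continuous_on (sphere c r) u" "0 \<le> r"
  shows "(\<lambda>t. u (c + of_real r * cis t)) integrable_on {0..2 * pi}"
  by (intro integrable_continuous_interval continuous_on_compose2[OF assms(1)] continuous_intros
      image_subsetI circle_in_sphere assms(2))

lemma cmean_const [simp]: "cmean c r (\<lambda>_. k) = k"
  by (simp add: cmean_def)

lemma cmean_add:
  assumes "continuous_on (sphere c r) u" "continuous_on (sphere c r) v" "0 \<le> r"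
  shows "cmean c r (\<lambda>z. u z + v z) = cmean c r u + cmean c r v"
  unfolding cmean_def
  by (simp add: integral_add cmean_integrable assms scaleR_add_right)

lemma cmean_diff:
  assumes "continuous_on (sphere c r) u" "continuous_on (sphere c r) v" "0 \<le> r"
  shows "cmean c r (\<lambda>z. u z - v z) = cmean c r u - cmean c r v"
  unfolding cmean_def
  by (simp add: integral_diff cmean_integrable assms scaleR_diff_right)

lemma cmean_cmult:
  fixes u :: "complex \<Rightarrow> real"
  shows "cmean c r (\<lambda>z. k * u z) = k * cmean c r u"
  by (simp add: cmean_def)

lemma cmean_sum:
  assumes "finite I" "\<And>i. i \<in> I \<Longrightarrow> continuous_on (sphere c r) (u i)" "0 \<le> r"
  shows "cmean c r (\<lambda>z. \<Sum>i\<in>I. u i z) = (\<Sum>i\<in>I. cmean c r (u i))"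
  unfolding cmean_def
  by (simp add: integral_sum cmean_integrable assms scaleR_right.sum)

lemma cmean_mono:
  fixes u v :: "complex \<Rightarrow> real"
  assumes "continuous_on (sphere c r) u" "continuous_on (sphere c r) v" "0 \<le> r"
    and "\<And>z. z \<in> sphere c r \<Longrightarrow> u z \<le> v z"
  shows "cmean c r u \<le> cmean c r v"
  unfolding cmean_def
  by (auto intro!: divide_right_mono integral_le cmean_integrable assms circle_in_sphere simp: assms)

lemma cmean_nonneg:
  fixes u :: "complex \<Rightarrow> real"
  assumes "continuous_on (sphere c r) u" "0 \<le> r"
    and "\<And>z. z \<in> sphere c r \<Longrightarrow> 0 \<le> u z"
  shows "0 \<le> cmean c r u"
  using cmean_mono[of c r "\<lambda>_. 0" u] assms by simp

lemma cmean_cong: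
  assumes "\<And>z. z \<in> sphere c r \<Longrightarrow> u z = v z" "0 \<le> r"
  shows "cmean c r u = cmean c r v"
proof -
  have "(\<lambda>t. u (c + of_real r * cis t)) = (\<lambda>t. v (c + of_real r * cis t))"
    using assms circle_in_sphere[OF assms(2)] by blast
  thus ?thesis by (simp only: cmean_def)
qed

lemma cmean_cong':
  assumes "\<And>t. u (c + of_real r * cis t) = v (c' + of_real r' * cis t)"
  shows "cmean c r u = cmean c' r' v"
  unfolding cmean_def by (simp add: assms)

lemma cmean_norm_le:
  fixes u :: "complex \<Rightarrow> 'a::euclidean_space"
  assumes "continuous_on (sphere c r) u" "0 \<le> r"
  shows "norm (cmean c r u) \<le> cmean c r (\<lambda>z. norm (u z))"
proof -
  have "norm (integral {0..2 * pi} (\<lambda>t. u (c + of_real r * cis t)))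
     \<le> integral {0..2 * pi} (\<lambda>t. norm (u (c + of_real r * cis t)))"
    by (intro integral_norm_bound_integral cmean_integrable[of c r "\<lambda>z. norm (u z)"] cmean_integrable
        continuous_intros assms) auto
  thus ?thesis by (simp add: cmean_def divide_right_mono)
qed

lemma cmean_linear:
  fixes u :: "complex \<Rightarrow> 'a::euclidean_space" and h :: "'a \<Rightarrow> 'b::euclidean_space"
  assumes "bounded_linear h" "continuous_on (sphere c r) u" "0 \<le> r"
  shows "cmean c r (\<lambda>z. h (u z)) = h (cmean c r u)"
proof -
  interpret bounded_linear h by fact
  have "integral {0..2 * pi} (h \<circ> (\<lambda>t. u (c + of_real r * cis t)))
      = h (integral {0..2 * pi} (\<lambda>t. u (c + of_real r * cis t)))"
    by (rule integral_linear[OF cmean_integrable assms(1)]) (use assms in auto)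
  thus ?thesis by (simp add: cmean_def scaleR o_def)
qed

text \<open>The factor \<open>z - c\<close> arises from dz = i (z - c) dt on the circle.\<close>

lemma contour_integral_circlepath_cmean:
  assumes "r > 0" "(f has_contour_integral I) (circlepath c r)"
  shows "cmean c r (\<lambda>z. f z * (z - c)) = I / (2 * pi * \<i>)"
proof -
  have "((\<lambda>t. f (c + r * cis t) * r * \<i> * cis t) has_integral I) {0..2*pi}"
    using assms(2) unfolding circlepath_def
    by (subst (asm) has_contour_integral_part_circlepath_iff) auto
  hence "((\<lambda>t. (f (c + r * cis t) * r * \<i> * cis t) / \<i>) has_integral I / \<i>) {0..2*pi}"
    by (rule has_integral_divide)
  hence "integral {0..2*pi} (\<lambda>t. (f (c + r * cis t) * r * \<i> * cis t) / \<i>) = I / \<i>"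
    by (rule integral_unique)
  moreover have "(\<lambda>t. (f (c + r * cis t) * r * \<i> * cis t) / \<i>)
      = (\<lambda>t. f (c + r * cis t) * (r * cis t))"
    by (auto simp: field_simps)
  ultimately have "integral {0..2*pi} (\<lambda>t. f (c + r * cis t) * (r * cis t)) = I / \<i>" by (simp only:)
  thus ?thesis by (simp add: cmean_def scaleR_conv_of_real field_simps)
qed

lemma cmean_Cauchy:
  assumes "continuous_on (cball c r) f" "f holomorphic_on ball c r" "w \<in> ball c r"
  shows "cmean c r (\<lambda>z. f z / (z - w) ^ Suc k * (z - c)) = (deriv ^^ k) f w / fact k"
proof -
  have "r > 0" using assms(3) by (rule ball_radius_pos)
  from contour_integral_circlepath_cmean[OF this Cauchy_has_contour_integral_higher_derivative_circlepath[OF assms]]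
  show ?thesis by simp
qed

lemma cmean_holomorphic:
  assumes "continuous_on (cball c r) f" "f holomorphic_on ball c r" "r > 0"
  shows "cmean c r f = f c"
proof -
  have "cmean c r (\<lambda>z. f z / (z - c) ^ Suc 0 * (z - c)) = cmean c r f"
    by (rule cmean_cong) (use \<open>r > 0\<close> in \<open>auto simp: dist_norm\<close>)
  with cmean_Cauchy[OF assms(1,2), of c 0] \<open>r > 0\<close> show ?thesis by simp
qed

lemma cmean_Re_holomorphic:
  assumes "continuous_on (cball c r) f" "f holomorphic_on ball c r" "r > 0"
  shows "cmean c r (\<lambda>z. Re (f z)) = Re (f c)"
proof -
  have "continuous_on (sphere c r) f" using assms(1) by (rule continuous_on_subset) auto
  thus ?thesis
    using cmean_linear[OF bounded_linear_Re, of c r f] cmean_holomorphic[OF assms] assms(3) by simp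
qed

text \<open>If \<open>w\<close> has modulus r, then \<open>w * cnj w\<close> is the square of r, and
  the left side vanishes at the reflection of \<open>x\<close> in that circle. So \<open>x\<close>
  may be traded for its reflection when only moduli on the circle matter.\<close>

lemma circle_reflection:
  fixes w x :: complex
  assumes "w \<noteq> 0"
  shows "1 - cnj x * w / (w * cnj w) = cnj (w - x) / cnj w"
  using assms by (simp add: field_simps)

text \<open>On the circle the distance to \<open>a\<close> is r times the modulus of a function
  whose zero is the reflection of \<open>a\<close>, outside the closed disc. The logarithm of that
  function is holomorphic in the disc and vanishes at the centre, so its real part has mean
  0.\<close>

lemma cmean_ln_dist:
  assumes "cmod (a - c) < r"
  shows "cmean c r (\<lambda>z. ln (cmod (z - a))) = ln r"
proof -
  have r: "r > 0" using assms by (meson norm_ge_zero order.strict_trans1)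
  define F where "F = (\<lambda>z. Ln (1 - cnj (a - c) * (z - c) / of_real (r^2)))"
  have small: "cmod (cnj (a - c) * (z - c) / of_real (r^2)) < 1" if "z \<in> cball c r" for z
  proof -
    have "cmod (cnj (a - c) * (z - c) / of_real (r^2)) = cmod (a - c) * cmod (z - c) / r^2"
      by (simp add: norm_mult norm_divide norm_power del: of_real_power complex_cnj_diff)
    also have "\<dots> \<le> cmod (a - c) * r / r^2"
      using that r by (intro divide_right_mono mult_left_mono) (auto simp: dist_norm norm_minus_commute)
    also have "\<dots> < 1" using assms r by (simp add: power2_eq_square)
    finally show ?thesis .
  qed
  have np: "1 - cnj (a - c) * (z - c) / of_real (r^2) \<notin> \<real>\<^sub>\<le>\<^sub>0" if "z \<in> cball c r" for z
  proof
    let ?w = "cnj (a - c) * (z - c) / of_real (r^2)"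
    assume "1 - ?w \<in> \<real>\<^sub>\<le>\<^sub>0"
    hence "Re (1 - ?w) \<le> 0" by (simp add: complex_nonpos_Reals_iff)
    hence "Re ?w \<ge> 1" by simp
    with small[OF that] abs_Re_le_cmod[of ?w] show False by linarith
  qed
  have hol: "F holomorphic_on cball c r"
    unfolding F_def by (intro holomorphic_intros) (use np r in auto)
  have "ln (cmod (z - a)) = ln r + Re (F z)" if z: "z \<in> sphere c r" for z
  proof -
    let ?x = "a - c" and ?w = "z - c"
    have nw: "cmod ?w = r" using z by (simp add: dist_norm norm_minus_commute)
    have "of_real (r^2) = ?w * cnj ?w" using nw by (metis complex_norm_square)
    moreover have "?w \<noteq> 0" using nw r by auto
    ultimately have eq: "1 - cnj ?x * ?w / of_real (r^2) = cnj (?w - ?x) / cnj ?w"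
      by (simp only: circle_reflection not_False_eq_True)
    have za: "z \<noteq> a" using z assms by (auto simp: dist_norm norm_minus_commute)
    have "F z = Ln (cnj (?w - ?x) / cnj ?w)" by (simp only: F_def eq)
    moreover have "Re (Ln (cnj (?w - ?x) / cnj ?w)) = ln (cmod (cnj (?w - ?x) / cnj ?w))"
      using za nw r by (intro Re_Ln) auto
    moreover have "cmod (cnj (?w - ?x) / cnj ?w) = cmod (z - a) / r"
      using nw by (simp add: norm_divide del: complex_cnj_diff)
    ultimately have "Re (F z) = ln (cmod (z - a) / r)" by simp
    thus ?thesis using za r by (simp add: ln_div)
  qed
  hence "cmean c r (\<lambda>z. ln (cmod (z - a))) = cmean c r (\<lambda>z. ln r + Re (F z))"
    using r by (intro cmean_cong) auto
  also have "\<dots> = ln r + cmean c r (\<lambda>z. Re (F z))"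
    using r hol by (subst cmean_add)
      (auto intro!: continuous_intros dest!: holomorphic_on_imp_continuous_on intro: continuous_on_subset)
  also have "cmean c r (\<lambda>z. Re (F z)) = Re (F c)"
    using hol r by (intro cmean_Re_holomorphic)
      (auto intro: holomorphic_on_imp_continuous_on holomorphic_on_subset)
  finally show ?thesis by (simp add: F_def)
qed

text \<open>
  On the circle \<open>cnj (\<zeta> - c) = r\<^sup>2 / (\<zeta> - c)\<close>, so the complex conjugate of \<open>cnj f\<close> times the
  Cauchy kernel is again holomorphic in the disc and vanishes at the centre. Hence \<open>f\<close> may be
  replaced by \<open>2 Re f\<close> in Cauchy's formula for the derivative.
\<close>
lemma deriv_bound_cmean_Re:
  assumes "continuous_on (cball c r) f" "f holomorphic_on ball c r" "z \<in> ball c r"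
  shows "cmod (deriv f z) \<le> 2 * r / (r - cmod (z - c))\<^sup>2 * cmean c r (\<lambda>w. \<bar>Re (f w)\<bar>)"
proof -
  have r: "r > 0" using assms(3) by (rule ball_radius_pos)
  have zr: "cmod (z - c) < r" using assms(3) by (simp add: dist_norm norm_minus_commute)
  have cs: "continuous_on (sphere c r) f"
    using assms(1) by (rule continuous_on_subset) auto
  have ne: "w \<noteq> z" if "w \<in> sphere c r" for w
    using that zr by (auto simp: dist_norm norm_minus_commute)
  define D where "D = (\<lambda>w. of_real (r^2) - cnj (z - c) * (w - c))"
  have Dn: "D w \<noteq> 0" if "w \<in> cball c r" for w
  proof
    assume "D w = 0"
    hence "r^2 = cmod (cnj (z - c) * (w - c))" using r
      by (metis D_def abs_of_nonneg eq_iff_diff_eq_0 norm_of_real zero_le_power2)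
    also have "\<dots> \<le> cmod (z - c) * r" unfolding norm_mult
      using that by (intro mult_mono) (auto simp: dist_norm norm_minus_commute simp del: complex_cnj_diff)
    also have "\<dots> < r * r" using zr r by simp
    finally show False by (simp add: power2_eq_square)
  qed
  define H where "H = (\<lambda>w. f w * of_real (r^2) * (w - c) / (D w)\<^sup>2)"
  have cH: "continuous_on (cball c r) H" unfolding H_def
    using Dn by (intro continuous_intros assms) (auto simp: D_def intro!: continuous_intros)
  have hH: "H holomorphic_on ball c r" unfolding H_def
    using Dn by (intro holomorphic_intros assms) (auto simp: D_def intro!: holomorphic_intros)
  have H0: "cmean c r H = 0"
    using cmean_holomorphic[OF cH hH r] by (simp add: H_def)
  let ?K = "\<lambda>w. (w - c) / (w - z)^2"
  have cK: "continuous_on (sphere c r) ?K"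
    using ne by (intro continuous_intros) auto
  have conj: "cnj (H w) = cnj (f w) * ?K w" if w: "w \<in> sphere c r" for w
  proof -
    let ?x = "z - c" and ?w = "w - c"
    have nw: "cmod ?w = r" using w by (simp add: dist_norm norm_minus_commute)
    have r2: "of_real (r^2) = ?w * cnj ?w" using nw by (metis complex_norm_square)
    have w0: "?w \<noteq> 0" using nw r by auto
    have "D w = ?w * cnj (?w - ?x)" unfolding D_def r2 by (simp add: algebra_simps)
    hence "H w = f w * (?w * cnj ?w) * ?w / (?w * cnj (?w - ?x))\<^sup>2"
      unfolding H_def r2 by simp
    also have "\<dots> = f w * cnj ?w / (cnj (?w - ?x))\<^sup>2"
    proof -
      have "g * (x * y) * x / (x * d)\<^sup>2 = g * y / d\<^sup>2" if "x \<noteq> 0" for g x y d :: complex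
        using that by (simp add: power2_eq_square)
      from this[OF w0] show ?thesis .
    qed
    also have "\<dots> = f w * cnj ?w / (cnj (w - z))\<^sup>2" by simp
    finally show ?thesis by simp
  qed
  have "cmean c r (\<lambda>w. cnj (f w) * ?K w) = cmean c r (\<lambda>w. cnj (H w))"
    using r conj by (intro cmean_cong) auto
  also have "\<dots> = cnj (cmean c r H)"
    using cH r by (intro cmean_linear bounded_linear_cnj) (auto intro: continuous_on_subset)
  finally have 1: "cmean c r (\<lambda>w. cnj (f w) * ?K w) = 0" using H0 by simp
  have "cmean c r (\<lambda>w. f w * ?K w) = cmean c r (\<lambda>w. f w / (w - z) ^ Suc 1 * (w - c))"
    by (simp add: power2_eq_square)
  also have "\<dots> = deriv f z" by (subst cmean_Cauchy[OF assms]) simp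
  finally have 2: "cmean c r (\<lambda>w. f w * ?K w) = deriv f z" .
  have "deriv f z = cmean c r (\<lambda>w. f w * ?K w + cnj (f w) * ?K w)"
  proof -
    have "continuous_on (sphere c r) (\<lambda>w. f w * ?K w)" "continuous_on (sphere c r) (\<lambda>w. cnj (f w) * ?K w)"
      by (intro continuous_intros cs cK)+
    from cmean_add[OF this] r show ?thesis by (simp only: 1 2 less_imp_le) simp
  qed
  also have "\<dots> = cmean c r (\<lambda>w. of_real (2 * Re (f w)) * ?K w)"
    by (rule arg_cong[of _ _ "cmean c r"]) (auto simp: fun_eq_iff complex_add_cnj simp flip: distrib_right add_divide_distrib)
  finally have eq: "deriv f z = cmean c r (\<lambda>w. of_real (2 * Re (f w)) * ?K w)" .
  have "cmod (deriv f z) \<le> cmean c r (\<lambda>w. cmod (of_real (2 * Re (f w)) * ?K w))"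
    unfolding eq using r ne by (intro cmean_norm_le continuous_intros cs) auto
  also have "\<dots> \<le> cmean c r (\<lambda>w. 2 * r / (r - cmod (z - c))\<^sup>2 * \<bar>Re (f w)\<bar>)"
  proof (rule cmean_mono)
    fix w assume w: "w \<in> sphere c r"
    have nw: "cmod (w - c) = r" using w by (simp add: dist_norm norm_minus_commute)
    have "r - cmod (z - c) \<le> cmod (w - z)"
      using norm_triangle_ineq2[of "w - c" "z - c"] nw by simp
    hence "r / cmod (w - z) ^ 2 \<le> r / (r - cmod (z - c)) ^ 2"
      using zr r ne[OF w] by (intro divide_left_mono power_mono mult_pos_pos) auto
    hence le: "2 * \<bar>Re (f w)\<bar> * (r / cmod (w - z) ^ 2) \<le> 2 * \<bar>Re (f w)\<bar> * (r / (r - cmod (z - c)) ^ 2)"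
      by (intro mult_left_mono) auto
    thus "cmod (of_real (2 * Re (f w)) * ?K w) \<le> 2 * r / (r - cmod (z - c))\<^sup>2 * \<bar>Re (f w)\<bar>"
    proof -
      have "cmod (of_real (2 * Re (f w)) * ?K w) = 2 * \<bar>Re (f w)\<bar> * (r / cmod (w - z) ^ 2)"
        unfolding norm_mult norm_divide norm_power nw norm_of_real by (simp add: abs_mult)
      with le show ?thesis by (simp add: mult_ac)
    qed
  qed (use r ne zr in \<open>auto intro!: continuous_intros cs\<close>)
  also have "\<dots> = 2 * r / (r - cmod (z - c))\<^sup>2 * cmean c r (\<lambda>w. \<bar>Re (f w)\<bar>)"
    by (rule cmean_cmult)
  finally show ?thesis .
qed

section \<open>Zeros, poles and Jensen's formula\<close>

definition nzm :: "(complex \<Rightarrow> complex) \<Rightarrow> bool" where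
  "nzm h \<longleftrightarrow> h meromorphic_on UNIV \<and> (\<forall>\<^sub>\<approx>z\<in>UNIV. h z \<noteq> 0)"

text \<open>Besides zeros and poles this set contains removable singularities and points that carry
  an arbitrary value. Off this set the values of \<open>h\<close> may be taken literally.\<close>

definition irr :: "(complex \<Rightarrow> complex) \<Rightarrow> complex set" where
  "irr h = {z. \<not> (h analytic_on {z} \<and> h z \<noteq> 0)}"

text \<open>The support of the divisor in the open disc. Unlike \<open>irr\<close>, it is blind to
  arbitrary values at isolated points.\<close>

definition zpset :: "(complex \<Rightarrow> complex) \<Rightarrow> complex \<Rightarrow> real \<Rightarrow> complex set" where
  "zpset h c r = {a \<in> ball c r. zorder h a \<noteq> 0}"

lemma nzm_meromorphic: "nzm h \<Longrightarrow> h meromorphic_on A"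
  unfolding nzm_def using meromorphic_on_subset by blast

lemma nzm_eventually_nz: "nzm h \<Longrightarrow> eventually (\<lambda>w. h w \<noteq> 0) (at z)"
  unfolding nzm_def by (auto simp: eventually_cosparse_open_eq)

lemma nzm_frequently_nz: "nzm h \<Longrightarrow> frequently (\<lambda>w. h w \<noteq> 0) (at z)"
  by (intro eventually_frequently nzm_eventually_nz) auto

lemma meromorphic_zero_or_nzm:
  assumes "h meromorphic_on UNIV"
  shows "nzm h \<or> (\<forall>\<^sub>\<approx>z\<in>UNIV. h z = 0)"
  using meromorphic_imp_constant_or_avoid[OF assms, of 0] assms by (auto simp: nzm_def)

lemma irr_sparse: "nzm h \<Longrightarrow> irr h sparse_in UNIV"
proof -
  assume h: "nzm h"
  have "\<forall>\<^sub>\<approx>z\<in>UNIV. h analytic_on {z}"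
    by (rule meromorphic_on_imp_analytic_cosparse[OF nzm_meromorphic[OF h]])
  moreover have "\<forall>\<^sub>\<approx>z\<in>UNIV. h z \<noteq> 0" using h by (simp add: nzm_def)
  ultimately have "\<forall>\<^sub>\<approx>z\<in>UNIV. h analytic_on {z} \<and> h z \<noteq> 0" by eventually_elim auto
  thus ?thesis unfolding irr_def by (simp add: eventually_cosparse)
qed

lemma sparse_finite_Int_cball: "A sparse_in UNIV \<Longrightarrow> finite (A \<inter> cball c r)"
  for A :: "complex set"
  by (metis compact_cball inf_commute sparse_in_compact_finite sparse_in_subset subset_UNIV)

lemma irr_finite: "nzm h \<Longrightarrow> finite (irr h \<inter> cball c r)"
  by (intro sparse_finite_Int_cball irr_sparse)

lemma zorder_not_irr: "z \<notin> irr h \<Longrightarrow> zorder h z = 0"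
  by (auto simp: irr_def intro: zorder_eq_0I)

lemma zpset_subset_irr: "zpset h c r \<subseteq> irr h \<inter> cball c r"
  using zorder_not_irr by (auto simp: zpset_def)

lemma finite_zpset [intro]: "nzm h \<Longrightarrow> finite (zpset h c r)"
  using finite_subset[OF zpset_subset_irr irr_finite] .

lemma zorder_linear_powi:
  "zorder (\<lambda>w. (w - a) powi n) z = (if z = a then n else 0)"
proof (cases "z = a")
  case True
  have "zorder (\<lambda>w. (w - a) powi n) a = n"
    by (rule zorder_eqI[of UNIV _ "\<lambda>_. 1"]) auto
  thus ?thesis using True by simp
next
  case False
  have "(\<lambda>w. (w - a) powi n) analytic_on {z}"
    by (intro analytic_intros) (use False in auto)
  hence "zorder (\<lambda>w. (w - a) powi n) z = 0"
    by (rule zorder_eq_0I) (use False in auto)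
  thus ?thesis using False by simp
qed

lemma zorder_prod_linear_powi:
  assumes "finite A"
  shows "zorder (\<lambda>w. \<Prod>a\<in>A. (w - a) powi (n a)) z = (if z \<in> A then n z else 0)"
proof -
  have "eventually (\<lambda>w. \<forall>a\<in>A. w \<noteq> a) (at z)"
    using assms by (auto simp: eventually_ball_finite_distrib intro!: eventually_neq_at_within)
  hence "eventually (\<lambda>w. (\<Prod>a\<in>A. (w - a) powi (n a)) \<noteq> 0) (at z)"
    by eventually_elim (use assms in auto)
  hence "zorder (\<lambda>w. \<Prod>a\<in>A. (w - a) powi (n a)) z = (\<Sum>a\<in>A. zorder (\<lambda>w. (w - a) powi (n a)) z)"
    by (intro zorder_prod) (auto intro!: meromorphic_intros)
  also have "\<dots> = (\<Sum>a\<in>A. if z = a then n a else 0)"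
    by (simp add: zorder_linear_powi)
  also have "\<dots> = (if z \<in> A then n z else 0)"
    using assms by (simp add: sum.delta)
  finally show ?thesis .
qed

text \<open>Provides the margin that makes later functions holomorphic on the closed disc. Near the
  circle there are only finitely many points of \<open>S\<close>, so their distances from
  \<open>c\<close> keep away from \<open>r\<close>.\<close>

lemma enlarge_clean_ball:
  fixes S :: "complex set"
  assumes "finite (S \<inter> cball c (r + 1))" "S \<inter> sphere c r = {}"
  obtains r' :: real where "r' > r" "S \<inter> ball c r' \<subseteq> ball c r"
proof -
  have "finite (dist c ` (S \<inter> cball c (r + 1)))" using assms(1) by blast
  from finite_set_avoid[OF this, of r] obtain d where d: "d > 0"
    "\<forall>x\<in>dist c ` (S \<inter> cball c (r + 1)). x \<noteq> r \<longrightarrow> d \<le> dist r x" by blast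
  show ?thesis
  proof (rule that[of "r + min d 1"])
    show "S \<inter> ball c (r + min d 1) \<subseteq> ball c r"
    proof
      fix x assume x: "x \<in> S \<inter> ball c (r + min d 1)"
      hence "dist c x \<noteq> r" using assms(2) by auto
      hence "d \<le> dist r (dist c x)" using d(2) x by auto
      thus "x \<in> ball c r" using x by (auto simp: dist_real_def)
    qed
  qed (use d in auto)
qed

text \<open>Division by the finite product with the same divisor leaves, once the removable
  singularities are filled, a holomorphic function without zeros on a disc, and such a function has
  a logarithm \<open>G\<close>.\<close>

lemma meromorphic_factorization:
  assumes h: "nzm h" and r: "r > 0" and clean: "irr h \<inter> sphere c r = {}"
  obtains G r' where "r' > r" "G holomorphic_on ball c r'" "irr h \<inter> ball c r' \<subseteq> ball c r"
    "\<And>z. z \<in> ball c r' - irr h \<Longrightarrow> h z = exp (G z) * (\<Prod>a\<in>zpset h c r. (z - a) powi zorder h a)"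
proof -
  obtain r' where r': "r' > r" "irr h \<inter> ball c r' \<subseteq> ball c r"
    using enlarge_clean_ball[OF irr_finite[OF h] clean] by metis
  define A where "A = zpset h c r"
  have fA: "finite A" using h by (auto simp: A_def)
  define q where "q = (\<lambda>z. \<Prod>a\<in>A. (z - a) powi zorder h a)"
  define \<phi> where "\<phi> = (\<lambda>z. h z / q z)"
  have qm: "q meromorphic_on X" for X unfolding q_def by (auto intro!: meromorphic_intros)
  have mer: "\<phi> meromorphic_on X" for X
    unfolding \<phi>_def by (intro meromorphic_intros qm nzm_meromorphic h)
  have q0: "q z \<noteq> 0" if "z \<notin> A" for z using that fA by (auto simp: q_def)
  have evA: "eventually (\<lambda>w. w \<notin> A) (at z)" for z
    using fA islimpt_finite islimpt_iff_eventually by blast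
  have evq: "eventually (\<lambda>w. q w \<noteq> 0) (at z)" for z
    using evA[of z] by eventually_elim (rule q0)
  have ev\<phi>: "eventually (\<lambda>w. \<phi> w \<noteq> 0) (at z)" for z
    using evq[of z] nzm_eventually_nz[OF h, of z] by eventually_elim (auto simp: \<phi>_def)
  have zo: "zorder \<phi> z = 0" if z: "z \<in> ball c r'" for z
  proof -
    have "zorder \<phi> z = zorder h z - zorder q z"
      unfolding \<phi>_def by (intro zorder_divide nzm_meromorphic h qm nzm_frequently_nz eventually_frequently evq) auto
    also have "zorder q z = (if z \<in> A then zorder h z else 0)"
      unfolding q_def by (rule zorder_prod_linear_powi[OF fA])
    also have "zorder h z - \<dots> = 0"
    proof -
      have "zorder h z \<noteq> 0 \<Longrightarrow> z \<in> A"
        using z r'(2) zorder_not_irr[of z h] unfolding A_def zpset_def by blast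
      thus ?thesis by auto
    qed
    finally show ?thesis .
  qed
  define \<psi> where "\<psi> = remove_sings \<phi>"
  have iso: "isolated_singularity_at \<phi> z" and ness: "not_essential \<phi> z" for z
    using mer[of "{z}"] by (auto simp: meromorphic_at_iff)
  have ana: "\<psi> analytic_on {z}" if "z \<in> ball c r'" for z
  proof -
    have "\<not> is_pole \<phi> z"
      using isolated_pole_imp_neg_zorder[OF iso, of z] zo[OF that] by auto
    then obtain l where "\<phi> \<midarrow>z\<rightarrow> l" using ness[of z] by (auto simp: not_essential_def)
    thus ?thesis unfolding \<psi>_def by (intro remove_sings_analytic_at iso)
  qed
  have \<psi>0: "\<psi> z \<noteq> 0" if "z \<in> ball c r'" for z
  proof -
    have "eventually (\<lambda>w. \<psi> w \<noteq> 0) (at z)"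
      using eventually_remove_sings_eq_at[OF iso] ev\<phi>[of z] unfolding \<psi>_def by eventually_elim auto
    moreover have "zorder \<psi> z = 0" using zo[OF that] iso by (simp add: \<psi>_def)
    ultimately show ?thesis
      using zorder_eq_0_iff[OF ana[OF that]] eventually_frequently[of "at z"] by auto
  qed
  have "\<psi> analytic_on ball c r'" using ana by (simp add: analytic_on_analytic_at[of _ "ball c r'"])
  hence hol: "\<psi> holomorphic_on ball c r'" by (rule analytic_imp_holomorphic)
  from holomorphic_logarithm_exists[OF convex_ball open_ball hol \<psi>0, of c] r r'
  obtain G where G: "G holomorphic_on ball c r'" "\<And>z. z \<in> ball c r' \<Longrightarrow> exp (G z) = \<psi> z"
    by (metis centre_in_ball order_less_trans)
  show ?thesis
  proof (rule that[OF r'(1) G(1) r'(2)])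
    fix z assume z: "z \<in> ball c r' - irr h"
    hence zA: "z \<notin> A" using zpset_subset_irr[of h c r] by (auto simp: A_def)
    have "q analytic_on {z}" unfolding q_def
      by (intro analytic_intros) (use zA in auto)
    hence "\<phi> analytic_on {z}" unfolding \<phi>_def
      by (intro analytic_intros) (use z q0[OF zA] in \<open>auto simp: irr_def\<close>)
    hence "\<psi> z = \<phi> z" by (simp add: \<psi>_def)
    hence "exp (G z) * q z = h z" using G(2)[of z] z q0[OF zA] by (simp add: \<phi>_def)
    thus "h z = exp (G z) * (\<Prod>a\<in>zpset h c r. (z - a) powi zorder h a)"
      by (simp add: q_def A_def)
  qed
qed

lemma ln_norm_powi:
  fixes z :: complex
  assumes "z \<noteq> 0"
  shows "ln (cmod (z powi n)) = of_int n * ln (cmod z)"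
proof (cases "n \<ge> 0")
  case True
  thus ?thesis using assms by (simp add: power_int_def norm_power ln_realpow)
next
  case False
  have "cmod (z powi n) = inverse (cmod z ^ nat (- n))"
    using False by (simp add: power_int_def norm_power norm_inverse power_inverse)
  hence "ln (cmod (z powi n)) = - ln (cmod z ^ nat (- n))"
    by (simp only: ln_inverse)
  also have "\<dots> = - (of_nat (nat (- n)) * ln (cmod z))"
    using assms by (subst ln_realpow) auto
  finally show ?thesis using False by simp
qed

lemma ln_norm_factorization:
  assumes "finite A" "z \<notin> A" "h = exp g * (\<Prod>a\<in>A. (z - a) powi n a)"
  shows "ln (cmod h) = Re g + (\<Sum>a\<in>A. of_int (n a) * ln (cmod (z - a)))"
proof -
  have nz: "cmod ((z - a) powi n a) \<noteq> 0" if "a \<in> A" for a using that assms(2) by auto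
  have "cmod h = exp (Re g) * (\<Prod>a\<in>A. cmod ((z - a) powi n a))"
    unfolding assms(3) norm_mult norm_exp_eq_Re prod_norm ..
  moreover have "(\<Prod>a\<in>A. cmod ((z - a) powi n a)) \<noteq> 0"
    using assms(1) nz by (simp only: prod_zero_iff) blast
  ultimately have "ln (cmod h) = Re g + ln (\<Prod>a\<in>A. cmod ((z - a) powi n a))"
    by (simp add: ln_mult)
  also have "ln (\<Prod>a\<in>A. cmod ((z - a) powi n a)) = (\<Sum>a\<in>A. ln (cmod ((z - a) powi n a)))"
    by (rule ln_prod[OF assms(1) nz])
  also have "\<dots> = (\<Sum>a\<in>A. of_int (n a) * ln (cmod (z - a)))"
    using assms(2) by (intro sum.cong refl ln_norm_powi) auto
  finally show ?thesis .
qed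

text \<open>The logarithm of the modulus of the leading Laurent coefficient at
  \<open>c\<close>.\<close>

definition lead_ln :: "(complex \<Rightarrow> complex) \<Rightarrow> complex \<Rightarrow> real" where
  "lead_ln h c = Lim (at c) (\<lambda>z. ln (cmod (h z)) - of_int (zorder h c) * ln (cmod (z - c)))"

text \<open>The integrated counting function of the zeros. The centre drops out because
  \<open>r / 0 = 0\<close> and \<open>ln 0 = 0\<close>; its order is a separate term of Jensen's
  formula.\<close>

definition Nzero :: "(complex \<Rightarrow> complex) \<Rightarrow> complex \<Rightarrow> real \<Rightarrow> real" where
  "Nzero h c r = (\<Sum>a\<in>zpset h c r. of_int (max 0 (zorder h a)) * ln (r / cmod (a - c)))"

definition Npole :: "(complex \<Rightarrow> complex) \<Rightarrow> complex \<Rightarrow> real \<Rightarrow> real" where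
  "Npole h c r = (\<Sum>a\<in>zpset h c r. of_int (max 0 (- zorder h a)) * ln (r / cmod (a - c)))"

lemma lead_ln_regular:
  assumes "c \<notin> irr h" shows "lead_ln h c = ln (cmod (h c))"
proof -
  have "isCont h c" "h c \<noteq> 0" using assms by (auto simp: irr_def intro: analytic_at_imp_isCont)
  hence "(\<lambda>z. ln (cmod (h z))) \<midarrow>c\<rightarrow> ln (cmod (h c))"
    by (intro tendsto_intros) (auto simp: isCont_def)
  thus ?thesis unfolding lead_ln_def zorder_not_irr[OF assms] by (simp add: tendsto_Lim)
qed

text \<open>The mean of the logarithm of the factorization is computed factor by factor:
  \<open>Re G\<close> has its central value as mean, and each linear factor contributes
  \<open>ln r\<close>, wherever its zero lies in the disc.\<close>

theorem Jensen_formula: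
  assumes h: "nzm h" and r: "r > 0" and clean: "irr h \<inter> sphere c r = {}"
  shows "cmean c r (\<lambda>z. ln (cmod (h z)))
       = lead_ln h c + of_int (zorder h c) * ln r + Nzero h c r - Npole h c r"
proof -
  obtain G r' where G: "r' > r" "G holomorphic_on ball c r'" "irr h \<inter> ball c r' \<subseteq> ball c r"
    "\<And>z. z \<in> ball c r' - irr h \<Longrightarrow> h z = exp (G z) * (\<Prod>a\<in>zpset h c r. (z - a) powi zorder h a)"
    by (rule meromorphic_factorization[OF assms]) (rule that; assumption)
  define A where "A = zpset h c r"
  have fA: "finite A" using h by (auto simp: A_def)
  have Airr: "A \<subseteq> irr h" using zpset_subset_irr by (auto simp: A_def)
  have Ar: "cmod (a - c) < r" if "a \<in> A" for a
    using that by (auto simp: A_def zpset_def dist_norm norm_minus_commute)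
  have sph: "z \<notin> irr h" "z \<notin> A" "z \<in> ball c r'" if "z \<in> sphere c r" for z
    using that clean G(1) Airr by auto
  have lnh: "ln (cmod (h z)) = Re (G z) + (\<Sum>a\<in>A. of_int (zorder h a) * ln (cmod (z - a)))"
    if "z \<in> ball c r' - irr h" for z
    using that Airr G(4)[OF that] by (intro ln_norm_factorization fA) (auto simp flip: A_def)
  have cG: "continuous_on (cball c r) G"
    using G(1) by (intro holomorphic_on_imp_continuous_on holomorphic_on_subset[OF G(2)]) auto
  have cl: "continuous_on (sphere c r) (\<lambda>z. of_int (zorder h a) * ln (cmod (z - a)))" if "a \<in> A" for a
    using that sph by (intro continuous_intros) auto
  have "cmean c r (\<lambda>z. ln (cmod (h z)))
      = cmean c r (\<lambda>z. Re (G z) + (\<Sum>a\<in>A. of_int (zorder h a) * ln (cmod (z - a))))"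
    using lnh sph r by (intro cmean_cong) auto
  also have "\<dots> = cmean c r (\<lambda>z. Re (G z)) + (\<Sum>a\<in>A. cmean c r (\<lambda>z. of_int (zorder h a) * ln (cmod (z - a))))"
  proof -
    have "continuous_on (sphere c r) (\<lambda>z. Re (G z))"
      by (intro continuous_intros continuous_on_subset[OF cG]) auto
    moreover have "continuous_on (sphere c r) (\<lambda>z. \<Sum>a\<in>A. of_int (zorder h a) * ln (cmod (z - a)))"
      by (intro continuous_on_sum cl)
    ultimately show ?thesis
      using r cl fA by (simp add: cmean_add cmean_sum)
  qed
  also have "cmean c r (\<lambda>z. Re (G z)) = Re (G c)"
    using r cG G(1) by (intro cmean_Re_holomorphic holomorphic_on_subset[OF G(2)]) auto
  also have "(\<Sum>a\<in>A. cmean c r (\<lambda>z. of_int (zorder h a) * ln (cmod (z - a))))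
           = (\<Sum>a\<in>A. of_int (zorder h a) * ln r)"
    using Ar by (intro sum.cong refl) (simp add: cmean_cmult cmean_ln_dist)
  finally have mean: "cmean c r (\<lambda>z. ln (cmod (h z))) = Re (G c) + (\<Sum>a\<in>A. of_int (zorder h a) * ln r)" .

  have lead: "lead_ln h c = Re (G c) + (\<Sum>a\<in>A - {c}. of_int (zorder h a) * ln (cmod (c - a)))"
  proof -
    let ?S = "\<lambda>z. \<Sum>a\<in>A - {c}. of_int (zorder h a) * ln (cmod (z - a))"
    have "isCont G c" using G(1,2) r
      by (meson centre_in_ball continuous_on_eq_continuous_at holomorphic_on_imp_continuous_on open_ball order_less_trans)
    hence lim: "(\<lambda>z. Re (G z) + ?S z) \<midarrow>c\<rightarrow> Re (G c) + ?S c"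
      by (intro tendsto_intros) (auto simp: isCont_def)
    have "\<forall>\<^sub>F z in at c. z \<notin> irr h"
      using irr_sparse[OF h] by (simp add: sparse_in_eventually_iff)
    moreover have "eventually (\<lambda>z. z \<in> ball c r') (at c)"
      using eventually_at_in_open'[of "ball c r'" c] G(1) r by auto
    ultimately have ev: "eventually (\<lambda>z. ln (cmod (h z)) - of_int (zorder h c) * ln (cmod (z - c)) = Re (G z) + ?S z) (at c)"
    proof eventually_elim
      case (elim z)
      have "(\<Sum>a\<in>A. of_int (zorder h a) * ln (cmod (z - a))) = of_int (zorder h c) * ln (cmod (z - c)) + ?S z"
      proof (cases "c \<in> A")
        case True thus ?thesis using fA by (simp add: sum.remove)
      next
        case False
        hence "zorder h c = 0" using r by (auto simp: A_def zpset_def)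
        thus ?thesis using False by simp
      qed
      thus ?case using lnh[of z] elim by simp
    qed
    have "(\<lambda>z. ln (cmod (h z)) - of_int (zorder h c) * ln (cmod (z - c))) \<midarrow>c\<rightarrow> Re (G c) + ?S c"
      using lim tendsto_cong[OF ev] by blast
    thus ?thesis unfolding lead_ln_def by (rule tendsto_Lim[rotated]) simp
  qed
  have "Nzero h c r - Npole h c r = (\<Sum>a\<in>A. of_int (zorder h a) * ln (r / cmod (a - c)))"
    unfolding Nzero_def Npole_def A_def[symmetric] sum_subtractf[symmetric]
  proof (intro sum.cong refl)
    fix a
    have "of_int (max 0 n) - of_int (max 0 (- n)) = (of_int n :: real)" for n :: int by (auto simp: max_def)
    thus "of_int (max 0 (zorder h a)) * ln (r / cmod (a - c)) - of_int (max 0 (- zorder h a)) * ln (r / cmod (a - c))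
       = of_int (zorder h a) * ln (r / cmod (a - c))" by (simp only: left_diff_distrib[symmetric])
  qed
  also have "\<dots> = (\<Sum>a\<in>A - {c}. of_int (zorder h a) * ln (r / cmod (a - c)))"
    using fA by (intro sum.mono_neutral_right) auto
  also have "\<dots> = (\<Sum>a\<in>A - {c}. of_int (zorder h a) * ln r - of_int (zorder h a) * ln (cmod (c - a)))"
    using r by (intro sum.cong refl) (simp add: ln_div norm_minus_commute[of c] right_diff_distrib)
  also have "\<dots> = (\<Sum>a\<in>A - {c}. of_int (zorder h a) * ln r) - (\<Sum>a\<in>A - {c}. of_int (zorder h a) * ln (cmod (c - a)))"
    by (rule sum_subtractf)
  also have "(\<Sum>a\<in>A - {c}. of_int (zorder h a) * ln r) = (\<Sum>a\<in>A. of_int (zorder h a) * ln r) - of_int (zorder h c) * ln r"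
  proof (cases "c \<in> A")
    case True thus ?thesis using fA by (simp add: sum_diff1)
  next
    case False
    hence "zorder h c = 0" using r by (auto simp: A_def zpset_def)
    thus ?thesis using False by simp
  qed
  finally show ?thesis using mean lead by simp
qed

section \<open>Pointwise bounds from circle means\<close>

lemma avoid_intervals:
  fixes S :: "nat \<Rightarrow> real set" and \<delta> :: "nat \<Rightarrow> real"
  assumes fin: "\<And>n. finite (S n)" and pos: "\<And>n. \<delta> n \<ge> 0"
    and sm: "(\<lambda>n. real (card (S n)) * (2 * \<delta> n)) sums q" "q < 1" and T: "countable T"
  obtains r where "r \<in> {\<rho>..\<rho> + 1}" "r \<notin> T" "\<And>n x. x \<in> S n \<Longrightarrow> \<delta> n \<le> \<bar>r - x\<bar>"
proof -
  define A where "A = (\<lambda>n. \<Union>x\<in>S n. {x - \<delta> n <..< x + \<delta> n})"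
  have Aset: "range A \<subseteq> sets lborel" unfolding A_def using fin by auto
  have Aem: "emeasure lborel (A n) \<le> ennreal (real (card (S n)) * (2 * \<delta> n))" for n
  proof -
    have "emeasure lborel (A n) \<le> (\<Sum>x\<in>S n. emeasure lborel {x - \<delta> n <..< x + \<delta> n})"
      unfolding A_def using fin by (intro emeasure_subadditive_finite) auto
    also have "\<dots> = (\<Sum>x\<in>S n. ennreal (2 * \<delta> n))" using pos[of n] by simp
    also have "\<dots> = ennreal (\<Sum>x\<in>S n. 2 * \<delta> n)" using pos[of n] by (intro sum_ennreal) auto
    finally show ?thesis by simp
  qed
  have T0: "emeasure lborel T = 0" "T \<in> sets lborel"
    using T countable_imp_null_set_lborel by blast+
  have "emeasure lborel ((\<Union>n. A n) \<union> T) \<le> emeasure lborel (\<Union>n. A n) + emeasure lborel T"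
    using Aset T0 by (intro emeasure_subadditive) auto
  also have "\<dots> = emeasure lborel (\<Union>n. A n)" using T0 by simp
  also have "\<dots> \<le> (\<Sum>n. emeasure lborel (A n))" by (rule emeasure_subadditive_countably[OF Aset])
  also have "\<dots> \<le> (\<Sum>n. ennreal (real (card (S n)) * (2 * \<delta> n)))" by (intro suminf_le Aem) auto
  also have "\<dots> = ennreal q" using sm(1) pos
    by (intro suminf_ennreal_eq) auto
  also have "\<dots> < 1" using sm(2) by (simp add: ennreal_less_one_iff)
  finally have less: "emeasure lborel ((\<Union>n. A n) \<union> T) < 1" .
  have "\<not> {\<rho>..\<rho> + 1} \<subseteq> (\<Union>n. A n) \<union> T"
  proof
    assume "{\<rho>..\<rho> + 1} \<subseteq> (\<Union>n. A n) \<union> T"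
    hence "emeasure lborel {\<rho>..\<rho> + 1} \<le> emeasure lborel ((\<Union>n. A n) \<union> T)"
      using Aset T0 by (intro emeasure_mono) auto
    with less show False by simp
  qed
  then obtain r where r: "r \<in> {\<rho>..\<rho> + 1}" "r \<notin> T" "r \<notin> (\<Union>n. A n)" by blast
  show ?thesis
  proof (rule that[OF r(1,2)])
    fix n x assume x: "x \<in> S n"
    have "r \<notin> {x - \<delta> n <..< x + \<delta> n}" using r(3) x by (auto simp: A_def)
    thus "\<delta> n \<le> \<bar>r - x\<bar>" by auto
  qed
qed

lemma good_radius:
  fixes S :: "real set"
  assumes "finite S" "countable T" "real (card S) \<le> N"
  obtains r where "r \<in> {\<rho>..\<rho> + 1}" "r \<notin> T" "\<And>x. x \<in> S \<Longrightarrow> 1 / (4 * (N + 1)) \<le> \<bar>r - x\<bar>"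
proof -
  \<comment> \<open>Only the first family is nonempty; its intervals have total length below 1 /
    2.\<close>
  let ?S = "\<lambda>n::nat. if n = 0 then S else {}" and ?d = "\<lambda>n::nat. 1 / (4 * (N + 1))"
  have N: "N \<ge> 0" using assms(3) by (meson of_nat_0_le_iff order_trans)
  have "(\<lambda>n. real (card (?S n)) * (2 * ?d n)) sums (\<Sum>n\<in>{0}. real (card (?S n)) * (2 * ?d n))"
    by (rule sums_finite) auto
  hence s: "(\<lambda>n. real (card (?S n)) * (2 * ?d n)) sums (real (card S) * (2 * (1 / (4 * (N + 1)))))"
    by simp
  have "real (card S) * (2 * (1 / (4 * (N + 1)))) < 1" using N assms(3) by (simp add: field_simps)
  with s obtain r where r: "r \<in> {\<rho>..\<rho> + 1}" "r \<notin> T" "\<And>n x. x \<in> ?S n \<Longrightarrow> ?d n \<le> \<bar>r - x\<bar>"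
    using assms(1,2) N by (elim avoid_intervals[of ?S ?d _ T \<rho>, rotated 2]) (simp_all split: if_splits)
  from that[OF r(1,2)] r(3)[of _ 0] show ?thesis by simp
qed

definition dsum :: "(complex \<Rightarrow> complex) \<Rightarrow> complex \<Rightarrow> real \<Rightarrow> real" where
  "dsum h c r = (\<Sum>a\<in>zpset h c r. \<bar>of_int (zorder h a)\<bar>)"

text \<open>This is what a pointwise estimate inside the disc needs to know about \<open>h\<close>.
  The absolute value of the logarithm makes small values count as much as large ones.\<close>

definition controlled :: "(complex \<Rightarrow> complex) \<Rightarrow> complex \<Rightarrow> real \<Rightarrow> real \<Rightarrow> bool" where
  "controlled h c r B \<longleftrightarrow> irr h \<inter> sphere c r = {} \<and> dsum h c r \<le> B \<and>
     cmean c r (\<lambda>z. \<bar>ln (cmod (h z))\<bar>) \<le> B"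

lemma card_zpset_le_dsum: "real (card (zpset h c r)) \<le> dsum h c r"
proof -
  have "real (card (zpset h c r)) = (\<Sum>a\<in>zpset h c r. 1)" by simp
  also have "\<dots> \<le> dsum h c r" unfolding dsum_def
  proof (rule sum_mono)
    fix a assume "a \<in> zpset h c r"
    hence "\<bar>zorder h a\<bar> \<ge> 1" by (auto simp: zpset_def)
    hence "real_of_int \<bar>zorder h a\<bar> \<ge> 1" by linarith
    thus "1 \<le> \<bar>real_of_int (zorder h a)\<bar>" by simp
  qed
  finally show ?thesis .
qed

lemma continuous_on_sphere_ln:
  assumes "irr h \<inter> sphere c r = {}"
  shows "continuous_on (sphere c r) (\<lambda>z. ln (cmod (h z)))"
proof -
  have "h analytic_on sphere c r" "\<And>z. z \<in> sphere c r \<Longrightarrow> h z \<noteq> 0"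
    using assms by (auto simp: irr_def analytic_on_analytic_at[of h "sphere c r"])
  thus ?thesis
    by (intro continuous_intros holomorphic_on_imp_continuous_on analytic_imp_holomorphic) auto
qed

text \<open>Since \<open>\<bar>x\<bar> \<le> 2 * b - x\<close> whenever \<open>x \<le> b\<close> and
  \<open>0 \<le> b\<close>, the exact mean of the logarithm and its upper bound
  \<open>ln (2 * r)\<close> are enough.\<close>

lemma cmean_abs_ln_dist_le:
  assumes "cmod (a - c) < r" "1 \<le> r"
  shows "cmean c r (\<lambda>z. \<bar>ln (cmod (z - a))\<bar>) \<le> 2 * ln (2 * r)"
proof -
  have ne: "z \<noteq> a" if "z \<in> sphere c r" for z using assms that by (auto simp: dist_norm norm_minus_commute)
  have co: "continuous_on (sphere c r) (\<lambda>z. ln (cmod (z - a)))"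
    using ne by (intro continuous_intros) auto
  have "cmean c r (\<lambda>z. \<bar>ln (cmod (z - a))\<bar>) \<le> cmean c r (\<lambda>z. 2 * ln (2 * r) - ln (cmod (z - a)))"
  proof (rule cmean_mono)
    fix z assume z: "z \<in> sphere c r"
    have "cmod (z - a) \<le> cmod (z - c) + cmod (a - c)"
      using norm_triangle_ineq4[of "z - c" "a - c"] by simp
    also have "\<dots> \<le> 2 * r" using z assms(1) by (simp add: dist_norm norm_minus_commute)
    finally have "ln (cmod (z - a)) \<le> ln (2 * r)" using ne[OF z] by (intro ln_mono) auto
    moreover have "ln (2 * r) \<ge> 0" using assms by simp
    ultimately show "\<bar>ln (cmod (z - a))\<bar> \<le> 2 * ln (2 * r) - ln (cmod (z - a))" by linarith
  qed (use co assms in \<open>auto intro!: continuous_intros\<close>)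
  also have "\<dots> = 2 * ln (2 * r) - ln r"
    using co assms by (subst cmean_diff) (auto simp: cmean_ln_dist)
  also have "\<dots> \<le> 2 * ln (2 * r)" using assms by simp
  finally show ?thesis .
qed

lemma has_field_derivative_prod_powi:
  fixes z :: complex
  assumes "finite A" "z \<notin> A"
  shows "((\<lambda>w. \<Prod>a\<in>A. (w - a) powi n a) has_field_derivative
     (\<Prod>a\<in>A. (z - a) powi n a) * (\<Sum>a\<in>A. of_int (n a) / (z - a))) (at z)"
  using assms
proof (induction A rule: finite_induct)
  case (insert a A)
  have "((\<lambda>w. (w - a) powi n a) has_field_derivative of_int (n a) * (z - a) powi (n a - 1) * 1) (at z)"
    using insert by (intro DERIV_power_int) (auto intro!: derivative_eq_intros)
  hence d1: "((\<lambda>w. (w - a) powi n a) has_field_derivative (z - a) powi n a * (of_int (n a) / (z - a))) (at z)"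
    using insert by (simp add: power_int_diff mult.commute)
  have d2: "((\<lambda>w. \<Prod>a\<in>A. (w - a) powi n a) has_field_derivative
     (\<Prod>a\<in>A. (z - a) powi n a) * (\<Sum>a\<in>A. of_int (n a) / (z - a))) (at z)"
    using insert by auto
  from DERIV_mult[OF d1 d2] show ?case using insert by (simp add: algebra_simps)
qed auto

text \<open>The constants and powers below are far from optimal; only polynomial growth matters.\<close>

lemma controlled_pointwise:
  assumes h: "nzm h" and ctl: "controlled h c R B" and R: "R \<ge> 2" and B: "B \<ge> 1"
    and \<delta>: "0 < \<delta>" "\<delta> \<le> 1"
    and z: "z \<in> cball c (R - 1)" "z \<notin> irr h" "\<And>a. a \<in> zpset h c R \<Longrightarrow> \<delta> \<le> cmod (z - a)"
  shows "\<bar>ln (cmod (h z))\<bar> \<le> 47 * R ^ 3 * B / \<delta>"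
    and "cmod (deriv h z / h z) \<le> 41 * R ^ 2 * B / \<delta>"
    and "cmod (deriv (\<lambda>w. deriv h w / h w) z) \<le> 81 * R ^ 2 * B / \<delta> ^ 2"
proof -
  have clean: "irr h \<inter> sphere c R = {}" and dB: "dsum h c R \<le> B"
    and mB: "cmean c R (\<lambda>z. \<bar>ln (cmod (h z))\<bar>) \<le> B" using ctl by (auto simp: controlled_def)
  have R0: "R > 0" using R by simp
  have ln4: "2 * ln (2 * R) \<le> 4 * R" using ln_le_minus_one[of "2 * R"] R by simp
  obtain G r' where G: "r' > R" "G holomorphic_on ball c r'" "irr h \<inter> ball c r' \<subseteq> ball c R"
    "\<And>z. z \<in> ball c r' - irr h \<Longrightarrow> h z = exp (G z) * (\<Prod>a\<in>zpset h c R. (z - a) powi zorder h a)"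
    by (rule meromorphic_factorization[OF h R0 clean]) (rule that; assumption)
  define A where "A = zpset h c R"
  define n where "n = (\<lambda>a. real_of_int (zorder h a))"
  have fA: "finite A" using h by (auto simp: A_def)
  have Airr: "A \<subseteq> irr h" using zpset_subset_irr by (auto simp: A_def)
  have Ar: "cmod (a - c) < R" if "a \<in> A" for a
    using that by (auto simp: A_def zpset_def dist_norm norm_minus_commute)
  have nB: "(\<Sum>a\<in>A. \<bar>n a\<bar>) \<le> B" using dB by (simp add: dsum_def A_def n_def)
  have lnh: "ln (cmod (h w)) = Re (G w) + (\<Sum>a\<in>A. n a * ln (cmod (w - a)))"
    if "w \<in> ball c r' - irr h" for w
    unfolding n_def using that Airr G(4)[OF that]
    by (intro ln_norm_factorization fA) (auto simp flip: A_def)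
  have cG: "continuous_on (cball c R) G"
    using G(1) by (intro holomorphic_on_imp_continuous_on holomorphic_on_subset[OF G(2)]) auto
  have hG: "G holomorphic_on ball c R" using G(1) by (intro holomorphic_on_subset[OF G(2)]) auto
  have cGs: "continuous_on (sphere c R) G" by (rule continuous_on_subset[OF cG]) auto
  define U where "U = cmean c R (\<lambda>w. \<bar>Re (G w)\<bar>)"
  have cl: "continuous_on (sphere c R) (\<lambda>w. ln (cmod (w - a)))" if "a \<in> A" for a
    using Ar[OF that] by (intro continuous_intros) (auto simp: dist_norm norm_minus_commute)
  \<comment> \<open>On the circle \<open>Re G\<close> differs from the logarithm of the modulus of
    \<open>h\<close> only by the logarithms of the linear factors, and all of these have bounded
    means.\<close>
  have U: "U \<le> 5 * R * B"
  proof -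
    have "U \<le> cmean c R (\<lambda>w. \<bar>ln (cmod (h w))\<bar> + (\<Sum>a\<in>A. \<bar>n a\<bar> * \<bar>ln (cmod (w - a))\<bar>))"
      unfolding U_def
    proof (rule cmean_mono)
      fix w assume w: "w \<in> sphere c R"
      hence "w \<in> ball c r' - irr h" using clean G(1) by auto
      hence "Re (G w) = ln (cmod (h w)) - (\<Sum>a\<in>A. n a * ln (cmod (w - a)))"
        using lnh[of w] by simp
      moreover have "\<bar>\<Sum>a\<in>A. n a * ln (cmod (w - a))\<bar> \<le> (\<Sum>a\<in>A. \<bar>n a\<bar> * \<bar>ln (cmod (w - a))\<bar>)"
        using sum_abs[of "\<lambda>a. n a * ln (cmod (w - a))" A] by (simp add: abs_mult)
      ultimately show "\<bar>Re (G w)\<bar> \<le> \<bar>ln (cmod (h w))\<bar> + (\<Sum>a\<in>A. \<bar>n a\<bar> * \<bar>ln (cmod (w - a))\<bar>)"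
        by linarith
    qed (use R0 in \<open>auto intro!: continuous_intros cGs cl continuous_on_sphere_ln[OF clean] dest: Ar simp: dist_norm norm_minus_commute\<close>)
    also have "\<dots> = cmean c R (\<lambda>w. \<bar>ln (cmod (h w))\<bar>) + (\<Sum>a\<in>A. \<bar>n a\<bar> * cmean c R (\<lambda>w. \<bar>ln (cmod (w - a))\<bar>))"
    proof -
      have "continuous_on (sphere c R) (\<lambda>w. \<bar>n a\<bar> * \<bar>ln (cmod (w - a))\<bar>)" if "a \<in> A" for a
        using cl[OF that] by (intro continuous_on_mult_left continuous_on_rabs)
      moreover have "continuous_on (sphere c R) (\<lambda>w. \<bar>ln (cmod (h w))\<bar>)"
        using continuous_on_sphere_ln[OF clean] by (intro continuous_on_rabs)
      ultimately show ?thesis using R0 fA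
        by (subst cmean_add) (auto intro!: continuous_on_sum simp: cmean_sum cmean_cmult)
    qed
    also have "\<dots> \<le> B + (\<Sum>a\<in>A. \<bar>n a\<bar> * (4 * R))"
      using Ar R by (intro add_mono mB sum_mono mult_left_mono order_trans[OF cmean_abs_ln_dist_le ln4]) auto
    also have "\<dots> = B + (\<Sum>a\<in>A. \<bar>n a\<bar>) * (4 * R)" by (simp add: sum_distrib_right)
    also have "\<dots> \<le> R * B + B * (4 * R)" using nB R B by (intro add_mono mult_right_mono) auto
    finally show ?thesis by (simp add: mult_ac)
  qed
  have U0: "U \<ge> 0" unfolding U_def using cGs R0 by (intro cmean_nonneg continuous_intros) auto
  \<comment> \<open>Half of the margin 1 between \<open>z\<close> and the circle is spent on this
    bound; the other half is the radius for Cauchy's inequality in the bound of the second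
    derivative.\<close>
  have G': "cmod (deriv G w) \<le> 40 * R ^ 2 * B" if "w \<in> cball c (R - 1 / 2)" for w
  proof -
    have wR: "cmod (w - c) \<le> R - 1 / 2" using that by (simp add: dist_norm norm_minus_commute)
    have "cmod (deriv G w) \<le> 2 * R / (R - cmod (w - c))\<^sup>2 * U"
      unfolding U_def using wR by (intro deriv_bound_cmean_Re cG hG) (auto simp: dist_norm norm_minus_commute)
    also have "\<dots> \<le> 2 * R / (1 / 2)\<^sup>2 * (5 * R * B)"
      using wR R0 U U0 by (intro mult_mono divide_left_mono power_mono mult_pos_pos) auto
    also have "\<dots> = 40 * R ^ 2 * B" by (simp add: power2_eq_square)
    finally show ?thesis .
  qed
  have zR: "cmod (z - c) \<le> R - 1" using z by (simp add: dist_norm norm_minus_commute)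
  have zb: "z \<in> ball c r'" using zR G(1) by (simp add: dist_norm norm_minus_commute)
  have zA: "z \<notin> A" using z Airr by auto
  have \<delta>A: "\<delta> \<le> cmod (z - a)" if "a \<in> A" for a using z that by (simp add: A_def)
  have hdG: "deriv G holomorphic_on ball c r'" by (intro holomorphic_deriv G(2)) auto
  have G'': "cmod (deriv (deriv G) z) \<le> 80 * R ^ 2 * B"
  proof -
    have sub: "cball z (1 / 2) \<subseteq> cball c (R - 1 / 2)"
    proof
      fix w assume "w \<in> cball z (1 / 2)"
      thus "w \<in> cball c (R - 1 / 2)" using zR dist_triangle[of c w z]
        by (simp add: dist_norm norm_minus_commute)
    qed
    have hol: "deriv G holomorphic_on cball z (1 / 2)"
      by (rule holomorphic_on_subset[OF hdG]) (use sub G(1) in auto)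
    have "norm ((deriv ^^ 1) (deriv G) z) \<le> fact 1 * (40 * R ^ 2 * B) / (1 / 2) ^ 1"
    proof (rule Cauchy_inequality)
      show "deriv G holomorphic_on ball z (1 / 2)" by (rule holomorphic_on_subset[OF hol]) auto
      show "continuous_on (cball z (1 / 2)) (deriv G)" by (rule holomorphic_on_imp_continuous_on[OF hol])
      show "norm (deriv G x) \<le> 40 * R ^ 2 * B" if "norm (z - x) = 1 / 2" for x
      proof -
        have "x \<in> cball z (1 / 2)" using that by (simp add: dist_norm)
        thus ?thesis using sub G' by blast
      qed
    qed simp
    thus ?thesis by simp
  qed
  have sum1: "cmod (\<Sum>a\<in>A. of_int (zorder h a) / (z - a) ^ k) \<le> B / \<delta> ^ k" for k
  proof -
    have "cmod (\<Sum>a\<in>A. of_int (zorder h a) / (z - a) ^ k) \<le> (\<Sum>a\<in>A. \<bar>n a\<bar> / \<delta> ^ k)"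
    proof (rule sum_norm_le)
      fix a assume "a \<in> A"
      hence "\<bar>n a\<bar> / cmod (z - a) ^ k \<le> \<bar>n a\<bar> / \<delta> ^ k"
        using \<delta>A[of a] \<delta> by (intro divide_left_mono power_mono mult_pos_pos zero_less_power) auto
      thus "cmod (of_int (zorder h a) / (z - a) ^ k) \<le> \<bar>n a\<bar> / \<delta> ^ k"
        by (simp add: norm_divide norm_power n_def)
    qed
    also have "\<dots> = (\<Sum>a\<in>A. \<bar>n a\<bar>) / \<delta> ^ k" by (simp add: sum_divide_distrib)
    also have "\<dots> \<le> B / \<delta> ^ k" using nB \<delta> by (intro divide_right_mono) auto
    finally show ?thesis .
  qed
  have Bd: "B \<le> B / \<delta> ^ k" for k
    using \<delta> B by (simp add: le_divide_eq mult_left_le power_le_one)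
  have Rk: "1 \<le> R ^ k" for k using R by simp
  \<comment> \<open>The derivative bound is integrated from the centre, where \<open>Re G\<close> is
    its own mean over the circle.\<close>
  have "\<bar>Re (G z)\<bar> \<le> 45 * R ^ 3 * B"
  proof -
    have "cmod (G z - G c) \<le> (40 * R ^ 2 * B) * cmod (z - c)"
    proof (rule field_differentiable_bound[of "cball c (R - 1 / 2)"])
      fix w assume w: "w \<in> cball c (R - 1 / 2)"
      hence "w \<in> ball c r'" using G(1) by auto
      thus "(G has_field_derivative deriv G w) (at w within cball c (R - 1 / 2))"
        using holomorphic_derivI[OF G(2) open_ball] by blast
      show "cmod (deriv G w) \<le> 40 * R ^ 2 * B" by (rule G'[OF w])
    qed (use zR R in \<open>auto simp: dist_norm norm_minus_commute\<close>)
    also have "\<dots> \<le> (40 * R ^ 2 * B) * R" using zR B by (intro mult_left_mono) auto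
    finally have 1: "\<bar>Re (G z - G c)\<bar> \<le> 40 * R ^ 3 * B"
      using abs_Re_le_cmod[of "G z - G c"] by (simp add: power2_eq_square power3_eq_cube mult_ac)
    have "\<bar>Re (G c)\<bar> = \<bar>cmean c R (\<lambda>w. Re (G w))\<bar>"
      using cmean_Re_holomorphic[OF cG hG R0] by simp
    also have "\<dots> \<le> U" unfolding U_def using cmean_norm_le[of c R "\<lambda>w. Re (G w)"] cGs R0
      by (auto intro!: continuous_intros)
    also have "\<dots> \<le> 5 * R ^ 3 * B"
    proof -
      have "R * B \<le> R ^ 3 * B" using R B power_increasing[of 1 3 R] by (intro mult_right_mono) auto
      thus ?thesis using U by linarith
    qed
    finally show ?thesis using 1 by simp
  qed
  moreover have "\<bar>\<Sum>a\<in>A. n a * ln (cmod (z - a))\<bar> \<le> 2 * R * B / \<delta>"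
  proof -
    have "\<bar>\<Sum>a\<in>A. n a * ln (cmod (z - a))\<bar> \<le> (\<Sum>a\<in>A. \<bar>n a\<bar> * (2 * R / \<delta>))"
    proof (rule order_trans[OF sum_abs], rule sum_mono)
      fix a assume a: "a \<in> A"
      have "ln (cmod (z - a)) \<le> cmod (z - a) - 1"
        using \<delta>A[OF a] \<delta> by (intro ln_le_minus_one) auto
      also have "\<dots> \<le> cmod (z - c) + cmod (a - c)" using norm_triangle_ineq4[of "z - c" "a - c"] by simp
      also have "\<dots> \<le> 2 * R" using zR Ar[OF a] by simp
      also have "\<dots> \<le> 2 * R / \<delta>" using \<delta> R by (simp add: le_divide_eq mult_left_le)
      finally have 1: "ln (cmod (z - a)) \<le> 2 * R / \<delta>" .
      have "- ln (cmod (z - a)) \<le> - ln \<delta>"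
        using \<delta>A[OF a] \<delta> ln_mono[of \<delta> "cmod (z - a)"] by simp
      also have "- ln \<delta> = ln (1 / \<delta>)" using \<delta> by (simp add: ln_div)
      also have "\<dots> \<le> 1 / \<delta> - 1" using \<delta> by (intro ln_le_minus_one) auto
      also have "\<dots> \<le> 2 * R / \<delta>" using \<delta> R by (simp add: divide_right_mono field_simps)
      finally have "\<bar>ln (cmod (z - a))\<bar> \<le> 2 * R / \<delta>" using 1 by linarith
      thus "\<bar>n a * ln (cmod (z - a))\<bar> \<le> \<bar>n a\<bar> * (2 * R / \<delta>)"
        unfolding abs_mult by (intro mult_left_mono) auto
    qed
    also have "\<dots> = (\<Sum>a\<in>A. \<bar>n a\<bar>) * (2 * R / \<delta>)" by (rule sum_distrib_right[symmetric])
    also have "\<dots> \<le> B * (2 * R / \<delta>)" using nB \<delta> R by (intro mult_right_mono) auto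
    finally show ?thesis by (simp add: mult_ac)
  qed
  ultimately have "\<bar>ln (cmod (h z))\<bar> \<le> 45 * R ^ 3 * B + 2 * R * B / \<delta>"
    using lnh[of z] z(2) zb by simp
  also have "\<dots> \<le> 45 * R ^ 3 * B / \<delta> + 2 * R ^ 3 * B / \<delta>"
  proof (rule add_mono)
    have "45 * R ^ 3 * B \<le> 45 * R ^ 3 * (B / \<delta> ^ 1)" using Bd[of 1] Rk[of 3] R by (intro mult_left_mono) auto
    thus "45 * R ^ 3 * B \<le> 45 * R ^ 3 * B / \<delta>" by simp
    show "2 * R * B / \<delta> \<le> 2 * R ^ 3 * B / \<delta>" using R B \<delta> power_increasing[of 1 3 R]
      by (intro divide_right_mono mult_right_mono) auto
  qed
  finally show "\<bar>ln (cmod (h z))\<bar> \<le> 47 * R ^ 3 * B / \<delta>" by (simp add: field_simps)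

  let ?w = "\<lambda>w. deriv G w + (\<Sum>a\<in>A. of_int (zorder h a) / (w - a))"
  \<comment> \<open>The factorization makes the logarithmic derivative the sum of
    \<open>deriv G\<close> and one simple fraction for each point of the divisor.\<close>
  have ld: "deriv h w / h w = ?w w" if "w \<in> ball c r' - irr h" for w
  proof -
    have wA: "w \<notin> A" using that Airr by auto
    have dG: "(G has_field_derivative deriv G w) (at w)"
      using that holomorphic_derivI[OF G(2) open_ball] by auto
    have "((\<lambda>v. exp (G v) * (\<Prod>a\<in>A. (v - a) powi zorder h a)) has_field_derivative
        (exp (G w) * (\<Prod>a\<in>A. (w - a) powi zorder h a)) * ?w w) (at w)"
      by (rule derivative_eq_intros DERIV_chain2[OF DERIV_exp dG] has_field_derivative_prod_powi[OF fA wA] refl)+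
         (simp add: algebra_simps)
    moreover have "eventually (\<lambda>v. v \<in> ball c r' - irr h) (nhds w)"
      using that by (intro eventually_nhds_in_open) (auto intro!: open_Diff sparse_in_UNIV_imp_closed irr_sparse[OF h])
    hence "eventually (\<lambda>v. h v = exp (G v) * (\<Prod>a\<in>A. (v - a) powi zorder h a)) (nhds w)"
      by eventually_elim (simp add: G(4) flip: A_def)
    ultimately have "(h has_field_derivative h w * ?w w) (at w)"
      using G(4)[OF that] by (subst DERIV_cong_ev[OF refl _ refl]) (simp_all flip: A_def)
    hence "deriv h w = h w * ?w w" by (rule DERIV_imp_deriv)
    moreover have "h w \<noteq> 0" using that by (auto simp: irr_def)
    ultimately show ?thesis by simp
  qed
  have zin: "z \<in> ball c r' - irr h" using zb z(2) by auto
  have "cmod (deriv h z / h z) \<le> 40 * R ^ 2 * B + B / \<delta> ^ 1"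
    unfolding ld[OF zin] using G'[of z] sum1[of 1] zR
    by (intro norm_triangle_le add_mono) (auto simp: dist_norm norm_minus_commute)
  also have "\<dots> \<le> 40 * R ^ 2 * (B / \<delta> ^ 1) + R ^ 2 * (B / \<delta> ^ 1)"
    using Bd[of 1] Rk[of 2] R B \<delta> mult_right_mono[of 1 "R ^ 2" "B / \<delta>"] by (intro add_mono mult_left_mono) auto
  finally show "cmod (deriv h z / h z) \<le> 41 * R ^ 2 * B / \<delta>" by (simp add: field_simps)

  have ds: "((\<lambda>w. \<Sum>a\<in>A. of_int (zorder h a) / (w - a)) has_field_derivative
      (\<Sum>a\<in>A. - (of_int (zorder h a) / (z - a) ^ 2))) (at z)"
    by (rule DERIV_sum) (use zA in \<open>auto intro!: derivative_eq_intros simp: power2_eq_square\<close>)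
  have dd: "(deriv G has_field_derivative deriv (deriv G) z) (at z)"
    using zb holomorphic_derivI[OF hdG open_ball] by auto
  have "(?w has_field_derivative deriv (deriv G) z + (\<Sum>a\<in>A. - (of_int (zorder h a) / (z - a) ^ 2))) (at z)"
    by (rule DERIV_add[OF dd ds])
  moreover have "eventually (\<lambda>v. v \<in> ball c r' - irr h) (nhds z)"
    using zin by (intro eventually_nhds_in_open) (auto intro!: open_Diff sparse_in_UNIV_imp_closed irr_sparse[OF h])
  hence "eventually (\<lambda>v. deriv h v / h v = ?w v) (nhds z)" by eventually_elim (rule ld)
  ultimately have "((\<lambda>v. deriv h v / h v) has_field_derivative
      deriv (deriv G) z + (\<Sum>a\<in>A. - (of_int (zorder h a) / (z - a) ^ 2))) (at z)"
    by (subst DERIV_cong_ev[OF refl _ refl])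
  hence "deriv (\<lambda>v. deriv h v / h v) z = deriv (deriv G) z - (\<Sum>a\<in>A. of_int (zorder h a) / (z - a) ^ 2)"
    by (simp add: DERIV_imp_deriv sum_negf)
  hence "cmod (deriv (\<lambda>v. deriv h v / h v) z) \<le> 80 * R ^ 2 * B + B / \<delta> ^ 2"
    using norm_triangle_ineq4[of "deriv (deriv G) z" "\<Sum>a\<in>A. of_int (zorder h a) / (z - a) ^ 2"] G'' sum1[of 2] by simp
  also have "\<dots> \<le> 80 * R ^ 2 * (B / \<delta> ^ 2) + R ^ 2 * (B / \<delta> ^ 2)"
    using Bd[of 2] Rk[of 2] R B \<delta> mult_right_mono[of 1 "R ^ 2" "B / \<delta>\<^sup>2"] by (intro add_mono mult_left_mono) auto
  finally show "cmod (deriv (\<lambda>w. deriv h w / h w) z) \<le> 81 * R ^ 2 * B / \<delta> ^ 2" by (simp add: field_simps)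
qed

section \<open>The positive part of the logarithm, and control derived from its circle means\<close>

lemma log_plus_nonneg [simp]: "log_plus x \<ge> 0"
  by (simp add: log_plus_def)

lemma log_plus_mono: "x \<le> y \<Longrightarrow> log_plus x \<le> log_plus y"
  unfolding log_plus_def by (intro ln_mono) auto

lemma log_plus_le_self: "0 \<le> x \<Longrightarrow> log_plus x \<le> x"
  using ln_le_minus_one[of "max 1 x"] by (auto simp: log_plus_def max_def split: if_splits)

lemma ln_le_log_plus: "0 \<le> x \<Longrightarrow> ln x \<le> log_plus x"
  by (cases "x = 0") (auto simp: log_plus_def intro!: ln_mono)

lemma log_plus_le_abs_ln: "0 \<le> x \<Longrightarrow> log_plus x \<le> \<bar>ln x\<bar>"
  by (auto simp: log_plus_def max_def)

lemma abs_ln_eq_log_plus: "0 < x \<Longrightarrow> \<bar>ln x\<bar> = 2 * log_plus x - ln x"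
  by (auto simp: log_plus_def max_def)

lemma ln_eq_log_plus_diff: "0 < x \<Longrightarrow> ln x = log_plus x - log_plus (inverse x)"
  by (auto simp: log_plus_def max_def ln_inverse one_le_inverse_iff)

lemma log_plus_mult_le:
  assumes "0 \<le> x" "0 \<le> y"
  shows "log_plus (x * y) \<le> log_plus x + log_plus y"
proof -
  have "max 1 (x * y) \<le> max 1 x * max 1 y"
    using assms mult_mono[of 1 "max 1 x" 1 "max 1 y"] mult_mono[of x "max 1 x" y "max 1 y"] by simp
  hence "ln (max 1 (x * y)) \<le> ln (max 1 x * max 1 y)" by (intro ln_mono) auto
  also have "\<dots> = ln (max 1 x) + ln (max 1 y)" by (intro ln_mult_pos) auto
  finally show ?thesis by (simp add: log_plus_def)
qed

lemma log_plus_add_le: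
  assumes "0 \<le> x" "0 \<le> y"
  shows "log_plus (x + y) \<le> log_plus x + log_plus y + ln 2"
proof -
  have "max 1 (x + y) \<le> 2 * (max 1 x * max 1 y)"
  proof -
    have a: "1 \<le> max 1 x" "1 \<le> max 1 y" "0 \<le> max 1 x" by auto
    have "1 \<le> max 1 x * max 1 y" "y \<le> max 1 x * max 1 y" "x \<le> max 1 x * max 1 y"
      using a assms mult_mono[of 1 "max 1 x" 1 "max 1 y"] mult_mono[of 1 "max 1 x" y "max 1 y"]
        mult_mono[of x "max 1 x" 1 "max 1 y"] by auto
    thus ?thesis by simp
  qed
  hence "ln (max 1 (x + y)) \<le> ln (2 * (max 1 x * max 1 y))" by (intro ln_mono) auto
  also have "\<dots> = ln 2 + (ln (max 1 x) + ln (max 1 y))" by (subst ln_mult_pos; simp add: ln_mult_pos)+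
  finally show ?thesis by (simp add: log_plus_def)
qed

lemma continuous_on_log_plus [continuous_intros]:
  "continuous_on A f \<Longrightarrow> continuous_on A (\<lambda>x. log_plus (f x))"
  unfolding log_plus_def by (intro continuous_intros) auto

lemma continuous_on_sphere_regular:
  assumes "irr h \<inter> sphere c r = {}"
  shows "continuous_on (sphere c r) h"
proof -
  have "h analytic_on sphere c r"
    using assms by (auto simp: irr_def analytic_on_analytic_at[of h "sphere c r"])
  thus ?thesis by (intro holomorphic_on_imp_continuous_on analytic_imp_holomorphic)
qed

lemma irr_dist_lower:
  assumes "nzm h"
  obtains \<eta> where "0 < \<eta>" "\<eta> \<le> 1" "\<And>a. a \<in> irr h \<Longrightarrow> a \<noteq> c \<Longrightarrow> \<eta> \<le> cmod (a - c)"
proof -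
  from finite_set_avoid[OF irr_finite[OF assms, of c 1], of c] obtain d where d: "d > 0"
    "\<forall>x\<in>irr h \<inter> cball c 1. x \<noteq> c \<longrightarrow> d \<le> dist c x" by blast
  show ?thesis
  proof (rule that[of "min d 1"])
    fix a assume a: "a \<in> irr h" "a \<noteq> c"
    show "min d 1 \<le> cmod (a - c)"
    proof (cases "a \<in> cball c 1")
      case True
      hence "d \<le> dist c a" using d(2) a by blast
      thus ?thesis by (simp add: dist_norm norm_minus_commute)
    qed (auto simp: dist_norm norm_minus_commute)
  qed (use d in auto)
qed

lemma zpset_mono: "r \<le> r' \<Longrightarrow> zpset h c r \<subseteq> zpset h c r'"
  by (auto simp: zpset_def)

text \<open>Both zeros and small values are controlled by Jensen's formula in terms of poles and large values.\<close>
lemma controlled_of_log_plus: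
  assumes h: "nzm h"
  obtains C where "C \<ge> 1" "\<And>R0 R1 M P. 1 \<le> R0 \<Longrightarrow> R0 + 1 \<le> R1 \<Longrightarrow>
    irr h \<inter> sphere c R0 = {} \<Longrightarrow> irr h \<inter> sphere c R1 = {} \<Longrightarrow>
    cmean c R0 (\<lambda>z. log_plus (cmod (h z))) \<le> M \<Longrightarrow> cmean c R1 (\<lambda>z. log_plus (cmod (h z))) \<le> M \<Longrightarrow>
    (\<Sum>a\<in>zpset h c R1. of_int (max 0 (- zorder h a))) \<le> P \<Longrightarrow>
    controlled h c R0 (C * R1\<^sup>2 * (M + P + 1))"
proof -
  obtain \<eta> where \<eta>: "0 < \<eta>" "\<eta> \<le> 1" "\<And>a. a \<in> irr h \<Longrightarrow> a \<noteq> c \<Longrightarrow> \<eta> \<le> cmod (a - c)"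
    by (rule irr_dist_lower[OF h, where c = c]) (rule that; blast)
  define L n0 where "L = \<bar>lead_ln h c\<bar>" and "n0 = \<bar>of_int (zorder h c) :: real\<bar>"
  define C where "C = 4 * (1 + L + n0 + 1 / \<eta>)"
  have C1: "C \<ge> 1" using \<eta> by (simp add: C_def L_def n0_def add_nonneg_nonneg)
  show ?thesis
  proof (rule that[OF C1])
    fix R0 R1 M P :: real
    assume R0: "1 \<le> R0" and R1: "R0 + 1 \<le> R1"
      and cl0: "irr h \<inter> sphere c R0 = {}" and cl1: "irr h \<inter> sphere c R1 = {}"
      and M0: "cmean c R0 (\<lambda>z. log_plus (cmod (h z))) \<le> M" and M1: "cmean c R1 (\<lambda>z. log_plus (cmod (h z))) \<le> M"
      and P: "(\<Sum>a\<in>zpset h c R1. of_int (max 0 (- zorder h a))) \<le> P"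
    have fin: "finite (zpset h c r)" for r using h by auto
    have P0: "P \<ge> 0" by (rule order_trans[OF _ P]) (auto intro: sum_nonneg)
    have Ppart: "(\<Sum>a\<in>zpset h c r. of_int (max 0 (- zorder h a))) \<le> P" if "r \<le> R1" for r
      by (rule order_trans[OF sum_mono2 P]) (use that zpset_mono fin in auto)
    have npos: "ln (r / cmod (a - c)) \<ge> 0" if "a \<in> zpset h c r" for a r
      using that by (cases "a = c") (auto simp: zpset_def dist_norm norm_minus_commute)
    have Np: "Npole h c r \<le> P * (R1 / \<eta>)" if "r \<le> R1" "1 \<le> r" for r
    proof -
      have "Npole h c r \<le> (\<Sum>a\<in>zpset h c r. of_int (max 0 (- zorder h a)) * (R1 / \<eta>))"
        unfolding Npole_def
      proof (intro sum_mono mult_left_mono)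
        fix a assume a: "a \<in> zpset h c r"
        show "ln (r / cmod (a - c)) \<le> R1 / \<eta>"
        proof (cases "a = c")
          case True thus ?thesis using R0 R1 \<eta> by simp
        next
          case False
          have ir: "a \<in> irr h" using a zpset_subset_irr by blast
          have "ln (r / cmod (a - c)) \<le> r / cmod (a - c) - 1"
            using False that by (intro ln_le_minus_one) auto
          also have "\<dots> \<le> R1 / \<eta>" using \<eta>(1) \<eta>(3)[OF ir False] that frac_le[of R1 r \<eta> "cmod (a - c)"] by simp
          finally show ?thesis .
        qed
      qed auto
      also have "\<dots> = (\<Sum>a\<in>zpset h c r. of_int (max 0 (- zorder h a))) * (R1 / \<eta>)"
        by (rule sum_distrib_right[symmetric])
      also have "\<dots> \<le> P * (R1 / \<eta>)" using Ppart[OF that(1)] R0 R1 \<eta> by (intro mult_right_mono) auto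
      finally show ?thesis .
    qed
    have Nz0: "Nzero h c r \<ge> 0" for r
      unfolding Nzero_def using npos by (auto intro!: sum_nonneg mult_nonneg_nonneg)
    have coln: "continuous_on (sphere c r) (\<lambda>z. log_plus (cmod (h z)))" "continuous_on (sphere c r) (\<lambda>z. ln (cmod (h z)))"
      "\<And>z. z \<in> sphere c r \<Longrightarrow> cmod (h z) > 0"
      if "irr h \<inter> sphere c r = {}" for r
      using continuous_on_sphere_regular[OF that] continuous_on_sphere_ln[OF that] that
      by (auto intro!: continuous_intros simp: irr_def)
    have M0': "M \<ge> 0" using M0 R0 by (intro order_trans[OF cmean_nonneg M0] coln(1) cl0) auto
    have lnr: "\<bar>of_int (zorder h c) * ln r\<bar> \<le> n0 * R1" if "1 \<le> r" "r \<le> R1" for r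
      unfolding n0_def abs_mult using that ln_le_minus_one[of r] by (intro mult_left_mono) auto
    have J: "cmean c r (\<lambda>z. ln (cmod (h z))) = lead_ln h c + of_int (zorder h c) * ln r + Nzero h c r - Npole h c r"
      if "1 \<le> r" "irr h \<inter> sphere c r = {}" for r
      using that by (intro Jensen_formula h) auto
    \<comment> \<open>\<open>E\<close> bounds Jensen's formula solved for \<open>Nzero\<close>: the
      mean, the leading coefficient, the order at the centre and the poles.\<close>
    define E where "E = M + L + n0 * R1 + P * (R1 / \<eta>)"
    have mean: "cmean c R0 (\<lambda>z. \<bar>ln (cmod (h z))\<bar>) \<le> M + E"
    proof -
      have "cmean c R0 (\<lambda>z. \<bar>ln (cmod (h z))\<bar>) = cmean c R0 (\<lambda>z. 2 * log_plus (cmod (h z)) - ln (cmod (h z)))"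
        using R0 coln(3)[OF cl0] by (intro cmean_cong abs_ln_eq_log_plus) auto
      also have "\<dots> = 2 * cmean c R0 (\<lambda>z. log_plus (cmod (h z))) - cmean c R0 (\<lambda>z. ln (cmod (h z)))"
        using R0 coln[OF cl0] by (subst cmean_diff) (auto intro!: continuous_intros simp: cmean_cmult)
      also have "\<dots> \<le> M + E"
        using J[OF R0 cl0] Np[of R0] Nz0[of R0] lnr[of R0] M0 R0 R1 by (simp add: E_def L_def)
      finally show ?thesis .
    qed
    have Nz: "Nzero h c R1 \<le> E"
    proof -
      have "cmean c R1 (\<lambda>z. ln (cmod (h z))) \<le> cmean c R1 (\<lambda>z. log_plus (cmod (h z)))"
        using R0 R1 coln[OF cl1] by (intro cmean_mono ln_le_log_plus) auto
      thus ?thesis using J[OF _ cl1] Np[of R1] lnr[of R1] M1 R0 R1 by (simp add: E_def L_def)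
    qed
    \<comment> \<open>A zero inside the smaller circle is at distance at most \<open>R1 - 1\<close>
      from \<open>c\<close>, so it has weight at least \<open>1 / R1\<close> in
      \<open>Nzero h c R1\<close>. The centre has weight 0 there and is counted by
      \<open>n0\<close>.\<close>
    have zeros: "(\<Sum>a\<in>zpset h c R0. of_int (max 0 (zorder h a))) \<le> n0 + R1 * E"
    proof -
      have "(\<Sum>a\<in>zpset h c R0. of_int (max 0 (zorder h a))) \<le>
          (\<Sum>a\<in>zpset h c R0. (if a = c then n0 else 0) + R1 * (of_int (max 0 (zorder h a)) * ln (R1 / cmod (a - c))))"
      proof (rule sum_mono)
        fix a assume a: "a \<in> zpset h c R0"
        show "of_int (max 0 (zorder h a)) \<le>
          (if a = c then n0 else 0) + R1 * (of_int (max 0 (zorder h a)) * ln (R1 / cmod (a - c)))"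
        proof (cases "a = c")
          case True thus ?thesis by (simp add: n0_def)
        next
          case False
          have "cmod (a - c) < R0" using a by (simp add: zpset_def dist_norm norm_minus_commute)
          hence "ln (cmod (a - c) / R1) \<le> cmod (a - c) / R1 - 1" using False R0 R1 by (intro ln_le_minus_one) auto
          also have "\<dots> \<le> (R1 - 1) / R1 - 1" using \<open>cmod (a - c) < R0\<close> R0 R1 by (simp add: divide_right_mono)
          also have "\<dots> = - 1 / R1" using R0 R1 by (simp add: field_simps)
          finally have "1 \<le> R1 * ln (R1 / cmod (a - c))" using R0 R1 False by (simp add: ln_div field_simps)
          hence "of_int (max 0 (zorder h a)) * 1 \<le> of_int (max 0 (zorder h a)) * (R1 * ln (R1 / cmod (a - c)))"
            by (intro mult_left_mono) auto
          thus ?thesis using False by (simp add: mult_ac)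
        qed
      qed
      also have "\<dots> = (\<Sum>a\<in>zpset h c R0. (if a = c then n0 else 0)) +
          R1 * (\<Sum>a\<in>zpset h c R0. of_int (max 0 (zorder h a)) * ln (R1 / cmod (a - c)))"
        by (simp only: sum.distrib sum_distrib_left)
      also have "(\<Sum>a\<in>zpset h c R0. (if a = c then n0 else 0)) \<le> n0"
        using fin[of R0] by (simp add: sum.delta n0_def)
      also have "(\<Sum>a\<in>zpset h c R0. of_int (max 0 (zorder h a)) * ln (R1 / cmod (a - c))) \<le> Nzero h c R1"
        unfolding Nzero_def using R1 npos fin by (intro sum_mono2 zpset_mono) auto
      also note Nz
      finally show ?thesis using R0 R1 by simp
    qed
    have dsum: "dsum h c R0 \<le> n0 + R1 * E + P"
    proof -
      have "dsum h c R0 = (\<Sum>a\<in>zpset h c R0. of_int (max 0 (zorder h a)) + of_int (max 0 (- zorder h a)))"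
        unfolding dsum_def by (intro sum.cong refl) (auto simp: max_def abs_if)
      also have "\<dots> \<le> n0 + R1 * E + P" unfolding sum.distrib using zeros Ppart[of R0] R1 by linarith
      finally show ?thesis .
    qed
    define K where "K = 1 + L + n0 + 1 / \<eta>"
    define Q where "Q = M + P + 1"
    have K: "K \<ge> 1" "L \<le> K" "n0 \<le> K" "1 / \<eta> \<le> K" "L + n0 + 1 / \<eta> + 1 \<le> K"
      using \<eta> by (auto simp: K_def L_def n0_def add_nonneg_nonneg)
    have Q: "Q \<ge> 1" "M \<le> Q" "P \<le> Q" using M0' P0 by (auto simp: Q_def)
    have R11: "R1 \<ge> 1" using R0 R1 by simp
    have EE: "E \<le> R1 * (K * Q)"
    proof -
      have n0pos: "n0 \<ge> 0" "L \<ge> 0" by (simp_all add: n0_def L_def)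
      have "E \<le> R1 * Q + R1 * (L * Q) + R1 * (n0 * Q) + R1 * ((1 / \<eta>) * Q)"
        unfolding E_def
      proof (intro add_mono)
        show "M \<le> R1 * Q" using Q R11 M0' mult_mono[of 1 R1 M Q] by simp
        show "L \<le> R1 * (L * Q)" using Q R11 n0pos mult_mono[of 1 R1 L "L * Q"] mult_left_mono[of 1 Q L] by simp
        show "n0 * R1 \<le> R1 * (n0 * Q)" using Q R11 n0pos mult_left_mono[of n0 "n0 * Q" R1] mult_left_mono[of 1 Q n0] by (simp add: mult.commute)
        show "P * (R1 / \<eta>) \<le> R1 * (1 / \<eta> * Q)"
          using mult_left_mono[of P Q "R1 / \<eta>"] Q R11 \<eta> by (simp add: mult_ac)
      qed
      also have "\<dots> = R1 * ((L + n0 + 1 / \<eta> + 1) * Q)" by (simp add: algebra_simps)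
      also have "\<dots> \<le> R1 * (K * Q)" using K Q R11 by (intro mult_left_mono mult_right_mono) auto
      finally show ?thesis .
    qed
    have KQ: "K * Q \<ge> 1" "Q \<le> K * Q" "K \<le> K * Q"
      using K(1) Q(1) mult_mono[of 1 K 1 Q] mult_right_mono[of 1 K Q] mult_left_mono[of 1 Q K] by auto
    have R2: "R1 * (K * Q) \<le> R1\<^sup>2 * (K * Q)" "K * Q \<le> R1\<^sup>2 * (K * Q)"
      using R11 KQ mult_right_mono[of R1 "R1\<^sup>2" "K * Q"] mult_right_mono[of 1 "R1\<^sup>2" "K * Q"]
        self_le_power[of R1 2] by auto
    have CC: "C * R1\<^sup>2 * (M + P + 1) = 4 * (R1\<^sup>2 * (K * Q))"
      by (simp add: C_def K_def Q_def mult_ac)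
    show "controlled h c R0 (C * R1\<^sup>2 * (M + P + 1))"
      unfolding controlled_def CC
    proof (intro conjI cl0)
      have "R1 * E \<le> R1 * (R1 * (K * Q))" using EE R11 by (intro mult_left_mono) auto
      hence "R1 * E \<le> R1\<^sup>2 * (K * Q)" by (simp add: power2_eq_square mult.assoc)
      thus "dsum h c R0 \<le> 4 * (R1\<^sup>2 * (K * Q))" using dsum K Q KQ R2 by linarith
      show "cmean c R0 (\<lambda>z. \<bar>ln (cmod (h z))\<bar>) \<le> 4 * (R1\<^sup>2 * (K * Q))"
        using mean EE Q KQ R2 by linarith
    qed
  qed
qed

section \<open>Control of the derivative and of the Schwarzian derivative\<close>

lemma nzm_zorder_neg_iff: "nzm h \<Longrightarrow> zorder h a < 0 \<longleftrightarrow> is_pole h a"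
  using zorder_neg_imp_is_pole[OF nzm_meromorphic nzm_eventually_nz, of h a]
    isolated_pole_imp_neg_zorder[of h a] nzm_meromorphic[of h "{a}"]
  by (auto simp: meromorphic_at_iff)

text \<open>Differentiation creates no new poles and turns order p into p + 1, which is at most 2 p
  since p is at least 1.\<close>

lemma pole_order_deriv_le:
  assumes f: "nzm f" "nzm (deriv f)"
  shows "max 0 (- zorder (deriv f) a) \<le> 2 * max 0 (- zorder f a)"
proof (cases "zorder (deriv f) a < 0")
  case True
  hence "is_pole f a"
    using nzm_zorder_neg_iff[OF f(2)] is_pole_deriv_iff[OF nzm_meromorphic[OF f(1)]] by blast
  hence neg: "zorder f a < 0" using nzm_zorder_neg_iff[OF f(1)] by blast
  have "zorder (deriv f) a = zorder f a - 1"
    using nzm_meromorphic[OF f(1), of "{a}"] neg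
    by (intro zorder_deriv_minus_1 nzm_frequently_nz f) (auto simp: meromorphic_at_iff)
  with neg show ?thesis by auto
qed auto

lemma pole_sum_deriv_le:
  assumes f: "nzm f" "nzm (deriv f)"
  shows "(\<Sum>a\<in>zpset (deriv f) c r. of_int (max 0 (- zorder (deriv f) a))) \<le> 2 * dsum f c r"
proof -
  let ?Z = "zpset (deriv f) c r \<inter> zpset f c r"
  have "(\<Sum>a\<in>zpset (deriv f) c r. real_of_int (max 0 (- zorder (deriv f) a)))
      = (\<Sum>a\<in>?Z. of_int (max 0 (- zorder (deriv f) a)))"
  proof (rule sum.mono_neutral_right)
    show "\<forall>i\<in>zpset (deriv f) c r - ?Z. real_of_int (max 0 (- zorder (deriv f) i)) = 0"
    proof
      fix i assume "i \<in> zpset (deriv f) c r - ?Z"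
      hence "zorder f i = 0" by (auto simp: zpset_def)
      hence "max 0 (- zorder (deriv f) i) = 0" using pole_order_deriv_le[OF f, of i] by linarith
      thus "real_of_int (max 0 (- zorder (deriv f) i)) = 0" by simp
    qed
  qed (use f in auto)
  also have "\<dots> \<le> (\<Sum>a\<in>?Z. 2 * \<bar>of_int (zorder f a)\<bar>)"
  proof (rule sum_mono)
    fix a
    have "max 0 (- zorder (deriv f) a) \<le> 2 * \<bar>zorder f a\<bar>" using pole_order_deriv_le[OF f, of a] by linarith
    hence "real_of_int (max 0 (- zorder (deriv f) a)) \<le> of_int (2 * \<bar>zorder f a\<bar>)" by (rule of_int_le_iff[THEN iffD2])
    thus "real_of_int (max 0 (- zorder (deriv f) a)) \<le> 2 * \<bar>of_int (zorder f a)\<bar>" by simp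
  qed
  also have "\<dots> \<le> (\<Sum>a\<in>zpset f c r. 2 * \<bar>of_int (zorder f a)\<bar>)"
    using f by (intro sum_mono2) auto
  also have "\<dots> = 2 * dsum f c r" by (simp add: dsum_def sum_distrib_left)
  finally show ?thesis .
qed

lemma dsum_mono: "nzm h \<Longrightarrow> r \<le> r' \<Longrightarrow> dsum h c r \<le> dsum h c r'"
  unfolding dsum_def by (intro sum_mono2 zpset_mono) auto

text \<open>In this form only the logarithmic derivative of \<open>deriv f\<close> and its
  derivative occur, and \<open>controlled_pointwise\<close> bounds both.\<close>

lemma schwarzian_logderiv:
  assumes "f analytic_on {z}" "deriv f z \<noteq> 0"
  defines "w \<equiv> \<lambda>z. deriv (deriv f) z / deriv f z"
  shows "schwarzian f z = deriv w z - w z ^ 2 / 2"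
proof -
  have a: "(deriv ^^ n) f analytic_on {z}" for n using assms(1) by (rule analytic_higher_deriv)
  have d: "((deriv ^^ n) f has_field_derivative (deriv ^^ Suc n) f z) (at z)" for n
    using a[of n] by (simp add: analytic_on_imp_differentiable_at field_differentiable_derivI)
  have "(w has_field_derivative (deriv (deriv (deriv f)) z * deriv f z - deriv (deriv f) z * deriv (deriv f) z) / (deriv f z * deriv f z)) (at z)"
    unfolding w_def using d[of 1] d[of 2] assms(2) by (intro DERIV_divide) (simp_all add: numeral_2_eq_2)
  hence "deriv w z = (deriv (deriv (deriv f)) z * deriv f z - deriv (deriv f) z * deriv (deriv f) z) / (deriv f z * deriv f z)"
    by (rule DERIV_imp_deriv)
  also have "\<dots> = deriv (deriv (deriv f)) z / deriv f z - w z ^ 2"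
    using assms(2) by (simp add: w_def diff_divide_distrib power2_eq_square)
  finally show ?thesis by (simp add: schwarzian_def numeral_3_eq_3 numeral_2_eq_2 w_def field_simps)
qed

text \<open>Control passes from \<open>f\<close> to \<open>deriv f\<close> on a smaller circle:
  \<open>deriv f\<close> is \<open>f\<close> times its logarithmic derivative, both bounded
  pointwise on circles that keep away from the zeros and poles of \<open>f\<close>, and the poles of
  \<open>deriv f\<close> are counted by those of \<open>f\<close>. The set \<open>W\<close> collects
  the zeros and poles of both functions. The distance \<open>\<delta>\<close> stays free because it
  is used in two ways: as a global lower bound, and as the distance to one given point.\<close>

lemma local_control:
  assumes f: "nzm f" "nzm (deriv f)"
  obtains C where "C \<ge> 1" "\<And>R B. 8 \<le> R \<Longrightarrow> 1 \<le> B \<Longrightarrow> controlled f c R B \<Longrightarrow>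
    \<exists>W. finite W \<and> real (card W) \<le> C * (R * B) ^ 14 \<and>
      (\<forall>z\<in>cball c (R - 6). \<forall>\<delta>. 0 < \<delta> \<longrightarrow> \<delta> \<le> 1 \<longrightarrow> (\<forall>a\<in>W. \<delta> \<le> cmod (z - a)) \<longrightarrow>
         z \<notin> irr f \<longrightarrow> z \<notin> irr (deriv f) \<longrightarrow>
         \<bar>ln (cmod (f z))\<bar> \<le> C * (R * B) ^ 14 / \<delta>\<^sup>2 \<and> cmod (schwarzian f z) \<le> C * (R * B) ^ 14 / \<delta>\<^sup>2)"
proof -
  obtain C0 where C0: "C0 \<ge> 1" "\<And>R0 R1 M P. 1 \<le> R0 \<Longrightarrow> R0 + 1 \<le> R1 \<Longrightarrow>
    irr (deriv f) \<inter> sphere c R0 = {} \<Longrightarrow> irr (deriv f) \<inter> sphere c R1 = {} \<Longrightarrow>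
    cmean c R0 (\<lambda>z. log_plus (cmod (deriv f z))) \<le> M \<Longrightarrow> cmean c R1 (\<lambda>z. log_plus (cmod (deriv f z))) \<le> M \<Longrightarrow>
    (\<Sum>a\<in>zpset (deriv f) c R1. of_int (max 0 (- zorder (deriv f) a))) \<le> P \<Longrightarrow>
    controlled (deriv f) c R0 (C0 * R1\<^sup>2 * (M + P + 1))"
    by (rule controlled_of_log_plus[OF f(2), where c = c]) (rule that; assumption)
  \<comment> \<open>The bound 704 = 88 * 8 for \<open>log_plus\<close> of the derivative becomes 707
    when \<open>2 * B + 1\<close> is added, and 922 rounds up 81 + 41^2 / 2 from the two terms of
    the Schwarzian derivative. The exponent 14 is that of \<open>R\<close> in the square of
    \<open>R ^ 7 * B ^ 2\<close>.\<close>
  define C where "C = 922 * (707 * C0) ^ 2"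
  have C1: "C \<ge> 1" using C0(1) power_mono[of 1 "707 * C0" 2] by (simp add: C_def)
  show ?thesis
  proof (rule that[OF C1])
    fix R B :: real
    assume R: "8 \<le> R" and B: "1 \<le> B" and ctl: "controlled f c R B"
    have dB: "dsum f c R \<le> B" using ctl by (simp add: controlled_def)
    define \<delta>0 where "\<delta>0 = 1 / (4 * (B + 1))"
    have \<delta>0: "0 < \<delta>0" "\<delta>0 \<le> 1" "1 / \<delta>0 \<le> 8 * B" using B by (auto simp: \<delta>0_def)
    define T where "T = dist c ` ((irr f \<union> irr (deriv f)) \<inter> cball c R)"
    have cT: "countable T" unfolding T_def Int_Un_distrib2
      using irr_finite[OF f(1)] irr_finite[OF f(2)] by (intro countable_finite) auto
    have "finite (dist c ` zpset f c R)" using f by auto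
    moreover have "real (card (dist c ` zpset f c R)) \<le> B"
    proof -
      have "card (dist c ` zpset f c R) \<le> card (zpset f c R)" using f by (intro card_image_le) auto
      thus ?thesis using card_zpset_le_dsum[of f c R] dB by linarith
    qed
    ultimately have ex: "\<exists>r\<in>{\<rho>..\<rho> + 1}. r \<notin> T \<and> (\<forall>a\<in>zpset f c R. \<delta>0 \<le> \<bar>r - dist c a\<bar>)" for \<rho>
      unfolding \<delta>0_def by (elim good_radius[OF _ cT, of _ _ \<rho>]) auto
    \<comment> \<open>The two radii lie in intervals with a gap of length 1 between them, as
      \<open>controlled_of_log_plus\<close> requires.\<close>
    obtain R1 where R1: "R1 \<in> {R - 2..R - 1}" "R1 \<notin> T" "\<And>a. a \<in> zpset f c R \<Longrightarrow> \<delta>0 \<le> \<bar>R1 - dist c a\<bar>"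
      using ex[of "R - 2"] by auto
    obtain R0 where R0: "R0 \<in> {R - 4..R - 3}" "R0 \<notin> T" "\<And>a. a \<in> zpset f c R \<Longrightarrow> \<delta>0 \<le> \<bar>R0 - dist c a\<bar>"
      using ex[of "R - 4"] by auto
    have clean: "irr f \<inter> sphere c r = {}" "irr (deriv f) \<inter> sphere c r = {}" if "r \<notin> T" "r \<le> R" for r
      using that by (auto simp: T_def)
    define M where "M = 704 * R ^ 3 * B\<^sup>2"
    have pw: "log_plus (cmod (deriv f z)) \<le> M"
      if z: "z \<in> sphere c r" and r: "r \<notin> T" "r \<le> R - 1" "\<And>a. a \<in> zpset f c R \<Longrightarrow> \<delta>0 \<le> \<bar>r - dist c a\<bar>" for z r
    proof -
      have zi: "z \<notin> irr f" using clean(1)[of r] r z by auto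
      have zd: "\<delta>0 \<le> cmod (z - a)" if "a \<in> zpset f c R" for a
      proof -
        have "\<bar>r - dist c a\<bar> \<le> dist z a" using z dist_triangle[of c z a] dist_triangle[of c a z]
          by (auto simp: dist_commute)
        thus ?thesis using r(3)[OF that] by (simp add: dist_norm)
      qed
      have zc: "z \<in> cball c (R - 1)" using z r by auto
      have R2: "2 \<le> R" using R by simp
      note pt = controlled_pointwise[OF f(1) ctl R2 B \<delta>0(1,2) zc zi zd]
      have "log_plus (cmod (deriv f z)) = log_plus (cmod (f z) * cmod (deriv f z / f z))"
        using zi by (simp add: irr_def norm_divide)
      also have "\<dots> \<le> log_plus (cmod (f z)) + log_plus (cmod (deriv f z / f z))"
        by (intro log_plus_mult_le) auto
      also have "\<dots> \<le> \<bar>ln (cmod (f z))\<bar> + cmod (deriv f z / f z)"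
        by (intro add_mono log_plus_le_abs_ln log_plus_le_self) auto
      also have "\<dots> \<le> 47 * R ^ 3 * B / \<delta>0 + 41 * R ^ 2 * B / \<delta>0"
        by (intro add_mono pt(1,2))
      also have "\<dots> \<le> 47 * R ^ 3 * B / \<delta>0 + 41 * R ^ 3 * B / \<delta>0"
        using R B \<delta>0 by (intro add_mono divide_right_mono mult_right_mono mult_left_mono power_increasing) auto
      also have "\<dots> = 88 * R ^ 3 * B * (1 / \<delta>0)" by (simp add: field_simps)
      also have "\<dots> \<le> 88 * R ^ 3 * B * (8 * B)" using R B \<delta>0(3) by (intro mult_left_mono) auto
      also have "\<dots> = M" by (simp add: M_def power2_eq_square)
      finally show ?thesis .
    qed
    have mean: "cmean c r (\<lambda>z. log_plus (cmod (deriv f z))) \<le> M"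
      if r: "0 \<le> r" "r \<notin> T" "r \<le> R - 1" "\<And>a. a \<in> zpset f c R \<Longrightarrow> \<delta>0 \<le> \<bar>r - dist c a\<bar>" for r
    proof -
      have "irr (deriv f) \<inter> sphere c r = {}" using r by (intro clean) auto
      hence "cmean c r (\<lambda>z. log_plus (cmod (deriv f z))) \<le> cmean c r (\<lambda>_. M)"
        using pw[OF _ r(2-)] r(1)
        by (intro cmean_mono continuous_on_log_plus continuous_on_norm continuous_on_sphere_regular) auto
      thus ?thesis by simp
    qed
    define B' where "B' = C0 * R\<^sup>2 * (707 * R ^ 3 * B\<^sup>2)"
    have RB: "1 \<le> R ^ 3 * B\<^sup>2" "B \<le> R ^ 3 * B\<^sup>2"
    proof -
      have "1 \<le> R ^ 3" "1 \<le> B\<^sup>2" "B \<le> B\<^sup>2" using R B self_le_power[of B 2] by auto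
      thus "1 \<le> R ^ 3 * B\<^sup>2" "B \<le> R ^ 3 * B\<^sup>2"
        using mult_mono[of 1 "R ^ 3" 1 "B\<^sup>2"] mult_mono[of 1 "R ^ 3" B "B\<^sup>2"] R B by auto
    qed
    have ctl0: "controlled (deriv f) c R0 (C0 * R1\<^sup>2 * (M + 2 * B + 1))"
    proof (rule C0(2))
      have "dsum f c R1 \<le> dsum f c R" using R1 f by (intro dsum_mono) auto
      thus "(\<Sum>a\<in>zpset (deriv f) c R1. of_int (max 0 (- zorder (deriv f) a))) \<le> 2 * B"
        using pole_sum_deriv_le[OF f, of c R1] dB by linarith
    qed (use R0 R1 R clean mean in auto)
    have B'le: "C0 * R1\<^sup>2 * (M + 2 * B + 1) \<le> B'"
    proof -
      have "M + 2 * B + 1 \<le> 707 * R ^ 3 * B\<^sup>2"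
        unfolding M_def mult.assoc using RB by linarith
      moreover have "0 \<le> M + 2 * B + 1" using R B by (simp add: M_def)
      ultimately show ?thesis
        unfolding B'_def using C0(1) R1(1) R by (intro mult_mono power_mono) auto
    qed
    have ctl': "controlled (deriv f) c R0 B'"
      using ctl0 B'le unfolding controlled_def by auto
    have B'1: "B' \<ge> 1"
    proof -
      have "1 * 1 * 1 \<le> C0 * R\<^sup>2 * (707 * R ^ 3 * B\<^sup>2)"
        using C0 R RB by (intro mult_mono) auto
      thus ?thesis by (simp add: B'_def)
    qed
    define W where "W = zpset f c R \<union> zpset (deriv f) c R0"
    have fW: "finite W" using f by (auto simp: W_def)
    have BB: "B' = 707 * C0 * (R ^ 5 * B\<^sup>2)" by (simp add: B'_def eval_nat_numeral)
    have pow: "R ^ i * B ^ j \<le> (R * B) ^ 14" if "i \<le> 14" "j \<le> 14" for i j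
      unfolding power_mult_distrib using that R B by (intro mult_mono power_increasing) auto
    have RB14: "(R * B) ^ 14 \<ge> 0" using R B by simp
    have "real (card W) \<le> real (card (zpset f c R)) + real (card (zpset (deriv f) c R0))"
      unfolding W_def using card_Un_le[of "zpset f c R" "zpset (deriv f) c R0"] by linarith
    also have "\<dots> \<le> B + B'"
      using card_zpset_le_dsum[of f c R] dB card_zpset_le_dsum[of "deriv f" c R0] ctl' by (simp add: controlled_def)
    also have "B \<le> B'"
    proof -
      have "1 * (R ^ 3 * B\<^sup>2) \<le> (C0 * R\<^sup>2) * (707 * (R ^ 3 * B\<^sup>2))"

      proof (rule mult_mono)
        show "1 \<le> C0 * R\<^sup>2" using C0(1) R mult_mono[of 1 C0 1 "R\<^sup>2"] by simp
      qed (use RB C0(1) R B in auto)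
      thus ?thesis using RB by (simp add: B'_def mult_ac)
    qed
    also have "B' + B' \<le> C * (R * B) ^ 14"
    proof -
      have "B' \<le> 707 * C0 * (R * B) ^ 14"
        unfolding BB using C0 pow[of 5 2] by (intro mult_left_mono) auto
      moreover have "2 * (707 * C0) \<le> C"
        unfolding C_def power2_eq_square using C0 mult_mono[of 1 "707 * C0" "2 * (707 * C0)" "922 * (707 * C0)"] by simp
      ultimately show ?thesis
        using mult_right_mono[OF _ RB14, of "2 * (707 * C0)" C] by linarith
    qed
    finally have cardW: "real (card W) \<le> C * (R * B) ^ 14" by simp
    show "\<exists>W. finite W \<and> real (card W) \<le> C * (R * B) ^ 14 \<and>
      (\<forall>z\<in>cball c (R - 6). \<forall>\<delta>. 0 < \<delta> \<longrightarrow> \<delta> \<le> 1 \<longrightarrow> (\<forall>a\<in>W. \<delta> \<le> cmod (z - a)) \<longrightarrow>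
         z \<notin> irr f \<longrightarrow> z \<notin> irr (deriv f) \<longrightarrow>
         \<bar>ln (cmod (f z))\<bar> \<le> C * (R * B) ^ 14 / \<delta>\<^sup>2 \<and> cmod (schwarzian f z) \<le> C * (R * B) ^ 14 / \<delta>\<^sup>2)"
    proof (intro exI[of _ W] conjI fW cardW ballI allI impI)
      fix z \<delta> assume z: "z \<in> cball c (R - 6)" and \<delta>: "0 < \<delta>" "\<delta> \<le> 1" and zW: "\<forall>a\<in>W. \<delta> \<le> cmod (z - a)"
        and zi: "z \<notin> irr f" "z \<notin> irr (deriv f)"
      have \<delta>2: "\<delta>\<^sup>2 \<le> \<delta>" "\<delta>\<^sup>2 > 0" using \<delta> by (auto simp: power2_eq_square mult_left_le)
      have C47: "47 \<le> C" using C0(1) power_mono[of 1 "707 * C0" 2] by (simp add: C_def)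
      have "\<bar>ln (cmod (f z))\<bar> \<le> 47 * R ^ 3 * B / \<delta>"
        using z R zW by (intro controlled_pointwise(1)[OF f(1) ctl _ B \<delta> _ zi(1)]) (auto simp: W_def)
      also have "\<dots> = 47 * (R ^ 3 * B ^ 1) / \<delta>" by simp
      also have "\<dots> \<le> C * (R * B) ^ 14 / \<delta>\<^sup>2"
        using pow[of 3 1] C47 R B \<delta> \<delta>2 C1 by (intro frac_le mult_mono mult_nonneg_nonneg) auto
      finally show "\<bar>ln (cmod (f z))\<bar> \<le> C * (R * B) ^ 14 / \<delta>\<^sup>2" .
      let ?w = "\<lambda>z. deriv (deriv f) z / deriv f z"
      have zc: "z \<in> cball c (R0 - 1)" using z R0 by auto
      have R02: "2 \<le> R0" using R0 R by auto
      have zW': "\<delta> \<le> cmod (z - a)" if "a \<in> zpset (deriv f) c R0" for a using zW that by (auto simp: W_def)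
      note pt = controlled_pointwise[OF f(2) ctl' R02 B'1 \<delta> zc zi(2) zW']
      have R0R: "R0\<^sup>2 \<le> R\<^sup>2" using R0 R by (intro power_mono) auto
      have "schwarzian f z = deriv ?w z - ?w z ^ 2 / 2"
        using zi by (intro schwarzian_logderiv) (auto simp: irr_def)
      hence "cmod (schwarzian f z) \<le> cmod (deriv ?w z) + cmod (?w z) ^ 2 / 2"
        using norm_triangle_ineq4[of "deriv ?w z" "?w z ^ 2 / 2"] by (simp add: norm_power norm_divide)
      also have "\<dots> \<le> 81 * R\<^sup>2 * B' / \<delta>\<^sup>2 + (41 * R\<^sup>2 * B' / \<delta>)\<^sup>2 / 2"
      proof (intro add_mono divide_right_mono power_mono)
        show "cmod (deriv ?w z) \<le> 81 * R\<^sup>2 * B' / \<delta>\<^sup>2"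
          using R0R B'1 by - (rule order_trans[OF pt(3)], assumption, intro divide_right_mono mult_right_mono mult_left_mono, auto)
        show "cmod (?w z) \<le> 41 * R\<^sup>2 * B' / \<delta>"
          using R0R B'1 \<delta> by - (rule order_trans[OF pt(2)], assumption, intro divide_right_mono mult_right_mono mult_left_mono, auto)
      qed auto
      also have "\<dots> = (81 * (R\<^sup>2 * B') + 1681 / 2 * (R\<^sup>2 * B')\<^sup>2) / \<delta>\<^sup>2"
        by (simp add: power_divide power_mult_distrib add_divide_distrib)
      also have "\<dots> \<le> (922 * (R\<^sup>2 * B')\<^sup>2) / \<delta>\<^sup>2"
      proof -
        have "1 \<le> R\<^sup>2 * B'" using R B'1 mult_mono[of 1 "R\<^sup>2" 1 B'] by simp
        hence "R\<^sup>2 * B' \<le> (R\<^sup>2 * B')\<^sup>2" by (intro self_le_power) auto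
        hence "81 * (R\<^sup>2 * B') + 1681 / 2 * (R\<^sup>2 * B')\<^sup>2 \<le> 922 * (R\<^sup>2 * B')\<^sup>2"
          using zero_le_power2[of "R\<^sup>2 * B'"] by linarith
        thus ?thesis by (rule divide_right_mono) simp
      qed
      also have "922 * (R\<^sup>2 * B')\<^sup>2 = C * (R ^ 14 * B ^ 4)"
        unfolding BB C_def by (simp add: power_mult_distrib flip: power_mult power_add)
      also have "\<dots> \<le> C * (R * B) ^ 14" using C1 pow[of 14 4] by (intro mult_left_mono) auto
      finally show "cmod (schwarzian f z) \<le> C * (R * B) ^ 14 / \<delta>\<^sup>2"
        using \<delta> by (simp add: divide_right_mono)
    qed
  qed
qed

section \<open>Rational coefficients\<close>

lemma eventually_poly_nz: "p \<noteq> 0 \<Longrightarrow> \<forall>\<^sub>F z in cofinite. poly p z \<noteq> 0"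
  for p :: "complex poly"
  by (simp add: eventually_cofinite poly_roots_finite)

text \<open>Evaluation returns 0 at a pole, so it respects the algebra only off a finite set. This
  restriction is carried along by all the evaluation rules.\<close>

lemma ratfun_eval_add: "\<forall>\<^sub>F z in cofinite. ratfun_eval (p + q) z = ratfun_eval p z + ratfun_eval q z"
proof -
  define a b c d where "a = fst (quot_of_fract p)" and "b = snd (quot_of_fract p)"
    and "c = fst (quot_of_fract q)" and "d = snd (quot_of_fract q)"
  have nz: "b \<noteq> 0" "d \<noteq> 0" by (simp_all add: b_def d_def)
  have pq: "p = Fract a b" "q = Fract c d" by (simp_all add: a_def b_def c_def d_def Fract_quot_of_fract)
  have "\<forall>\<^sub>F z in cofinite. poly b z \<noteq> 0" "\<forall>\<^sub>F z in cofinite. poly d z \<noteq> 0"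
    using nz by (auto intro: eventually_poly_nz)
  thus ?thesis
  proof eventually_elim
    case (elim z)
    have "ratfun_eval (p + q) z = poly (a * d + c * b) z / poly (b * d) z"
      unfolding pq add_fract[OF nz] using elim by (intro ratfun_eval_Fract) simp
    moreover have "ratfun_eval p z = poly a z / poly b z" "ratfun_eval q z = poly c z / poly d z"
      unfolding pq using elim by (auto intro: ratfun_eval_Fract)
    ultimately show ?case using elim by (simp add: add_frac_eq)
  qed
qed

lemma ratfun_eval_mult: "\<forall>\<^sub>F z in cofinite. ratfun_eval (p * q) z = ratfun_eval p z * ratfun_eval q z"
proof -
  define a b c d where "a = fst (quot_of_fract p)" and "b = snd (quot_of_fract p)"
    and "c = fst (quot_of_fract q)" and "d = snd (quot_of_fract q)"
  have nz: "b \<noteq> 0" "d \<noteq> 0" by (simp_all add: b_def d_def)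
  have pq: "p = Fract a b" "q = Fract c d" by (simp_all add: a_def b_def c_def d_def Fract_quot_of_fract)
  have "\<forall>\<^sub>F z in cofinite. poly b z \<noteq> 0" "\<forall>\<^sub>F z in cofinite. poly d z \<noteq> 0"
    using nz by (auto intro: eventually_poly_nz)
  thus ?thesis
  proof eventually_elim
    case (elim z)
    have "ratfun_eval (p * q) z = poly (a * c) z / poly (b * d) z"
      unfolding pq mult_fract using elim by (intro ratfun_eval_Fract) simp
    moreover have "ratfun_eval p z = poly a z / poly b z" "ratfun_eval q z = poly c z / poly d z"
      unfolding pq using elim by (auto intro: ratfun_eval_Fract)
    ultimately show ?case by simp
  qed
qed

lemma ratfun_eval_1 [simp]: "ratfun_eval 1 z = 1"
proof -
  have "ratfun_eval (Fract 1 1) z = poly 1 z / poly 1 z" by (rule ratfun_eval_Fract) simp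
  thus ?thesis unfolding One_fract_def[symmetric] by simp
qed

lemma ratfun_eval_uminus: "\<forall>\<^sub>F z in cofinite. ratfun_eval (- p) z = - ratfun_eval p z"
  using ratfun_eval_add[of "- p" p] by eventually_elim (simp add: eq_neg_iff_add_eq_0)

lemma ratpoly_eval_0 [simp]: "ratpoly_eval 0 z w = 0"
  by (simp add: ratpoly_eval_def)

lemma ratpoly_eval_pCons [simp]:
  "ratpoly_eval (pCons a A) z w = ratfun_eval a z + w * ratpoly_eval A z w"
  by (simp add: ratpoly_eval_def map_poly_pCons)

text \<open>The exceptional set must not depend on \<open>w\<close>, because \<open>w\<close> will
  be the value of \<open>f\<close> at the same point.\<close>

lemma ratpoly_eval_add:
  "\<forall>\<^sub>F z in cofinite. \<forall>w. ratpoly_eval (A + B) z w = ratpoly_eval A z w + ratpoly_eval B z w"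
proof (induction A arbitrary: B)
  case (pCons a A)
  obtain b B' where B: "B = pCons b B'" by (cases B)
  show ?case using pCons.IH[of B'] ratfun_eval_add[of a b]
    by eventually_elim (simp add: B algebra_simps)
qed auto

lemma ratpoly_eval_smult:
  "\<forall>\<^sub>F z in cofinite. \<forall>w. ratpoly_eval (smult c A) z w = ratfun_eval c z * ratpoly_eval A z w"
proof (induction A)
  case (pCons a A)
  show ?case using pCons.IH ratfun_eval_mult[of c a]
    by eventually_elim (simp add: algebra_simps)
qed auto

lemma ratpoly_eval_mult:
  "\<forall>\<^sub>F z in cofinite. \<forall>w. ratpoly_eval (A * B) z w = ratpoly_eval A z w * ratpoly_eval B z w"
proof (induction A)
  case (pCons a A)
  show ?case
    using pCons.IH ratpoly_eval_add[of "smult a B" "pCons 0 (A * B)"] ratpoly_eval_smult[of a B]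
  proof eventually_elim
    case (elim z)
    show ?case
    proof
      fix w
      have "ratpoly_eval (pCons a A * B) z w = ratpoly_eval (smult a B + pCons 0 (A * B)) z w"
        by (simp only: mult_pCons_left)
      also have "\<dots> = ratfun_eval a z * ratpoly_eval B z w + w * (ratpoly_eval A z w * ratpoly_eval B z w)"
        using elim by simp
      finally show "ratpoly_eval (pCons a A * B) z w = ratpoly_eval (pCons a A) z w * ratpoly_eval B z w"
        by (simp add: distrib_right mult.assoc)
    qed
  qed
qed auto

lemma ratfun_eval_poly:
  "\<forall>\<^sub>F z in cofinite. ratfun_eval (poly A b) z = ratpoly_eval A z (ratfun_eval b z)"
proof (induction A)
  case (pCons a A)
  show ?case using pCons.IH ratfun_eval_add[of a "b * poly A b"] ratfun_eval_mult[of b "poly A b"]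
    by eventually_elim simp
qed auto

section \<open>Growth of rational functions away from finitely many points\<close>

lemma const_le_power: "\<exists>m::nat. \<forall>X\<ge>2. (K::real) \<le> X ^ m"
proof -
  obtain m :: nat where "K < 2 ^ m" using real_arch_pow[of 2 K] by auto
  hence "K \<le> X ^ m" if "X \<ge> 2" for X :: real using power_mono[OF that, of m] by simp
  thus ?thesis by blast
qed

lemma base_ge_2:
  assumes "0 < \<delta>" "\<delta> \<le> 1"
  shows "2 \<le> (2 + cmod z) / \<delta>"
proof -
  have "2 * \<delta> \<le> 2 + cmod z" using assms norm_ge_zero[of z] by linarith
  thus ?thesis using assms(1) by (simp add: pos_le_divide_eq)
qed

text \<open>One root is split off at a time: its factor is at least \<open>\<delta>\<close> and at
  most linear in the modulus of \<open>z\<close>. The base measures closeness to infinity and to the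
  roots simultaneously; being at least 2, it lets every constant be absorbed in the
  exponent.\<close>

lemma poly_growth_bounds:
  fixes p :: "complex poly"
  assumes "p \<noteq> 0"
  shows "\<exists>Z C. finite Z \<and> (\<forall>z \<delta>. 0 < \<delta> \<longrightarrow> \<delta> \<le> 1 \<longrightarrow> (\<forall>a\<in>Z. \<delta> \<le> cmod (z - a)) \<longrightarrow>
     1 / ((2 + cmod z) / \<delta>) ^ C \<le> cmod (poly p z) \<and> cmod (poly p z) \<le> ((2 + cmod z) / \<delta>) ^ C)"
  using assms
proof (induction "degree p" arbitrary: p)
  case 0
  then obtain c where c: "p = [:c:]" "c \<noteq> 0" by (metis degree_eq_zeroE pCons_eq_0_iff)
  obtain m :: nat where m: "\<And>X :: real. X \<ge> 2 \<Longrightarrow> max (cmod c) (1 / cmod c) \<le> X ^ m"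
    using const_le_power[of "max (cmod c) (1 / cmod c)"] by blast
  show ?case
  proof (intro exI[of _ "{}"] exI[of _ m] conjI allI impI)
    fix z and \<delta> :: real assume \<delta>: "0 < \<delta>" "\<delta> \<le> 1"
    let ?X = "(2 + cmod z) / \<delta>"
    have X: "?X \<ge> 2" by (rule base_ge_2[OF \<delta>])
    from m[OF X] have mm: "1 / cmod c \<le> ?X ^ m" "cmod c \<le> ?X ^ m" by auto
    have inv: "1 / Y \<le> cmod c" if "1 / cmod c \<le> Y" "Y > 0" for Y
    proof -
      have "0 < 1 / cmod c" using c(2) by simp
      hence "1 / Y \<le> 1 / (1 / cmod c)" using that by (intro divide_left_mono mult_pos_pos) linarith+
      thus ?thesis by simp
    qed
    have pz: "cmod (poly p z) = cmod c" by (simp add: c(1))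
    show "cmod (poly p z) \<le> ?X ^ m" unfolding pz by (rule mm(2))
    show "1 / ?X ^ m \<le> cmod (poly p z)" unfolding pz
      by (rule inv[OF mm(1)]) (rule zero_less_power, use X in linarith)
  qed simp
next
  case (Suc n)
  have "\<not> constant (poly p)" using Suc.hyps(2) by (simp add: constant_degree)
  then obtain a where "poly p a = 0" using fundamental_theorem_of_algebra by blast
  then obtain q where q: "p = [:- a, 1:] * q" by (auto simp: poly_eq_0_iff_dvd elim: dvdE)
  have q0: "q \<noteq> 0" using q Suc.prems by auto
  have "degree p = degree [:- a, 1:] + degree q" unfolding q by (rule degree_mult_eq) (use q0 in auto)
  hence "degree q = n" using Suc.hyps(2) by simp
  from Suc.hyps(1)[OF this[symmetric] q0] obtain Z C where ZC: "finite Z"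
    "\<And>z \<delta>. 0 < \<delta> \<Longrightarrow> \<delta> \<le> 1 \<Longrightarrow> (\<forall>a\<in>Z. \<delta> \<le> cmod (z - a)) \<Longrightarrow>
     1 / ((2 + cmod z) / \<delta>) ^ C \<le> cmod (poly q z) \<and> cmod (poly q z) \<le> ((2 + cmod z) / \<delta>) ^ C" by blast
  obtain m :: nat where m: "\<And>X :: real. X \<ge> 2 \<Longrightarrow> 1 + cmod a \<le> X ^ m"
    using const_le_power[of "1 + cmod a"] by blast
  show ?case
  proof (intro exI[of _ "insert a Z"] exI[of _ "C + (m + 1)"] conjI allI impI)
    fix z and \<delta> :: real assume \<delta>: "0 < \<delta>" "\<delta> \<le> 1" and d: "\<forall>a\<in>insert a Z. \<delta> \<le> cmod (z - a)"
    let ?X = "(2 + cmod z) / \<delta>"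
    have X: "?X \<ge> 2" by (rule base_ge_2[OF \<delta>])
    have X1: "2 + cmod z \<le> ?X" using \<delta> by (simp add: le_divide_eq mult_left_le)
    have IH: "1 / ?X ^ C \<le> cmod (poly q z)" "cmod (poly q z) \<le> ?X ^ C"
      using ZC(2)[OF \<delta>] d by auto
    have up: "cmod (z - a) \<le> ?X ^ (m + 1)"
    proof -
      have "cmod (z - a) \<le> cmod z + cmod a" by (rule norm_triangle_ineq4)
      also have "\<dots> \<le> (2 + cmod z) * (1 + cmod a)" by (simp add: algebra_simps)
      also have "\<dots> \<le> ?X * ?X ^ m" using X X1 m[OF X] by (intro mult_mono) auto
      finally show ?thesis by simp
    qed
    have lo: "1 / ?X ^ (m + 1) \<le> cmod (z - a)"
    proof -
      have "?X \<le> ?X ^ (m + 1)" using X by (intro self_le_power) auto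
      hence "1 / ?X ^ (m + 1) \<le> 1 / ?X" by (intro frac_le) (use X in linarith)+
      also have "\<dots> = \<delta> / (2 + cmod z)" by simp
      also have "\<dots> \<le> \<delta> / 1" using \<delta> by (intro divide_left_mono) (auto intro: add_pos_nonneg)
      also have "\<dots> = \<delta>" by simp
      finally show ?thesis using d by auto
    qed
    have eq: "cmod (poly p z) = cmod (poly q z) * cmod (z - a)"
    proof -
      have "poly p z = poly q z * (z - a)" by (simp add: q algebra_simps)
      thus ?thesis by (simp only: norm_mult)
    qed
    show "cmod (poly p z) \<le> ?X ^ (C + (m + 1))"
      unfolding eq power_add[of _ C] using IH up X by (intro mult_mono) auto
    have "1 / ?X ^ (C + (m + 1)) = (1 / ?X ^ C) * (1 / ?X ^ (m + 1))" by (simp only: power_add[of _ C] times_divide_times_eq mult_1)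
    also have "\<dots> \<le> cmod (poly q z) * cmod (z - a)"
      by (rule mult_mono[OF IH(1) lo norm_ge_zero], rule divide_nonneg_nonneg, simp, rule zero_le_power)
         (use X in linarith)
    finally show "1 / ?X ^ (C + (m + 1)) \<le> cmod (poly p z)" unfolding eq .
  qed (use ZC in auto)
qed

definition tame_bounds :: "ratfun set \<Rightarrow> complex set \<Rightarrow> nat \<Rightarrow> bool" where
  "tame_bounds S Z C \<longleftrightarrow> finite Z \<and> (\<forall>z \<delta>. 0 < \<delta> \<longrightarrow> \<delta> \<le> 1 \<longrightarrow> (\<forall>a\<in>Z. \<delta> \<le> cmod (z - a)) \<longrightarrow>
     (\<forall>q\<in>S. cmod (ratfun_eval q z) \<le> ((2 + cmod z) / \<delta>) ^ C \<and>
        (q \<noteq> 0 \<longrightarrow> 1 / ((2 + cmod z) / \<delta>) ^ C \<le> cmod (ratfun_eval q z))))"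

lemma tame_bounds_insert:
  assumes "tame_bounds S Z C"
  shows "\<exists>Z C. tame_bounds (insert q S) Z C"
proof (cases "q = 0")
  case True
  show ?thesis
  proof (intro exI)
    show "tame_bounds (insert q S) Z C"
      using assms unfolding tame_bounds_def True by (auto intro!: zero_le_power divide_nonneg_nonneg)
  qed
next
  case False
  define a b where "a = fst (quot_of_fract q)" and "b = snd (quot_of_fract q)"
  have q: "q = Fract a b" by (simp add: a_def b_def Fract_quot_of_fract)
  have b: "b \<noteq> 0" by (simp add: b_def)
  have a: "a \<noteq> 0"
  proof
    assume "a = 0"
    hence "q = Fract 0 1" using q b by (simp only: eq_fract)
    thus False using False unfolding Zero_fract_def[symmetric] by simp
  qed
  obtain Z1 C1 where 1: "finite Z1" "\<And>z \<delta>. 0 < \<delta> \<Longrightarrow> \<delta> \<le> 1 \<Longrightarrow> (\<forall>a\<in>Z1. \<delta> \<le> cmod (z - a)) \<Longrightarrow>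
     1 / ((2 + cmod z) / \<delta>) ^ C1 \<le> cmod (poly a z) \<and> cmod (poly a z) \<le> ((2 + cmod z) / \<delta>) ^ C1"
    using poly_growth_bounds[OF a] by blast
  obtain Z2 C2 where 2: "finite Z2" "\<And>z \<delta>. 0 < \<delta> \<Longrightarrow> \<delta> \<le> 1 \<Longrightarrow> (\<forall>a\<in>Z2. \<delta> \<le> cmod (z - a)) \<Longrightarrow>
     1 / ((2 + cmod z) / \<delta>) ^ C2 \<le> cmod (poly b z) \<and> cmod (poly b z) \<le> ((2 + cmod z) / \<delta>) ^ C2"
    using poly_growth_bounds[OF b] by blast
  have "tame_bounds (insert q S) (Z \<union> Z1 \<union> Z2) (C + C1 + C2)"
    unfolding tame_bounds_def
  proof (intro conjI allI impI ballI)
    show "finite (Z \<union> Z1 \<union> Z2)" using assms 1 2 by (auto simp: tame_bounds_def)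
  next
    fix z q' and \<delta> :: real assume \<delta>: "0 < \<delta>" "\<delta> \<le> 1" and d: "\<forall>a\<in>Z \<union> Z1 \<union> Z2. \<delta> \<le> cmod (z - a)"
      and q': "q' \<in> insert q S"
    let ?X = "(2 + cmod z) / \<delta>"
    have X: "?X \<ge> 2" by (rule base_ge_2[OF \<delta>])
    have *: "\<exists>C'\<le>C + C1 + C2. cmod (ratfun_eval q' z) \<le> ?X ^ C' \<and> (q' \<noteq> 0 \<longrightarrow> 1 / ?X ^ C' \<le> cmod (ratfun_eval q' z))"
    proof (cases "q' = q")
      case True
      have b1: "1 / ?X ^ C1 \<le> cmod (poly a z)" "cmod (poly a z) \<le> ?X ^ C1" using 1(2)[OF \<delta>] d by auto
      have b2: "1 / ?X ^ C2 \<le> cmod (poly b z)" "cmod (poly b z) \<le> ?X ^ C2" using 2(2)[OF \<delta>] d by auto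
      have pos: "?X ^ C1 > 0" "?X ^ C2 > 0" using X by auto
      have bz: "cmod (poly b z) > 0" by (rule less_le_trans[OF _ b2(1)]) (use pos(2) in simp)
      have eq: "cmod (ratfun_eval q' z) = cmod (poly a z) / cmod (poly b z)"
        using bz unfolding True q by (subst ratfun_eval_Fract) (auto simp: norm_divide)
      have "cmod (ratfun_eval q' z) \<le> ?X ^ C1 / (1 / ?X ^ C2)"
        unfolding eq using b1 b2 pos by (intro frac_le) auto
      moreover have "(1 / ?X ^ C1) / ?X ^ C2 \<le> cmod (ratfun_eval q' z)"
        unfolding eq using b1 b2 pos bz by (intro frac_le) auto
      ultimately show ?thesis
        by (intro exI[of _ "C1 + C2"]) (simp add: power_add)
    next
      case False
      thus ?thesis using assms \<delta> d q' unfolding tame_bounds_def by (intro exI[of _ C]) auto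
    qed
    then obtain C' where C': "C' \<le> C + C1 + C2" "cmod (ratfun_eval q' z) \<le> ?X ^ C'"
      "q' \<noteq> 0 \<longrightarrow> 1 / ?X ^ C' \<le> cmod (ratfun_eval q' z)" by blast
    have le: "?X ^ C' \<le> ?X ^ (C + C1 + C2)" using C'(1) X by (intro power_increasing) auto
    show "cmod (ratfun_eval q' z) \<le> ?X ^ (C + C1 + C2)" using C'(2) le by linarith
    have "1 / ?X ^ (C + C1 + C2) \<le> 1 / ?X ^ C'" using le X by (intro divide_left_mono) auto
    thus "1 / ?X ^ (C + C1 + C2) \<le> cmod (ratfun_eval q' z)" if "q' \<noteq> 0" using C'(3) that by linarith
  qed
  thus ?thesis by blast
qed

lemma tame_bounds_exists: "finite S \<Longrightarrow> \<exists>Z C. tame_bounds S Z C"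
proof (induction S rule: finite_induct)
  case empty
  show ?case by (rule exI[of _ "{}"], rule exI[of _ 0]) (simp add: tame_bounds_def)
next
  case (insert q S)
  thus ?case using tame_bounds_insert by blast
qed

lemma norm_poly_le:
  fixes p :: "complex poly"
  assumes "degree p \<le> N" "\<And>i. cmod (coeff p i) \<le> \<Lambda>" "1 \<le> \<Lambda>" "cmod w \<le> 2 * \<Lambda>"
  shows "cmod (poly p w) \<le> (4 * \<Lambda>) ^ (N + 1)"
  using assms(1,2)
proof (induction N arbitrary: p)
  case 0
  then obtain c where "p = [:c:]" by (metis degree_eq_zeroE le_zero_eq)
  thus ?case using 0(2)[of 0] assms(3) by simp
next
  case (Suc N)
  obtain a q where p: "p = pCons a q" by (cases p)
  have "cmod (poly q w) \<le> (4 * \<Lambda>) ^ (N + 1)"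
  proof (rule Suc.IH)
    show "degree q \<le> N" using Suc.prems(1) by (auto simp: p split: if_splits)
    show "cmod (coeff q i) \<le> \<Lambda>" for i using Suc.prems(2)[of "Suc i"] by (simp add: p)
  qed
  hence "cmod (w * poly q w) \<le> 2 * \<Lambda> * (4 * \<Lambda>) ^ (N + 1)"
    unfolding norm_mult using assms by (intro mult_mono) auto
  moreover have "cmod a \<le> \<Lambda>" using Suc.prems(2)[of 0] by (simp add: p)
  moreover have "\<Lambda> * 1 \<le> \<Lambda> * (4 * \<Lambda>) ^ (N + 1)" using assms(3) by (intro mult_left_mono one_le_power) auto
  ultimately have "cmod (a + w * poly q w) \<le> 3 * (\<Lambda> * (4 * \<Lambda>) ^ (N + 1))"
    using norm_triangle_ineq[of a "w * poly q w"] by simp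
  also have "\<dots> \<le> (4 * \<Lambda>) ^ (Suc N + 1)" using assms(3) by simp
  finally show ?case by (simp add: p)
qed

lemma norm_poly_diff_le:
  fixes p :: "complex poly"
  assumes "degree p \<le> N" "\<And>i. cmod (coeff p i) \<le> \<Lambda>" "1 \<le> \<Lambda>" "cmod w \<le> 2 * \<Lambda>" "cmod b \<le> 2 * \<Lambda>"
  shows "cmod (poly p w - poly p b) \<le> cmod (w - b) * (4 * \<Lambda>) ^ (N + 1)"
  using assms(1,2)
proof (induction N arbitrary: p)
  case 0
  then obtain c where "p = [:c:]" by (metis degree_eq_zeroE le_zero_eq)
  thus ?case using assms(3) by simp
next
  case (Suc N)
  obtain a q where p: "p = pCons a q" by (cases p)
  have dq: "degree q \<le> N" "cmod (coeff q i) \<le> \<Lambda>" for i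
    using Suc.prems(1) Suc.prems(2)[of "Suc i"] by (auto simp: p split: if_splits)
  have "poly p w - poly p b = w * (poly q w - poly q b) + (w - b) * poly q b"
    by (simp add: p algebra_simps)
  also have "cmod \<dots> \<le> cmod w * cmod (poly q w - poly q b) + cmod (w - b) * cmod (poly q b)"
    using norm_triangle_ineq[of "w * (poly q w - poly q b)" "(w - b) * poly q b"] by (simp add: norm_mult)
  also have "\<dots> \<le> 2 * \<Lambda> * (cmod (w - b) * (4 * \<Lambda>) ^ (N + 1)) + cmod (w - b) * (4 * \<Lambda>) ^ (N + 1)"
    using assms by (intro add_mono mult_mono Suc.IH dq norm_poly_le) auto
  also have "\<dots> = cmod (w - b) * ((2 * \<Lambda> + 1) * (4 * \<Lambda>) ^ (N + 1))" by (simp add: algebra_simps)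
  also have "\<dots> \<le> cmod (w - b) * (4 * \<Lambda> * (4 * \<Lambda>) ^ (N + 1))"
    using assms(3) by (intro mult_left_mono mult_right_mono) auto
  finally show ?case by simp
qed

text \<open>From the stated radius on, the lower terms together amount to at most half of the lower
  bound for the leading term.\<close>

lemma norm_poly_large:
  fixes p :: "complex poly"
  assumes "\<And>i. cmod (coeff p i) \<le> \<Lambda>" "1 \<le> \<Lambda>" "1 / \<Lambda> \<le> cmod (lead_coeff p)"
    and "1 \<le> cmod w" "2 * real (degree p) * \<Lambda>\<^sup>2 \<le> cmod w"
  shows "cmod w ^ degree p / (2 * \<Lambda>) \<le> cmod (poly p w)"
    and "cmod (poly p w) \<le> (real (degree p) + 1) * \<Lambda> * cmod w ^ degree p"
proof -
  let ?n = "degree p"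
  have alt: "poly p w = lead_coeff p * w ^ ?n + (\<Sum>i<?n. coeff p i * w ^ i)"
    by (simp add: poly_altdef lessThan_Suc_atMost[symmetric] del: lessThan_Suc_atMost)
  have tm: "cmod (coeff p i * w ^ i) \<le> \<Lambda> * cmod w ^ j" if "i \<le> j" for i j
    unfolding norm_mult norm_power using assms that by (intro mult_mono power_increasing) auto
  have "cmod (poly p w) \<le> (\<Sum>i\<le>?n. \<Lambda> * cmod w ^ ?n)"
    unfolding poly_altdef by (rule sum_norm_le) (auto intro: tm)
  thus "cmod (poly p w) \<le> (real ?n + 1) * \<Lambda> * cmod w ^ ?n" by (simp add: algebra_simps)
  have rest: "cmod (\<Sum>i<?n. coeff p i * w ^ i) \<le> cmod w ^ ?n / (2 * \<Lambda>)"
  proof (cases "?n = 0")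
    case False
    have "cmod (\<Sum>i<?n. coeff p i * w ^ i) \<le> (\<Sum>i<?n. \<Lambda> * cmod w ^ (?n - 1))"
      by (rule sum_norm_le) (auto intro: tm)
    also have "\<dots> = (2 * real ?n * \<Lambda>\<^sup>2) * cmod w ^ (?n - 1) / (2 * \<Lambda>)" using assms(2) by (simp add: power2_eq_square)
    also have "\<dots> \<le> cmod w * cmod w ^ (?n - 1) / (2 * \<Lambda>)"
      using assms by (intro divide_right_mono mult_right_mono) auto
    also have "cmod w * cmod w ^ (?n - 1) = cmod w ^ ?n" using False by (simp flip: power_Suc)
    finally show ?thesis .
  qed (use assms in auto)
  have "1 / \<Lambda> * cmod w ^ ?n \<le> cmod (lead_coeff p * w ^ ?n)"
    unfolding norm_mult norm_power using assms by (intro mult_right_mono) auto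
  moreover have "1 / \<Lambda> * cmod w ^ ?n = cmod w ^ ?n / (2 * \<Lambda>) + cmod w ^ ?n / (2 * \<Lambda>)"
    using assms(2) by (simp add: field_simps)
  ultimately show "cmod w ^ ?n / (2 * \<Lambda>) \<le> cmod (poly p w)"
    using rest norm_triangle_ineq2[of "lead_coeff p * w ^ ?n" "- (\<Sum>i<?n. coeff p i * w ^ i)"] unfolding alt by simp
qed

lemma coeff_map_ratpoly: "coeff (map_poly (\<lambda>c. ratfun_eval c z) A) i = ratfun_eval (coeff A i) z"
  by (simp add: coeff_map_poly)

lemma degree_map_ratpoly:
  assumes "ratfun_eval (lead_coeff A) z \<noteq> 0"
  shows "degree (map_poly (\<lambda>c. ratfun_eval c z) A) = degree A"
  by (rule map_poly_degree_eq) (use assms in simp)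

lemma linear_not_unit: "\<not> is_unit [:- b, 1:]"
  for b :: "'a :: field"
  by (simp add: is_unit_iff_degree)

text \<open>Coprimality enters the estimates in this form: a coefficient that is nonzero as a
  rational function is bounded below away from finitely many points.\<close>

lemma coprime_linear_imp_poly_nz:
  fixes b :: "'a :: field"
  assumes "coprime A B" "[:- b, 1:] dvd B"
  shows "poly A b \<noteq> 0"
proof
  assume "poly A b = 0"
  hence "[:- b, 1:] dvd A" by (simp add: poly_eq_0_iff_dvd)
  thus False using assms linear_not_unit[of b] by (meson coprime_common_divisor)
qed

text \<open>Close to \<open>b\<close> both polynomials keep at least half of the lower bound that
  holds at \<open>b\<close>, so the double factor in the denominator makes the quotient large. Close
  to infinity the leading terms dominate. The single number \<open>\<Lambda>\<close> bounds all
  coefficients and the reciprocals of everything that must stay away from 0.\<close>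

lemma quotient_estimates:
  fixes p q :: "complex poly"
  assumes dp: "degree p = degree q + 2 + d" and \<Lambda>: "2 \<le> \<Lambda>"
    and cp: "\<And>i. cmod (coeff p i) \<le> \<Lambda>" and cq: "\<And>i. cmod (coeff q i) \<le> \<Lambda>"
    and b: "cmod b \<le> \<Lambda>" and pb: "1 / \<Lambda> \<le> cmod (poly p b)" and qb: "1 / \<Lambda> \<le> cmod (poly q b)"
    and lp: "1 / \<Lambda> \<le> cmod (lead_coeff p)" and lq: "1 / \<Lambda> \<le> cmod (lead_coeff q)"
  defines "L \<equiv> (4 * \<Lambda>) ^ (degree p + 3)"
  shows "w \<noteq> b \<Longrightarrow> cmod (w - b) \<le> 1 / L \<Longrightarrow> 1 / (L * (cmod (w - b))\<^sup>2) \<le> cmod (poly p w / ((w - b)\<^sup>2 * poly q w))"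
    and "L \<le> cmod w \<Longrightarrow> cmod w ^ d / L \<le> cmod (poly p w / ((w - b)\<^sup>2 * poly q w))"
proof -
  let ?n = "degree p" and ?l = "degree q"
  \<comment> \<open>\<open>T\<close> is the constant of \<open>norm_poly_le\<close> and
    \<open>norm_poly_diff_le\<close>. The two further factors \<open>4 * \<Lambda>\<close> of
    \<open>L\<close> pay for halving the values at \<open>b\<close> and for the constants at
    infinity.\<close>
  define T where "T = (4 * \<Lambda>) ^ (?n + 1)"
  have T1: "1 \<le> T" unfolding T_def using \<Lambda> by (intro one_le_power) auto
  have LT: "L = (16 * \<Lambda>\<^sup>2) * T"
  proof -
    have "L = (4 * \<Lambda>) ^ (2 + (?n + 1))" unfolding L_def by (rule arg_cong[of _ _ "\<lambda>k. (4 * \<Lambda>) ^ k"]) simp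
    also have "\<dots> = (4 * \<Lambda>) ^ 2 * T" unfolding T_def by (rule power_add)
    finally show ?thesis by (simp add: power_mult_distrib)
  qed
  have L2: "2 * \<Lambda> * T \<le> L"
  proof -
    have "\<Lambda> * 1 \<le> \<Lambda> * \<Lambda>" using \<Lambda> by (intro mult_left_mono) auto
    hence "2 * \<Lambda> \<le> 16 * \<Lambda>\<^sup>2" using \<Lambda> unfolding power2_eq_square by linarith
    thus ?thesis unfolding LT using T1 by (intro mult_right_mono) auto
  qed
  have \<Lambda>1: "1 \<le> \<Lambda>" "0 < \<Lambda>" using \<Lambda> by auto
  have L0: "L > 0" unfolding L_def using \<Lambda> by (intro zero_less_power) auto
  {
    assume wb: "w \<noteq> b" "cmod (w - b) \<le> 1 / L"
    have small: "cmod (w - b) * T \<le> 1 / (2 * \<Lambda>)"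
    proof -
      have "cmod (w - b) * T \<le> 1 / (2 * \<Lambda> * T) * T"
      proof (intro mult_right_mono)
        have "1 / L \<le> 1 / (2 * \<Lambda> * T)" using L2 L0 T1 \<Lambda> by (intro divide_left_mono mult_pos_pos) auto
        thus "cmod (w - b) \<le> 1 / (2 * \<Lambda> * T)" using wb(2) by linarith
      qed (use T1 in auto)
      thus ?thesis using T1 by simp
    qed
    have "cmod (w - b) \<le> 1"
    proof -
      have "cmod (w - b) * 1 \<le> cmod (w - b) * T" using T1 by (intro mult_left_mono) auto
      moreover have "1 / (2 * \<Lambda>) \<le> 1" using \<Lambda> by simp
      ultimately show ?thesis using small by linarith
    qed
    hence w: "cmod w \<le> 2 * \<Lambda>" using b \<Lambda> norm_triangle_sub[of w b] by linarith
    have b2: "cmod b \<le> 2 * \<Lambda>" using b \<Lambda> by linarith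
    have lower: "1 / (2 * \<Lambda>) \<le> cmod (poly u w)"
      if u: "degree u \<le> ?n" "\<And>i. cmod (coeff u i) \<le> \<Lambda>" "1 / \<Lambda> \<le> cmod (poly u b)" for u
    proof -
      have "cmod (poly u w - poly u b) \<le> cmod (w - b) * T"
        unfolding T_def by (rule norm_poly_diff_le[OF u(1,2) \<Lambda>1(1) w b2])
      hence "cmod (poly u b) - cmod (poly u w) \<le> 1 / (2 * \<Lambda>)"
        using small norm_triangle_ineq2[of "poly u b" "poly u w"] by (simp add: norm_minus_commute)
      moreover have "1 / \<Lambda> = 1 / (2 * \<Lambda>) + 1 / (2 * \<Lambda>)" by simp
      ultimately show ?thesis using u(3) by linarith
    qed
    have pw: "1 / (2 * \<Lambda>) \<le> cmod (poly p w)" by (rule lower[OF order_refl cp pb])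
    have qw: "1 / (2 * \<Lambda>) \<le> cmod (poly q w)" using dp by (intro lower cq qb) auto
    have qT: "cmod (poly q w) \<le> T"
      unfolding T_def using dp by (intro norm_poly_le cq \<Lambda>1 w) auto
    have q0: "0 < cmod (poly q w)" by (rule less_le_trans[OF _ qw]) (use \<Lambda> in simp)
    have d2: "0 < cmod (w - b) ^ 2" using wb by simp
    have "1 / (L * (cmod (w - b))\<^sup>2) \<le> 1 / ((2 * \<Lambda> * T) * (cmod (w - b))\<^sup>2)"
      using L2 T1 \<Lambda> d2 L0 by (intro divide_left_mono mult_right_mono mult_pos_pos) auto
    also have "\<dots> = (1 / (2 * \<Lambda>)) / ((cmod (w - b))\<^sup>2 * T)" by (simp add: mult_ac)
    also have "\<dots> \<le> cmod (poly p w) / ((cmod (w - b))\<^sup>2 * cmod (poly q w))"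
      using pw qT q0 d2 by (intro frac_le mult_left_mono mult_pos_pos) auto
    finally show "1 / (L * (cmod (w - b))\<^sup>2) \<le> cmod (poly p w / ((w - b)\<^sup>2 * poly q w))"
      by (simp add: norm_divide norm_mult norm_power)
  }
  {
    assume w: "L \<le> cmod w"
    have nT: "real ?n + 1 \<le> T"
    proof -
      have "real (?n + 1) < 2 ^ (?n + 1)" by (rule of_nat_less_two_power)
      hence "real ?n + 1 \<le> 2 ^ (?n + 1)" by (simp only: of_nat_add of_nat_1 less_imp_le)
      also have "\<dots> \<le> T" unfolding T_def using \<Lambda> by (intro power_mono) auto
      finally show ?thesis .
    qed
    have big: "2 * real (degree u) * \<Lambda>\<^sup>2 \<le> cmod w" if "degree u \<le> ?n" for u :: "complex poly"
    proof -
      have "2 * real (degree u) * \<Lambda>\<^sup>2 \<le> (16 * \<Lambda>\<^sup>2) * T"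
        using that nT mult_mono[of "2 * real (degree u)" "16 * T" "\<Lambda>\<^sup>2" "\<Lambda>\<^sup>2"] by (simp add: mult_ac)
      thus ?thesis using w LT by linarith
    qed
    have w1: "1 \<le> cmod w" and bw: "cmod b \<le> cmod w"
    proof -
      have "\<Lambda> * 1 \<le> 2 * \<Lambda> * T" using T1 \<Lambda> by (intro mult_mono) auto
      hence "\<Lambda> \<le> cmod w" using L2 w by linarith
      thus "1 \<le> cmod w" "cmod b \<le> cmod w" using \<Lambda> b by auto
    qed
    have pw: "cmod w ^ ?n / (2 * \<Lambda>) \<le> cmod (poly p w)"
      by (rule norm_poly_large(1)[OF cp \<Lambda>1(1) lp w1 big]) simp
    have ln: "?l \<le> ?n" using dp by simp
    have qw: "cmod w ^ ?l / (2 * \<Lambda>) \<le> cmod (poly q w)" "cmod (poly q w) \<le> (real ?l + 1) * \<Lambda> * cmod w ^ ?l"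
      by (rule norm_poly_large[OF cq \<Lambda>1(1) lq w1 big[OF ln]])+
    have wpos: "cmod w > 0" using w1 by linarith
    have q0: "0 < cmod (poly q w)" by (rule less_le_trans[OF _ qw(1)]) (use \<Lambda> wpos in simp)
    have wb: "0 < cmod (w - b)"
    proof -
      have "2 * \<Lambda> * 1 \<le> 2 * \<Lambda> * T" using T1 \<Lambda> by (intro mult_left_mono) auto
      hence "cmod b < cmod w" using L2 \<Lambda> w b by linarith
      thus ?thesis by auto
    qed
    have "cmod (w - b) \<le> 2 * cmod w" using norm_triangle_ineq4[of w b] bw by linarith
    hence wb2: "(cmod (w - b))\<^sup>2 \<le> 4 * cmod w ^ 2" using power_mono[of "cmod (w - b)" "2 * cmod w" 2] by (simp add: power_mult_distrib)
    have "cmod w ^ d / L \<le> cmod w ^ d / (8 * \<Lambda>\<^sup>2 * (real ?l + 1))"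
    proof (rule divide_left_mono)
      have "8 * \<Lambda>\<^sup>2 * (real ?l + 1) \<le> 16 * \<Lambda>\<^sup>2 * T" using nT ln by (intro mult_mono) auto
      thus "8 * \<Lambda>\<^sup>2 * (real ?l + 1) \<le> L" by (simp add: LT)
    qed (use L0 \<Lambda>1 in auto)
    also have "\<dots> = (cmod w ^ ?n / (2 * \<Lambda>)) / ((4 * cmod w ^ 2) * ((real ?l + 1) * \<Lambda> * cmod w ^ ?l))"
    proof -
      have "x / (8 * \<Lambda>\<^sup>2 * k) = (y * v * x / (2 * \<Lambda>)) / ((4 * v) * (k * \<Lambda> * y))"
        if "y > 0" "v > 0" "k > 0" for x y v k :: real
        using that \<Lambda>1 by (simp add: power2_eq_square)
      from this[of "cmod w ^ ?l" "(cmod w)\<^sup>2" "real ?l + 1" "cmod w ^ d"] wpos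
      show ?thesis unfolding dp power_add by simp
    qed
    also have "\<dots> \<le> cmod (poly p w) / ((cmod (w - b))\<^sup>2 * cmod (poly q w))"
      using pw qw(2) wb2 q0 wb by (intro frac_le mult_mono mult_pos_pos) auto
    finally show "cmod w ^ d / L \<le> cmod (poly p w / ((w - b)\<^sup>2 * poly q w))"
      by (simp add: norm_divide norm_mult norm_power)
  }
qed

text \<open>Here \<open>u\<close> stands for the product of the two neighbouring values and
  \<open>\<sigma>\<close> for the Schwarzian derivative. They are left free because only the
  algebraic form of the equation matters at this point.\<close>

lemma equation_estimates:
  fixes a b1 :: ratfun and P Qh :: "ratfun poly"
  assumes cop: "coprime P ([:- b1, 1:] ^ 2 * Qh)" "coprime Qh [:- b1, 1:]"
    and deg: "degree P = degree ([:- b1, 1:] ^ 2 * Qh) + d"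
  obtains Z C where "finite Z" "\<And>z \<delta> w u \<sigma>. 0 < \<delta> \<Longrightarrow> \<delta> \<le> 1 \<Longrightarrow> (\<And>e. e \<in> Z \<Longrightarrow> \<delta> \<le> cmod (z - e)) \<Longrightarrow>
      u + ratfun_eval a z * \<sigma> = ratpoly_eval P z w / ratpoly_eval ([:- b1, 1:] ^ 2 * Qh) z w \<Longrightarrow>
      (w \<noteq> ratfun_eval b1 z \<longrightarrow> cmod (w - ratfun_eval b1 z) \<le> 1 / ((2 + cmod z) / \<delta>) ^ C \<longrightarrow>
         1 / (((2 + cmod z) / \<delta>) ^ C * (cmod (w - ratfun_eval b1 z))\<^sup>2) \<le> cmod u + ((2 + cmod z) / \<delta>) ^ C * cmod \<sigma>) \<and>
      (((2 + cmod z) / \<delta>) ^ C \<le> cmod w \<longrightarrow>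
         cmod w ^ d / ((2 + cmod z) / \<delta>) ^ C \<le> cmod u + ((2 + cmod z) / \<delta>) ^ C * cmod \<sigma>)"
    "\<And>z \<delta>. 0 < \<delta> \<Longrightarrow> \<delta> \<le> 1 \<Longrightarrow> (\<And>e. e \<in> Z \<Longrightarrow> \<delta> \<le> cmod (z - e)) \<Longrightarrow>
       cmod (ratfun_eval b1 z) \<le> ((2 + cmod z) / \<delta>) ^ C"
proof -
  let ?B = "[:- b1, 1:]"
  have Qh0: "Qh \<noteq> 0" using cop(2) linear_not_unit[of b1] by (metis coprime_0_left_iff)
  have degQ: "degree (?B ^ 2 * Qh) = 2 + degree Qh"
    using Qh0 by (subst degree_mult_eq) (auto simp: degree_power_eq)
  have degP: "degree P = degree Qh + 2 + d" using deg degQ by simp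
  have P0: "P \<noteq> 0" using degP by auto
  have Pb: "poly P b1 \<noteq> 0"
    by (rule coprime_linear_imp_poly_nz[OF cop(1)]) (simp only: power2_eq_square mult.assoc dvd_triv_left)
  have Qb: "poly Qh b1 \<noteq> 0" by (rule coprime_linear_imp_poly_nz[OF cop(2)]) simp
  define S where "S = insert a (insert b1 (insert (poly P b1) (insert (poly Qh b1)
     (coeff P ` {..degree P} \<union> coeff Qh ` {..degree Qh}))))"
  have "finite S" by (simp add: S_def)
  then obtain Z0 C0 where tame: "tame_bounds S Z0 C0" using tame_bounds_exists by blast
  \<comment> \<open>Where evaluation fails to respect the algebra, the equation says nothing useful.
    These finitely many points join the exceptional set, and the positive distance
    \<open>\<delta>\<close> then excludes them.\<close>
  define good where "good = (\<lambda>z. ratfun_eval (poly P b1) z = ratpoly_eval P z (ratfun_eval b1 z) \<and>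
     ratfun_eval (poly Qh b1) z = ratpoly_eval Qh z (ratfun_eval b1 z) \<and>
     (\<forall>w. ratpoly_eval (?B ^ 2 * Qh) z w = (w - ratfun_eval b1 z)\<^sup>2 * ratpoly_eval Qh z w))"
  have "\<forall>\<^sub>F z in cofinite. good z"
    using ratfun_eval_poly[of P b1] ratfun_eval_poly[of Qh b1] ratfun_eval_uminus[of b1]
      ratpoly_eval_mult[of ?B "?B * Qh"] ratpoly_eval_mult[of ?B Qh]
  proof eventually_elim
    case (elim z)
    have B2: "?B ^ 2 * Qh = ?B * (?B * Qh)" by (simp only: power2_eq_square mult.assoc)
    have B1: "ratpoly_eval ?B z w = w - ratfun_eval b1 z" for w using elim(3) by simp
    have "ratpoly_eval (?B ^ 2 * Qh) z w = (w - ratfun_eval b1 z)\<^sup>2 * ratpoly_eval Qh z w" for w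
      unfolding B2 elim(4)[rule_format] elim(5)[rule_format] B1 by (simp only: power2_eq_square mult.assoc)
    thus ?case using elim(1,2) by (simp only: good_def) simp
  qed
  hence fin: "finite {z. \<not> good z}" by (simp add: eventually_cofinite)
  \<comment> \<open>Since \<open>4 \<le> X\<^sup>2\<close>, the number \<open>4 * \<Lambda>\<close>
    is at most \<open>X ^ (2 + C0 + 1)\<close>; the power of it that defines \<open>L\<close> stays
    below \<open>X ^ C\<close>.\<close>
  define C where "C = (2 + C0 + 1) * (degree P + 4)"
  define Z where "Z = Z0 \<union> {z. \<not> good z}"
  show ?thesis
  proof (rule that[of Z C])
    show "finite Z" using tame fin by (auto simp: Z_def tame_bounds_def)
  next
    fix z and \<delta> :: real and w u \<sigma>
    assume \<delta>: "0 < \<delta>" "\<delta> \<le> 1" and dist: "\<And>e. e \<in> Z \<Longrightarrow> \<delta> \<le> cmod (z - e)"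
    define X where "X = (2 + cmod z) / \<delta>"
    have X: "2 \<le> X" unfolding X_def by (rule base_ge_2[OF \<delta>])
    \<comment> \<open>The additional factor \<open>X\<close> makes \<open>\<Lambda>\<close> at least
      2.\<close>
    define \<Lambda> where "\<Lambda> = X ^ (C0 + 1)"
    have \<Lambda>C: "X ^ C0 \<le> \<Lambda>" unfolding \<Lambda>_def using X by (intro power_increasing) auto
    have \<Lambda>: "2 \<le> \<Lambda>"
    proof -
      have "2 * 1 \<le> X * X ^ C0" using X by (intro mult_mono one_le_power) auto
      thus ?thesis by (simp add: \<Lambda>_def)
    qed
    have up: "cmod (ratfun_eval q z) \<le> \<Lambda>" if "q \<in> S" for q
      using tame that \<delta> dist \<Lambda>C unfolding tame_bounds_def Z_def X_def by fastforce
    have lo: "1 / \<Lambda> \<le> cmod (ratfun_eval q z)" if "q \<in> S" "q \<noteq> 0" for q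
    proof -
      have "1 / X ^ C0 \<le> cmod (ratfun_eval q z)"
        using tame that \<delta> dist unfolding tame_bounds_def Z_def X_def by auto
      moreover have "1 / \<Lambda> \<le> 1 / X ^ C0" using \<Lambda>C X \<Lambda> by (intro divide_left_mono) auto
      ultimately show ?thesis by linarith
    qed
    define L where "L = (4 * \<Lambda>) ^ (degree P + 3)"
    have \<Lambda>L: "\<Lambda> \<le> L"
    proof -
      have "(4 * \<Lambda>) ^ 1 \<le> L" unfolding L_def using \<Lambda> by (intro power_increasing) auto
      thus ?thesis using \<Lambda> by simp
    qed
    have LX: "L \<le> X ^ C"
    proof -
      have "4 * \<Lambda> \<le> X ^ 2 * X ^ (C0 + 1)" unfolding \<Lambda>_def
        using X power_mono[of 2 X 2] by (intro mult_right_mono) auto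
      hence "4 * \<Lambda> \<le> X ^ (2 + C0 + 1)" by (simp only: power_add mult.assoc)
      hence "L \<le> (X ^ (2 + C0 + 1)) ^ (degree P + 3)" unfolding L_def using \<Lambda> by (intro power_mono) auto
      also have "\<dots> \<le> X ^ C" unfolding C_def power_mult[symmetric] using X by (intro power_increasing mult_le_mono) auto
      finally show ?thesis .
    qed
    have L0: "0 < L" using \<Lambda>L \<Lambda> by linarith
    show "cmod (ratfun_eval b1 z) \<le> ((2 + cmod z) / \<delta>) ^ C"
      using up[of b1] \<Lambda>L LX by (simp add: S_def X_def)
    assume eq: "u + ratfun_eval a z * \<sigma> = ratpoly_eval P z w / ratpoly_eval (?B ^ 2 * Qh) z w"
    let ?e = "\<lambda>c. ratfun_eval c z"
    define p q b where "p = map_poly ?e P" and "q = map_poly ?e Qh" and "b = ?e b1"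
    have "good z" using dist[of z] \<delta> by (auto simp: Z_def)
    hence g: "?e (poly P b1) = poly p b" "?e (poly Qh b1) = poly q b"
      "ratpoly_eval (?B ^ 2 * Qh) z w = (w - b)\<^sup>2 * poly q w"
      by (auto simp: good_def p_def q_def b_def ratpoly_eval_def)
    have S: "a \<in> S" "b1 \<in> S" "poly P b1 \<in> S" "poly Qh b1 \<in> S"
      "\<And>i. i \<le> degree P \<Longrightarrow> coeff P i \<in> S" "\<And>i. i \<le> degree Qh \<Longrightarrow> coeff Qh i \<in> S" by (auto simp: S_def)
    have lP: "1 / \<Lambda> \<le> cmod (?e (lead_coeff P))" and lQ: "1 / \<Lambda> \<le> cmod (?e (lead_coeff Qh))"
      using P0 Qh0 S by (auto intro!: lo)
    have nz: "?e (lead_coeff P) \<noteq> 0" "?e (lead_coeff Qh) \<noteq> 0" using lP lQ \<Lambda> by (auto simp: field_simps)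
    have dp: "degree p = degree P" "degree q = degree Qh"
      unfolding p_def q_def using nz by (auto intro: degree_map_ratpoly)
    have cp: "cmod (coeff p i) \<le> \<Lambda>" for i
      using up[OF S(5), of i] \<Lambda> by (cases "i \<le> degree P") (auto simp: p_def coeff_map_ratpoly coeff_eq_0)
    have cq: "cmod (coeff q i) \<le> \<Lambda>" for i
      using up[OF S(6), of i] \<Lambda> by (cases "i \<le> degree Qh") (auto simp: q_def coeff_map_ratpoly coeff_eq_0)
    have dpq: "degree p = degree q + 2 + d" using dp degP by simp
    have bb: "cmod b \<le> \<Lambda>" using up[OF S(2)] by (simp add: b_def)
    have pb: "1 / \<Lambda> \<le> cmod (poly p b)" "1 / \<Lambda> \<le> cmod (poly q b)"
      unfolding g(1,2)[symmetric] using Pb Qb S by (auto intro!: lo)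
    have lpq: "1 / \<Lambda> \<le> cmod (lead_coeff p)" "1 / \<Lambda> \<le> cmod (lead_coeff q)"
      unfolding dp using lP lQ by (auto simp: p_def q_def coeff_map_ratpoly)
    note est = quotient_estimates[OF dpq \<Lambda> cp cq bb pb lpq, unfolded dp, folded L_def]
    have "cmod (poly p w / ((w - b)\<^sup>2 * poly q w)) = cmod (u + ?e a * \<sigma>)"
      unfolding eq g(3) by (simp add: ratpoly_eval_def p_def)
    also have "\<dots> \<le> cmod u + \<Lambda> * cmod \<sigma>"
      using norm_triangle_ineq[of u "?e a * \<sigma>"] mult_right_mono[OF up[OF S(1)], of "cmod \<sigma>"] by (simp add: norm_mult)
    also have "\<dots> \<le> cmod u + X ^ C * cmod \<sigma>"
      using \<Lambda>L LX by (intro add_left_mono mult_right_mono) auto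
    finally have main: "cmod (poly p w / ((w - b)\<^sup>2 * poly q w)) \<le> cmod u + X ^ C * cmod \<sigma>" .
    have XC: "X ^ C > 0" using X by simp
    show "(w \<noteq> ratfun_eval b1 z \<longrightarrow> cmod (w - ratfun_eval b1 z) \<le> 1 / ((2 + cmod z) / \<delta>) ^ C \<longrightarrow>
         1 / (((2 + cmod z) / \<delta>) ^ C * (cmod (w - ratfun_eval b1 z))\<^sup>2) \<le> cmod u + ((2 + cmod z) / \<delta>) ^ C * cmod \<sigma>) \<and>
      (((2 + cmod z) / \<delta>) ^ C \<le> cmod w \<longrightarrow>
         cmod w ^ d / ((2 + cmod z) / \<delta>) ^ C \<le> cmod u + ((2 + cmod z) / \<delta>) ^ C * cmod \<sigma>)"
      unfolding X_def[symmetric] b_def[symmetric]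
    proof (intro conjI impI)
      assume wb: "w \<noteq> b" "cmod (w - b) \<le> 1 / X ^ C"
      have "1 / X ^ C \<le> 1 / L" using LX L0 XC by (intro divide_left_mono) auto
      hence "cmod (w - b) \<le> 1 / L" using wb by linarith
      note est(1)[OF wb(1) this]
      moreover have "1 / (X ^ C * (cmod (w - b))\<^sup>2) \<le> 1 / (L * (cmod (w - b))\<^sup>2)"
        using LX L0 XC wb by (intro divide_left_mono mult_right_mono mult_pos_pos) auto
      ultimately show "1 / (X ^ C * (cmod (w - b))\<^sup>2) \<le> cmod u + X ^ C * cmod \<sigma>" using main by linarith
    next
      assume w: "X ^ C \<le> cmod w"
      hence "L \<le> cmod w" using LX by linarith
      note est(2)[OF this]
      moreover have "cmod w ^ d / X ^ C \<le> cmod w ^ d / L"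
        using LX L0 XC by (intro divide_left_mono mult_pos_pos) auto
      ultimately show "cmod w ^ d / X ^ C \<le> cmod u + X ^ C * cmod \<sigma>" using main by linarith
    qed
  qed
qed

section \<open>Weighted sums over the integers\<close>

text \<open>The ratio is a compromise: close enough to 1 for a shift to cost less than 4 / 3, and
  small enough for the weight to beat the growth of the end terms.\<close>

definition wt :: "int \<Rightarrow> real" where "wt k = (4 / 5) ^ nat \<bar>k\<bar>"

lemma wt_pos [simp]: "wt k > 0" and wt_nonneg [simp]: "wt k \<ge> 0" and wt_0 [simp]: "wt 0 = 1"
  by (simp_all add: wt_def)

lemma wt_step: "wt (k + 1) \<le> 5 / 4 * wt k" "wt (k - 1) \<le> 5 / 4 * wt k"
proof -
  have "wt i \<le> 5 / 4 * wt j" if "\<bar>i - j\<bar> = 1" for i j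
  proof (cases "nat \<bar>i\<bar> \<ge> nat \<bar>j\<bar>")
    case True
    hence "wt i \<le> wt j" unfolding wt_def by (intro power_decreasing) auto
    thus ?thesis using wt_nonneg[of j] by linarith
  next
    case False
    hence "nat \<bar>j\<bar> = Suc (nat \<bar>i\<bar>)" using that by linarith
    thus ?thesis by (simp add: wt_def)
  qed
  thus "wt (k + 1) \<le> 5 / 4 * wt k" "wt (k - 1) \<le> 5 / 4 * wt k" by auto
qed

text \<open>Each of the two geometric tails contributes less than 4.\<close>

lemma sum_wt_le: "(\<Sum>k\<in>{- int K..int K}. wt k) \<le> 9"
proof -
  have "(\<Sum>k\<in>{- int K..int K}. wt k) = 9 - 8 * (4 / 5) ^ K"
  proof (induction K)
    case (Suc K)
    have "{- int (Suc K)..int (Suc K)} = insert (int (Suc K)) (insert (- int (Suc K)) {- int K..int K})"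
      by auto
    thus ?case using Suc by (simp add: wt_def nat_add_distrib)
  qed simp
  thus ?thesis by simp
qed

lemma sum_shift_int:
  fixes F :: "int \<Rightarrow> int \<Rightarrow> real"
  assumes "finite J" "\<And>k. k \<in> I \<Longrightarrow> k + m \<in> J"
  shows "(\<Sum>k\<in>I. F k (k + m)) = (\<Sum>j\<in>J. if j - m \<in> I then F (j - m) j else 0)"
proof -
  have "(\<Sum>j\<in>J. if j - m \<in> I then F (j - m) j else 0) = (\<Sum>j\<in>{j\<in>J. j - m \<in> I}. F (j - m) j)"
    using assms(1) by (simp add: sum.inter_filter)
  also have "\<dots> = (\<Sum>k\<in>I. F k (k + m))"
    by (rule sum.reindex_bij_witness[of _ "\<lambda>k. k + m" "\<lambda>j. j - m"]) (use assms(2) in auto)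
  finally show ?thesis by simp
qed

text \<open>
  Every large \<open>X j\<close> can be used by at most one of its two neighbours, so the large values of \<open>Y\<close>
  cost twice their size in values of \<open>X\<close>; the weights absorb the shift.
\<close>
lemma neighbour_sum_inequality:
  fixes X Y E :: "int \<Rightarrow> real"
  assumes nn: "\<And>k. X k \<ge> 0" "\<And>k. Y k \<ge> 0" "\<And>k. E k \<ge> 0"
    and \<alpha>: "\<And>k. \<bar>k\<bar> \<le> int K \<Longrightarrow> 4 / 3 * Y k \<le> X (k + 1) + X (k - 1) + E k"
    and \<beta>: "\<And>k. \<bar>k\<bar> \<le> int K \<Longrightarrow> min (min (Y (k - 1)) (Y (k + 1))) (X k) \<le> E k"
  shows "4 / 3 * (\<Sum>k\<in>{- int K..int K}. wt k * Y k)
     \<le> 5 / 4 * (\<Sum>k\<in>{- int (Suc K)..int (Suc K)}. wt k * X k) + 8 * (\<Sum>k\<in>{- int (Suc K)..int (Suc K)}. wt k * E k)"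
proof -
  define I J where "I = {- int K..int K}" and "J = {- int (Suc K)..int (Suc K)}"
  \<comment> \<open>\<open>A k j\<close> is the part of \<open>X j\<close> on which
    \<open>Y k\<close> may draw. If \<open>Y k \<le> E j\<close>, then \<open>Y k\<close> is itself
    an error term and draws nothing.\<close>
  define A where "A = (\<lambda>k j. if Y k > E j then X j else 0)"
  have A0: "A k j \<ge> 0" for k j using nn by (simp add: A_def)
  have finJ: "finite J" by (simp add: J_def)
  have IJ: "k + 1 \<in> J" "k + -1 \<in> J" "k \<in> J" if "k \<in> I" for k using that by (auto simp: I_def J_def)
  define B where "B = (\<lambda>k j. wt k * (A k j + 4 / 3 * E j))"
  have "4 / 3 * (\<Sum>k\<in>I. wt k * Y k) \<le> (\<Sum>k\<in>I. B k (k + 1) + B k (k + -1) + wt k * E k)"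
    unfolding sum_distrib_left
  proof (rule sum_mono)
    fix k assume "k \<in> I"
    hence *: "4 / 3 * Y k \<le> X (k + 1) + X (k - 1) + E k" by (intro \<alpha>) (auto simp: I_def)
    have "4 / 3 * Y k \<le> A k (k + 1) + A k (k - 1) + E k + 4 / 3 * (E (k + 1) + E (k - 1))"
    proof (cases "Y k \<le> E (k + 1) \<or> Y k \<le> E (k - 1)")
      case True
      then consider "Y k \<le> E (k + 1)" | "Y k \<le> E (k - 1)" by blast
      hence "4 / 3 * Y k \<le> 4 / 3 * (E (k + 1) + E (k - 1))"
        by cases (simp_all add: nn add_increasing add_increasing2)
      moreover have "0 \<le> A k (k + 1) + A k (k - 1) + E k" using A0 nn by simp
      ultimately show ?thesis by linarith
    next
      case False
      hence "A k (k + 1) = X (k + 1)" "A k (k - 1) = X (k - 1)" by (auto simp: A_def)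
      moreover have e0: "0 \<le> 4 / 3 * (E (k + 1) + E (k - 1))"
        by (intro mult_nonneg_nonneg add_nonneg_nonneg nn) simp
      ultimately show ?thesis using add_mono[OF * e0] by (simp only: add_0_right)
    qed
    from mult_left_mono[OF this wt_nonneg[of k]]
    show "4 / 3 * (wt k * Y k) \<le> B k (k + 1) + B k (k + -1) + wt k * E k"
      by (simp add: B_def algebra_simps)
  qed
  also have "\<dots> = (\<Sum>k\<in>I. B k (k + 1)) + (\<Sum>k\<in>I. B k (k + -1)) + (\<Sum>k\<in>I. wt k * E k)"
    by (simp add: sum.distrib)
  also have "(\<Sum>k\<in>I. B k (k + 1)) = (\<Sum>j\<in>J. if j - 1 \<in> I then B (j - 1) j else 0)"
    by (rule sum_shift_int[OF finJ IJ(1)])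
  also have "(\<Sum>k\<in>I. B k (k + -1)) = (\<Sum>j\<in>J. if j - -1 \<in> I then B (j - -1) j else 0)"
    by (rule sum_shift_int[OF finJ IJ(2)])
  also have "(\<Sum>k\<in>I. wt k * E k) \<le> (\<Sum>j\<in>J. wt j * E j)"
    using IJ finJ nn by (intro sum_mono2) auto
  also have "(\<Sum>j\<in>J. if j - 1 \<in> I then B (j - 1) j else 0) + (\<Sum>j\<in>J. if j - -1 \<in> I then B (j - -1) j else 0) + (\<Sum>j\<in>J. wt j * E j)
     = (\<Sum>j\<in>J. (if j - 1 \<in> I then B (j - 1) j else 0) + (if j - -1 \<in> I then B (j - -1) j else 0) + wt j * E j)"
    by (simp only: sum.distrib)
  also have "\<dots> \<le> (\<Sum>j\<in>J. 5 / 4 * (wt j * X j) + 8 * (wt j * E j))"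
  proof (rule sum_mono)
    fix j
    let ?a = "if j - 1 \<in> I then A (j - 1) j else 0" and ?b = "if j + 1 \<in> I then A (j + 1) j else 0"
    \<comment> \<open>Both neighbours of \<open>j\<close> draw on \<open>X j\<close> only if both
      values of \<open>Y\<close> exceed \<open>E j\<close>; the second hypothesis then makes
      \<open>X j\<close> itself an error.\<close>
    have ab: "?a + ?b \<le> X j + 2 * E j"
    proof (cases "j - 1 \<in> I \<and> j + 1 \<in> I \<and> Y (j - 1) > E j \<and> Y (j + 1) > E j")
      case True
      hence "\<bar>j\<bar> \<le> int K" by (auto simp: I_def)
      from \<beta>[OF this] True have "X j \<le> E j" by (auto simp: min_def split: if_splits)
      thus ?thesis using nn(1)[of j] nn(3)[of j] by (auto simp: A_def)
    next
      case False
      thus ?thesis using nn(1)[of j] nn(3)[of j] by (auto simp: A_def)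
    qed
    have Bj: "(if k \<in> I then B k j else 0) \<le> (5 / 4 * wt j) * ((if k \<in> I then A k j else 0) + 4 / 3 * E j)"
      if "wt k \<le> 5 / 4 * wt j" for k
    proof (cases "k \<in> I")
      case True
      have "B k j \<le> (5 / 4 * wt j) * (A k j + 4 / 3 * E j)"
        unfolding B_def by (rule mult_right_mono[OF that]) (simp add: A0 nn)
      thus ?thesis using True by (simp only: if_True)
    qed (simp add: nn)
    have "(if j - 1 \<in> I then B (j - 1) j else 0) \<le> (5 / 4 * wt j) * (?a + 4 / 3 * E j)"
      by (rule Bj[OF wt_step(2)])
    moreover have "(if j - -1 \<in> I then B (j - -1) j else 0) \<le> (5 / 4 * wt j) * (?b + 4 / 3 * E j)"
      using Bj[OF wt_step(1)] by (simp only: minus_minus diff_minus_eq_add)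
    moreover have "(5 / 4 * wt j) * (?a + 4 / 3 * E j) + (5 / 4 * wt j) * (?b + 4 / 3 * E j)
        = (5 / 4 * wt j) * ((?a + ?b) + 8 / 3 * E j)" by (simp only: distrib_left[symmetric]) simp
    moreover have "(5 / 4 * wt j) * ((?a + ?b) + 8 / 3 * E j) \<le> (5 / 4 * wt j) * ((X j + 2 * E j) + 8 / 3 * E j)"
      using ab by (intro mult_left_mono) auto
    \<comment> \<open>The constant 8 leaves room above 5 / 4 * (2 + 8 / 3) + 1.\<close>
    moreover have "(5 / 4 * wt j) * ((X j + 2 * E j) + 8 / 3 * E j) + wt j * E j \<le> 5 / 4 * (wt j * X j) + 8 * (wt j * E j)"
      using mult_nonneg_nonneg[OF wt_nonneg[of j] nn(3)[of j]] by (simp add: algebra_simps)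
    ultimately show "(if j - 1 \<in> I then B (j - 1) j else 0) + (if j - -1 \<in> I then B (j - -1) j else 0) + wt j * E j
        \<le> 5 / 4 * (wt j * X j) + 8 * (wt j * E j)" by linarith
  qed
  also have "\<dots> = 5 / 4 * (\<Sum>j\<in>J. wt j * X j) + 8 * (\<Sum>j\<in>J. wt j * E j)"
    by (simp only: sum.distrib sum_distrib_left)
  finally show ?thesis by (simp only: I_def J_def)
qed

section \<open>Growth of subnormal functions\<close>

lemma poles_finite: "nzm f \<Longrightarrow> finite {z. cmod z \<le> r \<and> is_pole f z}"
proof -
  assume f: "nzm f"
  have "{z. cmod z \<le> r \<and> is_pole f z} \<subseteq> irr f \<inter> cball 0 r"
    by (auto simp: irr_def dest: analytic_at_imp_no_pole)
  thus ?thesis using irr_finite[OF f] finite_subset by blast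
qed

text \<open>The share of a single pole of modulus \<open>x\<close> in the integral that defines the
  counting function.\<close>

lemma has_integral_inverse_tail:
  fixes x r :: real
  assumes "0 < x" "x \<le> r"
  shows "((\<lambda>t. if x \<le> t then 1 / t else 0) has_integral ln (r / x)) {0..r}"
proof -
  have "((\<lambda>t. 1 / t) has_integral ln r - ln x) {x..r}"
    using assms by (intro fundamental_theorem_of_calculus)
      (auto intro!: derivative_eq_intros simp flip: has_real_derivative_iff_has_vector_derivative)
  hence "((\<lambda>t. if t \<in> {x..r} then 1 / t else 0) has_integral ln r - ln x) {0..r}"
    using assms by (subst has_integral_restrict) auto
  moreover have "ln (r / x) = ln r - ln x" using assms by (simp add: ln_div)
  ultimately show ?thesis
    by (subst has_integral_cong[where g = "\<lambda>t. if t \<in> {x..r} then 1 / t else 0"]) auto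
qed

text \<open>Summing the integral pole by pole brings the classical counting function into the form
  in which Jensen's formula is stated here.\<close>

lemma nev_counting_eq:
  assumes f: "nzm f" and r: "r \<ge> 1"
  shows "nev_counting f r = (\<Sum>z | 0 < cmod z \<and> cmod z \<le> r \<and> is_pole f z. of_int (- zorder f z) * ln (r / cmod z))
     + pole_count f 0 * ln r"
proof -
  define S where "S = {z. 0 < cmod z \<and> cmod z \<le> r \<and> is_pole f z}"
  have fS: "finite S" unfolding S_def by (rule finite_subset[OF _ poles_finite[OF f, of r]]) auto
  have diff: "pole_count f t - pole_count f 0 = (\<Sum>z\<in>S. if cmod z \<le> t then of_int (- zorder f z) else 0)"
    if "0 \<le> t" "t \<le> r" for t
  proof -
    let ?A = "{z. cmod z \<le> t \<and> is_pole f z}" and ?B = "{z. cmod z \<le> 0 \<and> is_pole f z}"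
    have "pole_count f t = (\<Sum>z\<in>?B. - of_int (zorder f z)) + (\<Sum>z\<in>?A - ?B. - of_int (zorder f z))"
      unfolding pole_count_def using that by (subst sum.subset_diff[of ?B ?A]) (auto intro: poles_finite[OF f])
    also have "(\<Sum>z\<in>?A - ?B. - of_int (zorder f z)) = (\<Sum>z\<in>{z\<in>S. cmod z \<le> t}. of_int (- zorder f z))"
      by (intro sum.cong) (use that in \<open>auto simp: S_def\<close>)
    also have "\<dots> = (\<Sum>z\<in>S. if cmod z \<le> t then of_int (- zorder f z) else 0)"
      using fS by (simp only: sum.inter_filter)
    finally show ?thesis by (simp add: pole_count_def)
  qed
  have "((\<lambda>t. \<Sum>z\<in>S. of_int (- zorder f z) * (if cmod z \<le> t then 1 / t else 0)) has_integral
      (\<Sum>z\<in>S. of_int (- zorder f z) * ln (r / cmod z))) {0..r}"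
    using fS by (intro has_integral_sum has_integral_mult_right has_integral_inverse_tail) (auto simp: S_def)
  moreover have "(pole_count f t - pole_count f 0) / t = (\<Sum>z\<in>S. of_int (- zorder f z) * (if cmod z \<le> t then 1 / t else 0))"
    if "t \<in> {0..r}" for t
    using that by (subst diff) (auto simp: sum_divide_distrib intro!: sum.cong)
  ultimately have "((\<lambda>t. (pole_count f t - pole_count f 0) / t) has_integral
      (\<Sum>z\<in>S. of_int (- zorder f z) * ln (r / cmod z))) {0..r}"
    by (subst has_integral_cong)
  thus ?thesis unfolding nev_counting_def S_def by (simp add: integral_unique)
qed

lemma nev_proximity_nonneg: "nev_proximity f r \<ge> 0"
proof -
  have "integral {0..2 * pi} (\<lambda>t. log_plus (cmod (f (of_real r * cis t)))) \<ge> 0"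
    \<comment> \<open>A function that is not integrable has integral 0 by convention, so this also
      covers circles through poles.\<close>
    by (cases "(\<lambda>t. log_plus (cmod (f (of_real r * cis t)))) integrable_on {0..2 * pi}")
       (auto intro: integral_nonneg simp: not_integrable_integral)
  thus ?thesis by (simp add: nev_proximity_def)
qed

lemma nev_proximity_cmean: "nev_proximity f r = cmean 0 r (\<lambda>z. log_plus (cmod (f z)))"
  by (simp add: nev_proximity_def cmean_def)

lemma pole_count_0: "nzm f \<Longrightarrow> pole_count f 0 \<ge> 0"
  unfolding pole_count_def
  by (intro sum_nonneg) (auto simp: nzm_zorder_neg_iff[symmetric])

lemma nev_counting_nonneg:
  assumes f: "nzm f" and r: "r \<ge> 1"
  shows "nev_counting f r \<ge> 0"
  unfolding nev_counting_eq[OF assms] using r pole_count_0[OF f]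
  by (intro add_nonneg_nonneg sum_nonneg mult_nonneg_nonneg)
     (auto simp: nzm_zorder_neg_iff[OF f, symmetric])

text \<open>A pole of modulus below \<open>r\<close>, other than the origin, has weight at least
  \<open>1 / (r + 1)\<close> in the counting function at \<open>r + 1\<close>. The origin has to be
  counted separately.\<close>

lemma pole_sum_le_nev_counting:
  assumes f: "nzm f" and r: "r \<ge> 1"
  shows "(\<Sum>a\<in>zpset f 0 r. of_int (max 0 (- zorder f a))) \<le> pole_count f 0 + (r + 1) * nev_counting f (r + 1)"
proof -
  let ?p = "\<lambda>a. real_of_int (max 0 (- zorder f a))"
  define S where "S = {z. 0 < cmod z \<and> cmod z \<le> r + 1 \<and> is_pole f z}"
  have fS: "finite S" unfolding S_def by (rule finite_subset[OF _ poles_finite[OF f, of "r + 1"]]) auto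
  have "(\<Sum>a\<in>zpset f 0 r. ?p a) \<le> (\<Sum>a\<in>insert 0 (S \<inter> ball 0 r). ?p a)"
  proof -
    have "(\<Sum>a\<in>zpset f 0 r. ?p a) = (\<Sum>a\<in>zpset f 0 r \<inter> {a. is_pole f a}. ?p a)"
      using f by (intro sum.mono_neutral_right) (auto simp: nzm_zorder_neg_iff[OF f, symmetric])
    also have "\<dots> \<le> (\<Sum>a\<in>insert 0 (S \<inter> ball 0 r). ?p a)"
      using fS by (intro sum_mono2) (auto simp: S_def zpset_def)
    finally show ?thesis .
  qed
  also have "\<dots> \<le> ?p 0 + (\<Sum>a\<in>S \<inter> ball 0 r. ?p a)"
    using fS by (subst sum.insert) (auto simp: S_def)
  also have "?p 0 \<le> pole_count f 0"
  proof (cases "is_pole f 0")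
    case True
    hence "{z. cmod z \<le> 0 \<and> is_pole f z} = {0}" by auto
    thus ?thesis using True nzm_zorder_neg_iff[OF f, of 0] by (simp add: pole_count_def)
  next
    case False
    thus ?thesis using nzm_zorder_neg_iff[OF f, of 0] pole_count_0[OF f] by simp
  qed
  also have "(\<Sum>a\<in>S \<inter> ball 0 r. ?p a) \<le> (\<Sum>a\<in>S \<inter> ball 0 r. (r + 1) * (of_int (- zorder f a) * ln ((r + 1) / cmod a)))"
  proof (rule sum_mono)
    fix a assume a: "a \<in> S \<inter> ball 0 r"
    hence neg: "zorder f a < 0" and pos: "0 < cmod a" "cmod a < r"
      using nzm_zorder_neg_iff[OF f, of a] by (auto simp: S_def)
    have "ln (cmod a / (r + 1)) \<le> cmod a / (r + 1) - 1" using pos r by (intro ln_le_minus_one divide_pos_pos) auto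
    also have "\<dots> \<le> r / (r + 1) - 1" using pos r by (simp add: divide_right_mono)
    also have "\<dots> = - 1 / (r + 1)" using r by (simp add: field_simps)
    finally have "1 \<le> (r + 1) * ln ((r + 1) / cmod a)" using pos r by (simp add: ln_div field_simps)
    hence "of_int (- zorder f a) * 1 \<le> of_int (- zorder f a) * ((r + 1) * ln ((r + 1) / cmod a))"
      using neg by (intro mult_left_mono) auto
    thus "?p a \<le> (r + 1) * (of_int (- zorder f a) * ln ((r + 1) / cmod a))" using neg by (simp add: mult_ac)
  qed
  also have "\<dots> = (r + 1) * (\<Sum>a\<in>S \<inter> ball 0 r. of_int (- zorder f a) * ln ((r + 1) / cmod a))"
    by (rule sum_distrib_left[symmetric])
  also have "\<dots> \<le> (r + 1) * nev_counting f (r + 1)"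
  proof (rule mult_left_mono)
    have "(\<Sum>a\<in>S \<inter> ball 0 r. of_int (- zorder f a) * ln ((r + 1) / cmod a)) \<le> (\<Sum>a\<in>S. of_int (- zorder f a) * ln ((r + 1) / cmod a))"
      using fS r by (intro sum_mono2 mult_nonneg_nonneg) (auto simp: S_def nzm_zorder_neg_iff[OF f, symmetric])
    also have "\<dots> \<le> nev_counting f (r + 1)"
      using r pole_count_0[OF f] nev_counting_eq[OF f, of "r + 1"] by (simp add: S_def)
    finally show "(\<Sum>a\<in>S \<inter> ball 0 r. of_int (- zorder f a) * ln ((r + 1) / cmod a)) \<le> nev_counting f (r + 1)" .
  qed (use r in auto)
  finally show ?thesis by simp
qed

lemma subnormal_bound:
  assumes "subnormal f" "\<epsilon> > 0"
  shows "eventually (\<lambda>r. nev_characteristic f r \<le> exp (\<epsilon> * r)) at_top"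
proof -
  have "Limsup at_top (\<lambda>r. ereal (ln (nev_characteristic f r) / r)) < ereal \<epsilon>"
    using assms by (simp add: subnormal_def zero_ereal_def)
  hence "eventually (\<lambda>r. ereal (ln (nev_characteristic f r) / r) < ereal \<epsilon>) at_top"
    by (rule Limsup_lessD)
  with eventually_gt_at_top[of 0] show ?thesis
  proof eventually_elim
    case (elim r)
    hence "ln (nev_characteristic f r) < \<epsilon> * r" by (simp add: divide_less_eq)
    hence less: "exp (ln (nev_characteristic f r)) < exp (\<epsilon> * r)" by simp
    show ?case
    proof (cases "nev_characteristic f r > 0")
      case True
      thus ?thesis using less by simp
    next
      case False
      thus ?thesis using exp_gt_zero[of "\<epsilon> * r"] by linarith
    qed
  qed
qed

text \<open>A circle may run through zeros or poles, so control is asked for only one radius in each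
  unit interval.\<close>

definition growth_bound :: "(complex \<Rightarrow> complex) \<Rightarrow> complex \<Rightarrow> (real \<Rightarrow> real) \<Rightarrow> bool" where
  "growth_bound f c V \<longleftrightarrow> eventually (\<lambda>\<rho>. \<exists>R\<in>{\<rho>..\<rho> + 1}. controlled f c R (V \<rho>)) at_top"

lemma sparse_radii_countable:
  fixes A :: "complex set"
  assumes "A sparse_in UNIV" shows "countable (dist c ` A)"
  using sparse_imp_countable[OF open_UNIV assms] by auto

lemma clean_radius:
  assumes h: "nzm h"
  obtains R where "R \<in> {\<rho>..\<rho> + 1}" "irr h \<inter> sphere c R = {}"
proof -
  have "countable (dist c ` irr h)" by (intro sparse_radii_countable irr_sparse h)
  then obtain R where "R \<in> {\<rho>..\<rho> + 1}" "R \<notin> dist c ` irr h"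
    by (rule good_radius[of "{}" "dist c ` irr h" 0 \<rho>, rotated]) auto
  thus ?thesis using that unfolding sphere_def by blast
qed

text \<open>The characteristic is estimated with the smaller rate 1 / 4000, which leaves room for
  the polynomial factors of \<open>controlled_of_log_plus\<close>. The rate 1 / 1000 is chosen for
  the end terms in \<open>growth_improvement\<close>.\<close>

lemma subnormal_growth_bound:
  assumes f: "nzm f" and sub: "subnormal f"
  shows "growth_bound f 0 (\<lambda>\<rho>. exp (\<rho> / 1000))"
proof -
  obtain C where C: "C \<ge> 1" "\<And>R0 R1 M P. 1 \<le> R0 \<Longrightarrow> R0 + 1 \<le> R1 \<Longrightarrow>
    irr f \<inter> sphere 0 R0 = {} \<Longrightarrow> irr f \<inter> sphere 0 R1 = {} \<Longrightarrow>
    cmean 0 R0 (\<lambda>z. log_plus (cmod (f z))) \<le> M \<Longrightarrow> cmean 0 R1 (\<lambda>z. log_plus (cmod (f z))) \<le> M \<Longrightarrow>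
    (\<Sum>a\<in>zpset f 0 R1. of_int (max 0 (- zorder f a))) \<le> P \<Longrightarrow>
    controlled f 0 R0 (C * R1\<^sup>2 * (M + P + 1))"
    by (rule controlled_of_log_plus[OF f, where c = 0]) (rule that; assumption)
  let ?T = "nev_characteristic f"
  obtain r0 where r0: "\<And>r. r \<ge> r0 \<Longrightarrow> ?T r \<le> exp (1 / 4000 * r)"
    using subnormal_bound[OF sub, of "1 / 4000"] by (auto simp: eventually_at_top_linorder)
  define n0 where "n0 = pole_count f 0"
  have n0: "n0 \<ge> 0" using pole_count_0[OF f] by (simp add: n0_def)
  define U where "U = (\<lambda>\<rho>. C * (\<rho> + 3)\<^sup>2 * (exp (1 / 4000 * (\<rho> + 4)) + (n0 + (\<rho> + 4) * exp (1 / 4000 * (\<rho> + 4))) + 1))"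
  have "eventually (\<lambda>\<rho>. U \<rho> \<le> exp (\<rho> / 1000)) at_top"
    unfolding U_def using C(1) n0 by real_asymp
  moreover have "eventually (\<lambda>\<rho>. \<rho> \<ge> max 1 r0) at_top" by (rule eventually_ge_at_top)
  ultimately show ?thesis unfolding growth_bound_def
  proof eventually_elim
    case (elim \<rho>)
    obtain R0 where R0: "R0 \<in> {\<rho>..\<rho> + 1}" "irr f \<inter> sphere 0 R0 = {}" by (rule clean_radius[OF f])
    obtain R1 where R1: "R1 \<in> {\<rho> + 2..(\<rho> + 2) + 1}" "irr f \<inter> sphere 0 R1 = {}" by (rule clean_radius[OF f])
    have T: "nev_proximity f R \<le> exp (1 / 4000 * (\<rho> + 4))" "nev_counting f R \<le> exp (1 / 4000 * (\<rho> + 4))"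
      if "\<rho> \<le> R" "R \<le> \<rho> + 4" for R
    proof -
      have "?T R \<le> exp (1 / 4000 * R)" using elim that by (intro r0) auto
      also have "\<dots> \<le> exp (1 / 4000 * (\<rho> + 4))" using that by simp
      finally show "nev_proximity f R \<le> exp (1 / 4000 * (\<rho> + 4))" "nev_counting f R \<le> exp (1 / 4000 * (\<rho> + 4))"
        using nev_proximity_nonneg[of f R] nev_counting_nonneg[OF f, of R] elim that by (auto simp: nev_characteristic_def)
    qed
    have "controlled f 0 R0 (C * R1\<^sup>2 * (exp (1 / 4000 * (\<rho> + 4)) + (n0 + (\<rho> + 4) * exp (1 / 4000 * (\<rho> + 4))) + 1))"
    proof (rule C(2))
      show "cmean 0 R0 (\<lambda>z. log_plus (cmod (f z))) \<le> exp (1 / 4000 * (\<rho> + 4))"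
        "cmean 0 R1 (\<lambda>z. log_plus (cmod (f z))) \<le> exp (1 / 4000 * (\<rho> + 4))"
        unfolding nev_proximity_cmean[symmetric] by (rule T; use R0 R1 in auto)+
      have "(\<Sum>a\<in>zpset f 0 R1. of_int (max 0 (- zorder f a))) \<le> n0 + (R1 + 1) * nev_counting f (R1 + 1)"
        unfolding n0_def using R1 elim by (intro pole_sum_le_nev_counting f) auto
      also have "\<dots> \<le> n0 + (\<rho> + 4) * exp (1 / 4000 * (\<rho> + 4))"
        using R1 elim nev_counting_nonneg[OF f, of "R1 + 1"] by (intro add_left_mono mult_mono T) auto
      finally show "(\<Sum>a\<in>zpset f 0 R1. of_int (max 0 (- zorder f a))) \<le> n0 + (\<rho> + 4) * exp (1 / 4000 * (\<rho> + 4))" .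
    qed (use R0 R1 elim in auto)
    moreover have "C * R1\<^sup>2 * (exp (1 / 4000 * (\<rho> + 4)) + (n0 + (\<rho> + 4) * exp (1 / 4000 * (\<rho> + 4))) + 1) \<le> U \<rho>"
      unfolding U_def using R1 elim C(1) n0 by (intro mult_right_mono mult_left_mono power_mono add_nonneg_nonneg mult_nonneg_nonneg) auto
    ultimately have "controlled f 0 R0 (exp (\<rho> / 1000))"
      using elim unfolding controlled_def by auto
    thus ?case using R0 by blast
  qed
qed

section \<open>Local behaviour: orders as comparisons of moduli\<close>

lemma poly_analytic [analytic_intros]: "(\<lambda>z. poly p z) analytic_on A" for p :: "complex poly"
proof -
  have "poly p holomorphic_on UNIV"
    by (intro holomorphic_onI) (meson poly_DERIV field_differentiable_def has_field_derivative_at_within)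
  thus ?thesis using analytic_on_holomorphic by (metis open_UNIV subset_UNIV)
qed

lemma ratfun_eval_meromorphic: "ratfun_eval q meromorphic_on A"
proof -
  have "ratfun_eval q = (\<lambda>z. poly (fst (quot_of_fract q)) z / poly (snd (quot_of_fract q)) z)"
    by (rule ext) (simp add: ratfun_eval_def)
  moreover have "(\<lambda>z. poly (fst (quot_of_fract q)) z / poly (snd (quot_of_fract q)) z) meromorphic_on A"
    by (intro meromorphic_intros analytic_on_imp_meromorphic_on poly_analytic)
  ultimately show ?thesis by simp
qed

lemma ratfun_eval_analytic:
  assumes "poly (snd (quot_of_fract q)) z \<noteq> 0" shows "ratfun_eval q analytic_on {z}"
proof -
  have "ratfun_eval q = (\<lambda>z. poly (fst (quot_of_fract q)) z / poly (snd (quot_of_fract q)) z)"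
    by (rule ext) (simp add: ratfun_eval_def)
  moreover have "(\<lambda>z. poly (fst (quot_of_fract q)) z / poly (snd (quot_of_fract q)) z) analytic_on {z}"
    by (intro analytic_intros poly_analytic) (use assms in auto)
  ultimately show ?thesis by simp
qed

lemma eventually_at_shift:
  fixes z c :: complex
  assumes "eventually P (at (z + c))" shows "eventually (\<lambda>\<zeta>. P (\<zeta> + c)) (at z)"
proof (rule eventually_compose_filterlim[OF assms])
  show "filterlim (\<lambda>\<zeta>. \<zeta> + c) (at (z + c)) (at z)"
    by (rule filterlim_atI) (auto intro!: tendsto_intros simp: eventually_at_filter)
qed

lemma zorder_asymp:
  assumes h: "nzm h"
  obtains c1 c2 where "0 < c1" "0 < c2"
    "eventually (\<lambda>\<zeta>. c1 * cmod (\<zeta> - z) powi zorder h z \<le> cmod (h \<zeta>) \<and> cmod (h \<zeta>) \<le> c2 * cmod (\<zeta> - z) powi zorder h z) (at z)"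
proof -
  define g where "g = zor_poly h z"
  have "isolated_singularity_at h z" "not_essential h z"
    using nzm_meromorphic[OF h, of "{z}"] by (auto simp: meromorphic_at_iff)
  from zorder_exist[OF this nzm_frequently_nz[OF h]] obtain r where
    r: "g z \<noteq> 0" "r > 0" "g holomorphic_on cball z r"
    "\<And>w. w \<in> cball z r - {z} \<Longrightarrow> h w = g w * (w - z) powi zorder h z \<and> g w \<noteq> 0"
    unfolding g_def by blast
  have "continuous_on (cball z r) g" using r(3) by (rule holomorphic_on_imp_continuous_on)
  hence "isCont g z" using r(2)
    by (metis centre_in_ball continuous_on_eq_continuous_at continuous_on_subset ball_subset_cball open_ball)
  hence lim: "((\<lambda>\<zeta>. cmod (g \<zeta>)) \<longlongrightarrow> cmod (g z)) (at z)" by (intro tendsto_norm) (simp add: isCont_def)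
  have "eventually (\<lambda>\<zeta>. cmod (g \<zeta>) > cmod (g z) / 2) (at z)" "eventually (\<lambda>\<zeta>. cmod (g \<zeta>) < 2 * cmod (g z)) (at z)"
    by (rule order_tendstoD[OF lim], use r(1) in simp)+
  moreover have "eventually (\<lambda>\<zeta>. \<zeta> \<in> ball z r - {z}) (at z)"
    using eventually_at_in_open[of "ball z r" z] r(2) by auto
  ultimately have "eventually (\<lambda>\<zeta>. cmod (g z) / 2 * cmod (\<zeta> - z) powi zorder h z \<le> cmod (h \<zeta>) \<and> cmod (h \<zeta>) \<le> (2 * cmod (g z)) * cmod (\<zeta> - z) powi zorder h z) (at z)"
  proof eventually_elim
    case (elim \<zeta>)
    hence "h \<zeta> = g \<zeta> * (\<zeta> - z) powi zorder h z" using r(4)[of \<zeta>] by auto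
    hence eq: "cmod (h \<zeta>) = cmod (g \<zeta>) * cmod (\<zeta> - z) powi zorder h z" by (simp add: norm_mult norm_power_int)
    show ?case unfolding eq using elim by (intro conjI mult_right_mono zero_le_power_int) auto
  qed
  thus ?thesis using that[of "cmod (g z) / 2" "2 * cmod (g z)"] r(1) by simp
qed

text \<open>After division by the power with exponent \<open>e0\<close>, two larger exponents on the
  right would let the right side tend to 0. Together with \<open>zorder_asymp\<close> this turns an
  inequality between moduli near a point into one between orders.\<close>

lemma powi_comparison:
  fixes c A B :: real and z :: complex
  assumes ev: "eventually (\<lambda>\<zeta>. c * cmod (\<zeta> - z) powi e0 \<le> A * cmod (\<zeta> - z) powi e1 + B * cmod (\<zeta> - z) powi e2) (at z)"
    and "c > 0"
  shows "e1 \<le> e0 \<or> e2 \<le> e0"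
proof (rule ccontr)
  assume "\<not> ?thesis"
  hence e: "e0 < e1" "e0 < e2" by auto
  define i j where "i = nat (e1 - e0)" and "j = nat (e2 - e0)"
  have ij: "i > 0" "j > 0" "e1 = e0 + int i" "e2 = e0 + int j" using e by (auto simp: i_def j_def)
  have "eventually (\<lambda>\<zeta>. c \<le> A * cmod (\<zeta> - z) ^ i + B * cmod (\<zeta> - z) ^ j) (at z)"
    using ev eventually_neq_at_within[of z z]
  proof eventually_elim
    case (elim \<zeta>)
    let ?t = "cmod (\<zeta> - z)"
    have t: "?t > 0" using elim by simp
    have p: "?t powi e1 = ?t powi e0 * ?t ^ i" "?t powi e2 = ?t powi e0 * ?t ^ j"
      using t by (simp_all add: ij power_int_add)
    have "?t powi e0 * c \<le> ?t powi e0 * (A * ?t ^ i + B * ?t ^ j)"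
      using elim(1) unfolding p by (simp add: algebra_simps)
    thus ?case using t by (simp add: zero_less_power_int mult_le_cancel_left_pos)
  qed
  moreover have "((\<lambda>\<zeta>. A * cmod (\<zeta> - z) ^ i + B * cmod (\<zeta> - z) ^ j) \<longlongrightarrow> A * cmod (z - z) ^ i + B * cmod (z - z) ^ j) (at z)"
    by (intro tendsto_intros)
  hence "((\<lambda>\<zeta>. A * cmod (\<zeta> - z) ^ i + B * cmod (\<zeta> - z) ^ j) \<longlongrightarrow> 0) (at z)" using ij by (simp add: power_0_left)
  ultimately have "c \<le> 0" using tendsto_lowerbound[of _ 0 "at z" c] by simp
  thus False using \<open>c > 0\<close> by simp
qed

lemma clean_radius_controlled:
  assumes h: "nzm h"
  obtains R B where "R \<ge> R0" "B \<ge> 1" "controlled h c R B"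
proof -
  obtain R where R: "R \<in> {R0..R0 + 1}" "irr h \<inter> sphere c R = {}" by (rule clean_radius[OF h])
  show ?thesis
    by (rule that[of R "max 1 (max (dsum h c R) (cmean c R (\<lambda>z. \<bar>ln (cmod (h z))\<bar>)))"])
       (use R in \<open>auto simp: controlled_def\<close>)
qed

lemma eventually_not_irr: "nzm h \<Longrightarrow> eventually (\<lambda>\<zeta>. \<zeta> \<notin> irr h) (at z)"
  using irr_sparse sparse_in_eventually_iff[of UNIV "irr h"] by auto

lemma finite_dist_lower:
  assumes "finite W"
  obtains \<eta> where "0 < \<eta>" "\<eta> \<le> (1::real)" "\<And>a \<zeta> :: complex. a \<in> W \<Longrightarrow> a \<noteq> z \<Longrightarrow> dist \<zeta> z \<le> \<eta> \<Longrightarrow> \<eta> \<le> dist \<zeta> a"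
proof -
  from finite_set_avoid[OF assms, of z] obtain d where d: "d > 0" "\<forall>x\<in>W. x \<noteq> z \<longrightarrow> d \<le> dist z x" by blast
  show ?thesis
  proof (rule that[of "min (d / 2) 1"])
    fix a \<zeta> assume "a \<in> W" "a \<noteq> z" "dist \<zeta> z \<le> min (d / 2) 1"
    thus "min (d / 2) 1 \<le> dist \<zeta> a" using d(2) dist_triangle[of z a \<zeta>] by (force simp: dist_commute)
  qed (use d in auto)
qed

text \<open>\<open>local_control\<close> is applied with the distance from \<open>z\<close> as
  \<open>\<delta>\<close>: sufficiently close to \<open>z\<close>, every point of \<open>W\<close>
  is at least that far away. So the poles of the Schwarzian derivative are at most double.\<close>

lemma schwarzian_local_bound:
  assumes f: "nzm f" "nzm (deriv f)"
  obtains C where "C > 0" "eventually (\<lambda>\<zeta>. cmod (schwarzian f \<zeta>) \<le> C * cmod (\<zeta> - z) powi (- 2)) (at z)"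
proof -
  obtain C where C: "C \<ge> 1" "\<And>R B. 8 \<le> R \<Longrightarrow> 1 \<le> B \<Longrightarrow> controlled f z R B \<Longrightarrow>
    \<exists>W. finite W \<and> real (card W) \<le> C * (R * B) ^ 14 \<and>
      (\<forall>w\<in>cball z (R - 6). \<forall>\<delta>. 0 < \<delta> \<longrightarrow> \<delta> \<le> 1 \<longrightarrow> (\<forall>a\<in>W. \<delta> \<le> cmod (w - a)) \<longrightarrow>
         w \<notin> irr f \<longrightarrow> w \<notin> irr (deriv f) \<longrightarrow>
         \<bar>ln (cmod (f w))\<bar> \<le> C * (R * B) ^ 14 / \<delta>\<^sup>2 \<and> cmod (schwarzian f w) \<le> C * (R * B) ^ 14 / \<delta>\<^sup>2)"
    by (rule local_control[OF f, where c = z]) (rule that; assumption)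
  obtain R B where RB: "R \<ge> 8" "B \<ge> 1" "controlled f z R B" by (rule clean_radius_controlled[OF f(1)])
  from C(2)[OF RB] obtain W where W: "finite W"
    "\<And>w \<delta>. w \<in> cball z (R - 6) \<Longrightarrow> 0 < \<delta> \<Longrightarrow> \<delta> \<le> 1 \<Longrightarrow> (\<forall>a\<in>W. \<delta> \<le> cmod (w - a)) \<Longrightarrow>
         w \<notin> irr f \<Longrightarrow> w \<notin> irr (deriv f) \<Longrightarrow> cmod (schwarzian f w) \<le> C * (R * B) ^ 14 / \<delta>\<^sup>2" by blast
  obtain \<eta> where \<eta>: "0 < \<eta>" "\<eta> \<le> (1::real)" "\<And>a \<zeta> :: complex. a \<in> W \<Longrightarrow> a \<noteq> z \<Longrightarrow> dist \<zeta> z \<le> \<eta> \<Longrightarrow> \<eta> \<le> dist \<zeta> a"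
    by (rule finite_dist_lower[OF W(1), of z]) (rule that; assumption)
  have "eventually (\<lambda>\<zeta>. \<zeta> \<in> ball z \<eta> - {z}) (at z)"
    using eventually_at_in_open[of "ball z \<eta>" z] \<eta> by auto
  with eventually_not_irr[OF f(1), of z] eventually_not_irr[OF f(2), of z]
  have "eventually (\<lambda>\<zeta>. cmod (schwarzian f \<zeta>) \<le> C * (R * B) ^ 14 * cmod (\<zeta> - z) powi (- 2)) (at z)"
  proof eventually_elim
    case (elim \<zeta>)
    have dz: "dist \<zeta> z < \<eta>" "\<zeta> \<noteq> z" using elim by (auto simp: dist_commute)
    have "cmod (schwarzian f \<zeta>) \<le> C * (R * B) ^ 14 / (cmod (\<zeta> - z))\<^sup>2"
    proof (rule W(2))
      show "\<forall>a\<in>W. cmod (\<zeta> - z) \<le> cmod (\<zeta> - a)"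
      proof
        fix a assume a: "a \<in> W"
        show "cmod (\<zeta> - z) \<le> cmod (\<zeta> - a)"
          using \<eta>(3)[OF a, of \<zeta>] dz by (cases "a = z") (auto simp: dist_norm)
      qed
    qed (use elim dz \<eta> RB in \<open>auto simp: dist_norm norm_minus_commute\<close>)
    thus ?case by (simp add: power_int_minus divide_inverse)
  qed
  moreover have "C * (R * B) ^ 14 > 0" using C(1) RB by simp
  ultimately show ?thesis using that by blast
qed

section \<open>The delay equation\<close>

definition zpart :: "(complex \<Rightarrow> complex) \<Rightarrow> complex \<Rightarrow> real" where
  "zpart h z = of_int (max 0 (zorder h z))"

definition ppart :: "int \<Rightarrow> (complex \<Rightarrow> complex) \<Rightarrow> complex \<Rightarrow> real" where
  "ppart m h z = (if m \<le> - zorder h z then of_int (- zorder h z) else 0)"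

text \<open>The setting of the indirect proof. \<open>m\<close> is the least positive multiplicity
  of zeros of \<open>g\<close> that is not assumed to be rare. The admissible pairs satisfy
  \<open>int d * m > 2\<close>, so that the power \<open>d\<close> of a pole of order
  \<open>m\<close> outweighs a double pole of the Schwarzian derivative.\<close>

locale delay_equation =
  fixes f :: "complex \<Rightarrow> complex" and a b1 :: ratfun and P Qh :: "ratfun poly" and d :: nat and m :: int
  assumes nzf: "nzm f" and nzf': "nzm (deriv f)" and nzg: "nzm (\<lambda>z. f z - ratfun_eval b1 z)"
    and cop: "coprime P ([:- b1, 1:] ^ 2 * Qh)" "coprime Qh [:- b1, 1:]"
    and deg: "degree P = degree ([:- b1, 1:] ^ 2 * Qh) + d"
    and eq: "\<forall>\<^sub>\<approx>z\<in>UNIV. f (z + 1) * f (z - 1) + ratfun_eval a z * schwarzian f z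
                     = ratpoly_eval P z (f z) / ratpoly_eval ([:- b1, 1:] ^ 2 * Qh) z (f z)"
    and dm: "d = 1 \<and> m = 3 \<or> d = 2 \<and> m = 2"
    and few: "finite {z. 0 < zorder (\<lambda>z. f z - ratfun_eval b1 z) z \<and> zorder (\<lambda>z. f z - ratfun_eval b1 z) z < m}"
begin

abbreviation g where "g \<equiv> \<lambda>z. f z - ratfun_eval b1 z"

definition eqbad where "eqbad = {z. \<not> (f (z + 1) * f (z - 1) + ratfun_eval a z * schwarzian f z
                     = ratpoly_eval P z (f z) / ratpoly_eval ([:- b1, 1:] ^ 2 * Qh) z (f z))}"

lemma eqbad_sparse: "eqbad sparse_in UNIV"
  using eq by (simp add: eqbad_def eventually_cosparse)

text \<open>The base \<open>3 + cmod z\<close> and the translates added to the exceptional set let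
  one bound serve \<open>z\<close>, \<open>z + 1\<close> and \<open>z - 1\<close>. The poles of the
  coefficient \<open>b1\<close> are added as well.\<close>

lemma uniform_estimates:
  obtains Z C where "finite Z" "\<And>z \<delta>. 0 < \<delta> \<Longrightarrow> \<delta> \<le> 1 \<Longrightarrow> (\<And>e. e \<in> Z \<Longrightarrow> \<delta> \<le> cmod (z - e)) \<Longrightarrow> z \<notin> eqbad \<Longrightarrow>
      (g z \<noteq> 0 \<longrightarrow> cmod (g z) \<le> 1 / ((3 + cmod z) / \<delta>) ^ C \<longrightarrow>
         1 / (((3 + cmod z) / \<delta>) ^ C * (cmod (g z))\<^sup>2) \<le> cmod (f (z + 1) * f (z - 1)) + ((3 + cmod z) / \<delta>) ^ C * cmod (schwarzian f z)) \<and>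
      (((3 + cmod z) / \<delta>) ^ C \<le> cmod (f z) \<longrightarrow>
         cmod (f z) ^ d / ((3 + cmod z) / \<delta>) ^ C \<le> cmod (f (z + 1) * f (z - 1)) + ((3 + cmod z) / \<delta>) ^ C * cmod (schwarzian f z))"
    "\<And>z \<delta>. 0 < \<delta> \<Longrightarrow> \<delta> \<le> 1 \<Longrightarrow> (\<And>e. e \<in> Z \<Longrightarrow> \<delta> \<le> cmod (z - e)) \<Longrightarrow>
       cmod (ratfun_eval b1 z) \<le> ((3 + cmod z) / \<delta>) ^ C \<and> cmod (ratfun_eval b1 (z + 1)) \<le> ((3 + cmod z) / \<delta>) ^ C
        \<and> cmod (ratfun_eval b1 (z - 1)) \<le> ((3 + cmod z) / \<delta>) ^ C"
    "\<And>z. z \<notin> Z \<Longrightarrow> ratfun_eval b1 analytic_on {z}"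
proof (rule equation_estimates[OF cop deg, where a = a], goal_cases)
  case (1 Z C)
  note ZC = 1(2-)
  let ?D = "{z. poly (snd (quot_of_fract b1)) z = 0}"
  define Z' where "Z' = Z \<union> (\<lambda>e. e + 1) ` Z \<union> (\<lambda>e. e - 1) ` Z \<union> ?D"
  have fZ': "finite Z'" using ZC(1) by (simp add: Z'_def poly_roots_finite)
  have mono: "((2 + cmod w) / \<delta>) ^ C \<le> ((3 + cmod z) / \<delta>) ^ C"
    if "0 < \<delta>" "cmod w \<le> cmod z + 1" for w z and \<delta> :: real
    using that by (intro power_mono divide_right_mono) auto
  have pos: "((2 + cmod z) / \<delta>) ^ C > 0" if "0 < \<delta>" for z and \<delta> :: real
    using that by (intro zero_less_power divide_pos_pos add_pos_nonneg) auto
  show ?thesis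
  proof (rule that[of Z' C])
    fix z and \<delta> :: real
    assume \<delta>: "0 < \<delta>" "\<delta> \<le> 1" and dist: "\<And>e. e \<in> Z' \<Longrightarrow> \<delta> \<le> cmod (z - e)"
    have dist': "\<delta> \<le> cmod (z - e)" "\<delta> \<le> cmod (z + 1 - e)" "\<delta> \<le> cmod (z - 1 - e)" if "e \<in> Z" for e
      using dist[of e] dist[of "e - 1"] dist[of "e + 1"] that by (auto simp: Z'_def algebra_simps)
    have tri: "cmod (z + 1) \<le> cmod z + 1" "cmod (z - 1) \<le> cmod z + 1"
      using norm_triangle_ineq[of z 1] norm_triangle_ineq4[of z 1] by auto
    show "cmod (ratfun_eval b1 z) \<le> ((3 + cmod z) / \<delta>) ^ C \<and> cmod (ratfun_eval b1 (z + 1)) \<le> ((3 + cmod z) / \<delta>) ^ C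
        \<and> cmod (ratfun_eval b1 (z - 1)) \<le> ((3 + cmod z) / \<delta>) ^ C"
      using order_trans[OF ZC(3)[OF \<delta> dist'(1)] mono[OF \<delta>(1), of z z]]
        order_trans[OF ZC(3)[OF \<delta> dist'(2)] mono[OF \<delta>(1) tri(1)]]
        order_trans[OF ZC(3)[OF \<delta> dist'(3)] mono[OF \<delta>(1) tri(2)]] by simp
    assume zb: "z \<notin> eqbad"
    hence e: "f (z + 1) * f (z - 1) + ratfun_eval a z * schwarzian f z
         = ratpoly_eval P z (f z) / ratpoly_eval ([:- b1, 1:] ^ 2 * Qh) z (f z)" by (simp add: eqbad_def)
    define X Y where "X = ((2 + cmod z) / \<delta>) ^ C" and "Y = ((3 + cmod z) / \<delta>) ^ C"
    have XY: "X \<le> Y" "X > 0" unfolding X_def Y_def using mono[OF \<delta>(1), of z z] pos[OF \<delta>(1)] by auto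
    have est: "f z \<noteq> ratfun_eval b1 z \<Longrightarrow> cmod (f z - ratfun_eval b1 z) \<le> 1 / X \<Longrightarrow>
         1 / (X * (cmod (f z - ratfun_eval b1 z))\<^sup>2) \<le> cmod (f (z + 1) * f (z - 1)) + X * cmod (schwarzian f z)"
      "X \<le> cmod (f z) \<Longrightarrow> cmod (f z) ^ d / X \<le> cmod (f (z + 1) * f (z - 1)) + X * cmod (schwarzian f z)"
      using ZC(2)[OF \<delta> dist'(1) e] unfolding X_def by blast+
    have last: "cmod (f (z + 1) * f (z - 1)) + X * cmod (schwarzian f z) \<le> cmod (f (z + 1) * f (z - 1)) + Y * cmod (schwarzian f z)"
      using XY by (intro add_left_mono mult_right_mono) auto
    show "(g z \<noteq> 0 \<longrightarrow> cmod (g z) \<le> 1 / ((3 + cmod z) / \<delta>) ^ C \<longrightarrow>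
         1 / (((3 + cmod z) / \<delta>) ^ C * (cmod (g z))\<^sup>2) \<le> cmod (f (z + 1) * f (z - 1)) + ((3 + cmod z) / \<delta>) ^ C * cmod (schwarzian f z)) \<and>
      (((3 + cmod z) / \<delta>) ^ C \<le> cmod (f z) \<longrightarrow>
         cmod (f z) ^ d / ((3 + cmod z) / \<delta>) ^ C \<le> cmod (f (z + 1) * f (z - 1)) + ((3 + cmod z) / \<delta>) ^ C * cmod (schwarzian f z))"
      unfolding Y_def[symmetric]
    proof (intro conjI impI)
      assume gz: "g z \<noteq> 0" "cmod (g z) \<le> 1 / Y"
      have "1 / Y \<le> 1 / X" using XY by (intro divide_left_mono) auto
      with gz have "1 / (X * (cmod (g z))\<^sup>2) \<le> cmod (f (z + 1) * f (z - 1)) + X * cmod (schwarzian f z)"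
        by (intro est(1)) auto
      moreover have "1 / (Y * (cmod (g z))\<^sup>2) \<le> 1 / (X * (cmod (g z))\<^sup>2)"
        using XY gz by (intro divide_left_mono mult_right_mono mult_pos_pos zero_less_power) auto
      ultimately show "1 / (Y * (cmod (g z))\<^sup>2) \<le> cmod (f (z + 1) * f (z - 1)) + Y * cmod (schwarzian f z)"
        using last by linarith
    next
      assume "Y \<le> cmod (f z)"
      hence "cmod (f z) ^ d / X \<le> cmod (f (z + 1) * f (z - 1)) + X * cmod (schwarzian f z)"
        using XY by (intro est(2)) auto
      moreover have "cmod (f z) ^ d / Y \<le> cmod (f z) ^ d / X" using XY by (intro divide_left_mono) auto
      ultimately show "cmod (f z) ^ d / Y \<le> cmod (f (z + 1) * f (z - 1)) + Y * cmod (schwarzian f z)"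
        using last by linarith
    qed
  next
    fix z assume "z \<notin> Z'"
    thus "ratfun_eval b1 analytic_on {z}" by (intro ratfun_eval_analytic) (auto simp: Z'_def)
  qed (rule fZ')
qed

text \<open>Where \<open>g\<close> is small, the logarithm of the equation gives the factor 2; it is
  weakened to 4 / 3 so that values and multiplicities obey the same inequality. For the second
  claim, small values of \<open>g\<close> on both sides bound \<open>f\<close> there by
  \<open>2 * \<Lambda>\<close>, and since \<open>d\<close> is positive the equation then bounds
  \<open>f z\<close>.\<close>

lemma pointwise_inequalities:
  assumes \<Lambda>: "2 \<le> \<Lambda>" and S: "1 \<le> S" "cmod (schwarzian f z) \<le> S"
    and gnz: "g z \<noteq> 0" "g (z + 1) \<noteq> 0" "g (z - 1) \<noteq> 0"
    and est: "cmod (g z) \<le> 1 / \<Lambda> \<Longrightarrow> 1 / (\<Lambda> * (cmod (g z))\<^sup>2) \<le> cmod (f (z + 1) * f (z - 1)) + \<Lambda> * cmod (schwarzian f z)"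
      "\<Lambda> \<le> cmod (f z) \<Longrightarrow> cmod (f z) ^ d / \<Lambda> \<le> cmod (f (z + 1) * f (z - 1)) + \<Lambda> * cmod (schwarzian f z)"
    and b: "cmod (ratfun_eval b1 (z + 1)) \<le> \<Lambda>" "cmod (ratfun_eval b1 (z - 1)) \<le> \<Lambda>"
  defines "Y \<equiv> \<lambda>z. log_plus (inverse (cmod (g z)))" and "X \<equiv> \<lambda>z. log_plus (cmod (f z))"
  shows "4 / 3 * Y z \<le> X (z + 1) + X (z - 1) + (8 * ln \<Lambda> + 2 * ln S)"
    and "min (min (Y (z - 1)) (Y (z + 1))) (X z) \<le> 8 * ln \<Lambda> + 2 * ln S"
proof -
  have l: "ln \<Lambda> \<ge> ln 2" "ln S \<ge> 0" "ln \<Lambda> \<ge> 0" "ln 2 \<ge> (0::real)" using \<Lambda> S by (auto intro: ln_mono)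
  have lp: "log_plus \<Lambda> = ln \<Lambda>" "log_plus S = ln S" using \<Lambda> S by (auto simp: log_plus_def max_def)
  have X0: "X (z + 1) \<ge> 0" "X (z - 1) \<ge> 0" "X z \<ge> 0" "Y z \<ge> 0" by (simp_all add: X_def Y_def)
  let ?G = "cmod (g z)"
  have G: "?G > 0" using gnz by simp
  have "2 * Y z \<le> X (z + 1) + X (z - 1) + (8 * ln \<Lambda> + 2 * ln S)"
  proof (cases "?G \<le> 1 / \<Lambda>")
    case False
    hence "inverse ?G \<le> \<Lambda>" using \<Lambda> G by (simp add: field_simps)
    hence "Y z \<le> ln \<Lambda>" unfolding Y_def lp(1)[symmetric] by (rule log_plus_mono)
    thus ?thesis using l X0 by linarith
  next
    case True
    have "inverse ?G \<ge> 1" using True \<Lambda> G by (intro one_le_inverse) (auto intro: order_trans)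
    hence "2 * Y z = ln ((inverse ?G)\<^sup>2)" using G by (simp add: Y_def log_plus_def max_def ln_realpow)
    also have "\<dots> \<le> log_plus ((inverse ?G)\<^sup>2)" by (rule ln_le_log_plus) simp
    also have "(inverse ?G)\<^sup>2 \<le> \<Lambda> * cmod (f (z + 1) * f (z - 1)) + \<Lambda> * (\<Lambda> * S)"
    proof -
      have "(inverse ?G)\<^sup>2 = \<Lambda> * (1 / (\<Lambda> * ?G\<^sup>2))" using \<Lambda> G by (simp add: field_simps)
      also have "\<dots> \<le> \<Lambda> * (cmod (f (z + 1) * f (z - 1)) + \<Lambda> * cmod (schwarzian f z))"
        using \<Lambda> by (intro mult_left_mono est(1) True) auto
      also have "\<dots> \<le> \<Lambda> * (cmod (f (z + 1) * f (z - 1)) + \<Lambda> * S)"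
        using \<Lambda> S by (intro mult_left_mono add_left_mono) auto
      finally show ?thesis by (simp add: distrib_left)
    qed
    hence "log_plus ((inverse ?G)\<^sup>2) \<le> log_plus (\<Lambda> * cmod (f (z + 1) * f (z - 1)) + \<Lambda> * (\<Lambda> * S))" by (rule log_plus_mono)
    also have "\<dots> \<le> log_plus (\<Lambda> * cmod (f (z + 1) * f (z - 1))) + log_plus (\<Lambda> * (\<Lambda> * S)) + ln 2"
      using \<Lambda> S by (intro log_plus_add_le) auto
    also have "log_plus (\<Lambda> * cmod (f (z + 1) * f (z - 1))) \<le> ln \<Lambda> + (X (z + 1) + X (z - 1))"
      unfolding X_def lp(1)[symmetric] norm_mult using \<Lambda>
      by (intro order_trans[OF log_plus_mult_le] add_left_mono log_plus_mult_le) auto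
    also have "log_plus (\<Lambda> * (\<Lambda> * S)) \<le> ln \<Lambda> + (ln \<Lambda> + ln S)"
      unfolding lp[symmetric] using \<Lambda> S
      by (intro order_trans[OF log_plus_mult_le] add_left_mono log_plus_mult_le) auto
    finally show ?thesis using l by linarith
  qed
  thus "4 / 3 * Y z \<le> X (z + 1) + X (z - 1) + (8 * ln \<Lambda> + 2 * ln S)" using X0 by linarith
  show "min (min (Y (z - 1)) (Y (z + 1))) (X z) \<le> 8 * ln \<Lambda> + 2 * ln S"
  proof (rule ccontr)
    assume "\<not> ?thesis"
    hence big: "Y (z - 1) > 8 * ln \<Lambda> + 2 * ln S" "Y (z + 1) > 8 * ln \<Lambda> + 2 * ln S" "X z > 8 * ln \<Lambda> + 2 * ln S"
      by (auto simp: min_def split: if_splits)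
    have small: "cmod (f w) \<le> 2 * \<Lambda>" if w: "Y w > 0" "cmod (ratfun_eval b1 w) \<le> \<Lambda>" for w
    proof -
      have "inverse (cmod (g w)) > 1"
      proof (rule ccontr)
        assume "\<not> ?thesis"
        hence "max 1 (inverse (cmod (g w))) = 1" by simp
        thus False using w(1) by (simp add: Y_def log_plus_def)
      qed
      hence "cmod (g w) < 1" by (metis inverse_le_1_iff less_imp_not_less norm_ge_zero not_le one_less_inverse_iff)
      thus ?thesis using w(2) \<Lambda> norm_triangle_ineq[of "g w" "ratfun_eval b1 w"] by simp
    qed
    have f2: "cmod (f (z + 1)) \<le> 2 * \<Lambda>" "cmod (f (z - 1)) \<le> 2 * \<Lambda>"
    proof -
      have "Y (z + 1) > 0" "Y (z - 1) > 0" using big l by linarith+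
      thus "cmod (f (z + 1)) \<le> 2 * \<Lambda>" "cmod (f (z - 1)) \<le> 2 * \<Lambda>"
        using b by (auto intro: small)
    qed
    have "cmod (f z) > \<Lambda>"
    proof (rule ccontr)
      assume "\<not> ?thesis"
      hence "X z \<le> ln \<Lambda>" unfolding X_def lp(1)[symmetric] by (intro log_plus_mono) auto
      thus False using big l by linarith
    qed
    hence fz: "cmod (f z) \<ge> \<Lambda>" "cmod (f z) \<ge> 1" using \<Lambda> by auto
    have "cmod (f z) \<le> cmod (f z) ^ d" using fz dm by (intro self_le_power) auto
    also have "\<dots> = \<Lambda> * (cmod (f z) ^ d / \<Lambda>)" using \<Lambda> by simp
    also have "\<dots> \<le> \<Lambda> * (cmod (f (z + 1) * f (z - 1)) + \<Lambda> * cmod (schwarzian f z))"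
      using \<Lambda> by (intro mult_left_mono est(2) fz) auto
    also have "\<dots> \<le> \<Lambda> * ((2 * \<Lambda>) * (2 * \<Lambda>) + \<Lambda> * S)"
      unfolding norm_mult using \<Lambda> S f2 by (intro mult_left_mono add_mono mult_mono) auto
    also have "\<dots> \<le> \<Lambda> * ((2 * \<Lambda>) * (2 * \<Lambda>) * S + \<Lambda> * \<Lambda> * S)"
      using \<Lambda> S mult_left_mono[OF S(1), of "4 * \<Lambda> * \<Lambda>"] mult_right_mono[of 1 \<Lambda> "\<Lambda> * S"]
      by (intro mult_left_mono add_mono) (auto simp: mult_ac)
    also have "\<dots> = 5 * (\<Lambda> ^ 3 * S)" by (simp add: power3_eq_cube algebra_simps)
    also have "\<dots> \<le> \<Lambda> ^ 3 * (\<Lambda> ^ 3 * S)" using \<Lambda> S power_mono[of 2 \<Lambda> 3] by (intro mult_right_mono) auto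
    also have "\<dots> = \<Lambda> ^ 6 * S" by (simp flip: power_add)
    finally have le: "cmod (f z) \<le> \<Lambda> ^ 6 * S" .
    have "X z = ln (cmod (f z))" using fz by (simp add: X_def log_plus_def max_def)
    also have "\<dots> \<le> ln (\<Lambda> ^ 6 * S)" using le fz by (intro ln_mono) auto
    also have "\<dots> = 6 * ln \<Lambda> + ln S" using \<Lambda> S by (simp add: ln_mult_pos ln_realpow)
    finally show False using big(3) l by linarith
  qed
qed

text \<open>
  The same dichotomy for multiplicities; here the double poles of the Schwarzian derivative cannot
  be absorbed in an error term, which is why \<open>ppart m\<close> ignores poles of order below \<open>m\<close>.
\<close>
lemma order_inequalities:
  obtains Ex where "finite Ex"
    "\<And>z. z \<notin> Ex \<Longrightarrow> 4 / 3 * zpart g z \<le> ppart m f (z + 1) + ppart m f (z - 1)"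
    "\<And>z. z \<notin> Ex \<Longrightarrow> min (min (zpart g (z - 1)) (zpart g (z + 1))) (ppart m f z) \<le> 0"
    "\<And>z. z \<notin> Ex \<Longrightarrow> ratfun_eval b1 analytic_on {z}"
proof (rule uniform_estimates, goal_cases)
  case (1 Z C)
  note Z = 1(2-)
  define Ex where "Ex = Z \<union> {z. 0 < zorder g z \<and> zorder g z < m}"
  have m2: "m \<ge> 2" "int d * m > 2" "m \<le> 3" "d \<ge> 1" using dm by auto
  have fEx: "finite Ex" using Z(1) few by (simp add: Ex_def)
  \<comment> \<open>Near a fixed point off \<open>Ex\<close> the distance to the exceptional set is
    bounded below, so the estimates hold with a constant \<open>\<Lambda>\<close>, and the
    Schwarzian derivative may be replaced by a double pole.\<close>
  have local: "\<exists>\<Lambda>>0. \<exists>D>0. eventually (\<lambda>\<zeta>.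
        (cmod (g \<zeta>) \<le> 1 / \<Lambda> \<longrightarrow> 1 / (\<Lambda> * (cmod (g \<zeta>))\<^sup>2) \<le> cmod (f (\<zeta> + 1)) * cmod (f (\<zeta> - 1)) + D * cmod (\<zeta> - z) powi (-2)) \<and>
        (\<Lambda> \<le> cmod (f \<zeta>) \<longrightarrow> cmod (f \<zeta>) ^ d / \<Lambda> \<le> cmod (f (\<zeta> + 1)) * cmod (f (\<zeta> - 1)) + D * cmod (\<zeta> - z) powi (-2)) \<and>
        cmod (ratfun_eval b1 (\<zeta> + 1)) \<le> \<Lambda> \<and> cmod (ratfun_eval b1 (\<zeta> - 1)) \<le> \<Lambda>) (at z)"
    if z: "z \<notin> Ex" for z
  proof -
    obtain \<eta> where \<eta>: "0 < \<eta>" "\<eta> \<le> (1::real)" "\<And>e \<zeta> :: complex. e \<in> Z \<Longrightarrow> e \<noteq> z \<Longrightarrow> dist \<zeta> z \<le> \<eta> \<Longrightarrow> \<eta> \<le> dist \<zeta> e"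
      by (rule finite_dist_lower[OF Z(1), of z]) (rule that; assumption)
    have zZ: "z \<notin> Z" using z by (simp add: Ex_def)
    define \<Lambda> where "\<Lambda> = ((4 + cmod z) / \<eta>) ^ C"
    have \<Lambda>0: "\<Lambda> > 0" unfolding \<Lambda>_def using \<eta> by (intro zero_less_power divide_pos_pos add_pos_nonneg) auto
    obtain S where S: "S > 0" "eventually (\<lambda>\<zeta>. cmod (schwarzian f \<zeta>) \<le> S * cmod (\<zeta> - z) powi (- 2)) (at z)"
      by (rule schwarzian_local_bound[OF nzf nzf'])
    have "eventually (\<lambda>\<zeta>. \<zeta> \<in> ball z \<eta> - {z}) (at z)"
      using eventually_at_in_open[of "ball z \<eta>" z] \<eta> by auto
    moreover have "eventually (\<lambda>\<zeta>. \<zeta> \<notin> eqbad) (at z)"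
      using eqbad_sparse sparse_in_eventually_iff[of UNIV eqbad] by auto
    moreover note S(2) nzm_eventually_nz[OF nzg, of z]
    ultimately have "eventually (\<lambda>\<zeta>.
        (cmod (g \<zeta>) \<le> 1 / \<Lambda> \<longrightarrow> 1 / (\<Lambda> * (cmod (g \<zeta>))\<^sup>2) \<le> cmod (f (\<zeta> + 1)) * cmod (f (\<zeta> - 1)) + (\<Lambda> * S) * cmod (\<zeta> - z) powi (-2)) \<and>
        (\<Lambda> \<le> cmod (f \<zeta>) \<longrightarrow> cmod (f \<zeta>) ^ d / \<Lambda> \<le> cmod (f (\<zeta> + 1)) * cmod (f (\<zeta> - 1)) + (\<Lambda> * S) * cmod (\<zeta> - z) powi (-2)) \<and>
        cmod (ratfun_eval b1 (\<zeta> + 1)) \<le> \<Lambda> \<and> cmod (ratfun_eval b1 (\<zeta> - 1)) \<le> \<Lambda>) (at z)"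
    proof eventually_elim
      case (elim \<zeta>)
      have di: "\<eta> \<le> cmod (\<zeta> - e)" if "e \<in> Z" for e
        using \<eta>(3)[OF that, of \<zeta>] zZ that elim(1) by (auto simp: dist_norm norm_minus_commute)
      define Y where "Y = ((3 + cmod \<zeta>) / \<eta>) ^ C"
      have "cmod \<zeta> \<le> cmod z + 1"
        using elim(1) \<eta> norm_triangle_sub[of \<zeta> z] by (auto simp: dist_norm norm_minus_commute)
      hence Y\<Lambda>: "Y \<le> \<Lambda>" unfolding Y_def \<Lambda>_def using \<eta> by (intro power_mono divide_right_mono) auto
      have Y0: "Y > 0" unfolding Y_def using \<eta> by (intro zero_less_power divide_pos_pos add_pos_nonneg) auto
      note est = Z(2)[OF \<eta>(1,2) di elim(2), folded Y_def] Z(3)[OF \<eta>(1,2) di, folded Y_def]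
      have last: "cmod (f (\<zeta> + 1) * f (\<zeta> - 1)) + Y * cmod (schwarzian f \<zeta>)
          \<le> cmod (f (\<zeta> + 1)) * cmod (f (\<zeta> - 1)) + (\<Lambda> * S) * cmod (\<zeta> - z) powi (-2)"
        using mult_mono[OF Y\<Lambda> elim(3)] \<Lambda>0 by (simp add: norm_mult mult.assoc)
      show ?case
      proof (intro conjI impI)
        assume g: "cmod (g \<zeta>) \<le> 1 / \<Lambda>"
        have "1 / \<Lambda> \<le> 1 / Y" using Y\<Lambda> Y0 by (intro divide_left_mono) auto
        hence "1 / (Y * (cmod (g \<zeta>))\<^sup>2) \<le> cmod (f (\<zeta> + 1) * f (\<zeta> - 1)) + Y * cmod (schwarzian f \<zeta>)"
          using est(1) g elim(4) by auto
        moreover have "1 / (\<Lambda> * (cmod (g \<zeta>))\<^sup>2) \<le> 1 / (Y * (cmod (g \<zeta>))\<^sup>2)"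
          using Y\<Lambda> Y0 elim(4) by (intro divide_left_mono mult_right_mono mult_pos_pos zero_less_power) auto
        ultimately show "1 / (\<Lambda> * (cmod (g \<zeta>))\<^sup>2) \<le> cmod (f (\<zeta> + 1)) * cmod (f (\<zeta> - 1)) + (\<Lambda> * S) * cmod (\<zeta> - z) powi (-2)"
          using last by linarith
      next
        assume "\<Lambda> \<le> cmod (f \<zeta>)"
        hence "cmod (f \<zeta>) ^ d / Y \<le> cmod (f (\<zeta> + 1) * f (\<zeta> - 1)) + Y * cmod (schwarzian f \<zeta>)"
          using est(1) Y\<Lambda> by auto
        moreover have "cmod (f \<zeta>) ^ d / \<Lambda> \<le> cmod (f \<zeta>) ^ d / Y" using Y\<Lambda> Y0 by (intro divide_left_mono) auto
        ultimately show "cmod (f \<zeta>) ^ d / \<Lambda> \<le> cmod (f (\<zeta> + 1)) * cmod (f (\<zeta> - 1)) + (\<Lambda> * S) * cmod (\<zeta> - z) powi (-2)"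
          using last by linarith
      qed (use est(2) Y\<Lambda> in auto)
    qed
    moreover have "\<Lambda> * S > 0" using \<Lambda>0 S(1) by simp
    ultimately show ?thesis using \<Lambda>0 by blast
  qed
  have tpos: "cmod (\<zeta> - z) powi n > 0" if "\<zeta> \<noteq> z" for \<zeta> z n using that by (simp add: zero_less_power_int)
  \<comment> \<open>The left side of the estimate has a pole of order twice that of the zero. This
    is at least 2 * m > 2, so the double pole of the Schwarzian derivative cannot account for it and
    the neighbours must.\<close>
  have \<alpha>: "- zorder f (z + 1) - zorder f (z - 1) \<ge> 2 * zorder g z" if z: "z \<notin> Ex" and gz: "zorder g z \<ge> m" for z
  proof -
    obtain \<Lambda> D where \<Lambda>: "\<Lambda> > 0" "D > 0" and ev: "eventually (\<lambda>\<zeta>.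
        (cmod (g \<zeta>) \<le> 1 / \<Lambda> \<longrightarrow> 1 / (\<Lambda> * (cmod (g \<zeta>))\<^sup>2) \<le> cmod (f (\<zeta> + 1)) * cmod (f (\<zeta> - 1)) + D * cmod (\<zeta> - z) powi (-2)) \<and>
        (\<Lambda> \<le> cmod (f \<zeta>) \<longrightarrow> cmod (f \<zeta>) ^ d / \<Lambda> \<le> cmod (f (\<zeta> + 1)) * cmod (f (\<zeta> - 1)) + D * cmod (\<zeta> - z) powi (-2)) \<and>
        cmod (ratfun_eval b1 (\<zeta> + 1)) \<le> \<Lambda> \<and> cmod (ratfun_eval b1 (\<zeta> - 1)) \<le> \<Lambda>) (at z)"
      using local[OF z] by blast
    obtain c1 c2 where c: "0 < c1" "0 < c2" "eventually (\<lambda>\<zeta>. c1 * cmod (\<zeta> - z) powi zorder g z \<le> cmod (g \<zeta>) \<and> cmod (g \<zeta>) \<le> c2 * cmod (\<zeta> - z) powi zorder g z) (at z)"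
      by (rule zorder_asymp[OF nzg])
    obtain p1 p2 where p: "0 < p1" "0 < p2" "eventually (\<lambda>\<zeta>. p1 * cmod (\<zeta> - (z + 1)) powi zorder f (z + 1) \<le> cmod (f \<zeta>) \<and> cmod (f \<zeta>) \<le> p2 * cmod (\<zeta> - (z + 1)) powi zorder f (z + 1)) (at (z + 1))"
      by (rule zorder_asymp[OF nzf])
    obtain q1 q2 where q: "0 < q1" "0 < q2" "eventually (\<lambda>\<zeta>. q1 * cmod (\<zeta> - (z + -1)) powi zorder f (z + -1) \<le> cmod (f \<zeta>) \<and> cmod (f \<zeta>) \<le> q2 * cmod (\<zeta> - (z + -1)) powi zorder f (z + -1)) (at (z + -1))"
      by (rule zorder_asymp[OF nzf])
    have "zorder g z > 0" using gz m2 by simp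
    hence "isolated_zero g z" by (intro zorder_pos_imp_isolated_zero nzm_meromorphic[OF nzg] nzm_eventually_nz[OF nzg])
    hence "g \<midarrow>z\<rightarrow> 0" by (simp add: isolated_zero_def)
    hence "((\<lambda>\<zeta>. cmod (g \<zeta>)) \<longlongrightarrow> 0) (at z)" by (rule tendsto_norm_zero)
    hence small: "eventually (\<lambda>\<zeta>. cmod (g \<zeta>) < 1 / \<Lambda>) (at z)" using \<Lambda> by (intro order_tendstoD(2)) auto
    have "eventually (\<lambda>\<zeta>. 1 / (\<Lambda> * c2\<^sup>2) * cmod (\<zeta> - z) powi (- 2 * zorder g z)
        \<le> (p2 * q2) * cmod (\<zeta> - z) powi (zorder f (z + 1) + zorder f (z - 1)) + D * cmod (\<zeta> - z) powi (-2)) (at z)"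
      using ev c(3) eventually_at_shift[OF p(3)] eventually_at_shift[OF q(3)] small
        nzm_eventually_nz[OF nzg, of z] eventually_neq_at_within[of z z UNIV]
    proof eventually_elim
      case (elim \<zeta>)
      let ?t = "cmod (\<zeta> - z)"
      have t: "?t > 0" using elim(7) by simp
      have gle: "cmod (g \<zeta>) \<le> c2 * ?t powi zorder g z" using elim(2) by simp
      have g0: "cmod (g \<zeta>) > 0" using elim(6) by simp
      have "1 / (\<Lambda> * c2\<^sup>2) * ?t powi (- 2 * zorder g z) = 1 / (\<Lambda> * (c2 * ?t powi zorder g z)\<^sup>2)"
      proof -
        have "?t powi (- 2 * zorder g z) = inverse ((?t powi zorder g z)\<^sup>2)"
        proof -
          have "?t powi (- 2 * zorder g z) = ?t powi (- (zorder g z + zorder g z))" by simp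
          also have "\<dots> = inverse ((?t powi zorder g z)\<^sup>2)"
            unfolding power_int_minus power2_eq_square using t by (subst power_int_add) auto
          finally show ?thesis .
        qed
        thus ?thesis by (simp add: power_mult_distrib field_simps)
      qed
      also have "\<dots> \<le> 1 / (\<Lambda> * (cmod (g \<zeta>))\<^sup>2)"
        using gle g0 \<Lambda> c(2) tpos[OF elim(7)] by (intro divide_left_mono mult_left_mono power_mono mult_pos_pos zero_less_power) auto
      also have "\<dots> \<le> cmod (f (\<zeta> + 1)) * cmod (f (\<zeta> - 1)) + D * ?t powi (-2)" using elim(1,5) by auto
      also have "cmod (f (\<zeta> + 1)) * cmod (f (\<zeta> - 1)) \<le> (p2 * ?t powi zorder f (z + 1)) * (q2 * ?t powi zorder f (z - 1))"
        using elim(3,4) p(2) t by (intro mult_mono mult_nonneg_nonneg) auto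
      also have "\<dots> = (p2 * q2) * ?t powi (zorder f (z + 1) + zorder f (z - 1))"
        using t by (simp add: power_int_add)
      finally show ?case by simp
    qed
    from powi_comparison[OF this] \<Lambda> c(2) have "zorder f (z + 1) + zorder f (z - 1) \<le> - 2 * zorder g z \<or> - 2 \<le> - 2 * zorder g z"
      by simp
    thus ?thesis using gz m2 by auto
  qed
  \<comment> \<open>With zeros of \<open>g\<close> on both sides the product of the neighbours stays
    bounded, and a double pole is too weak for the order \<open>int d * m > 2\<close> on the
    left.\<close>
  have \<beta>: False if z: "z \<notin> Ex" and fz: "- zorder f z \<ge> m" and gp: "zorder g (z + 1) > 0" "zorder g (z - 1) > 0" for z
  proof -
    obtain \<Lambda> D where \<Lambda>: "\<Lambda> > 0" "D > 0" and ev: "eventually (\<lambda>\<zeta>.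
        (cmod (g \<zeta>) \<le> 1 / \<Lambda> \<longrightarrow> 1 / (\<Lambda> * (cmod (g \<zeta>))\<^sup>2) \<le> cmod (f (\<zeta> + 1)) * cmod (f (\<zeta> - 1)) + D * cmod (\<zeta> - z) powi (-2)) \<and>
        (\<Lambda> \<le> cmod (f \<zeta>) \<longrightarrow> cmod (f \<zeta>) ^ d / \<Lambda> \<le> cmod (f (\<zeta> + 1)) * cmod (f (\<zeta> - 1)) + D * cmod (\<zeta> - z) powi (-2)) \<and>
        cmod (ratfun_eval b1 (\<zeta> + 1)) \<le> \<Lambda> \<and> cmod (ratfun_eval b1 (\<zeta> - 1)) \<le> \<Lambda>) (at z)"
      using local[OF z] by blast
    obtain c1 c2 where c: "0 < c1" "0 < c2" "eventually (\<lambda>\<zeta>. c1 * cmod (\<zeta> - z) powi zorder f z \<le> cmod (f \<zeta>) \<and> cmod (f \<zeta>) \<le> c2 * cmod (\<zeta> - z) powi zorder f z) (at z)"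
      by (rule zorder_asymp[OF nzf])
    have gsmall: "eventually (\<lambda>\<zeta>. cmod (g \<zeta>) < 1) (at w)" if "zorder g w > 0" for w
    proof -
      have "isolated_zero g w" using that
        by (intro zorder_pos_imp_isolated_zero nzm_meromorphic[OF nzg] nzm_eventually_nz[OF nzg])
      hence "g \<midarrow>w\<rightarrow> 0" by (simp add: isolated_zero_def)
      hence "((\<lambda>\<zeta>. cmod (g \<zeta>)) \<longlongrightarrow> 0) (at w)" by (rule tendsto_norm_zero)
      thus ?thesis by (rule order_tendstoD(2)) simp
    qed
    have gs: "eventually (\<lambda>\<zeta>. cmod (g (\<zeta> + 1)) < 1) (at z)" "eventually (\<lambda>\<zeta>. cmod (g (\<zeta> + -1)) < 1) (at z)"
      using eventually_at_shift[of "\<lambda>\<zeta>. cmod (g \<zeta>) < 1" z 1] eventually_at_shift[of "\<lambda>\<zeta>. cmod (g \<zeta>) < 1" z "-1"]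
        gsmall[OF gp(1)] gsmall[OF gp(2)] by auto
    have "is_pole f z" using nzm_zorder_neg_iff[OF nzf, of z] fz m2 by simp
    hence "filterlim (\<lambda>\<zeta>. cmod (f \<zeta>)) at_top (at z)" unfolding is_pole_def by (rule filterlim_at_infinity_imp_norm_at_top)
    hence large: "eventually (\<lambda>\<zeta>. \<Lambda> \<le> cmod (f \<zeta>)) (at z)" by (simp add: filterlim_at_top)
    have "eventually (\<lambda>\<zeta>. c1 ^ d / \<Lambda> * cmod (\<zeta> - z) powi (int d * zorder f z)
        \<le> (1 + \<Lambda>)\<^sup>2 * cmod (\<zeta> - z) powi 0 + D * cmod (\<zeta> - z) powi (-2)) (at z)"
      using ev c(3) gs large eventually_neq_at_within[of z z UNIV]
    proof eventually_elim
      case (elim \<zeta>)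
      let ?t = "cmod (\<zeta> - z)"
      have t: "?t > 0" using elim(6) by simp
      have "c1 ^ d / \<Lambda> * ?t powi (int d * zorder f z) = (c1 * ?t powi zorder f z) ^ d / \<Lambda>"
        by (simp add: power_mult_distrib power_int_mult mult.commute[of "int d"])
      also have "\<dots> \<le> cmod (f \<zeta>) ^ d / \<Lambda>"
        using elim(2) \<Lambda> c(1) t by (intro divide_right_mono power_mono mult_nonneg_nonneg) auto
      also have "\<dots> \<le> cmod (f (\<zeta> + 1)) * cmod (f (\<zeta> - 1)) + D * ?t powi (-2)" using elim(1,5) by auto
      also have "cmod (f (\<zeta> + 1)) * cmod (f (\<zeta> - 1)) \<le> (1 + \<Lambda>) * (1 + \<Lambda>)"
      proof (rule mult_mono)
        show "cmod (f (\<zeta> + 1)) \<le> 1 + \<Lambda>" using elim(1,3) norm_triangle_ineq[of "g (\<zeta> + 1)" "ratfun_eval b1 (\<zeta> + 1)"] by simp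
        show "cmod (f (\<zeta> - 1)) \<le> 1 + \<Lambda>" using elim(1,4) norm_triangle_ineq[of "g (\<zeta> - 1)" "ratfun_eval b1 (\<zeta> - 1)"] by simp
      qed (use \<Lambda> in auto)
      finally show ?case by (simp add: power2_eq_square)
    qed
    from powi_comparison[OF this] \<Lambda> c(1) have "0 \<le> int d * zorder f z \<or> - 2 \<le> int d * zorder f z" by simp
    moreover have "int d * m \<le> int d * (- zorder f z)" using fz by (intro mult_left_mono) auto
    ultimately show False using m2 by simp
  qed
  show ?case
  proof (rule 1(1)[OF fEx])
    fix z assume z: "z \<notin> Ex"
    show "ratfun_eval b1 analytic_on {z}" using z by (intro Z(4)) (simp add: Ex_def)
    show "min (min (zpart g (z - 1)) (zpart g (z + 1))) (ppart m f z) \<le> 0"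
    proof (cases "m \<le> - zorder f z")
      case True
      hence "zorder g (z + 1) \<le> 0 \<or> zorder g (z - 1) \<le> 0" using \<beta>[OF z True] by (meson not_le)
      hence "zpart g (z + 1) = 0 \<or> zpart g (z - 1) = 0" by (auto simp: zpart_def)
      thus ?thesis by auto
    next
      case False
      hence "ppart m f z = 0" by (simp add: ppart_def)
      thus ?thesis by (simp add: min_le_iff_disj)
    qed
    show "4 / 3 * zpart g z \<le> ppart m f (z + 1) + ppart m f (z - 1)"
    proof (cases "zorder g z \<ge> m")
      case False
      hence "zorder g z \<le> 0" using z by (auto simp: Ex_def)
      thus ?thesis using m2 by (simp add: zpart_def ppart_def)
    next
      case True
      define k p q where "k = zorder g z" and "p = - zorder f (z + 1)" and "q = - zorder f (z - 1)"
      have kpq: "2 * k \<le> p + q" using \<alpha>[OF z True] by (simp add: k_def p_def q_def)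
      have km: "m \<le> k" using True by (simp add: k_def)
      \<comment> \<open>A neglected neighbour has order at most m - 1, and since p + q \<ge> 2 k > 2
        (m - 1) at most one is neglected. The loss is thus at most 2 for m = 3, and 2 k - 2 \<ge> 4
        k / 3 for k \<ge> 3; for m = 2 the loss is at most 1. A triple zero next to a double pole
        gives equality and explains the constant 4 / 3.\<close>
      have "4 * k \<le> 3 * ((if m \<le> p then p else 0) + (if m \<le> q then q else 0))"
        using kpq km m2 by auto
      hence "real_of_int (4 * k) \<le> of_int (3 * ((if m \<le> p then p else 0) + (if m \<le> q then q else 0)))"
        by (rule of_int_le_iff[THEN iffD2])
      moreover have "zpart g z = of_int k" using km m2 by (simp add: zpart_def k_def)
      moreover have "ppart m f (z + 1) = of_int (if m \<le> p then p else 0)" "ppart m f (z - 1) = of_int (if m \<le> q then q else 0)"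
        by (simp_all add: ppart_def p_def q_def)
      ultimately show ?thesis by simp
    qed
  qed
qed

end

text \<open>
  A Borel--Cantelli argument: the values of \<open>s\<close> excluded by the zeros and poles near \<open>s + k\<close>
  form finitely many intervals for each \<open>k\<close>, of total length at most \<open>1 / 2\<close>.
\<close>
lemma good_centre:
  fixes Bad :: "complex set"
  assumes f: "nzm f" and V: "growth_bound f 0 (\<lambda>\<rho>. exp (\<rho> / 1000))" and Bad: "Bad sparse_in UNIV"
  obtains s C where "s \<in> {0..1::real}" "C \<ge> 1" "\<And>k::int. complex_of_real (s + of_int k) \<notin> Bad"
    "\<And>k::int. log_plus (cmod (f (complex_of_real (s + of_int k)))) \<le> C * exp (\<bar>of_int k\<bar> / 100)"
    "\<And>(k::int) e. zorder f e \<noteq> 0 \<Longrightarrow> exp (- \<bar>of_int k\<bar> / 100) / C \<le> cmod (e - complex_of_real (s + of_int k))"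
proof -
  \<comment> \<open>\<open>?V n\<close> is the bound at radius \<open>n + 3\<close>, which leaves
    room around \<open>s + n\<close> and \<open>s - n\<close>, whose moduli are at most
    \<open>n + 1\<close>.\<close>
  let ?V = "\<lambda>n::nat. exp ((real n + 3) / 1000)"
  obtain N where N: "\<And>\<rho>. \<rho> \<ge> N \<Longrightarrow> \<exists>R\<in>{\<rho>..\<rho> + 1}. controlled f 0 R (exp (\<rho> / 1000))"
    using V unfolding growth_bound_def eventually_at_top_linorder by blast
  define n0 where "n0 = nat \<lceil>N\<rceil>"
  have "\<exists>R\<in>{real n + 3..real n + 4}. controlled f 0 R (?V n)" if "n \<ge> n0" for n
  proof -
    have "real n + 3 \<ge> N" using that by (simp add: n0_def)
    from N[OF this] show ?thesis by (simp add: add.assoc)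
  qed
  then obtain R where R: "\<And>n. n \<ge> n0 \<Longrightarrow> R n \<in> {real n + 3..real n + 4} \<and> controlled f 0 (R n) (?V n)" by metis
  \<comment> \<open>Distances in the plane are bounded below by distances of real parts, so each
    zero or pole blocks an interval of values of \<open>s\<close>. The translates by
    \<open>n\<close> and by \<open>- n\<close> are handled together.\<close>
  define S where "S = (\<lambda>n. if n < n0 then {} else (\<lambda>e. Re e - real n) ` zpset f 0 (R n) \<union> (\<lambda>e. Re e + real n) ` zpset f 0 (R n))"
  \<comment> \<open>The n-th set has at most \<open>2 * ?V n\<close> points, so these lengths sum to
    at most half of a telescoping series with sum 1.\<close>
  define \<delta> where "\<delta> = (\<lambda>n. 1 / (8 * ?V n * ((real n + 1) * (real n + 2))))"
  \<comment> \<open>The values of \<open>s\<close> for which some translate is irregular form a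
    countable set, because sparse sets are countable.\<close>
  define T where "T = (\<Union>k::int. (\<lambda>e. Re e - of_int k) ` (Bad \<union> irr f))"
  have cT: "countable T" unfolding T_def
    using sparse_imp_countable[OF open_UNIV Bad] sparse_imp_countable[OF open_UNIV irr_sparse[OF f]] by auto
  have fS: "finite (S n)" for n using f by (auto simp: S_def)
  have \<delta>pos: "0 < \<delta> n" for n by (simp add: \<delta>_def)
  have card: "real (card (S n)) * (2 * \<delta> n) \<le> 1 / 2 * (1 / (real n + 1) - 1 / (real n + 2))" for n
  proof -
    have cardle: "real (card (S n)) \<le> 2 * ?V n"
    proof (cases "n < n0")
      case False
      have "card (S n) \<le> card (zpset f 0 (R n)) + card (zpset f 0 (R n))"
        using False f by (simp add: S_def) (intro order_trans[OF card_Un_le] add_mono card_image_le finite_zpset)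
      moreover have "real (card (zpset f 0 (R n))) \<le> ?V n"
        using card_zpset_le_dsum[of f 0 "R n"] R[of n] False by (simp add: controlled_def)
      ultimately show ?thesis by linarith
    qed (simp add: S_def)
    have "real (card (S n)) * (2 * \<delta> n) \<le> 2 * ?V n * (2 * \<delta> n)"
      using \<delta>pos[of n] by (intro mult_right_mono cardle) auto
    also have "\<dots> = 1 / 2 * (1 / ((real n + 1) * (real n + 2)))" by (simp add: \<delta>_def)
    also have "1 / ((real n + 1) * (real n + 2)) = 1 / (real n + 1) - 1 / (real n + 2)" by (simp add: divide_simps)
    finally show ?thesis .
  qed
  have tel: "(\<lambda>n. 1 / 2 * (1 / (real n + 1) - 1 / (real n + 2))) sums (1 / 2 * 1)"
  proof (rule sums_mult)
    have "(\<lambda>n. 1 / (real n + 1)) \<longlonglongrightarrow> 0" by real_asymp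
    from telescope_sums'[OF this] show "(\<lambda>n. 1 / (real n + 1) - 1 / (real n + 2)) sums 1" by (simp add: add.commute)
  qed
  have summ: "summable (\<lambda>n. real (card (S n)) * (2 * \<delta> n))"
  proof (rule summable_comparison_test'[OF sums_summable[OF tel], of 0])
    fix n
    have "0 \<le> real (card (S n)) * (2 * \<delta> n)" using \<delta>pos[of n] by simp
    thus "norm (real (card (S n)) * (2 * \<delta> n)) \<le> 1 / 2 * (1 / (real n + 1) - 1 / (real n + 2))"
      using card[of n] by (simp only: real_norm_def abs_of_nonneg)
  qed
  define q where "q = (\<Sum>n. real (card (S n)) * (2 * \<delta> n))"
  have "q \<le> 1 / 2 * 1" unfolding q_def sums_unique[OF tel]
    by (intro suminf_le card summ sums_summable[OF tel])
  hence q1: "q < 1" by simp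
  have qs: "(\<lambda>n. real (card (S n)) * (2 * \<delta> n)) sums q" unfolding q_def using summ by (rule summable_sums)
  obtain s where s: "s \<in> {0..0 + 1}" "s \<notin> T" "\<And>n x. x \<in> S n \<Longrightarrow> \<delta> n \<le> \<bar>s - x\<bar>"
    by (rule avoid_intervals[OF fS less_imp_le[OF \<delta>pos] qs q1 cT, of 0]) (rule that; assumption)
  let ?c = "\<lambda>k::int. complex_of_real (s + of_int k)"
  have notbad: "?c k \<notin> Bad \<union> irr f" for k
  proof
    assume "?c k \<in> Bad \<union> irr f"
    hence "Re (?c k) - of_int k \<in> T" unfolding T_def by blast
    thus False using s(2) by simp
  qed
  have ck: "cmod (?c k) \<le> \<bar>of_int k\<bar> + 1" for k using s(1) unfolding norm_of_real by auto
  have d1: "\<delta> n \<le> 1" for n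
  proof -
    have V1: "1 \<le> 8 * ?V n" using one_le_exp_iff[of "(real n + 3) / 1000"] by (simp del: one_le_exp_iff)
    have "1 * 1 \<le> (real n + 1) * (real n + 2)" by (intro mult_mono) auto
    hence "1 * 1 \<le> (8 * ?V n) * ((real n + 1) * (real n + 2))" by (intro mult_mono V1) auto
    thus ?thesis by (simp add: \<delta>_def)
  qed
  have far: "\<delta> (nat \<bar>k\<bar>) \<le> cmod (e - ?c k)" if "zorder f e \<noteq> 0" "nat \<bar>k\<bar> \<ge> n0" for k e
  proof (cases "e \<in> zpset f 0 (R (nat \<bar>k\<bar>))")
    case True
    have "Re e - of_int k \<in> S (nat \<bar>k\<bar>)"
      using True that by (cases "k \<ge> 0") (auto simp: S_def)
    from s(3)[OF this] have "\<delta> (nat \<bar>k\<bar>) \<le> \<bar>Re (e - ?c k)\<bar>" by (simp add: algebra_simps)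
    thus ?thesis using abs_Re_le_cmod[of "e - ?c k"] by linarith
  next
    case False
    have "cmod e \<ge> R (nat \<bar>k\<bar>)" using False that by (simp add: zpset_def)
    hence "cmod e \<ge> \<bar>of_int k\<bar> + 3" using R[OF that(2)] by simp
    hence "1 \<le> cmod (e - ?c k)" using ck[of k] norm_triangle_ineq2[of e "?c k"] by linarith
    thus ?thesis using d1[of "nat \<bar>k\<bar>"] by linarith
  qed
  have near: "log_plus (cmod (f (?c k))) \<le> 47 * (real (nat \<bar>k\<bar>) + 4) ^ 3 * ?V (nat \<bar>k\<bar>) / \<delta> (nat \<bar>k\<bar>)"
    if n: "nat \<bar>k\<bar> \<ge> n0" for k
  proof -
    let ?n = "nat \<bar>k\<bar>"
    have R2: "2 \<le> R ?n"
    proof -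
      have "real ?n + 3 \<le> R ?n" using R[OF n] by simp
      moreover have "0 \<le> real ?n" by (rule of_nat_0_le_iff)
      ultimately show ?thesis by linarith
    qed
    have "\<bar>ln (cmod (f (?c k)))\<bar> \<le> 47 * R ?n ^ 3 * ?V ?n / \<delta> ?n"
    proof (rule controlled_pointwise(1)[OF f])
      show "\<delta> ?n \<le> cmod (?c k - e)" if "e \<in> zpset f 0 (R ?n)" for e
        using far[of e k] that n by (simp add: zpset_def norm_minus_commute)
    qed (use R2 R[OF n] \<delta>pos[of ?n] d1[of ?n] notbad[of k] ck[of k] in auto)
    also have "\<dots> \<le> 47 * (real ?n + 4) ^ 3 * ?V ?n / \<delta> ?n"
      using R2 R[OF n] \<delta>pos[of ?n] by (intro divide_right_mono mult_right_mono mult_left_mono power_mono) auto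
    finally show ?thesis using log_plus_le_abs_ln[of "cmod (f (?c k))"] by simp
  qed
  \<comment> \<open>Up to polynomial factors the left side is the square of \<open>?V n\<close>, of
    rate 2 / 1000, well below the rate 1 / 100 allowed at the centres.\<close>
  have "eventually (\<lambda>n. 47 * (real n + 4) ^ 3 * ?V n / \<delta> n \<le> exp (real n / 100)) at_top"
    unfolding \<delta>_def by real_asymp
  moreover have "eventually (\<lambda>n. exp (- (real n / 100)) \<le> \<delta> n) at_top"
    unfolding \<delta>_def by real_asymp
  ultimately have "eventually (\<lambda>n. 47 * (real n + 4) ^ 3 * ?V n / \<delta> n \<le> exp (real n / 100) \<and> exp (- (real n / 100)) \<le> \<delta> n) at_top"
    by eventually_elim simp
  then obtain n1 where n1: "\<And>n. n \<ge> n1 \<Longrightarrow> 47 * (real n + 4) ^ 3 * ?V n / \<delta> n \<le> exp (real n / 100)"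
    "\<And>n. n \<ge> n1 \<Longrightarrow> exp (- (real n / 100)) \<le> \<delta> n"
    unfolding eventually_at_top_linorder by blast
  define M where "M = max n0 n1"
  define K where "K = {- int M..int M}"
  have fK: "finite K" by (simp add: K_def)
  have "\<exists>\<eta>>0. \<forall>e. zorder f e \<noteq> 0 \<longrightarrow> \<eta> \<le> cmod (e - ?c k)" for k
  proof -
    obtain \<eta> where "0 < \<eta>" "\<And>e. e \<in> irr f \<Longrightarrow> e \<noteq> ?c k \<Longrightarrow> \<eta> \<le> cmod (e - ?c k)"
      by (rule irr_dist_lower[OF f, where c = "?c k"]) (rule that; blast)
    thus ?thesis using notbad[of k] zorder_not_irr[of _ f] by (metis UnCI)
  qed
  then obtain \<eta> where \<eta>: "\<And>k. \<eta> k > 0" "\<And>k e. zorder f e \<noteq> 0 \<Longrightarrow> \<eta> k \<le> cmod (e - ?c k)" by metis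
  \<comment> \<open>The asymptotic bounds cover all but finitely many \<open>k\<close>; the
    remaining centres are regular points and only enlarge the constant.\<close>
  define C where "C = 1 + (\<Sum>k\<in>K. log_plus (cmod (f (?c k)))) + (\<Sum>k\<in>K. 1 / \<eta> k)"
  have nn: "(\<Sum>k\<in>K. log_plus (cmod (f (?c k)))) \<ge> 0" "(\<Sum>k\<in>K. 1 / \<eta> k) \<ge> 0"
    by (intro sum_nonneg divide_nonneg_nonneg less_imp_le[OF \<eta>(1)] log_plus_nonneg; simp)+
  have C1: "C \<ge> 1" using nn by (simp add: C_def)
  show ?thesis
  proof (rule that[of s C])
    show "s \<in> {0..1}" using s(1) by simp
    show "C \<ge> 1" by (rule C1)
    fix k :: int
    show "?c k \<notin> Bad" using notbad by blast
    have n: "real (nat \<bar>k\<bar>) = \<bar>of_int k\<bar>" by simp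
    have e1: "1 \<le> exp (\<bar>real_of_int k\<bar> / 100)" by simp
    show "log_plus (cmod (f (?c k))) \<le> C * exp (\<bar>of_int k\<bar> / 100)"
    proof (cases "k \<in> K")
      case True
      have "log_plus (cmod (f (?c k))) \<le> (\<Sum>k\<in>K. log_plus (cmod (f (?c k))))"
        using fK True by (intro member_le_sum) auto
      also have "\<dots> \<le> C * 1" using nn by (simp add: C_def)
      also have "\<dots> \<le> C * exp (\<bar>of_int k\<bar> / 100)" using C1 e1 by (intro mult_left_mono) auto
      finally show ?thesis .
    next
      case False
      hence kM: "nat \<bar>k\<bar> \<ge> n0" "nat \<bar>k\<bar> \<ge> n1" by (auto simp: K_def M_def)
      have "log_plus (cmod (f (?c k))) \<le> 1 * exp (\<bar>of_int k\<bar> / 100)"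
        using near[OF kM(1)] n1(1)[OF kM(2)] by simp
      also have "\<dots> \<le> C * exp (\<bar>of_int k\<bar> / 100)" using C1 by (intro mult_right_mono) auto
      finally show ?thesis .
    qed
    fix e assume e: "zorder f e \<noteq> 0"
    show "exp (- \<bar>of_int k\<bar> / 100) / C \<le> cmod (e - ?c k)"
    proof (cases "k \<in> K")
      case True
      have "1 / \<eta> k \<le> (\<Sum>k\<in>K. 1 / \<eta> k)" using fK True \<eta>(1) by (intro member_le_sum) (auto intro: less_imp_le)
      also have "\<dots> \<le> C" using nn by (simp add: C_def)
      finally have "1 / C \<le> \<eta> k" using C1 \<eta>(1)[of k] by (simp add: field_simps)
      moreover have "exp (- \<bar>of_int k\<bar> / 100) / C \<le> 1 / C" using C1 by (intro divide_right_mono) auto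
      ultimately show ?thesis using \<eta>(2)[OF e, of k] by linarith
    next
      case False
      hence kM: "nat \<bar>k\<bar> \<ge> n0" "nat \<bar>k\<bar> \<ge> n1" by (auto simp: K_def M_def)
      have "exp (- \<bar>of_int k\<bar> / 100) / C \<le> exp (- \<bar>of_int k\<bar> / 100) / 1"
        using C1 by (intro divide_left_mono) auto
      also have "\<dots> \<le> \<delta> (nat \<bar>k\<bar>)" using n1(2)[OF kM(2)] by simp
      also have "\<dots> \<le> cmod (e - ?c k)" by (rule far[OF e kM(1)])
      finally show ?thesis .
    qed
  qed
qed

section \<open>Characteristics of translated discs and their weighted sum\<close>

definition nev_char_at :: "(complex \<Rightarrow> complex) \<Rightarrow> complex \<Rightarrow> real \<Rightarrow> real" where
  "nev_char_at h c r = cmean c r (\<lambda>z. log_plus (cmod (h z))) + Npole h c r"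

lemma ln_ratio_nonneg: "a \<in> ball c r \<Longrightarrow> 0 \<le> ln (r / cmod (a - c))"
  by (cases "a = c") (auto simp: dist_norm norm_minus_commute)

lemma Npole_nonneg: "Npole h c r \<ge> 0" and Nzero_nonneg: "Nzero h c r \<ge> 0"
  unfolding Npole_def Nzero_def
  by (intro sum_nonneg mult_nonneg_nonneg ln_ratio_nonneg; simp add: zpset_def)+

lemma nev_char_at_nonneg:
  assumes "irr h \<inter> sphere c r = {}" "0 \<le> r" shows "nev_char_at h c r \<ge> 0"
  unfolding nev_char_at_def using assms
  by (intro add_nonneg_nonneg Npole_nonneg cmean_nonneg continuous_on_log_plus continuous_on_norm continuous_on_sphere_regular) auto

text \<open>Moves a counting function to the disc about 0, so that the sums for all the centres run
  over one set \<open>W\<close> and may be exchanged with the sum over the translates.\<close>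

lemma sum_shifted_ball:
  fixes \<phi> :: "complex \<Rightarrow> real"
  assumes "finite W" "W \<subseteq> ball 0 r" "A \<subseteq> ball c r" "(\<lambda>a. a - c) ` A \<subseteq> W" "\<And>a. a \<in> ball c r \<Longrightarrow> a \<notin> A \<Longrightarrow> \<phi> a = 0"
  shows "(\<Sum>z\<in>W. \<phi> (c + z) * ln (r / cmod z)) = (\<Sum>a\<in>A. \<phi> a * ln (r / cmod (a - c)))"
proof -
  have "(\<Sum>z\<in>W. \<phi> (c + z) * ln (r / cmod z)) = (\<Sum>z\<in>(\<lambda>a. a - c) ` A. \<phi> (c + z) * ln (r / cmod z))"
  proof (rule sum.mono_neutral_right[OF assms(1,4)], rule ballI)
    fix z assume z: "z \<in> W - (\<lambda>a. a - c) ` A"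
    have "c + z \<in> ball c r" using z assms(2) by (auto simp: dist_norm)
    moreover have "c + z \<notin> A"
    proof
      assume "c + z \<in> A"
      hence "(c + z) - c \<in> (\<lambda>a. a - c) ` A" by blast
      thus False using z by simp
    qed
    ultimately show "\<phi> (c + z) * ln (r / cmod z) = 0" using assms(5) by simp
  qed
  also have "\<dots> = (\<Sum>a\<in>A. \<phi> a * ln (r / cmod (a - c)))"
    by (subst sum.reindex) (auto simp: inj_on_def)
  finally show ?thesis .
qed

context delay_equation
begin

text \<open>The two functions differ by \<open>b1\<close>, which is bounded near \<open>z\<close>
  and cannot contribute to a pole.\<close>

lemma pole_order_f_le_g:
  assumes "ratfun_eval b1 analytic_on {z}"
  shows "max 0 (- zorder f z) \<le> max 0 (- zorder g z)"
proof (cases "zorder f z < 0")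
  case True
  obtain c1 c2 where c: "0 < c1" "0 < c2" "eventually (\<lambda>\<zeta>. c1 * cmod (\<zeta> - z) powi zorder f z \<le> cmod (f \<zeta>) \<and> cmod (f \<zeta>) \<le> c2 * cmod (\<zeta> - z) powi zorder f z) (at z)"
    by (rule zorder_asymp[OF nzf])
  obtain p1 p2 where p: "0 < p1" "0 < p2" "eventually (\<lambda>\<zeta>. p1 * cmod (\<zeta> - z) powi zorder g z \<le> cmod (g \<zeta>) \<and> cmod (g \<zeta>) \<le> p2 * cmod (\<zeta> - z) powi zorder g z) (at z)"
    by (rule zorder_asymp[OF nzg])
  define B where "B = cmod (ratfun_eval b1 z) + 1"
  have "isCont (ratfun_eval b1) z" using assms by (rule analytic_at_imp_isCont)
  hence "((\<lambda>\<zeta>. cmod (ratfun_eval b1 \<zeta>)) \<longlongrightarrow> cmod (ratfun_eval b1 z)) (at z)" by (intro tendsto_norm) (simp add: isCont_def)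
  hence "eventually (\<lambda>\<zeta>. cmod (ratfun_eval b1 \<zeta>) < B) (at z)" by (rule order_tendstoD(2)) (simp add: B_def)
  with c(3) p(3) have "eventually (\<lambda>\<zeta>. c1 * cmod (\<zeta> - z) powi zorder f z \<le> p2 * cmod (\<zeta> - z) powi zorder g z + B * cmod (\<zeta> - z) powi 0) (at z)"
  proof eventually_elim
    case (elim \<zeta>)
    thus ?case using norm_triangle_ineq[of "g \<zeta>" "ratfun_eval b1 \<zeta>"] by simp
  qed
  from powi_comparison[OF this c(1)] True show ?thesis by auto
qed auto

text \<open>\<open>A\<close> and \<open>B\<close> apply \<open>neighbour_sum_inequality\<close> to
  the proximity and counting functions; \<open>C\<close> passes from the reciprocal of
  \<open>g\<close> back to \<open>f\<close>. Only the two terms with k = K + 1 and k = - K - 1 occur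
  on the right without a counterpart on the left, and these survive as end terms.\<close>

lemma main_inequality:
  fixes s r E \<eta> M :: real and K :: nat and D :: "int \<Rightarrow> real" and c :: "int \<Rightarrow> complex"
  assumes Exc: "finite Exc"
    "\<And>z. z \<notin> Exc \<Longrightarrow> 4 / 3 * zpart g z \<le> ppart m f (z + 1) + ppart m f (z - 1)"
    "\<And>z. z \<notin> Exc \<Longrightarrow> min (min (zpart g (z - 1)) (zpart g (z + 1))) (ppart m f z) \<le> 0"
    "\<And>z. z \<notin> Exc \<Longrightarrow> ratfun_eval b1 analytic_on {z}"
    and c_def: "c = (\<lambda>k. complex_of_real (s + of_int k))"
    and M_def: "M = (\<Sum>e\<in>Exc. 2 * zpart g e + 2 * \<bar>of_int (zorder f e)\<bar>)"
    and r: "r \<ge> 1"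
    and clean: "\<And>k. \<bar>k\<bar> \<le> int (Suc K) \<Longrightarrow> irr f \<inter> sphere (c k) r = {}" "\<And>k. \<bar>k\<bar> \<le> int (Suc K) \<Longrightarrow> irr g \<inter> sphere (c k) r = {}"
    and centre: "\<And>k. c k \<notin> irr g"
    and arch: "\<And>k z. \<bar>k\<bar> \<le> int K \<Longrightarrow> z \<in> sphere (c k) r \<Longrightarrow>
        4 / 3 * log_plus (inverse (cmod (g z))) \<le> log_plus (cmod (f (z + 1))) + log_plus (cmod (f (z - 1))) + E"
      "\<And>k z. \<bar>k\<bar> \<le> int K \<Longrightarrow> z \<in> sphere (c k) r \<Longrightarrow>
        min (min (log_plus (inverse (cmod (g (z - 1))))) (log_plus (inverse (cmod (g (z + 1)))))) (log_plus (cmod (f z))) \<le> E"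
    and E: "0 \<le> E" "\<And>k z. \<bar>k\<bar> \<le> int K \<Longrightarrow> z \<in> sphere (c k) r \<Longrightarrow> log_plus (cmod (ratfun_eval b1 z)) + ln 2 \<le> E"
    and \<eta>: "0 < \<eta>" "\<eta> \<le> 1" "\<And>e k. e \<in> Exc \<Longrightarrow> \<eta> \<le> cmod (e - c k)"
    and D: "\<And>k. log_plus (cmod (g (c k))) \<le> D k"
  shows "nev_char_at f (c 0) r \<le> 15 * (wt (int (Suc K)) * (nev_char_at f (c (int (Suc K))) r + nev_char_at f (c (- int (Suc K))) r))
     + 1008 * (E + M * ln (r / \<eta>)) + 16 * (\<Sum>k\<in>{- int K..int K}. wt k * D k)"
proof -
  define I J where "I = {- int K..int K}" and "J = {- int (Suc K)..int (Suc K)}"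
  have fin: "finite I" "finite J" by (simp_all add: I_def J_def)
  have IJ: "I \<subseteq> J" by (auto simp: I_def J_def)
  have Jk: "\<bar>k\<bar> \<le> int (Suc K)" if "k \<in> J" for k using that by (auto simp: J_def)
  have Ik: "\<bar>k\<bar> \<le> int K" if "k \<in> I" for k using that by (auto simp: I_def)
  have wI: "(\<Sum>k\<in>I. wt k) \<le> 9" "(\<Sum>k\<in>J. wt k) \<le> 9" unfolding I_def J_def by (rule sum_wt_le)+
  define L where "L = ln (r / \<eta>)"
  have L0: "L \<ge> 0" unfolding L_def using r \<eta> by (intro ln_ge_zero) (simp add: le_divide_eq)
  have c1: "c k + z + 1 = c (k + 1) + z" "c k + z - 1 = c (k - 1) + z" for k z by (simp_all add: c_def)
  define Yl Xl where "Yl = (\<lambda>z. log_plus (inverse (cmod (g z))))" and "Xl = (\<lambda>z. log_plus (cmod (f z)))"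
  have coX: "continuous_on (sphere (c k) r) Xl" if "k \<in> J" for k
    unfolding Xl_def using clean(1)[OF Jk[OF that]]
    by (intro continuous_on_log_plus continuous_on_norm continuous_on_sphere_regular) auto
  have g0: "g z \<noteq> 0" if "k \<in> J" "z \<in> sphere (c k) r" for k z
    using clean(2)[OF Jk[OF that(1)]] that(2) by (auto simp: irr_def)
  have cog: "continuous_on (sphere (c k) r) g" if "k \<in> J" for k
    using clean(2)[OF Jk[OF that]] by (rule continuous_on_sphere_regular)
  have coY: "continuous_on (sphere (c k) r) Yl" if "k \<in> J" for k
    unfolding Yl_def using g0[OF that] by (intro continuous_on_log_plus continuous_on_inverse continuous_on_norm cog that) auto
  have sh: "continuous_on (sphere 0 r) (\<lambda>z. u (c k + z))" if "continuous_on (sphere (c k) r) u" for u :: "complex \<Rightarrow> real" and k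
    by (rule continuous_on_compose2[OF that]) (auto intro!: continuous_intros simp: dist_norm)
  have cms: "cmean 0 r (\<lambda>z. u (c k + z)) = cmean (c k) r u" for u :: "complex \<Rightarrow> real" and k
    by (rule cmean_cong') simp

  \<comment> \<open>All the circles are translates of one circle about 0, so the inequality holds at
    each of its points and can be averaged. The constant 72 is 8 times the bound 9 for the sum of
    the weights.\<close>
  have A: "4 / 3 * (\<Sum>k\<in>I. wt k * cmean (c k) r Yl) \<le> 5 / 4 * (\<Sum>k\<in>J. wt k * cmean (c k) r Xl) + 72 * E"
  proof -
    have pw: "4 / 3 * (\<Sum>k\<in>I. wt k * Yl (c k + z)) \<le> 5 / 4 * (\<Sum>k\<in>J. wt k * Xl (c k + z)) + 72 * E"
      if z: "z \<in> sphere 0 r" for z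
    proof -
      have zs: "c k + z \<in> sphere (c k) r" for k using z by (simp add: dist_norm)
      have "4 / 3 * (\<Sum>k\<in>I. wt k * Yl (c k + z)) \<le> 5 / 4 * (\<Sum>k\<in>J. wt k * Xl (c k + z)) + 8 * (\<Sum>k\<in>J. wt k * E)"
        unfolding I_def J_def
      proof (rule neighbour_sum_inequality)
        fix k assume k: "\<bar>k\<bar> \<le> int K"
        show "4 / 3 * Yl (c k + z) \<le> Xl (c (k + 1) + z) + Xl (c (k - 1) + z) + E"
          using arch(1)[OF k zs] unfolding c1 Xl_def Yl_def .
        show "min (min (Yl (c (k - 1) + z)) (Yl (c (k + 1) + z))) (Xl (c k + z)) \<le> E"
          using arch(2)[OF k zs] unfolding c1 Xl_def Yl_def .
      qed (auto simp: Xl_def Yl_def E)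
      also have "(\<Sum>k\<in>J. wt k * E) = (\<Sum>k\<in>J. wt k) * E" by (rule sum_distrib_right[symmetric])
      also have "\<dots> \<le> 9 * E" using wI E by (intro mult_right_mono) auto
      finally show ?thesis by simp
    qed
    have co1: "continuous_on (sphere 0 r) (\<lambda>z. wt k * Yl (c k + z))" if "k \<in> I" for k
      using IJ that by (intro continuous_on_mult_left sh coY) auto
    have co2: "continuous_on (sphere 0 r) (\<lambda>z. wt k * Xl (c k + z))" if "k \<in> J" for k
      using that by (intro continuous_on_mult_left sh coX) auto
    have s1: "cmean 0 r (\<lambda>z. \<Sum>k\<in>I. wt k * Yl (c k + z)) = (\<Sum>k\<in>I. wt k * cmean (c k) r Yl)"
      using fin r co1 by (subst cmean_sum) (auto simp: cmean_cmult cms)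
    have s2: "cmean 0 r (\<lambda>z. \<Sum>k\<in>J. wt k * Xl (c k + z)) = (\<Sum>k\<in>J. wt k * cmean (c k) r Xl)"
      using fin r co2 by (subst cmean_sum) (auto simp: cmean_cmult cms)
    have coS: "continuous_on (sphere 0 r) (\<lambda>z. \<Sum>k\<in>I. wt k * Yl (c k + z))" "continuous_on (sphere 0 r) (\<lambda>z. \<Sum>k\<in>J. wt k * Xl (c k + z))"
      using co1 co2 by (auto intro!: continuous_on_sum)
    have "cmean 0 r (\<lambda>z. 4 / 3 * (\<Sum>k\<in>I. wt k * Yl (c k + z))) \<le> cmean 0 r (\<lambda>z. 5 / 4 * (\<Sum>k\<in>J. wt k * Xl (c k + z)) + 72 * E)"
      using r coS by (intro cmean_mono pw continuous_on_add continuous_on_mult_left continuous_on_const) auto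
    also have "\<dots> = cmean 0 r (\<lambda>z. 5 / 4 * (\<Sum>k\<in>J. wt k * Xl (c k + z))) + 72 * E"
      using cmean_add[OF continuous_on_mult_left[OF coS(2)] continuous_on_const] r by (simp only: cmean_const)
    finally show ?thesis unfolding cmean_cmult s1 s2 .
  qed

  have M0: "M \<ge> 0" unfolding M_def by (intro sum_nonneg) (simp add: zpart_def)
  \<comment> \<open>The exceptional points keep the distance \<open>\<eta>\<close> from every
    centre, so their share of a counting function grows only like a logarithm.\<close>
  have MExc: "(\<Sum>e\<in>Exc \<inter> ball (c k) r. \<phi> e * ln (r / cmod (e - c k))) \<le> M * L"
    if "\<And>e. 0 \<le> \<phi> e" "\<And>e. \<phi> e \<le> 2 * zpart g e + 2 * \<bar>of_int (zorder f e)\<bar>" for \<phi> k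
  proof -
    have "(\<Sum>e\<in>Exc \<inter> ball (c k) r. \<phi> e * ln (r / cmod (e - c k))) \<le> (\<Sum>e\<in>Exc \<inter> ball (c k) r. (2 * zpart g e + 2 * \<bar>of_int (zorder f e)\<bar>) * L)"
    proof (intro sum_mono mult_mono that)
      fix e assume e: "e \<in> Exc \<inter> ball (c k) r"
      have "\<eta> \<le> cmod (e - c k)" using e by (intro \<eta>) auto
      thus "ln (r / cmod (e - c k)) \<le> L" unfolding L_def using \<eta>(1) r
        by (intro ln_mono divide_left_mono divide_pos_pos mult_pos_pos) auto
      show "0 \<le> ln (r / cmod (e - c k))" using e by (intro ln_ratio_nonneg) auto
      show "0 \<le> 2 * zpart g e + 2 * \<bar>of_int (zorder f e)\<bar>" by (simp add: zpart_def)
    qed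
    also have "\<dots> \<le> (\<Sum>e\<in>Exc. (2 * zpart g e + 2 * \<bar>of_int (zorder f e)\<bar>) * L)"
      using Exc(1) L0 by (intro sum_mono2) (auto simp: zpart_def)
    also have "\<dots> = M * L" by (simp add: M_def sum_distrib_right)
    finally show ?thesis .
  qed

  have B: "4 / 3 * (\<Sum>k\<in>I. wt k * Nzero g (c k) r) \<le> 5 / 4 * (\<Sum>k\<in>J. wt k * Npole f (c k) r) + 72 * (M * L)"
  proof -
    \<comment> \<open>At the finitely many exceptional points the inequalities between
      multiplicities may fail; there the multiplicities themselves are entered as the error.\<close>
    define err where "err = (\<lambda>w. if w \<in> Exc then 2 * zpart g w + ppart m f w else 0)"
    have z0: "zpart g w \<ge> 0" "ppart m f w \<ge> 0" "err w \<ge> 0" for w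
      using dm by (auto simp: zpart_def ppart_def err_def)
    define A where "A = (\<lambda>k. zpset g (c k) r \<union> zpset f (c k) r \<union> (Exc \<inter> ball (c k) r))"
    have fA: "finite (A k)" for k using nzf nzg Exc(1) by (auto simp: A_def)
    define W where "W = (\<Union>k\<in>J. (\<lambda>a. a - c k) ` A k)"
    have fW: "finite W" unfolding W_def using fin fA by auto
    have Ab: "A k \<subseteq> ball (c k) r" for k by (auto simp: A_def zpset_def)
    have Wb: "W \<subseteq> ball 0 r"
    proof
      fix z assume "z \<in> W"
      then obtain k a where "a \<in> A k" "z = a - c k" by (auto simp: W_def)
      thus "z \<in> ball 0 r" using Ab[of k] by (auto simp: dist_norm norm_minus_commute)
    qed
    have AW: "(\<lambda>a. a - c k) ` A k \<subseteq> W" if "k \<in> J" for k using that by (auto simp: W_def)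
    have pw: "4 / 3 * (\<Sum>k\<in>I. wt k * zpart g (c k + z)) \<le> 5 / 4 * (\<Sum>k\<in>J. wt k * ppart m f (c k + z)) + 8 * (\<Sum>k\<in>J. wt k * err (c k + z))" for z
      unfolding I_def J_def
    proof (rule neighbour_sum_inequality)
      fix k :: int
      show "4 / 3 * zpart g (c k + z) \<le> ppart m f (c (k + 1) + z) + ppart m f (c (k - 1) + z) + err (c k + z)"
        using Exc(2)[of "c k + z"] z0[of "c k + z"] z0(2)[of "c (k + 1) + z"] z0(2)[of "c (k - 1) + z"]
        by (cases "c k + z \<in> Exc") (simp_all add: c1 err_def)
      show "min (min (zpart g (c (k - 1) + z)) (zpart g (c (k + 1) + z))) (ppart m f (c k + z)) \<le> err (c k + z)"
        using Exc(3)[of "c k + z"] z0[of "c k + z"]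
        by (cases "c k + z \<in> Exc") (simp_all add: c1 err_def min_le_iff_disj)
    qed (rule z0)+
    have ln0: "0 \<le> ln (r / cmod z)" if "z \<in> W" for z using ln_ratio_nonneg[of z 0 r] that Wb by auto
    have swap: "(\<Sum>z\<in>W. (\<Sum>k\<in>I'. wt k * \<phi> (c k + z)) * ln (r / cmod z)) = (\<Sum>k\<in>I'. wt k * (\<Sum>a\<in>A k. \<phi> a * ln (r / cmod (a - c k))))"
      if "I' \<subseteq> J" "\<And>a k. a \<in> ball (c k) r \<Longrightarrow> a \<notin> A k \<Longrightarrow> \<phi> a = 0" for I' and \<phi> :: "complex \<Rightarrow> real"
    proof -
      have "(\<Sum>z\<in>W. (\<Sum>k\<in>I'. wt k * \<phi> (c k + z)) * ln (r / cmod z)) = (\<Sum>z\<in>W. \<Sum>k\<in>I'. wt k * (\<phi> (c k + z) * ln (r / cmod z)))"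
        by (simp only: sum_distrib_right mult.assoc)
      also have "\<dots> = (\<Sum>k\<in>I'. \<Sum>z\<in>W. wt k * (\<phi> (c k + z) * ln (r / cmod z)))" by (rule sum.swap)
      also have "\<dots> = (\<Sum>k\<in>I'. wt k * (\<Sum>z\<in>W. \<phi> (c k + z) * ln (r / cmod z)))" by (simp only: sum_distrib_left)
      also have "\<dots> = (\<Sum>k\<in>I'. wt k * (\<Sum>a\<in>A k. \<phi> a * ln (r / cmod (a - c k))))"
      proof (rule sum.cong[OF refl])
        fix k assume "k \<in> I'"
        hence "k \<in> J" using that(1) by auto
        have "(\<Sum>z\<in>W. \<phi> (c k + z) * ln (r / cmod z)) = (\<Sum>a\<in>A k. \<phi> a * ln (r / cmod (a - c k)))"
          by (rule sum_shifted_ball[OF fW Wb Ab AW[OF \<open>k \<in> J\<close>]]) (rule that(2); assumption)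
        thus "wt k * (\<Sum>z\<in>W. \<phi> (c k + z) * ln (r / cmod z)) = wt k * (\<Sum>a\<in>A k. \<phi> a * ln (r / cmod (a - c k)))"
          by (simp only:)
      qed
      finally show ?thesis .
    qed
    have sz: "(\<Sum>a\<in>A k. zpart g a * ln (r / cmod (a - c k))) = Nzero g (c k) r" for k
      unfolding Nzero_def zpart_def[symmetric] using fA Ab[of k]
      by (intro sum.mono_neutral_right) (auto simp: A_def zpart_def zpset_def)
    have sp: "(\<Sum>a\<in>A k. ppart m f a * ln (r / cmod (a - c k))) \<le> Npole f (c k) r" for k
    proof -
      have "(\<Sum>a\<in>A k. ppart m f a * ln (r / cmod (a - c k))) \<le> (\<Sum>a\<in>A k. of_int (max 0 (- zorder f a)) * ln (r / cmod (a - c k)))"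
        using Ab[of k] dm by (intro sum_mono mult_right_mono ln_ratio_nonneg) (auto simp: ppart_def)
      also have "\<dots> = Npole f (c k) r"
        unfolding Npole_def using fA Ab[of k] by (intro sum.mono_neutral_right) (auto simp: A_def zpset_def)
      finally show ?thesis .
    qed
    have se: "(\<Sum>a\<in>A k. err a * ln (r / cmod (a - c k))) \<le> M * L" for k
    proof -
      have "(\<Sum>a\<in>A k. err a * ln (r / cmod (a - c k))) = (\<Sum>a\<in>Exc \<inter> ball (c k) r. err a * ln (r / cmod (a - c k)))"
        using fA Ab[of k] by (intro sum.mono_neutral_right) (auto simp: A_def err_def)
      also have "\<dots> \<le> M * L" using z0 by (intro MExc) (auto simp: err_def ppart_def zpart_def)
      finally show ?thesis .
    qed
    have "(\<Sum>z\<in>W. (4 / 3 * (\<Sum>k\<in>I. wt k * zpart g (c k + z))) * ln (r / cmod z))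
      \<le> (\<Sum>z\<in>W. (5 / 4 * (\<Sum>k\<in>J. wt k * ppart m f (c k + z)) + 8 * (\<Sum>k\<in>J. wt k * err (c k + z))) * ln (r / cmod z))"
      by (intro sum_mono mult_right_mono pw ln0)
    also have "\<dots> = 5 / 4 * (\<Sum>z\<in>W. (\<Sum>k\<in>J. wt k * ppart m f (c k + z)) * ln (r / cmod z))
       + 8 * (\<Sum>z\<in>W. (\<Sum>k\<in>J. wt k * err (c k + z)) * ln (r / cmod z))"
      by (simp only: distrib_right sum.distrib mult.assoc sum_distrib_left[symmetric])
    also have "(\<Sum>z\<in>W. (\<Sum>k\<in>J. wt k * ppart m f (c k + z)) * ln (r / cmod z)) = (\<Sum>k\<in>J. wt k * (\<Sum>a\<in>A k. ppart m f a * ln (r / cmod (a - c k))))"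
      using dm by (intro swap) (auto simp: A_def zpset_def ppart_def)
    also have "\<dots> \<le> (\<Sum>k\<in>J. wt k * Npole f (c k) r)" by (intro sum_mono mult_left_mono sp) auto
    also have "(\<Sum>z\<in>W. (\<Sum>k\<in>J. wt k * err (c k + z)) * ln (r / cmod z)) = (\<Sum>k\<in>J. wt k * (\<Sum>a\<in>A k. err a * ln (r / cmod (a - c k))))"
      by (intro swap) (auto simp: A_def err_def)
    also have "\<dots> \<le> (\<Sum>k\<in>J. wt k * (M * L))" by (intro sum_mono mult_left_mono se) auto
    also have "\<dots> = (\<Sum>k\<in>J. wt k) * (M * L)" by (rule sum_distrib_right[symmetric])
    also have "\<dots> \<le> 9 * (M * L)" using wI M0 L0 by (intro mult_right_mono) auto
    also have "(\<Sum>z\<in>W. (4 / 3 * (\<Sum>k\<in>I. wt k * zpart g (c k + z))) * ln (r / cmod z)) = 4 / 3 * (\<Sum>z\<in>W. (\<Sum>k\<in>I. wt k * zpart g (c k + z)) * ln (r / cmod z))"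
      by (simp only: mult.assoc sum_distrib_left[symmetric])
    also have "(\<Sum>z\<in>W. (\<Sum>k\<in>I. wt k * zpart g (c k + z)) * ln (r / cmod z)) = (\<Sum>k\<in>I. wt k * (\<Sum>a\<in>A k. zpart g a * ln (r / cmod (a - c k))))"
      using IJ by (intro swap) (auto simp: A_def zpset_def zpart_def)
    finally show ?thesis unfolding sz by simp
  qed

  \<comment> \<open>Jensen's formula for \<open>g\<close> exchanges poles and large values for zeros
    and small values, at the cost of the logarithm of \<open>g\<close> at the centre. The step from
    \<open>f\<close> to \<open>g\<close> costs only \<open>b1\<close> and the exceptional
    points.\<close>
  have C: "nev_char_at f (c k) r \<le> cmean (c k) r Yl + Nzero g (c k) r + (D k + E + M * L)" if k: "k \<in> I" for k
  proof -
    have kJ: "k \<in> J" using k IJ by auto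
    have r0: "0 \<le> r" "r > 0" using r by auto
    have colg: "continuous_on (sphere (c k) r) (\<lambda>z. log_plus (cmod (g z)))"
      by (intro continuous_on_log_plus continuous_on_norm cog kJ)
    have "cmean (c k) r Xl \<le> cmean (c k) r (\<lambda>z. log_plus (cmod (g z)) + E)"
    proof (rule cmean_mono)
      fix z assume z: "z \<in> sphere (c k) r"
      have "Xl z \<le> log_plus (cmod (g z) + cmod (ratfun_eval b1 z))"
        unfolding Xl_def using norm_triangle_ineq[of "g z" "ratfun_eval b1 z"] by (intro log_plus_mono) simp
      also have "\<dots> \<le> log_plus (cmod (g z)) + log_plus (cmod (ratfun_eval b1 z)) + ln 2" by (rule log_plus_add_le) auto
      also have "\<dots> \<le> log_plus (cmod (g z)) + E" using E(2)[OF Ik[OF k] z] by simp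
      finally show "Xl z \<le> log_plus (cmod (g z)) + E" .
    qed (use r0 coX[OF kJ] colg in \<open>auto intro!: continuous_on_add\<close>)
    also have "\<dots> = cmean (c k) r (\<lambda>z. log_plus (cmod (g z))) + E" using r0 colg by (subst cmean_add) auto
    finally have 1: "cmean (c k) r Xl \<le> cmean (c k) r (\<lambda>z. log_plus (cmod (g z))) + E" .
    have "cmean (c k) r (\<lambda>z. ln (cmod (g z))) = cmean (c k) r (\<lambda>z. log_plus (cmod (g z)) - Yl z)"
      using g0[OF kJ] r0 unfolding Yl_def by (intro cmean_cong ln_eq_log_plus_diff) auto
    also have "\<dots> = cmean (c k) r (\<lambda>z. log_plus (cmod (g z))) - cmean (c k) r Yl"
      by (intro cmean_diff colg coY kJ r0)
    finally have 2: "cmean (c k) r (\<lambda>z. log_plus (cmod (g z))) = cmean (c k) r (\<lambda>z. ln (cmod (g z))) + cmean (c k) r Yl" by simp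
    have "cmean (c k) r (\<lambda>z. ln (cmod (g z))) = ln (cmod (g (c k))) + Nzero g (c k) r - Npole g (c k) r"
      using Jensen_formula[OF nzg r0(2) clean(2)[OF Jk[OF kJ]]] lead_ln_regular[OF centre[of k]] zorder_not_irr[OF centre[of k]] by simp
    also have "ln (cmod (g (c k))) \<le> D k" using D[of k] ln_le_log_plus[of "cmod (g (c k))"] by simp
    finally have 3: "cmean (c k) r (\<lambda>z. ln (cmod (g z))) \<le> D k + Nzero g (c k) r - Npole g (c k) r" by simp
    have 4: "Npole f (c k) r \<le> Npole g (c k) r + M * L"
    proof -
      let ?l = "\<lambda>a. ln (r / cmod (a - c k))"
      let ?A = "zpset f (c k) r \<union> zpset g (c k) r \<union> (Exc \<inter> ball (c k) r)"
      let ?e = "\<lambda>a. if a \<in> Exc then \<bar>real_of_int (zorder f a)\<bar> else 0"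
      have fA: "finite ?A" using nzf nzg Exc(1) by auto
      have "Npole f (c k) r = (\<Sum>a\<in>?A. of_int (max 0 (- zorder f a)) * ?l a)"
        unfolding Npole_def using fA by (intro sum.mono_neutral_left) (auto simp: zpset_def)
      also have "\<dots> \<le> (\<Sum>a\<in>?A. (of_int (max 0 (- zorder g a)) + ?e a) * ?l a)"
      proof (intro sum_mono mult_right_mono)
        fix a assume "a \<in> ?A"
        thus "0 \<le> ?l a" by (intro ln_ratio_nonneg) (auto simp: zpset_def)
        show "real_of_int (max 0 (- zorder f a)) \<le> of_int (max 0 (- zorder g a)) + ?e a"
        proof (cases "a \<in> Exc")
          case True thus ?thesis by (auto simp: max_def)
        next
          case False
          from pole_order_f_le_g[OF Exc(4)[OF False]]
          have "real_of_int (max 0 (- zorder f a)) \<le> of_int (max 0 (- zorder g a))" by (rule of_int_le_iff[THEN iffD2])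
          thus ?thesis using False by simp
        qed
      qed
      also have "\<dots> = (\<Sum>a\<in>?A. of_int (max 0 (- zorder g a)) * ?l a) + (\<Sum>a\<in>?A. ?e a * ?l a)"
        by (simp only: distrib_right sum.distrib)
      also have "(\<Sum>a\<in>?A. of_int (max 0 (- zorder g a)) * ?l a) = Npole g (c k) r"
        unfolding Npole_def using fA by (intro sum.mono_neutral_right) (auto simp: zpset_def)
      also have "(\<Sum>a\<in>?A. ?e a * ?l a) = (\<Sum>a\<in>Exc \<inter> ball (c k) r. ?e a * ?l a)"
        using fA by (intro sum.mono_neutral_right) (auto simp: zpset_def)
      also have "\<dots> \<le> M * L" by (intro MExc) (auto simp: zpart_def)
      finally show ?thesis by simp
    qed
    show ?thesis unfolding nev_char_at_def Xl_def[symmetric] using 1 2 3 4 by linarith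
  qed

  define T where "T = (\<lambda>k. nev_char_at f (c k) r)"
  have T0: "T k \<ge> 0" if "k \<in> J" for k unfolding T_def using clean(1)[OF Jk[OF that]] r by (intro nev_char_at_nonneg) auto
  define U where "U = (\<lambda>k. cmean (c k) r Yl + Nzero g (c k) r)"
  have AB: "4 / 3 * (\<Sum>k\<in>I. wt k * U k) \<le> 5 / 4 * (\<Sum>k\<in>J. wt k * T k) + 72 * E + 72 * (M * L)"
    using A B by (simp add: U_def T_def nev_char_at_def Xl_def sum.distrib distrib_left)
  have "(\<Sum>k\<in>I. wt k * T k) \<le> (\<Sum>k\<in>I. wt k * (U k + (D k + E + M * L)))"
    using C by (intro sum_mono mult_left_mono) (auto simp: T_def U_def)
  also have "\<dots> = (\<Sum>k\<in>I. wt k * U k) + (\<Sum>k\<in>I. wt k * D k) + (\<Sum>k\<in>I. wt k) * (E + M * L)"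
    by (simp add: distrib_left sum.distrib sum_distrib_right)
  also have "(\<Sum>k\<in>I. wt k) * (E + M * L) \<le> 9 * (E + M * L)" using wI E M0 L0 by (intro mult_right_mono) auto
  finally have TU: "(\<Sum>k\<in>I. wt k * T k) \<le> (\<Sum>k\<in>I. wt k * U k) + (\<Sum>k\<in>I. wt k * D k) + 9 * (E + M * L)" by simp
  have JI: "(\<Sum>k\<in>J. wt k * T k) = (\<Sum>k\<in>I. wt k * T k) + wt (int (Suc K)) * (T (int (Suc K)) + T (- int (Suc K)))"
  proof -
    have "J = insert (int (Suc K)) (insert (- int (Suc K)) I)" by (auto simp: I_def J_def)
    moreover have "wt (- int (Suc K)) = wt (int (Suc K))" by (simp only: wt_def abs_minus_cancel)
    moreover have "int (Suc K) \<notin> insert (- int (Suc K)) I" "- int (Suc K) \<notin> I" by (auto simp: I_def)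
    ultimately show ?thesis using fin(1) by (simp only: sum.insert finite_insert distrib_left) simp
  qed
  have "T 0 = wt 0 * T 0" by simp
  also have "\<dots> \<le> (\<Sum>k\<in>I. wt k * T k)"
    using fin T0 IJ by (intro member_le_sum) (auto simp: I_def)
  finally have "T 0 \<le> (\<Sum>k\<in>I. wt k * T k)" .
  \<comment> \<open>Moving 5 / 4 of the sum to the left leaves 1 / 12 of it. Multiplication by 12
    turns 5 / 4 into 15, 4 / 3 into 16, and 72 + 4 / 3 * 9 = 84 into 1008.\<close>
  hence "T 0 \<le> 15 * (wt (int (Suc K)) * (T (int (Suc K)) + T (- int (Suc K)))) + 1008 * (E + M * L) + 16 * (\<Sum>k\<in>I. wt k * D k)"
    using AB TU unfolding JI distrib_left by linarith
  thus ?thesis unfolding T_def L_def I_def .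
qed

end

text \<open>The growth allowed at the centres is slower than the decay of the weights: the ratio
  becomes at most 4 / 5 * 9 / 8 = 9 / 10, and each tail of the series sums to at most 9.\<close>

lemma sum_wt_exp_le: "(\<Sum>k\<in>{- int K..int K}. wt k * exp (\<bar>of_int k\<bar> / 100)) \<le> 19"
proof -
  have e: "exp (1 / 100) \<le> (9 / 8 :: real)" using exp_bound[of "1 / 100"] by (simp add: power2_eq_square)
  have "wt k * exp (\<bar>of_int k\<bar> / 100) \<le> (9 / 10) ^ nat \<bar>k\<bar>" for k
  proof -
    have "exp (\<bar>of_int k\<bar> / 100) = exp (1 / 100 :: real) ^ nat \<bar>k\<bar>"
      by (simp flip: exp_of_nat_mult)
    hence "wt k * exp (\<bar>of_int k\<bar> / 100) = (4 / 5 * exp (1 / 100)) ^ nat \<bar>k\<bar>"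
      by (simp only: wt_def power_mult_distrib)
    also have "\<dots> \<le> (9 / 10) ^ nat \<bar>k\<bar>" using e by (intro power_mono) auto
    finally show ?thesis .
  qed
  hence "(\<Sum>k\<in>{- int K..int K}. wt k * exp (\<bar>of_int k\<bar> / 100)) \<le> (\<Sum>k\<in>{- int K..int K}. (9 / 10) ^ nat \<bar>k\<bar>)"
    by (rule sum_mono)
  also have "(\<Sum>k\<in>{- int K..int K}. (9 / 10 :: real) ^ nat \<bar>k\<bar>) = 19 - 18 * (9 / 10) ^ K"
  proof (induction K)
    case (Suc K)
    have "{- int (Suc K)..int (Suc K)} = insert (int (Suc K)) (insert (- int (Suc K)) {- int K..int K})"
      by auto
    thus ?case using Suc by (simp add: nat_add_distrib)
  qed simp
  finally show ?thesis by (rule order_trans) simp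
qed

text \<open>Only finitely many of the points \<open>s + k\<close> are close to a given point of
  \<open>A\<close>, because they tend to infinity; one lower bound therefore serves all
  \<open>k\<close>.\<close>

lemma lattice_dist_lower:
  fixes A :: "complex set" and s :: real
  assumes A: "finite A" and s: "\<And>k::int. complex_of_real (s + of_int k) \<notin> A"
  obtains \<eta> where "0 < \<eta>" "\<eta> \<le> 1" "\<And>e k. e \<in> A \<Longrightarrow> \<eta> \<le> cmod (e - complex_of_real (s + of_int k))"
proof -
  have "\<exists>\<eta>>0. \<forall>k::int. \<eta> \<le> cmod (e - complex_of_real (s + of_int k))" if e: "e \<in> A" for e
  proof -
    define N where "N = \<lceil>cmod e + \<bar>s\<bar> + 1\<rceil>"
    have "finite ((\<lambda>k::int. complex_of_real (s + of_int k)) ` {- N..N})" by simp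
    from finite_set_avoid[OF this, of e] obtain d where d: "d > 0"
      "\<forall>x\<in>(\<lambda>k::int. complex_of_real (s + of_int k)) ` {- N..N}. x \<noteq> e \<longrightarrow> d \<le> dist e x" by blast
    show ?thesis
    proof (rule exI[of _ "min d 1"], intro conjI allI)
      fix k :: int
      show "min d 1 \<le> cmod (e - complex_of_real (s + of_int k))"
      proof (cases "k \<in> {- N..N}")
        case True
        have ne: "complex_of_real (s + of_int k) \<noteq> e" using s[of k] e by metis
        have "d \<le> dist e (complex_of_real (s + of_int k))" by (rule d(2)[rule_format, OF imageI[OF True] ne])
        thus ?thesis by (simp add: dist_norm)
      next
        case False
        hence "N < \<bar>k\<bar>" by auto
        hence "real_of_int N < \<bar>of_int k\<bar>" by linarith
        hence "cmod e + \<bar>s\<bar> + 1 \<le> \<bar>of_int k\<bar>" unfolding N_def by linarith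
        hence "cmod e + 1 \<le> \<bar>s + of_int k\<bar>" by linarith
        also have "\<dots> = cmod (complex_of_real (s + of_int k))" by (simp only: norm_of_real)
        finally have "1 \<le> cmod (e - complex_of_real (s + of_int k))"
          using norm_triangle_ineq2[of "complex_of_real (s + of_int k)" e] by (simp only: norm_minus_commute)
        thus ?thesis by linarith
      qed
    qed (use d in auto)
  qed
  then obtain \<eta> where \<eta>: "\<And>e. e \<in> A \<Longrightarrow> \<eta> e > 0" "\<And>e k. e \<in> A \<Longrightarrow> \<eta> e \<le> cmod (e - complex_of_real (s + of_int k))" by metis
  show ?thesis
  proof (rule that[of "Min (insert 1 (\<eta> ` A))"])
    show "0 < Min (insert 1 (\<eta> ` A))" using A \<eta> by (subst Min_gr_iff) auto
    show "Min (insert 1 (\<eta> ` A)) \<le> 1" using A by (intro Min_le) auto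
    fix e and k :: int assume e: "e \<in> A"
    have "Min (insert 1 (\<eta> ` A)) \<le> \<eta> e" using A e by (intro Min_le) auto
    also have "\<dots> \<le> cmod (e - complex_of_real (s + of_int k))" by (rule \<eta>(2)[OF e])
    finally show "Min (insert 1 (\<eta> ` A)) \<le> cmod (e - complex_of_real (s + of_int k))" .
  qed
qed

context delay_equation
begin

text \<open>The error terms are logarithms of pointwise bounds, and these are powers of
  \<open>V\<close> on a disc of about twice the radius; hence the logarithm of \<open>V\<close> on
  the right. The centre \<open>c0\<close> of the given bound is kept apart from the centres
  \<open>c k\<close>: it is 0 in the first pass and the chosen centre in the second.\<close>

lemma growth_improvement:
  fixes s Cs Cv :: real and V :: "real \<Rightarrow> real" and c0 :: complex
  assumes V: "growth_bound f c0 V" "\<And>\<rho>. \<rho> \<ge> 0 \<Longrightarrow> 1 \<le> V \<rho>" "eventually (\<lambda>\<rho>. V \<rho> \<le> Cv * exp (\<rho> / 1000)) at_top"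
    and c0: "cmod c0 \<le> 1" and s01: "s \<in> {0..1}" and Cs: "Cs \<ge> 1"
    and Exc: "finite Exc"
      "\<And>z. z \<notin> Exc \<Longrightarrow> 4 / 3 * zpart g z \<le> ppart m f (z + 1) + ppart m f (z - 1)"
      "\<And>z. z \<notin> Exc \<Longrightarrow> min (min (zpart g (z - 1)) (zpart g (z + 1))) (ppart m f z) \<le> 0"
      "\<And>z. z \<notin> Exc \<Longrightarrow> ratfun_eval b1 analytic_on {z}"
    and Z: "finite Z" "\<And>z \<delta>. 0 < \<delta> \<Longrightarrow> \<delta> \<le> 1 \<Longrightarrow> (\<And>e. e \<in> Z \<Longrightarrow> \<delta> \<le> cmod (z - e)) \<Longrightarrow> z \<notin> eqbad \<Longrightarrow>
      (g z \<noteq> 0 \<longrightarrow> cmod (g z) \<le> 1 / ((3 + cmod z) / \<delta>) ^ C2 \<longrightarrow>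
         1 / (((3 + cmod z) / \<delta>) ^ C2 * (cmod (g z))\<^sup>2) \<le> cmod (f (z + 1) * f (z - 1)) + ((3 + cmod z) / \<delta>) ^ C2 * cmod (schwarzian f z)) \<and>
      (((3 + cmod z) / \<delta>) ^ C2 \<le> cmod (f z) \<longrightarrow>
         cmod (f z) ^ d / ((3 + cmod z) / \<delta>) ^ C2 \<le> cmod (f (z + 1) * f (z - 1)) + ((3 + cmod z) / \<delta>) ^ C2 * cmod (schwarzian f z))"
    "\<And>z \<delta>. 0 < \<delta> \<Longrightarrow> \<delta> \<le> 1 \<Longrightarrow> (\<And>e. e \<in> Z \<Longrightarrow> \<delta> \<le> cmod (z - e)) \<Longrightarrow>
       cmod (ratfun_eval b1 z) \<le> ((3 + cmod z) / \<delta>) ^ C2 \<and> cmod (ratfun_eval b1 (z + 1)) \<le> ((3 + cmod z) / \<delta>) ^ C2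
        \<and> cmod (ratfun_eval b1 (z - 1)) \<le> ((3 + cmod z) / \<delta>) ^ C2"
  defines "c \<equiv> \<lambda>k::int. complex_of_real (s + of_int k)"
  assumes c: "\<And>k. c k \<notin> irr g" "\<And>k. c k \<notin> Exc" "\<And>k. c k \<notin> Z"
    "\<And>k. log_plus (cmod (f (c k))) \<le> Cs * exp (\<bar>of_int k\<bar> / 100)"
    "\<And>k e. zorder f e \<noteq> 0 \<Longrightarrow> exp (- \<bar>of_int k\<bar> / 100) / Cs \<le> cmod (e - c k)"
  shows "\<exists>C. eventually (\<lambda>\<rho>. \<exists>r\<in>{\<rho>..\<rho> + 1}. irr f \<inter> sphere (c 0) r = {} \<and>
      nev_char_at f (c 0) r \<le> C * (ln (V (2 * \<rho> + 20)) + ln \<rho>)) at_top"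
proof -
  obtain C1 where C1: "C1 \<ge> 1" "\<And>R B. 8 \<le> R \<Longrightarrow> 1 \<le> B \<Longrightarrow> controlled f c0 R B \<Longrightarrow>
    \<exists>W. finite W \<and> real (card W) \<le> C1 * (R * B) ^ 14 \<and>
      (\<forall>z\<in>cball c0 (R - 6). \<forall>\<delta>. 0 < \<delta> \<longrightarrow> \<delta> \<le> 1 \<longrightarrow> (\<forall>a\<in>W. \<delta> \<le> cmod (z - a)) \<longrightarrow>
         z \<notin> irr f \<longrightarrow> z \<notin> irr (deriv f) \<longrightarrow>
         \<bar>ln (cmod (f z))\<bar> \<le> C1 * (R * B) ^ 14 / \<delta>\<^sup>2 \<and> cmod (schwarzian f z) \<le> C1 * (R * B) ^ 14 / \<delta>\<^sup>2)"
    by (rule local_control[OF nzf nzf', where c = c0]) (rule that; assumption)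
  obtain \<eta> where \<eta>: "0 < \<eta>" "\<eta> \<le> 1" "\<And>e k. e \<in> Exc \<union> Z \<Longrightarrow> \<eta> \<le> cmod (e - c k)"
    unfolding c_def using lattice_dist_lower[of "Exc \<union> Z" s] Exc(1) Z(1) c(2,3) unfolding c_def by blast
  define M where "M = (\<Sum>e\<in>Exc. 2 * zpart g e + 2 * \<bar>of_int (zorder f e)\<bar>)"
  have M0: "M \<ge> 0" unfolding M_def by (intro sum_nonneg) (simp add: zpart_def)
  define nZ where "nZ = real (card Z)"
  \<comment> \<open>With \<open>Q = \<rho> * B\<close>, where \<open>B\<close> is the bound on the
    large disc, \<open>R * B\<close> is at most \<open>30 * Q\<close> and there are at most
    \<open>7 * Q - 1\<close> circles. So \<open>1 / \<delta>\<close> is at most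
    \<open>C4 * Q ^ 15\<close> with 28 = 4 * 7. The later exponent 44 is 14 + 2 * 15.\<close>
  define C4 where "C4 = 28 * (C1 * 30 ^ 14 + nZ + 1)"
  define C5 where "C5 = C1 * 30 ^ 14 * C4\<^sup>2"
  define C3 where "C3 = Cs + 400 * (real C2 / \<eta>) + 1"
  have C41: "C4 \<ge> 1" using C1(1) by (simp add: C4_def nZ_def)
  have C51: "C5 \<ge> 1" unfolding C5_def using C1(1) C41 mult_mono[of 1 "C1 * 30 ^ 14" 1 "C4\<^sup>2"] by (simp add: one_le_power)
  have C31: "C3 \<ge> 0" using Cs \<eta> by (simp add: C3_def)
  define DD where "DD = (\<lambda>k. log_plus (cmod (g (c k))))"
  have ck: "cmod (c k) \<le> \<bar>of_int k\<bar> + 1" for k using s01 unfolding c_def norm_of_real by auto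
  have DDle: "DD k \<le> C3 * exp (\<bar>of_int k\<bar> / 100)" for k
  proof -
    let ?e = "exp (\<bar>real_of_int k\<bar> / 100)" and ?Y = "(3 + cmod (c k)) / \<eta>"
    have e1: "1 \<le> ?e" by simp
    have Y1: "1 \<le> ?Y" using \<eta> by (simp add: le_divide_eq) (use norm_ge_zero[of "c k"] in linarith)
    have "cmod (ratfun_eval b1 (c k)) \<le> ?Y ^ C2"
      using Z(3)[OF \<eta>(1,2), of "c k"] \<eta>(3)[of _ k] by (simp add: norm_minus_commute)
    hence "log_plus (cmod (ratfun_eval b1 (c k))) \<le> log_plus (?Y ^ C2)" by (rule log_plus_mono)
    also have "\<dots> = real C2 * ln ?Y" using Y1 by (simp add: log_plus_def max_def ln_realpow one_le_power)
    also have "\<dots> \<le> real C2 * ?Y" using Y1 ln_le_minus_one[of ?Y] by (intro mult_left_mono) auto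
    also have "\<dots> = (real C2 / \<eta>) * (3 + cmod (c k))" by simp
    also have "\<dots> \<le> (real C2 / \<eta>) * (400 * ?e)"
    proof (rule mult_left_mono)
      have "1 + \<bar>of_int k\<bar> / 100 \<le> ?e" by (rule exp_ge_add_one_self)
      thus "3 + cmod (c k) \<le> 400 * ?e" using ck[of k] by linarith
    qed (use \<eta> in auto)
    finally have 1: "log_plus (cmod (ratfun_eval b1 (c k))) \<le> 400 * (real C2 / \<eta>) * ?e" by (simp add: mult_ac)
    have "DD k \<le> log_plus (cmod (f (c k)) + cmod (ratfun_eval b1 (c k)))"
      unfolding DD_def by (intro log_plus_mono norm_triangle_ineq4)
    also have "\<dots> \<le> log_plus (cmod (f (c k))) + log_plus (cmod (ratfun_eval b1 (c k))) + ln 2"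
      by (rule log_plus_add_le) auto
    also have "\<dots> \<le> Cs * ?e + 400 * (real C2 / \<eta>) * ?e + 1 * ?e"
    proof (intro add_mono 1)
      show "log_plus (cmod (f (c k))) \<le> Cs * ?e" by (rule c(4))
      show "ln 2 \<le> 1 * ?e" using e1 ln_2_less_1 by linarith
    qed
    also have "\<dots> = C3 * ?e" by (simp add: C3_def algebra_simps)
    finally show ?thesis .
  qed
  have DDsum: "(\<Sum>k\<in>{- int K..int K}. wt k * DD k) \<le> 19 * C3" for K
  proof -
    have "(\<Sum>k\<in>{- int K..int K}. wt k * DD k) \<le> (\<Sum>k\<in>{- int K..int K}. C3 * (wt k * exp (\<bar>of_int k\<bar> / 100)))"
      using DDle by (intro sum_mono) (metis mult.left_commute mult_left_mono wt_nonneg)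
    also have "\<dots> = C3 * (\<Sum>k\<in>{- int K..int K}. wt k * exp (\<bar>of_int k\<bar> / 100))" by (rule sum_distrib_left[symmetric])
    also have "\<dots> \<le> C3 * 19" using C31 by (intro mult_left_mono sum_wt_exp_le) auto
    finally show ?thesis by simp
  qed
  define T where "T = (\<Union>k::int. dist (c k) ` (irr f \<union> irr (deriv f) \<union> irr g \<union> eqbad))"
  have cT: "countable T" unfolding T_def image_Un
    using irr_sparse[OF nzf] irr_sparse[OF nzf'] irr_sparse[OF nzg] eqbad_sparse
    by (intro countable_UN countable_Un sparse_radii_countable) auto
  define A1 A2 where "A1 = 8 * (real C2 + 1)" and "A2 = ln 12 + ln C4 + 16"
  define CC where "CC = 15 + 1008 * (A1 * A2 + 2 * (ln C5 + 44) + M * (1 + ln 2 + ln (1 / \<eta>))) + 16 * (19 * C3)"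
  \<comment> \<open>The competition at the ends of the sum: the weight is at most exp (- \<rho> /
    5), while the power 44 of the bound at twice the radius grows with rate 88 / 1000 only, up to
    powers of \<rho>. The second summand accounts for poles near the centres.\<close>
  have bd: "eventually (\<lambda>\<rho>. 2 * exp (- \<rho> / 5) * (C5 * (\<rho> * (\<bar>Cv\<bar> * exp ((2 * \<rho> + 20) / 1000))) ^ 44
      + 2 * (\<rho> * (\<bar>Cv\<bar> * exp ((2 * \<rho> + 20) / 1000))) * (Cs * exp ((\<rho> + 2) / 100))) \<le> 1) at_top"
  proof -
    have "eventually (\<lambda>\<rho>::real. 2 * exp (- \<rho> / 5) * (C5 * (\<rho> * (q * exp ((2 * \<rho> + 20) / 1000))) ^ 44
      + 2 * (\<rho> * (q * exp ((2 * \<rho> + 20) / 1000))) * (Cs * exp ((\<rho> + 2) / 100))) \<le> 1) at_top" if "q > 0" for q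
      using that Cs C51 by real_asymp
    from this[of "\<bar>Cv\<bar>"] show ?thesis by (cases "Cv = 0") auto
  qed
  have V1: "eventually (\<lambda>\<rho>. \<exists>R\<in>{2 * \<rho> + 20..2 * \<rho> + 20 + 1}. controlled f c0 R (V (2 * \<rho> + 20))) at_top"
    using V(1) unfolding growth_bound_def
    by (rule eventually_compose_filterlim) real_asymp
  have V3: "eventually (\<lambda>\<rho>. V (2 * \<rho> + 20) \<le> Cv * exp ((2 * \<rho> + 20) / 1000)) at_top"
    using V(3) by (rule eventually_compose_filterlim) real_asymp
  have "eventually (\<lambda>\<rho>. \<exists>r\<in>{\<rho>..\<rho> + 1}. irr f \<inter> sphere (c 0) r = {} \<and>
      nev_char_at f (c 0) r \<le> CC * (ln (V (2 * \<rho> + 20)) + ln \<rho>)) at_top"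
    using bd V1 V3 eventually_ge_at_top[of 3]
  proof eventually_elim
    case (elim \<rho>)
    define B where "B = V (2 * \<rho> + 20)"
    have B1: "B \<ge> 1" unfolding B_def using elim(4) by (intro V(2)) auto
    obtain R where R: "R \<in> {2 * \<rho> + 20..2 * \<rho> + 21}" "controlled f c0 R B" using elim(2) by (auto simp: B_def add.assoc)
    have "8 \<le> R" using R elim(4) by auto
    from C1(2)[OF this B1 R(2)] obtain W where W: "finite W" "real (card W) \<le> C1 * (R * B) ^ 14"
      "\<And>z \<delta>. z \<in> cball c0 (R - 6) \<Longrightarrow> 0 < \<delta> \<Longrightarrow> \<delta> \<le> 1 \<Longrightarrow> (\<forall>a\<in>W. \<delta> \<le> cmod (z - a)) \<Longrightarrow>
         z \<notin> irr f \<Longrightarrow> z \<notin> irr (deriv f) \<Longrightarrow>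
         \<bar>ln (cmod (f z))\<bar> \<le> C1 * (R * B) ^ 14 / \<delta>\<^sup>2 \<and> cmod (schwarzian f z) \<le> C1 * (R * B) ^ 14 / \<delta>\<^sup>2" by blast
    \<comment> \<open>With \<open>K\<close> close to \<open>\<rho>\<close> the discs stay within
      \<open>2 * \<rho> + 5\<close> of the origin, yet the end weights decay exponentially in
      \<open>\<rho>\<close>.\<close>
    define K where "K = nat \<lceil>\<rho>\<rceil>"
    have K: "\<rho> \<le> real K" "real K \<le> \<rho> + 1" using elim(4) unfolding K_def by linarith+
    define Q where "Q = \<rho> * B"
    have Q: "Q \<ge> 3" "\<rho> \<le> Q" "B \<le> Q"
      using elim(4) B1 mult_mono[of 3 \<rho> 1 B] mult_left_mono[of 1 B \<rho>] mult_right_mono[of 1 \<rho> B] by (auto simp: Q_def)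
    have RB: "R * B \<le> 30 * Q" "R * B \<ge> 1"
    proof -
      have "R \<le> 30 * \<rho>" using R elim(4) by auto
      thus "R * B \<le> 30 * Q" using B1 mult_right_mono[of R "30 * \<rho>" B] by (simp add: Q_def)
      show "R * B \<ge> 1" using B1 \<open>8 \<le> R\<close> mult_mono[of 1 R 1 B] by simp
    qed
    have RB14: "(R * B) ^ 14 \<le> 30 ^ 14 * Q ^ 14" using power_mono[OF RB(1), of 14] RB(2) by (simp add: power_mult_distrib)
    define J where "J = {- int (Suc K)..int (Suc K)}"
    \<comment> \<open>A single radius has to serve all the circles, so the distances of the
      exceptional points from every centre are avoided.\<close>
    define S where "S = (\<lambda>(e, k). dist e (c k)) ` ((W \<union> Z) \<times> J)"
    define N where "N = (C1 * 30 ^ 14 * Q ^ 14 + nZ) * (7 * Q - 1)"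
    have cardJ: "real (card J) \<le> 7 * Q - 1" using K Q elim(4) by (simp add: J_def)
    have cardS: "real (card S) \<le> N"
    proof -
      have "card S \<le> card ((W \<union> Z) \<times> J)" unfolding S_def using W(1) Z(1) by (intro card_image_le) (auto simp: J_def)
      also have "\<dots> = card (W \<union> Z) * card J" by (rule card_cartesian_product)
      also have "\<dots> \<le> (card W + card Z) * card J" by (intro mult_right_mono card_Un_le) auto
      finally have "real (card S) \<le> (real (card W) + nZ) * real (card J)" unfolding nZ_def by (simp flip: of_nat_add of_nat_mult)
      also have "\<dots> \<le> N" unfolding N_def
      proof (intro mult_mono add_right_mono cardJ)
        have "C1 * (R * B) ^ 14 \<le> C1 * (30 ^ 14 * Q ^ 14)" using C1(1) RB14 by (intro mult_left_mono) auto
        thus "real (card W) \<le> C1 * 30 ^ 14 * Q ^ 14" using W(2) by simp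
      qed (use C1(1) Q in \<open>auto simp: nZ_def\<close>)
      finally show ?thesis .
    qed
    have finS: "finite S" unfolding S_def using W(1) Z(1) by (auto simp: J_def)
    obtain r where r: "r \<in> {\<rho>..\<rho> + 1}" "r \<notin> T" "\<And>x. x \<in> S \<Longrightarrow> 1 / (4 * (N + 1)) \<le> \<bar>r - x\<bar>"
      by (rule good_radius[OF finS cT cardS, of \<rho>]) (rule that; assumption)
    define \<delta> where "\<delta> = 1 / (4 * (N + 1))"
    have N0: "N \<ge> 0" using cardS by linarith
    have \<delta>: "0 < \<delta>" "\<delta> \<le> 1" using N0 by (auto simp: \<delta>_def)
    have \<delta>Q: "1 / \<delta> \<le> C4 * Q ^ 15"
    proof -
      have Q14: "1 \<le> Q ^ 14" using Q by simp
      have "N + 1 \<le> ((C1 * 30 ^ 14 + nZ + 1) * Q ^ 14) * (7 * Q)"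
      proof -
        have a: "C1 * 30 ^ 14 * Q ^ 14 + nZ + 1 \<le> (C1 * 30 ^ 14 + nZ + 1) * Q ^ 14"
          using Q14 mult_left_mono[OF Q14, of nZ] by (simp add: distrib_right nZ_def)
        have "N + 1 \<le> (C1 * 30 ^ 14 * Q ^ 14 + nZ + 1) * (7 * Q - 1) + 1" unfolding N_def using Q
          by (intro add_right_mono mult_right_mono) auto
        also have "\<dots> \<le> (C1 * 30 ^ 14 * Q ^ 14 + nZ + 1) * (7 * Q)"
        proof -
          have "1 \<le> C1 * 30 ^ 14 * Q ^ 14 + nZ + 1" using C1(1) Q by (simp add: nZ_def)
          thus ?thesis by (simp add: right_diff_distrib)
        qed
        also have "\<dots> \<le> ((C1 * 30 ^ 14 + nZ + 1) * Q ^ 14) * (7 * Q)" using a Q by (intro mult_right_mono) auto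
        finally show ?thesis .
      qed
      hence "1 / \<delta> \<le> 4 * (((C1 * 30 ^ 14 + nZ + 1) * Q ^ 14) * (7 * Q))" by (simp add: \<delta>_def)
      also have "\<dots> = C4 * (Q ^ 14 * Q ^ 1)" by (simp add: C4_def)
      also have "Q ^ 14 * Q ^ 1 = Q ^ 15" by (simp only: power_add[symmetric]) simp
      finally show ?thesis .
    qed
    define \<Sigma> where "\<Sigma> = C1 * (R * B) ^ 14 / \<delta>\<^sup>2"
    have \<Sigma>: "1 \<le> \<Sigma>" "\<Sigma> \<le> C5 * Q ^ 44"
    proof -
      have "1 * 1 \<le> C1 * (R * B) ^ 14" using C1(1) RB by (intro mult_mono) (auto intro: one_le_power)
      moreover have "\<delta>\<^sup>2 \<le> 1" using \<delta> by (simp add: power_le_one)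
      ultimately show "1 \<le> \<Sigma>" unfolding \<Sigma>_def using \<delta> by (simp add: le_divide_eq)
      have "\<Sigma> = C1 * (R * B) ^ 14 * (1 / \<delta>)\<^sup>2" by (simp add: \<Sigma>_def power_divide)
      also have "\<dots> \<le> C1 * (30 ^ 14 * Q ^ 14) * (C4 * Q ^ 15)\<^sup>2"
        using \<delta> \<delta>Q RB14 C1(1) Q by (intro mult_mono power_mono) auto
      also have "\<dots> = C5 * (Q ^ 14 * Q ^ 30)" by (simp add: C5_def power_mult_distrib flip: power_mult)
      also have "Q ^ 14 * Q ^ 30 = Q ^ 44" by (simp flip: power_add)
      finally show "\<Sigma> \<le> C5 * Q ^ 44" .
    qed
    have r0: "1 \<le> r" "0 < r" using r(1) elim(4) by auto
    have sph: "z \<notin> irr f" "z \<notin> irr (deriv f)" "z \<notin> irr g" "z \<notin> eqbad" if "z \<in> sphere (c k) r" for z k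
      using that r(2) unfolding T_def by auto
    have zbound: "cmod z \<le> 2 * \<rho> + 5" "z \<in> cball c0 (R - 6)" if "\<bar>k\<bar> \<le> int (Suc K)" "z \<in> sphere (c k) r" for z k
    proof -
      have k: "\<bar>real_of_int k\<bar> \<le> real K + 1" using that(1) by linarith
      have "cmod z \<le> cmod (z - c k) + cmod (c k)" using norm_triangle_ineq[of "z - c k" "c k"] by simp
      also have "\<dots> \<le> r + (\<bar>of_int k\<bar> + 1)" using that(2) ck[of k] by (simp add: dist_norm norm_minus_commute)
      also have "\<dots> \<le> 2 * \<rho> + 5" using k K r(1) by auto
      finally show z: "cmod z \<le> 2 * \<rho> + 5" .
      have "cmod (z - c0) \<le> cmod z + cmod c0" by (rule norm_triangle_ineq4)
      also have "\<dots> \<le> R - 6" using z c0 R(1) by auto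
      finally show "z \<in> cball c0 (R - 6)" by (simp add: dist_norm norm_minus_commute)
    qed
    have dist\<delta>: "\<delta> \<le> cmod (z - e)" if "\<bar>k\<bar> \<le> int (Suc K)" "z \<in> sphere (c k) r" "e \<in> W \<union> Z" for z k e
    proof -
      have "dist e (c k) \<in> S" unfolding S_def using that by (force simp: J_def)
      from r(3)[OF this] have "\<delta> \<le> \<bar>r - dist e (c k)\<bar>" by (simp add: \<delta>_def)
      also have "\<dots> \<le> dist z e" using that(2) dist_triangle[of "c k" z e] dist_triangle[of "c k" e z]
        by (auto simp: dist_commute)
      finally show ?thesis by (simp add: dist_norm)
    qed
    have bounds: "\<bar>ln (cmod (f z))\<bar> \<le> \<Sigma>" "cmod (schwarzian f z) \<le> \<Sigma>" if "\<bar>k\<bar> \<le> int (Suc K)" "z \<in> sphere (c k) r" for z k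
    proof -
      have "\<forall>a\<in>W. \<delta> \<le> cmod (z - a)" using dist\<delta>[OF that] by blast
      from W(3)[OF zbound(2)[OF that] \<delta> this sph(1,2)[OF that(2)]]
      show "\<bar>ln (cmod (f z))\<bar> \<le> \<Sigma>" "cmod (schwarzian f z) \<le> \<Sigma>" by (auto simp: \<Sigma>_def)
    qed
    define \<Lambda> where "\<Lambda> = ((2 * \<rho> + 8) / \<delta>) ^ (C2 + 1)"
    have base: "2 \<le> (2 * \<rho> + 8) / \<delta>" using \<delta> elim(4) by (simp add: le_divide_eq)
    have \<Lambda>2: "2 \<le> \<Lambda>"
    proof -
      have "2 * 1 \<le> (2 * \<rho> + 8) / \<delta> * ((2 * \<rho> + 8) / \<delta>) ^ C2" using base by (intro mult_mono one_le_power) auto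
      thus ?thesis by (simp add: \<Lambda>_def)
    qed
    define E where "E = 8 * ln \<Lambda> + 2 * ln \<Sigma>"
    have E0: "E \<ge> 0" using \<Lambda>2 \<Sigma>(1) by (simp add: E_def)
    have est: "cmod (g z) \<le> 1 / \<Lambda> \<Longrightarrow> 1 / (\<Lambda> * (cmod (g z))\<^sup>2) \<le> cmod (f (z + 1) * f (z - 1)) + \<Lambda> * cmod (schwarzian f z)"
      "\<Lambda> \<le> cmod (f z) \<Longrightarrow> cmod (f z) ^ d / \<Lambda> \<le> cmod (f (z + 1) * f (z - 1)) + \<Lambda> * cmod (schwarzian f z)"
      "cmod (ratfun_eval b1 z) \<le> \<Lambda>" "cmod (ratfun_eval b1 (z + 1)) \<le> \<Lambda>" "cmod (ratfun_eval b1 (z - 1)) \<le> \<Lambda>"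
      if k: "\<bar>k\<bar> \<le> int (Suc K)" and z: "z \<in> sphere (c k) r" for z k
    proof -
      define Y where "Y = ((3 + cmod z) / \<delta>) ^ C2"
      have di: "\<delta> \<le> cmod (z - e)" if "e \<in> Z" for e using dist\<delta>[OF k z] that by blast
      have "Y \<le> ((2 * \<rho> + 8) / \<delta>) ^ C2" unfolding Y_def using zbound(1)[OF k z] \<delta>
        by (intro power_mono divide_right_mono) (auto intro: divide_nonneg_nonneg add_nonneg_nonneg)
      also have "\<dots> \<le> \<Lambda>" unfolding \<Lambda>_def using base by (intro power_increasing) auto
      finally have Y\<Lambda>: "Y \<le> \<Lambda>" .
      have Y0: "Y > 0" unfolding Y_def using \<delta> by (intro zero_less_power divide_pos_pos add_pos_nonneg) auto
      have gz: "g z \<noteq> 0" using sph(3)[OF z] by (auto simp: irr_def)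
      note e1 = Z(2)[OF \<delta> di sph(4)[OF z], folded Y_def] and e2 = Z(3)[OF \<delta> di, folded Y_def]
      have last: "cmod (f (z + 1) * f (z - 1)) + Y * cmod (schwarzian f z) \<le> cmod (f (z + 1) * f (z - 1)) + \<Lambda> * cmod (schwarzian f z)"
        using Y\<Lambda> by (intro add_left_mono mult_right_mono) auto
      show "cmod (ratfun_eval b1 z) \<le> \<Lambda>" "cmod (ratfun_eval b1 (z + 1)) \<le> \<Lambda>" "cmod (ratfun_eval b1 (z - 1)) \<le> \<Lambda>"
        using e2 Y\<Lambda> by auto
      show "1 / (\<Lambda> * (cmod (g z))\<^sup>2) \<le> cmod (f (z + 1) * f (z - 1)) + \<Lambda> * cmod (schwarzian f z)" if "cmod (g z) \<le> 1 / \<Lambda>"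
      proof -
        have "1 / \<Lambda> \<le> 1 / Y" using Y\<Lambda> Y0 by (intro divide_left_mono) auto
        hence "1 / (Y * (cmod (g z))\<^sup>2) \<le> cmod (f (z + 1) * f (z - 1)) + Y * cmod (schwarzian f z)"
          using e1 gz that by auto
        moreover have "1 / (\<Lambda> * (cmod (g z))\<^sup>2) \<le> 1 / (Y * (cmod (g z))\<^sup>2)"
          using Y\<Lambda> Y0 gz by (intro divide_left_mono mult_right_mono mult_pos_pos zero_less_power) auto
        ultimately show ?thesis using last by linarith
      qed
      show "cmod (f z) ^ d / \<Lambda> \<le> cmod (f (z + 1) * f (z - 1)) + \<Lambda> * cmod (schwarzian f z)" if "\<Lambda> \<le> cmod (f z)"
      proof -
        have "cmod (f z) ^ d / Y \<le> cmod (f (z + 1) * f (z - 1)) + Y * cmod (schwarzian f z)"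
          using e1 that Y\<Lambda> by auto
        moreover have "cmod (f z) ^ d / \<Lambda> \<le> cmod (f z) ^ d / Y" using Y\<Lambda> Y0 by (intro divide_left_mono) auto
        ultimately show ?thesis using last by linarith
      qed
    qed
    have shiftsph: "z + 1 \<in> sphere (c (k + 1)) r" "z - 1 \<in> sphere (c (k - 1)) r" if "z \<in> sphere (c k) r" for z k
    proof -
      have "c (k + 1) - (z + 1) = c k - z" "c (k - 1) - (z - 1) = c k - z" by (simp_all add: c_def)
      thus "z + 1 \<in> sphere (c (k + 1)) r" "z - 1 \<in> sphere (c (k - 1)) r" using that by (simp_all only: mem_sphere dist_norm)
    qed
    have gnz: "g z \<noteq> 0" if "z \<in> sphere (c k) r" for z k using sph(3)[OF that] by (auto simp: irr_def)
    have main: "nev_char_at f (c 0) r \<le> 15 * (wt (int (Suc K)) * (nev_char_at f (c (int (Suc K))) r + nev_char_at f (c (- int (Suc K))) r))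
       + 1008 * (E + M * ln (r / \<eta>)) + 16 * (\<Sum>k\<in>{- int K..int K}. wt k * DD k)"
    proof (rule main_inequality[where E = E and \<eta> = \<eta> and D = DD and K = K and c = c and M = M and s = s])
      show "c = (\<lambda>k. complex_of_real (s + of_int k))" by (simp add: c_def)
      show "M = (\<Sum>e\<in>Exc. 2 * zpart g e + 2 * \<bar>of_int (zorder f e)\<bar>)" by (rule M_def)
    next
      fix k z assume k: "\<bar>k\<bar> \<le> int K" and z: "z \<in> sphere (c k) r"
      have k': "\<bar>k\<bar> \<le> int (Suc K)" using k by simp
      note pi = pointwise_inequalities[OF \<Lambda>2 \<Sigma>(1) bounds(2)[OF k' z] gnz[OF z] gnz[OF shiftsph(1)[OF z]] gnz[OF shiftsph(2)[OF z]]
          est(1,2)[OF k' z] est(4,5)[OF k' z], folded E_def]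
      show "4 / 3 * log_plus (inverse (cmod (g z))) \<le> log_plus (cmod (f (z + 1))) + log_plus (cmod (f (z - 1))) + E"
        by (rule pi(1))
      show "min (min (log_plus (inverse (cmod (g (z - 1))))) (log_plus (inverse (cmod (g (z + 1)))))) (log_plus (cmod (f z))) \<le> E"
        by (rule pi(2))
      have "log_plus (cmod (ratfun_eval b1 z)) \<le> log_plus \<Lambda>" by (rule log_plus_mono[OF est(3)[OF k' z]])
      also have "\<dots> = ln \<Lambda>" using \<Lambda>2 by (simp add: log_plus_def max_def)
      finally have "log_plus (cmod (ratfun_eval b1 z)) \<le> ln \<Lambda>" .
      moreover have "ln 2 \<le> ln \<Lambda>" using \<Lambda>2 by (intro ln_mono) auto
      moreover have "0 \<le> ln \<Lambda>" "0 \<le> ln \<Sigma>" using \<Lambda>2 \<Sigma>(1) by auto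
      ultimately show "log_plus (cmod (ratfun_eval b1 z)) + ln 2 \<le> E" unfolding E_def by linarith
    next
      fix k assume "\<bar>k\<bar> \<le> int (Suc K)"
      show "irr f \<inter> sphere (c k) r = {}" "irr g \<inter> sphere (c k) r = {}" using sph by auto
    next
      fix e k assume "e \<in> Exc"
      thus "\<eta> \<le> cmod (e - c k)" by (intro \<eta>(3)) auto
    qed (use Exc r0 c(1) E0 \<eta> in \<open>auto simp: DD_def\<close>)
    \<comment> \<open>A crude bound is enough for the two end discs: values are estimated pointwise
      on the circle, and each pole is weighted by means of its guaranteed distance from the
      centre.\<close>
    have Tk: "nev_char_at f (c k) r \<le> \<Sigma> + 2 * Q * (Cs * exp ((\<rho> + 2) / 100))" if k: "\<bar>k\<bar> = int (Suc K)" for k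
    proof -
      have k': "\<bar>k\<bar> \<le> int (Suc K)" using k by simp
      have clean: "irr f \<inter> sphere (c k) r = {}" using sph by auto
      have "cmean (c k) r (\<lambda>z. log_plus (cmod (f z))) \<le> cmean (c k) r (\<lambda>_. \<Sigma>)"
      proof (intro cmean_mono continuous_on_log_plus continuous_on_norm continuous_on_sphere_regular clean continuous_on_const)
        fix z assume "z \<in> sphere (c k) r"
        from bounds(1)[OF k' this] show "log_plus (cmod (f z)) \<le> \<Sigma>"
          by (rule order_trans[OF log_plus_le_abs_ln, rotated]) simp
      qed (use r0 in simp)
      hence 1: "cmean (c k) r (\<lambda>z. log_plus (cmod (f z))) \<le> \<Sigma>" by simp
      have sub: "zpset f (c k) r \<subseteq> zpset f c0 R"
      proof
        fix a assume a: "a \<in> zpset f (c k) r"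
        have "cmod (a - c0) \<le> cmod (a - c k) + (cmod (c k) + cmod c0)"
          using norm_triangle_ineq[of "a - c k" "c k - c0"] norm_triangle_ineq4[of "c k" c0] by simp
        also have "\<dots> < r + ((real K + 1 + 1) + 1)"
          using a c0 ck[of k] k' by (intro add_less_le_mono add_mono) (auto simp: zpset_def dist_norm norm_minus_commute)
        also have "\<dots> \<le> R" using r(1) K R(1) by auto
        finally show "a \<in> zpset f c0 R" using a by (simp add: zpset_def dist_norm norm_minus_commute)
      qed
      have X: "ln (r / cmod (a - c k)) \<le> r * (Cs * exp ((\<rho> + 2) / 100))" if a: "a \<in> zpset f (c k) r" for a
      proof -
        have low: "exp (- \<bar>of_int k\<bar> / 100) / Cs \<le> cmod (a - c k)" using a by (intro c(5)) (simp add: zpset_def)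
        have low0: "0 < exp (- \<bar>of_int k\<bar> / 100) / Cs" using Cs by simp
        have pos: "0 < cmod (a - c k)" using low low0 by linarith
        have "ln (r / cmod (a - c k)) \<le> r / cmod (a - c k) - 1" using pos r0 by (intro ln_le_minus_one) auto
        also have "\<dots> \<le> r / (exp (- \<bar>of_int k\<bar> / 100) / Cs)"
          using divide_left_mono[OF low, of r] r0 mult_pos_pos[OF pos low0] by simp
        also have "\<dots> = r * (Cs * exp (\<bar>of_int k\<bar> / 100))" by (simp add: exp_minus field_simps)
        also have "\<dots> \<le> r * (Cs * exp ((\<rho> + 2) / 100))"
        proof -
          have "\<bar>real_of_int k\<bar> \<le> \<rho> + 2" using k K(2) by linarith
          thus ?thesis using r0 Cs by (intro mult_left_mono) auto
        qed
        finally show ?thesis .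
      qed
      have "Npole f (c k) r \<le> (\<Sum>a\<in>zpset f (c k) r. \<bar>of_int (zorder f a)\<bar> * (r * (Cs * exp ((\<rho> + 2) / 100))))"
        unfolding Npole_def using X by (intro sum_mono mult_mono ln_ratio_nonneg) (auto simp: zpset_def)
      also have "\<dots> \<le> (\<Sum>a\<in>zpset f c0 R. \<bar>of_int (zorder f a)\<bar> * (r * (Cs * exp ((\<rho> + 2) / 100))))"
        using sub nzf r0 Cs by (intro sum_mono2) auto
      also have "\<dots> = dsum f c0 R * (r * (Cs * exp ((\<rho> + 2) / 100)))" by (simp only: dsum_def sum_distrib_right)
      also have "\<dots> \<le> B * (2 * \<rho> * (Cs * exp ((\<rho> + 2) / 100)))"
        using R(2) r r0 Cs B1 elim(4) by (intro mult_mono mult_right_mono) (auto simp: controlled_def)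
      also have "\<dots> = 2 * Q * (Cs * exp ((\<rho> + 2) / 100))" by (simp add: Q_def)
      finally show ?thesis using 1 by (simp add: nev_char_at_def)
    qed
    have boundary: "wt (int (Suc K)) * (nev_char_at f (c (int (Suc K))) r + nev_char_at f (c (- int (Suc K))) r) \<le> 1"
    proof -
      define Qv where "Qv = \<rho> * (\<bar>Cv\<bar> * exp ((2 * \<rho> + 20) / 1000))"
      have "B \<le> \<bar>Cv\<bar> * exp ((2 * \<rho> + 20) / 1000)"
        using elim(3) unfolding B_def by (rule order_trans) (intro mult_right_mono; simp)
      hence QQ: "Q \<le> Qv" unfolding Q_def Qv_def using elim(4) by (intro mult_left_mono) auto
      have w: "wt (int (Suc K)) \<le> exp (- \<rho> / 5)"
      proof -
        have "1 + (- 1 / 5) \<le> exp (- 1 / 5 :: real)" by (rule exp_ge_add_one_self)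
        hence "wt (int (Suc K)) \<le> exp (- 1 / 5) ^ Suc K" unfolding wt_def abs_of_nat nat_int by (intro power_mono) auto
        also have "\<dots> = exp (real (Suc K) * (- 1 / 5))" by (rule exp_of_nat_mult[symmetric])
        also have "\<dots> \<le> exp (- \<rho> / 5)" using K(1) by simp
        finally show ?thesis .
      qed
      have "nev_char_at f (c (int (Suc K))) r + nev_char_at f (c (- int (Suc K))) r \<le> 2 * (\<Sigma> + 2 * Q * (Cs * exp ((\<rho> + 2) / 100)))"
        using Tk[of "int (Suc K)"] Tk[of "- int (Suc K)"] by simp
      also have "\<dots> \<le> 2 * (C5 * Qv ^ 44 + 2 * Qv * (Cs * exp ((\<rho> + 2) / 100)))"
      proof -
        have "C5 * Q ^ 44 \<le> C5 * Qv ^ 44" using QQ Q C51 by (intro mult_left_mono power_mono) auto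
        moreover have "2 * Q * (Cs * exp ((\<rho> + 2) / 100)) \<le> 2 * Qv * (Cs * exp ((\<rho> + 2) / 100))"
          using QQ Cs by (intro mult_right_mono) auto
        ultimately show ?thesis using order_trans[OF \<Sigma>(2)] by (intro mult_left_mono add_mono) auto
      qed
      finally have 1: "nev_char_at f (c (int (Suc K))) r + nev_char_at f (c (- int (Suc K))) r
          \<le> 2 * (C5 * Qv ^ 44 + 2 * Qv * (Cs * exp ((\<rho> + 2) / 100)))" .
      have "wt (int (Suc K)) * (nev_char_at f (c (int (Suc K))) r + nev_char_at f (c (- int (Suc K))) r)
          \<le> exp (- \<rho> / 5) * (2 * (C5 * Qv ^ 44 + 2 * Qv * (Cs * exp ((\<rho> + 2) / 100))))"
        using w 1 sph r0 by (intro mult_mono add_nonneg_nonneg nev_char_at_nonneg) auto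
      also have "\<dots> = 2 * exp (- \<rho> / 5) * (C5 * Qv ^ 44 + 2 * Qv * (Cs * exp ((\<rho> + 2) / 100)))" by (simp only: mult_ac)
      also have "\<dots> \<le> 1" using elim(1) by (simp only: Qv_def)
      finally show ?thesis .
    qed
    define l where "l = ln Q"
    have lQ: "l = ln \<rho> + ln B" unfolding l_def Q_def using elim(4) B1 by (intro ln_mult_pos) auto
    have lB: "ln B \<ge> 0" "ln \<rho> \<ge> 1"
    proof -
      show "ln B \<ge> 0" using B1 by simp
      have "exp 1 \<le> \<rho>" using elim(4) exp_le by linarith
      thus "ln \<rho> \<ge> 1" using elim(4) by (simp add: ln_ge_iff)
    qed
    have l1: "l \<ge> 1" using lQ lB by linarith
    have ln\<Lambda>: "ln \<Lambda> \<le> (real C2 + 1) * (A2 * l)"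
    proof -
      have "(2 * \<rho> + 8) / \<delta> = (2 * \<rho> + 8) * (1 / \<delta>)" by simp
      also have "\<dots> \<le> (12 * Q) * (C4 * Q ^ 15)" using \<delta>Q Q elim(4) \<delta> by (intro mult_mono) auto
      finally have "ln ((2 * \<rho> + 8) / \<delta>) \<le> ln ((12 * Q) * (C4 * Q ^ 15))" using base by (intro ln_mono) auto
      also have "\<dots> = (ln 12 + ln C4) + 16 * l" using Q C41 by (simp add: ln_mult_pos ln_realpow l_def)
      also have "\<dots> \<le> A2 * l"
      proof -
        have "ln 12 + ln C4 \<ge> 0" using C41 by simp
        hence "(ln 12 + ln C4) * 1 \<le> (ln 12 + ln C4) * l" using l1 by (intro mult_left_mono) auto
        thus ?thesis by (simp add: A2_def distrib_right)
      qed
      finally have "ln ((2 * \<rho> + 8) / \<delta>) \<le> A2 * l" .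
      moreover have "ln \<Lambda> = (real C2 + 1) * ln ((2 * \<rho> + 8) / \<delta>)" unfolding \<Lambda>_def using base by (subst ln_realpow) auto
      ultimately show ?thesis by (simp add: mult_left_mono)
    qed
    have ln\<Sigma>: "ln \<Sigma> \<le> (ln C5 + 44) * l"
    proof -
      have "ln \<Sigma> \<le> ln (C5 * Q ^ 44)" using \<Sigma> by (intro ln_mono) auto
      also have "\<dots> = ln C5 + 44 * l" using C51 Q by (simp add: ln_mult_pos ln_realpow l_def)
      also have "\<dots> \<le> ln C5 * l + 44 * l" using C51 l1 mult_left_mono[OF l1, of "ln C5"] by simp
      finally show ?thesis by (simp add: distrib_right)
    qed
    have lnr: "ln (r / \<eta>) \<le> (1 + ln 2 + ln (1 / \<eta>)) * l"
    proof -
      have "ln (r / \<eta>) \<le> ln (2 * \<rho> * (1 / \<eta>))" using r0 r(1) \<eta> elim(4) by (intro ln_mono) (auto intro!: divide_right_mono)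
      also have "\<dots> = ln 2 + ln \<rho> + ln (1 / \<eta>)" using elim(4) \<eta>(1) by (subst ln_mult_pos; (subst ln_mult_pos)?; simp)
      also have "\<dots> \<le> l + (ln 2 + ln (1 / \<eta>)) * 1" using lQ lB by simp
      also have "\<dots> \<le> l + (ln 2 + ln (1 / \<eta>)) * l"
      proof -
        have "0 \<le> ln (1 / \<eta>)" using \<eta> by simp
        thus ?thesis using l1 by (intro add_left_mono mult_left_mono) auto
      qed
      finally show ?thesis by (simp add: algebra_simps)
    qed
    have El: "E \<le> (A1 * A2 + 2 * (ln C5 + 44)) * l"
      using ln\<Lambda> ln\<Sigma> unfolding E_def A1_def by (simp add: algebra_simps)
    have "nev_char_at f (c 0) r \<le> 15 * 1 + 1008 * ((A1 * A2 + 2 * (ln C5 + 44)) * l + M * ((1 + ln 2 + ln (1 / \<eta>)) * l)) + 16 * (19 * C3)"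
      by (intro order_trans[OF main] add_mono mult_left_mono boundary El lnr M0 DDsum) simp_all
    also have "\<dots> \<le> 15 * l + 1008 * ((A1 * A2 + 2 * (ln C5 + 44)) * l + M * ((1 + ln 2 + ln (1 / \<eta>)) * l)) + 16 * (19 * C3) * l"
      using l1 C31 mult_left_mono[OF l1, of "16 * (19 * C3)"] by (intro add_mono) auto
    also have "\<dots> = CC * l" by (simp add: CC_def algebra_simps)
    finally have "nev_char_at f (c 0) r \<le> CC * (ln (V (2 * \<rho> + 20)) + ln \<rho>)" unfolding lQ B_def by (simp add: add.commute)
    moreover have "irr f \<inter> sphere (c 0) r = {}" using sph by auto
    ultimately show ?case using r(1) by blast
  qed
  thus ?thesis by blast
qed

end

section \<open>Functions of logarithmic growth are rational\<close>

lemma pole_sum_le_Npole: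
  assumes h: "nzm h" and c: "c \<notin> irr h" and r: "0 < r1" "r1 \<le> r - 1"
  shows "(\<Sum>a\<in>zpset h c r1. of_int (max 0 (- zorder h a))) \<le> r * Npole h c r"
proof -
  have "(\<Sum>a\<in>zpset h c r1. real_of_int (max 0 (- zorder h a))) \<le> (\<Sum>a\<in>zpset h c r1. r * (of_int (max 0 (- zorder h a)) * ln (r / cmod (a - c))))"
  proof (rule sum_mono)
    fix a assume a: "a \<in> zpset h c r1"
    hence pos: "0 < cmod (a - c)" "cmod (a - c) < r1"
      using c zpset_subset_irr by (auto simp: zpset_def dist_norm norm_minus_commute)
    have "ln (cmod (a - c) / r) \<le> cmod (a - c) / r - 1" using pos r by (intro ln_le_minus_one) auto
    also have "\<dots> \<le> (r - 1) / r - 1" using pos r by (simp add: divide_right_mono)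
    also have "\<dots> = - 1 / r" using r by (simp add: field_simps)
    finally have "1 \<le> r * ln (r / cmod (a - c))" using pos r by (simp add: ln_div field_simps)
    hence "of_int (max 0 (- zorder h a)) * 1 \<le> of_int (max 0 (- zorder h a)) * (r * ln (r / cmod (a - c)))"
      by (intro mult_left_mono) auto
    thus "real_of_int (max 0 (- zorder h a)) \<le> r * (of_int (max 0 (- zorder h a)) * ln (r / cmod (a - c)))" by (simp only: mult_ac)
  qed
  also have "\<dots> = r * (\<Sum>a\<in>zpset h c r1. of_int (max 0 (- zorder h a)) * ln (r / cmod (a - c)))" by (rule sum_distrib_left[symmetric])
  also have "\<dots> \<le> r * Npole h c r" unfolding Npole_def
    using r by (intro mult_left_mono sum_mono2 zpset_mono finite_zpset h mult_nonneg_nonneg ln_ratio_nonneg) (auto simp: zpset_def)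
  finally show ?thesis .
qed

lemma nev_char_at_parts_le:
  assumes "irr h \<inter> sphere c r = {}" "0 \<le> r" "nev_char_at h c r \<le> t"
  shows "cmean c r (\<lambda>z. log_plus (cmod (h z))) \<le> t" "Npole h c r \<le> t"
proof -
  have "cmean c r (\<lambda>z. log_plus (cmod (h z))) \<ge> 0"
    using assms by (intro cmean_nonneg continuous_on_log_plus continuous_on_norm continuous_on_sphere_regular) auto
  thus "cmean c r (\<lambda>z. log_plus (cmod (h z))) \<le> t" "Npole h c r \<le> t"
    using assms(3) Npole_nonneg[of h c r] by (auto simp: nev_char_at_def)
qed

text \<open>Converts the outcome of the first pass into a polynomial \<open>V\<close>, so that the
  logarithm taken in the second pass leaves a multiple of \<open>ln \<rho>\<close>. Two radii serve
  \<open>controlled_of_log_plus\<close>; a third, larger one is needed to count the poles.\<close>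

lemma growth_bound_of_linear_char:
  assumes f: "nzm f" and c: "c \<notin> irr f" and A: "A \<ge> 0"
    and ev: "eventually (\<lambda>\<rho>. \<exists>r\<in>{\<rho>..\<rho> + 1}. irr f \<inter> sphere c r = {} \<and> nev_char_at f c r \<le> A * \<rho>) at_top"
  obtains C where "C \<ge> 1" "growth_bound f c (\<lambda>\<rho>. C * (\<rho> + 3)\<^sup>2 * (A * (\<rho> + 5) + (\<rho> + 5) * (A * (\<rho> + 5)) + 1))"
proof -
  obtain C where C: "C \<ge> 1" "\<And>R0 R1 M P. 1 \<le> R0 \<Longrightarrow> R0 + 1 \<le> R1 \<Longrightarrow>
    irr f \<inter> sphere c R0 = {} \<Longrightarrow> irr f \<inter> sphere c R1 = {} \<Longrightarrow>
    cmean c R0 (\<lambda>z. log_plus (cmod (f z))) \<le> M \<Longrightarrow> cmean c R1 (\<lambda>z. log_plus (cmod (f z))) \<le> M \<Longrightarrow>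
    (\<Sum>a\<in>zpset f c R1. of_int (max 0 (- zorder f a))) \<le> P \<Longrightarrow>
    controlled f c R0 (C * R1\<^sup>2 * (M + P + 1))"
    by (rule controlled_of_log_plus[OF f, where c = c]) (rule that; assumption)
  obtain \<rho>0 where \<rho>0: "\<And>\<rho>. \<rho> \<ge> \<rho>0 \<Longrightarrow> \<exists>r\<in>{\<rho>..\<rho> + 1}. irr f \<inter> sphere c r = {} \<and> nev_char_at f c r \<le> A * \<rho>"
    using ev by (auto simp: eventually_at_top_linorder)
  have "eventually (\<lambda>\<rho>. \<exists>R\<in>{\<rho>..\<rho> + 1}. controlled f c R (C * (\<rho> + 3)\<^sup>2 * (A * (\<rho> + 5) + (\<rho> + 5) * (A * (\<rho> + 5)) + 1))) at_top"
    using eventually_ge_at_top[of "max 1 \<rho>0"]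
  proof eventually_elim
    case (elim \<rho>)
    have ex: "\<exists>r\<in>{\<rho> + t..\<rho> + (t + 1)}. irr f \<inter> sphere c r = {} \<and> nev_char_at f c r \<le> A * (\<rho> + 5)" if t: "0 \<le> t" "t \<le> 5" for t
    proof -
      obtain r where "r \<in> {\<rho> + t..\<rho> + t + 1}" "irr f \<inter> sphere c r = {}" "nev_char_at f c r \<le> A * (\<rho> + t)"
        using \<rho>0[of "\<rho> + t"] elim t by auto
      moreover have "A * (\<rho> + t) \<le> A * (\<rho> + 5)" using A t by (intro mult_left_mono) auto
      ultimately show ?thesis unfolding add.assoc[symmetric] by (meson order_trans)
    qed
    obtain R0 where R0: "R0 \<in> {\<rho>..\<rho> + 1}" "irr f \<inter> sphere c R0 = {}" "nev_char_at f c R0 \<le> A * (\<rho> + 5)" using ex[of 0] by force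
    obtain R1 where R1: "R1 \<in> {\<rho> + 2..\<rho> + 3}" "irr f \<inter> sphere c R1 = {}" "nev_char_at f c R1 \<le> A * (\<rho> + 5)" using ex[of 2] by force
    obtain R2 where R2: "R2 \<in> {\<rho> + 4..\<rho> + 5}" "irr f \<inter> sphere c R2 = {}" "nev_char_at f c R2 \<le> A * (\<rho> + 5)" using ex[of 4] by force
    have "controlled f c R0 (C * R1\<^sup>2 * (A * (\<rho> + 5) + (\<rho> + 5) * (A * (\<rho> + 5)) + 1))"
    proof (rule C(2))
      have "(\<Sum>a\<in>zpset f c R1. of_int (max 0 (- zorder f a))) \<le> R2 * Npole f c R2"
        using R1 R2 elim by (intro pole_sum_le_Npole f c) auto
      also have "\<dots> \<le> (\<rho> + 5) * (A * (\<rho> + 5))"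
        using R2 elim nev_char_at_parts_le(2)[OF R2(2) _ R2(3)] Npole_nonneg by (intro mult_mono) auto
      finally show "(\<Sum>a\<in>zpset f c R1. of_int (max 0 (- zorder f a))) \<le> (\<rho> + 5) * (A * (\<rho> + 5))" .
      show "cmean c R0 (\<lambda>z. log_plus (cmod (f z))) \<le> A * (\<rho> + 5)"
        using R0 elim by (intro nev_char_at_parts_le) auto
      show "cmean c R1 (\<lambda>z. log_plus (cmod (f z))) \<le> A * (\<rho> + 5)"
        using R1 elim by (intro nev_char_at_parts_le) auto
    qed (use R0 R1 elim in auto)
    moreover have "C * R1\<^sup>2 * (A * (\<rho> + 5) + (\<rho> + 5) * (A * (\<rho> + 5)) + 1) \<le> C * (\<rho> + 3)\<^sup>2 * (A * (\<rho> + 5) + (\<rho> + 5) * (A * (\<rho> + 5)) + 1)"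
      using R1 elim A C(1) by (intro mult_right_mono mult_left_mono power_mono add_nonneg_nonneg mult_nonneg_nonneg) auto
    ultimately show ?case using R0(1) unfolding controlled_def by force
  qed
  thus ?thesis using that C(1) unfolding growth_bound_def by blast
qed

text \<open>Every point within \<open>\<rho>\<close> of the centre has weight at least
  \<open>ln r / 2\<close> as soon as \<open>r\<close> exceeds the square of \<open>\<rho>\<close>. A
  counting function of order \<open>ln r\<close> therefore bounds the divisor independently of
  \<open>\<rho>\<close>.\<close>

lemma bounded_divisor_sum:
  fixes \<phi> :: "complex \<Rightarrow> real"
  assumes h: "nzm h" and c: "c \<notin> irr h" and \<phi>: "\<And>a. 0 \<le> \<phi> a" and C: "C \<ge> 0" and \<rho>: "1 \<le> \<rho>"
    and r: "\<rho>\<^sup>2 \<le> r" "r \<ge> 2" and le: "(\<Sum>a\<in>zpset h c r. \<phi> a * ln (r / cmod (a - c))) \<le> C * ln r"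
  shows "(\<Sum>a\<in>zpset h c \<rho>. \<phi> a) \<le> 2 * C"
proof -
  have lr: "ln r > 0" using r by simp
  have \<rho>r: "\<rho> \<le> r" using r \<rho> self_le_power[of \<rho> 2] by simp
  have "(\<Sum>a\<in>zpset h c \<rho>. \<phi> a) * (ln r / 2) = (\<Sum>a\<in>zpset h c \<rho>. \<phi> a * (ln r / 2))" by (rule sum_distrib_right)
  also have "\<dots> \<le> (\<Sum>a\<in>zpset h c \<rho>. \<phi> a * ln (r / cmod (a - c)))"
  proof (intro sum_mono mult_left_mono \<phi>)
    fix a assume a: "a \<in> zpset h c \<rho>"
    hence pos: "0 < cmod (a - c)" "cmod (a - c) < \<rho>"
      using c zpset_subset_irr by (auto simp: zpset_def dist_norm norm_minus_commute)
    have "2 * ln \<rho> = ln (\<rho>\<^sup>2)" using \<rho> by (simp add: ln_realpow)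
    also have "\<dots> \<le> ln r" using r \<rho> by (intro ln_mono) auto
    finally have "ln r / 2 \<le> ln r - ln \<rho>" by simp
    also have "\<dots> \<le> ln r - ln (cmod (a - c))" using ln_mono[OF less_imp_le[OF pos(2)] pos(1)] by simp
    also have "\<dots> = ln (r / cmod (a - c))" using pos r by (simp add: ln_div)
    finally show "ln r / 2 \<le> ln (r / cmod (a - c))" .
  qed
  also have "\<dots> \<le> (\<Sum>a\<in>zpset h c r. \<phi> a * ln (r / cmod (a - c)))"
    using \<rho>r \<phi> by (intro sum_mono2 zpset_mono finite_zpset h mult_nonneg_nonneg ln_ratio_nonneg) (auto simp: zpset_def)
  also note le
  finally have "(\<Sum>a\<in>zpset h c \<rho>. \<phi> a) * (ln r / 2) \<le> (2 * C) * (ln r / 2)" by simp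
  thus ?thesis using lr by (subst (asm) mult_le_cancel_right) auto
qed

lemma ratfun_of_divisor:
  assumes A: "finite A"
  obtains q where "\<And>z. z \<notin> A \<Longrightarrow> ratfun_eval q z = k * (\<Prod>a\<in>A. (z - a) powi n a)"
proof -
  define p1 p2 where "p1 = smult k (\<Prod>a\<in>A. [:- a, 1:] ^ nat (n a))" and "p2 = (\<Prod>a\<in>A. [:- a, 1:] ^ nat (- n a))"
  show ?thesis
  proof (rule that[of "Fract p1 p2"])
    fix z assume z: "z \<notin> A"
    have nz: "poly p2 z \<noteq> 0" using z A by (auto simp: p2_def poly_prod)
    have "ratfun_eval (Fract p1 p2) z = poly p1 z / poly p2 z" by (rule ratfun_eval_Fract[OF nz])
    also have "\<dots> = k * ((\<Prod>a\<in>A. (z - a) ^ nat (n a)) / (\<Prod>a\<in>A. (z - a) ^ nat (- n a)))"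
      by (simp add: p1_def p2_def poly_prod)
    also have "(\<Prod>a\<in>A. (z - a) ^ nat (n a)) / (\<Prod>a\<in>A. (z - a) ^ nat (- n a)) = (\<Prod>a\<in>A. (z - a) ^ nat (n a) / (z - a) ^ nat (- n a))"
      by (rule prod_dividef[symmetric])
    also have "\<dots> = (\<Prod>a\<in>A. (z - a) powi n a)"
    proof (rule prod.cong[OF refl])
      fix a
      show "(z - a) ^ nat (n a) / (z - a) ^ nat (- n a) = (z - a) powi n a"
        by (cases "n a \<ge> 0") (auto simp: power_int_def divide_inverse power_inverse)
    qed
    finally show "ratfun_eval (Fract p1 p2) z = k * (\<Prod>a\<in>A. (z - a) powi n a)" .
  qed
qed

text \<open>Only finitely many zeros and poles are possible, by \<open>bounded_divisor_sum\<close>.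
  Dividing them out leaves a zero-free function whose logarithm has a real part of logarithmic mean
  size, and Liouville's argument makes it constant.\<close>

lemma rational_of_log_growth:
  assumes f: "nzm f" and c: "c \<notin> irr f" and C: "C \<ge> 0"
    and ev: "eventually (\<lambda>\<rho>. \<exists>r\<in>{\<rho>..\<rho> + 1}. irr f \<inter> sphere c r = {} \<and> nev_char_at f c r \<le> C * ln \<rho>) at_top"
  shows "\<exists>q. \<forall>\<^sub>\<approx>z\<in>UNIV. f z = ratfun_eval q z"
proof -
  define L where "L = \<bar>lead_ln f c\<bar>"
  define C' where "C' = 3 * C + L"
  have C'0: "C' \<ge> 0" using C by (simp add: C'_def L_def)
  have n0: "zorder f c = 0" by (rule zorder_not_irr[OF c])
  have facts: "Npole f c r \<le> C' * ln r" "Nzero f c r \<le> C' * ln r" "cmean c r (\<lambda>z. \<bar>ln (cmod (f z))\<bar>) \<le> C' * ln r"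
    if r: "r \<ge> 3" "irr f \<inter> sphere c r = {}" "nev_char_at f c r \<le> C * ln r" for r
  proof -
    have "exp 1 \<le> r" using r(1) exp_le by linarith
    hence lr: "ln r \<ge> 1" using r(1) by (simp add: ln_ge_iff)
    have r0: "r > 0" "0 \<le> r" using r by auto
    have LL: "L \<le> L * ln r" using lr by (simp add: L_def mult_le_cancel_left1)
    have Cl: "0 \<le> C * ln r" using C lr by simp
    note parts = nev_char_at_parts_le[OF r(2) r0(2) r(3)]
    have J: "cmean c r (\<lambda>z. ln (cmod (f z))) = lead_ln f c + Nzero f c r - Npole f c r"
      using Jensen_formula[OF f r0(1) r(2)] n0 by simp
    have co: "continuous_on (sphere c r) (\<lambda>z. log_plus (cmod (f z)))" "continuous_on (sphere c r) (\<lambda>z. ln (cmod (f z)))"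
      using continuous_on_sphere_regular[OF r(2)] continuous_on_sphere_ln[OF r(2)]
      by (auto intro: continuous_on_log_plus continuous_on_norm)
    have le: "cmean c r (\<lambda>z. ln (cmod (f z))) \<le> cmean c r (\<lambda>z. log_plus (cmod (f z)))"
      using r0 co by (intro cmean_mono ln_le_log_plus) auto
    have CC: "C' * ln r = 3 * (C * ln r) + L * ln r" by (simp add: C'_def algebra_simps)
    have Lb: "lead_ln f c \<le> L" "- L \<le> lead_ln f c" by (auto simp: L_def)
    have L0: "0 \<le> L * ln r" using lr by (simp add: L_def)
    show "Npole f c r \<le> C' * ln r" unfolding CC using parts(2) Cl L0 by linarith
    show "Nzero f c r \<le> C' * ln r" unfolding CC using J le parts Lb Cl LL by (simp add: nev_char_at_def)
    have "cmean c r (\<lambda>z. \<bar>ln (cmod (f z))\<bar>) = cmean c r (\<lambda>z. 2 * log_plus (cmod (f z)) - ln (cmod (f z)))"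
      using r0 r(2) by (intro cmean_cong abs_ln_eq_log_plus) (auto simp: irr_def)
    also have "\<dots> = cmean c r (\<lambda>z. 2 * log_plus (cmod (f z))) - cmean c r (\<lambda>z. ln (cmod (f z)))"
      by (rule cmean_diff[OF continuous_on_mult_left[OF co(1)] co(2) r0(2)])
    also have "\<dots> = 2 * cmean c r (\<lambda>z. log_plus (cmod (f z))) - cmean c r (\<lambda>z. ln (cmod (f z)))" by (simp only: cmean_cmult)
    also have "\<dots> \<le> C' * ln r" unfolding CC using J parts Lb LL Nzero_nonneg[of f c r] by linarith
    finally show "cmean c r (\<lambda>z. \<bar>ln (cmod (f z))\<bar>) \<le> C' * ln r" .
  qed
  obtain \<rho>0 where \<rho>0: "\<rho>0 \<ge> 3" "\<And>\<rho>. \<rho> \<ge> \<rho>0 \<Longrightarrow> \<exists>r\<in>{\<rho>..\<rho> + 1}. irr f \<inter> sphere c r = {} \<and> nev_char_at f c r \<le> C * ln r"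
  proof -
    obtain N where N: "\<And>\<rho>. \<rho> \<ge> N \<Longrightarrow> \<exists>r\<in>{\<rho>..\<rho> + 1}. irr f \<inter> sphere c r = {} \<and> nev_char_at f c r \<le> C * ln \<rho>"
      using ev by (auto simp: eventually_at_top_linorder)
    show ?thesis
    proof (rule that[of "max 3 N"])
      fix \<rho> assume \<rho>: "max 3 N \<le> \<rho>"
      then obtain r where r: "r \<in> {\<rho>..\<rho> + 1}" "irr f \<inter> sphere c r = {}" "nev_char_at f c r \<le> C * ln \<rho>" using N[of \<rho>] by auto
      have "C * ln \<rho> \<le> C * ln r" using r \<rho> C by (intro mult_left_mono ln_mono) auto
      thus "\<exists>r\<in>{\<rho>..\<rho> + 1}. irr f \<inter> sphere c r = {} \<and> nev_char_at f c r \<le> C * ln r" using r by force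
    qed simp
  qed
  define A where "A = {a. zorder f a \<noteq> 0}"
  define N where "N = 4 * C'"
  have dN: "dsum f c \<rho> \<le> N" if \<rho>: "\<rho> \<ge> 1" for \<rho>
  proof -
    obtain r where r: "r \<in> {max \<rho>0 (\<rho>\<^sup>2)..max \<rho>0 (\<rho>\<^sup>2) + 1}" "irr f \<inter> sphere c r = {}" "nev_char_at f c r \<le> C * ln r"
      using \<rho>0(2)[of "max \<rho>0 (\<rho>\<^sup>2)"] by auto
    have r3: "r \<ge> 3" "\<rho>\<^sup>2 \<le> r" using r(1) \<rho>0(1) by auto
    note fa = facts[OF r3(1) r(2,3)]
    have "(\<Sum>a\<in>zpset f c \<rho>. real_of_int (max 0 (- zorder f a))) \<le> 2 * C'"
      using fa(1) r3 by (intro bounded_divisor_sum[OF f c _ C'0 \<rho> r3(2)]) (auto simp: Npole_def)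
    moreover have "(\<Sum>a\<in>zpset f c \<rho>. real_of_int (max 0 (zorder f a))) \<le> 2 * C'"
      using fa(2) r3 by (intro bounded_divisor_sum[OF f c _ C'0 \<rho> r3(2)]) (auto simp: Nzero_def)
    moreover have "dsum f c \<rho> = (\<Sum>a\<in>zpset f c \<rho>. of_int (max 0 (zorder f a)) + of_int (max 0 (- zorder f a)))"
      unfolding dsum_def by (intro sum.cong refl) (auto simp: max_def abs_if)
    ultimately show ?thesis unfolding N_def sum.distrib by linarith
  qed
  have fA: "finite A"
  proof -
    have "card G \<le> nat \<lceil>N\<rceil>" if G: "G \<subseteq> A" "finite G" for G
    proof -
      obtain b where b: "\<And>x. x \<in> G \<Longrightarrow> cmod x \<le> b" using finite_imp_bounded[OF G(2)] by (auto simp: bounded_iff)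
      define \<rho> where "\<rho> = max 1 (b + cmod c + 1)"
      have "G \<subseteq> zpset f c \<rho>"
      proof
        fix x assume x: "x \<in> G"
        have "cmod (c - x) \<le> cmod c + cmod x" by (rule norm_triangle_ineq4)
        also have "\<dots> < \<rho>" using b[OF x] by (simp add: \<rho>_def)
        finally show "x \<in> zpset f c \<rho>" using x G by (auto simp: zpset_def A_def dist_norm)
      qed
      hence "card G \<le> card (zpset f c \<rho>)" using f by (intro card_mono) auto
      hence "real (card G) \<le> N" using card_zpset_le_dsum[of f c \<rho>] dN[of \<rho>] by (simp add: \<rho>_def)
      thus ?thesis by linarith
    qed
    thus ?thesis using finite_if_finite_subsets_card_bdd[of A "nat \<lceil>N\<rceil>"] by blast
  qed
  obtain b where b: "\<And>x. x \<in> A \<Longrightarrow> cmod (x - c) < b" "b > 0"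
  proof -
    have "finite ((\<lambda>x. cmod (x - c)) ` A)" using fA by blast
    then obtain b where "\<forall>y\<in>(\<lambda>x. cmod (x - c)) ` A. y \<le> b" using bdd_above_finite[of "(\<lambda>x. cmod (x - c)) ` A"] by (auto simp: bdd_above_def)
    thus ?thesis using that[of "max 1 (b + 1)"] by force
  qed
  define q where "q = (\<lambda>z. \<Prod>a\<in>A. (z - a) powi zorder f a)"
  define n where "n = (\<lambda>a. real_of_int (zorder f a))"
  define D where "D = C' + 2 * (\<Sum>a\<in>A. \<bar>n a\<bar>) * 2"
  have D0: "D \<ge> 0" unfolding D_def using C'0 by (intro add_nonneg_nonneg mult_nonneg_nonneg sum_nonneg) auto
  have Airr: "A \<subseteq> irr f" using zorder_not_irr by (auto simp: A_def)
  have q0: "q z \<noteq> 0" if "z \<notin> irr f" for z using that Airr fA by (auto simp: q_def)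
  have const: "f z / q z = f c / q c" if z: "z \<notin> irr f" for z
  proof -
    \<comment> \<open>The logarithm \<open>G\<close> depends on the chosen disc, so constancy is
      proved for the quotient itself: on every large disc \<open>X\<close> equals
      \<open>exp (G z - G c)\<close>.\<close>
    define X where "X = (f z / q z) / (f c / q c)"
    define p where "p = cmod (z - c) + 1"
    have p0: "p > 0" by (simp add: p_def add_nonneg_pos)
    have close: "cmod (X - 1) < e" if e: "e > 0" for e
    proof -
      have "isCont exp (0::complex)" by simp
      hence "(exp \<longlongrightarrow> (1::complex)) (at 0)" by (simp add: isCont_def)
      then obtain \<delta> where \<delta>: "\<delta> > 0" "\<And>w::complex. w \<noteq> 0 \<Longrightarrow> cmod w < \<delta> \<Longrightarrow> cmod (exp w - 1) < e"
        using e unfolding LIM_def by (auto simp: dist_norm)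
      \<comment> \<open>The kernel of \<open>deriv_bound_cmean_Re\<close> decays like 1 / \<rho> and
        beats the logarithmic mean of \<open>Re G\<close>, so the increment of \<open>G\<close> from
        \<open>c\<close> to \<open>z\<close> tends to 0.\<close>
      have "eventually (\<lambda>\<rho>. p * (2 * (\<rho> + 1) / (\<rho> - p)\<^sup>2 * (D * ln (\<rho> + 1))) < \<delta>) at_top"
        if "D > 0" for D using that p0 \<delta>(1) by real_asymp
      hence "eventually (\<lambda>\<rho>. p * (2 * (\<rho> + 1) / (\<rho> - p)\<^sup>2 * (D * ln (\<rho> + 1))) < \<delta>) at_top"
        using D0 \<delta>(1) by (cases "D = 0") auto
      with eventually_ge_at_top[of "max \<rho>0 (max (p + 1) b)"]
      have "eventually (\<lambda>\<rho>. \<rho> \<ge> max \<rho>0 (max (p + 1) b) \<and> p * (2 * (\<rho> + 1) / (\<rho> - p)\<^sup>2 * (D * ln (\<rho> + 1))) < \<delta>) at_top"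
        by eventually_elim simp
      then obtain \<rho> where \<rho>: "\<rho> \<ge> \<rho>0" "\<rho> \<ge> p + 1" "\<rho> \<ge> b" "p * (2 * (\<rho> + 1) / (\<rho> - p)\<^sup>2 * (D * ln (\<rho> + 1))) < \<delta>"
        by (auto simp: eventually_at_top_linorder)
      obtain r where r: "r \<in> {\<rho>..\<rho> + 1}" "irr f \<inter> sphere c r = {}" "nev_char_at f c r \<le> C * ln r" using \<rho>0(2)[OF \<rho>(1)] by auto
      have r3: "r \<ge> 3" "r > 0" "r \<ge> 1" using r(1) \<rho>(1) \<rho>0(1) by auto
      have zpA: "zpset f c r = A"
        using b(1) r(1) \<rho>(3) by (force simp: zpset_def A_def dist_norm norm_minus_commute)
      obtain G r' where G: "r' > r" "G holomorphic_on ball c r'" "irr f \<inter> ball c r' \<subseteq> ball c r"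
        "\<And>w. w \<in> ball c r' - irr f \<Longrightarrow> f w = exp (G w) * (\<Prod>a\<in>zpset f c r. (w - a) powi zorder f a)"
        by (rule meromorphic_factorization[OF f r3(2) r(2)]) (rule that; assumption)
      have Gq: "f w = exp (G w) * q w" if "w \<in> ball c r' - irr f" for w
        using G(4)[OF that] by (simp only: zpA q_def)
      have cG: "continuous_on (cball c r) G"
        using G(1) by (intro holomorphic_on_imp_continuous_on holomorphic_on_subset[OF G(2)]) auto
      have hG: "G holomorphic_on ball c r" using G(1) by (intro holomorphic_on_subset[OF G(2)]) auto
      have cGs: "continuous_on (sphere c r) G" by (rule continuous_on_subset[OF cG]) auto
      have Ar: "cmod (a - c) < r" if "a \<in> A" for a using b(1)[OF that] r(1) \<rho>(3) by auto
      have mean: "cmean c r (\<lambda>w. \<bar>Re (G w)\<bar>) \<le> D * ln r"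
      proof -
        have cl: "continuous_on (sphere c r) (\<lambda>w. \<bar>n a\<bar> * \<bar>ln (cmod (w - a))\<bar>)" if "a \<in> A" for a
          using Ar[OF that] by (intro continuous_on_mult_left continuous_on_rabs continuous_on_ln continuous_intros) (auto simp: dist_norm norm_minus_commute)
        have cf: "continuous_on (sphere c r) (\<lambda>w. \<bar>ln (cmod (f w))\<bar>)"
          by (intro continuous_on_rabs continuous_on_sphere_ln r)
        have "cmean c r (\<lambda>w. \<bar>Re (G w)\<bar>) \<le> cmean c r (\<lambda>w. \<bar>ln (cmod (f w))\<bar> + (\<Sum>a\<in>A. \<bar>n a\<bar> * \<bar>ln (cmod (w - a))\<bar>))"
        proof (rule cmean_mono)
          fix w assume w: "w \<in> sphere c r"
          have wi: "w \<in> ball c r' - irr f" using w r(2) G(1) by auto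
          have "ln (cmod (f w)) = Re (G w) + (\<Sum>a\<in>A. n a * ln (cmod (w - a)))"
            unfolding n_def using wi Airr by (intro ln_norm_factorization fA) (auto simp: Gq[OF wi] q_def)
          moreover have "\<bar>\<Sum>a\<in>A. n a * ln (cmod (w - a))\<bar> \<le> (\<Sum>a\<in>A. \<bar>n a\<bar> * \<bar>ln (cmod (w - a))\<bar>)"
            using sum_abs[of "\<lambda>a. n a * ln (cmod (w - a))" A] by (simp add: abs_mult)
          ultimately show "\<bar>Re (G w)\<bar> \<le> \<bar>ln (cmod (f w))\<bar> + (\<Sum>a\<in>A. \<bar>n a\<bar> * \<bar>ln (cmod (w - a))\<bar>)" by linarith
        qed (use r3 cGs cf cl in \<open>auto intro!: continuous_on_add continuous_on_sum continuous_on_rabs continuous_on_Re\<close>)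
        also have "\<dots> = cmean c r (\<lambda>w. \<bar>ln (cmod (f w))\<bar>) + (\<Sum>a\<in>A. \<bar>n a\<bar> * cmean c r (\<lambda>w. \<bar>ln (cmod (w - a))\<bar>))"
          using r3 fA cl cf by (subst cmean_add) (auto intro!: continuous_on_sum simp: cmean_sum cmean_cmult)
        also have "\<dots> \<le> C' * ln r + (\<Sum>a\<in>A. \<bar>n a\<bar> * (2 * ln (2 * r)))"
          using Ar r3 by (intro add_mono facts(3)[OF r3(1) r(2,3)] sum_mono mult_left_mono cmean_abs_ln_dist_le) auto
        also have "\<dots> = C' * ln r + (\<Sum>a\<in>A. \<bar>n a\<bar>) * (2 * ln (2 * r))" by (simp only: sum_distrib_right)
        also have "\<dots> \<le> C' * ln r + (\<Sum>a\<in>A. \<bar>n a\<bar>) * (2 * (2 * ln r))"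
        proof -
          have "ln (2 * r) = ln 2 + ln r" using r3 by (intro ln_mult_pos) auto
          also have "\<dots> \<le> 2 * ln r" using r3 ln_mono[of 2 r] by simp
          finally show ?thesis by (intro add_left_mono mult_left_mono sum_nonneg) auto
        qed
        also have "\<dots> = D * ln r" by (simp add: D_def algebra_simps)
        finally show ?thesis .
      qed
      have inb: "cmod (w - c) \<le> p" if "w \<in> closed_segment c z" for w
      proof -
        have "cmod (w - c) \<le> cmod (z - c)" using segment_bound(1)[OF that] by (simp add: norm_minus_commute)
        thus ?thesis by (simp add: p_def)
      qed
      have rp: "r > p" using r(1) \<rho>(2) by auto
      define Bd where "Bd = 2 * (\<rho> + 1) / (\<rho> - p)\<^sup>2 * (D * ln (\<rho> + 1))"
      have dG: "cmod (deriv G w) \<le> Bd" if w: "w \<in> closed_segment c z" for w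
      proof -
        have wb: "w \<in> ball c r" using inb[OF w] rp by (simp add: dist_norm norm_minus_commute)
        have "cmod (deriv G w) \<le> 2 * r / (r - cmod (w - c))\<^sup>2 * cmean c r (\<lambda>w. \<bar>Re (G w)\<bar>)"
          by (rule deriv_bound_cmean_Re[OF cG hG wb])
        also have "\<dots> \<le> 2 * (\<rho> + 1) / (\<rho> - p)\<^sup>2 * (D * ln (\<rho> + 1))"
        proof (rule mult_mono)
          show "2 * r / (r - cmod (w - c))\<^sup>2 \<le> 2 * (\<rho> + 1) / (\<rho> - p)\<^sup>2"
            using r(1) r3 inb[OF w] \<rho>(2) by (intro frac_le power_mono) auto
          have "D * ln r \<le> D * ln (\<rho> + 1)" using r(1) r3 D0 by (intro mult_left_mono ln_mono) auto
          thus "cmean c r (\<lambda>w. \<bar>Re (G w)\<bar>) \<le> D * ln (\<rho> + 1)" using mean by linarith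
          show "0 \<le> cmean c r (\<lambda>w. \<bar>Re (G w)\<bar>)" using r3 cGs by (intro cmean_nonneg continuous_on_rabs continuous_on_Re) auto
        qed (use \<rho>(2) p0 in auto)
        finally show ?thesis by (simp add: Bd_def)
      qed
      have "cmod (G z - G c) \<le> Bd * cmod (z - c)"
      proof (rule field_differentiable_bound[of "closed_segment c z"])
        fix w assume w: "w \<in> closed_segment c z"
        have "w \<in> ball c r'" using inb[OF w] rp G(1) by (simp add: dist_norm norm_minus_commute)
        thus "(G has_field_derivative deriv G w) (at w within closed_segment c z)"
          using holomorphic_derivI[OF G(2) open_ball] by blast
        show "cmod (deriv G w) \<le> Bd" by (rule dG[OF w])
      qed auto
      also have "\<dots> \<le> Bd * p" using order_trans[OF norm_ge_zero dG[of c]] by (intro mult_left_mono) (auto simp: p_def)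
      also have "\<dots> < \<delta>" using \<rho>(4) by (simp only: Bd_def mult.commute)
      finally have small: "cmod (G z - G c) < \<delta>" .
      have zb: "z \<in> ball c r' - irr f" "c \<in> ball c r' - irr f"
        using inb[of z] rp G(1) z c r3 by (auto simp: dist_norm norm_minus_commute)
      have "X = exp (G z - G c)"
        unfolding X_def Gq[OF zb(1)] Gq[OF zb(2)] using q0[OF z] q0[OF c] by (simp add: exp_diff)
      thus ?thesis using \<delta>(2)[of "G z - G c"] small e by (cases "G z - G c = 0") auto
    qed
    have "X = 1"
    proof (rule ccontr)
      assume "X \<noteq> 1"
      thus False using close[of "cmod (X - 1)"] by simp
    qed
    moreover have "f c / q c \<noteq> 0" using c q0[OF c] by (auto simp: irr_def)
    ultimately show ?thesis by (auto simp: X_def frac_eq_eq mult.commute)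
  qed
  obtain Q where Q: "\<And>z. z \<notin> A \<Longrightarrow> ratfun_eval Q z = (f c / q c) * (\<Prod>a\<in>A. (z - a) powi zorder f a)"
    by (rule ratfun_of_divisor[OF fA]) (rule that)
  have "\<forall>\<^sub>\<approx>z\<in>UNIV. z \<notin> irr f" using irr_sparse[OF f] by (simp add: eventually_cosparse)
  hence "\<forall>\<^sub>\<approx>z\<in>UNIV. f z = ratfun_eval Q z"
  proof eventually_elim
    case (elim z)
    have "f z = (f c / q c) * q z" using const[OF elim] q0[OF elim] by (simp add: field_simps)
    also have "\<dots> = ratfun_eval Q z" using Q[of z] elim Airr fun_cong[OF q_def, of z] by (metis subsetD)
    finally show ?case .
  qed
  thus ?thesis by blast
qed

context delay_equation
begin

lemma subnormal_imp_rational: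
  assumes sub: "subnormal f"
  shows "\<exists>q. \<forall>\<^sub>\<approx>z\<in>UNIV. f z = ratfun_eval q z"
proof (rule uniform_estimates, goal_cases)
  case (1 Z C2)
  note Z = 1
  show ?case
  proof (rule order_inequalities, goal_cases)
    case (1 Exc)
    note Exc = this
    have V1: "growth_bound f 0 (\<lambda>\<rho>. exp (\<rho> / 1000))" by (rule subnormal_growth_bound[OF nzf sub])
    have sparse: "irr f \<union> irr g \<union> Exc \<union> Z sparse_in UNIV"
      using irr_sparse[OF nzf] irr_sparse[OF nzg] finite_imp_sparse[OF Exc(1)] finite_imp_sparse[OF Z(1)]
      by (intro sparse_in_union')
    obtain s Cs where s: "s \<in> {0..1::real}" "Cs \<ge> 1" "\<And>k::int. complex_of_real (s + of_int k) \<notin> irr f \<union> irr g \<union> Exc \<union> Z"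
      "\<And>k::int. log_plus (cmod (f (complex_of_real (s + of_int k)))) \<le> Cs * exp (\<bar>of_int k\<bar> / 100)"
      "\<And>(k::int) e. zorder f e \<noteq> 0 \<Longrightarrow> exp (- \<bar>of_int k\<bar> / 100) / Cs \<le> cmod (e - complex_of_real (s + of_int k))"
      by (rule good_centre[OF nzf V1 sparse]) (rule that; assumption)
    let ?c = "complex_of_real (s + of_int 0)"
    have c_irr: "?c \<notin> irr f" using s(3)[of 0] by blast
    have c1: "cmod ?c \<le> 1" using s(1) unfolding norm_of_real by auto
    have notin: "complex_of_real (s + of_int k) \<notin> irr g" "complex_of_real (s + of_int k) \<notin> Exc" "complex_of_real (s + of_int k) \<notin> Z" for k :: int
      using s(3)[of k] by blast+
    \<comment> \<open>The centre and the exceptional data are fixed here once; the two passes differ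
      only in \<open>V\<close>, \<open>c0\<close> and \<open>Cv\<close>.\<close>
    have step: "\<exists>C. eventually (\<lambda>\<rho>. \<exists>r\<in>{\<rho>..\<rho> + 1}. irr f \<inter> sphere ?c r = {} \<and>
        nev_char_at f ?c r \<le> C * (ln (V (2 * \<rho> + 20)) + ln \<rho>)) at_top"
      if "growth_bound f c0 V" "\<And>\<rho>. \<rho> \<ge> 0 \<Longrightarrow> 1 \<le> V \<rho>" "eventually (\<lambda>\<rho>. V \<rho> \<le> Cv * exp (\<rho> / 1000)) at_top" "cmod c0 \<le> 1" for c0 V Cv
      by (rule growth_improvement[OF that(1) that(2) that(3) that(4) s(1,2) Exc(1) Exc(2) Exc(3) Exc(4) Z(1) Z(2) Z(3) notin s(4) s(5)])
    obtain A where A: "eventually (\<lambda>\<rho>. \<exists>r\<in>{\<rho>..\<rho> + 1}. irr f \<inter> sphere ?c r = {} \<and>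
        nev_char_at f ?c r \<le> A * (ln (exp ((2 * \<rho> + 20) / 1000)) + ln \<rho>)) at_top"
      using step[OF V1, of 1] by auto
    have ev1: "eventually (\<lambda>\<rho>. \<exists>r\<in>{\<rho>..\<rho> + 1}. irr f \<inter> sphere ?c r = {} \<and> nev_char_at f ?c r \<le> \<bar>A\<bar> * \<rho>) at_top"
    proof -
      have "eventually (\<lambda>\<rho>::real. (2 * \<rho> + 20) / 1000 + ln \<rho> \<le> \<rho>) at_top" by real_asymp
      moreover have "eventually (\<lambda>\<rho>::real. 0 \<le> (2 * \<rho> + 20) / 1000 + ln \<rho>) at_top" by real_asymp
      ultimately show ?thesis using A
      proof eventually_elim
        case (elim \<rho>)
        then obtain r where r: "r \<in> {\<rho>..\<rho> + 1}" "irr f \<inter> sphere ?c r = {}"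
          "nev_char_at f ?c r \<le> A * ((2 * \<rho> + 20) / 1000 + ln \<rho>)" by auto
        have "A * ((2 * \<rho> + 20) / 1000 + ln \<rho>) \<le> \<bar>A\<bar> * ((2 * \<rho> + 20) / 1000 + ln \<rho>)"
          using elim(2) by (intro mult_right_mono) auto
        also have "\<dots> \<le> \<bar>A\<bar> * \<rho>" using elim(1) by (intro mult_left_mono) auto
        finally show ?case using r by (meson order_trans)
      qed
    qed
    obtain B where B: "B \<ge> 1" "growth_bound f ?c (\<lambda>\<rho>. B * (\<rho> + 3)\<^sup>2 * (\<bar>A\<bar> * (\<rho> + 5) + (\<rho> + 5) * (\<bar>A\<bar> * (\<rho> + 5)) + 1))"
      by (rule growth_bound_of_linear_char[OF nzf c_irr abs_ge_zero ev1])
    let ?V = "\<lambda>\<rho>. B * (\<rho> + 3)\<^sup>2 * (\<bar>A\<bar> * (\<rho> + 5) + (\<rho> + 5) * (\<bar>A\<bar> * (\<rho> + 5)) + 1)"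
    have V2: "1 \<le> ?V \<rho>" if "\<rho> \<ge> 0" for \<rho>
    proof -
      have "1 * 1 * 1 \<le> ?V \<rho>" using that B(1) by (intro mult_mono) (auto intro: one_le_power)
      thus ?thesis by simp
    qed
    have V3: "eventually (\<lambda>\<rho>. ?V \<rho> \<le> 1 * exp (\<rho> / 1000)) at_top"
    proof (cases "A = 0")
      case True
      have "eventually (\<lambda>\<rho>. B * (\<rho> + 3)\<^sup>2 \<le> exp (\<rho> / 1000)) at_top" using B(1) by real_asymp
      thus ?thesis using True by simp
    next
      case False
      have "eventually (\<lambda>\<rho>. B * (\<rho> + 3)\<^sup>2 * (q * (\<rho> + 5) + (\<rho> + 5) * (q * (\<rho> + 5)) + 1) \<le> 1 * exp (\<rho> / 1000)) at_top"
        if "q > 0" for q using B(1) that by real_asymp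
      from this[of "\<bar>A\<bar>"] show ?thesis using False by simp
    qed
    obtain C where C: "eventually (\<lambda>\<rho>. \<exists>r\<in>{\<rho>..\<rho> + 1}. irr f \<inter> sphere ?c r = {} \<and>
        nev_char_at f ?c r \<le> C * (ln (?V (2 * \<rho> + 20)) + ln \<rho>)) at_top"
      using step[OF B(2) V2 V3 c1] by blast
    \<comment> \<open>\<open>?V\<close> is a polynomial of degree at most 4, so the factor 5 leaves
      room for its constants.\<close>
    have lnV: "eventually (\<lambda>\<rho>. ln (?V (2 * \<rho> + 20)) \<le> 5 * ln \<rho>) at_top"
    proof (cases "A = 0")
      case True
      have "eventually (\<lambda>\<rho>. ln (B * (2 * \<rho> + 20 + 3)\<^sup>2) \<le> 5 * ln \<rho>) at_top" using B(1) by real_asymp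
      thus ?thesis using True by simp
    next
      case False
      have "eventually (\<lambda>\<rho>. ln (B * (2 * \<rho> + 20 + 3)\<^sup>2 * (q * (2 * \<rho> + 20 + 5) + (2 * \<rho> + 20 + 5) * (q * (2 * \<rho> + 20 + 5)) + 1)) \<le> 5 * ln \<rho>) at_top"
        if "q > 0" for q using B(1) that by real_asymp
      from this[of "\<bar>A\<bar>"] show ?thesis using False by simp
    qed
    have "eventually (\<lambda>\<rho>. \<exists>r\<in>{\<rho>..\<rho> + 1}. irr f \<inter> sphere ?c r = {} \<and> nev_char_at f ?c r \<le> (\<bar>C\<bar> * 6) * ln \<rho>) at_top"
      using C lnV eventually_ge_at_top[of 1]
    proof eventually_elim
      case (elim \<rho>)
      then obtain r where r: "r \<in> {\<rho>..\<rho> + 1}" "irr f \<inter> sphere ?c r = {}"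
          "nev_char_at f ?c r \<le> C * (ln (?V (2 * \<rho> + 20)) + ln \<rho>)" by blast
      have "0 \<le> ln (?V (2 * \<rho> + 20)) + ln \<rho>" using V2[of "2 * \<rho> + 20"] elim(3) by (intro add_nonneg_nonneg ln_ge_zero) auto
      hence "C * (ln (?V (2 * \<rho> + 20)) + ln \<rho>) \<le> \<bar>C\<bar> * (ln (?V (2 * \<rho> + 20)) + ln \<rho>)"
        by (intro mult_right_mono) auto
      also have "\<dots> \<le> \<bar>C\<bar> * (6 * ln \<rho>)" using elim(2) by (intro mult_left_mono) auto
      finally have "nev_char_at f ?c r \<le> (\<bar>C\<bar> * 6) * ln \<rho>" using r(3) by (simp only: mult.assoc)
      thus ?case using r(1,2) by blast
    qed
    from rational_of_log_growth[OF nzf c_irr _ this] show ?case by simp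
  qed
qed

end

text \<open>The plane without a sparse set is still connected, so a vanishing derivative forces one
  constant on all of it. This ensures that the Schwarzian derivative of a transcendental function
  has a denominator that is not identically zero.\<close>

lemma deriv_zero_imp_rational:
  assumes f: "f meromorphic_on UNIV" and d: "\<forall>\<^sub>\<approx>z\<in>UNIV. deriv f z = 0"
  shows "\<exists>q. \<forall>\<^sub>\<approx>z\<in>UNIV. f z = ratfun_eval q z"
proof -
  define D where "D = {z. \<not> (f analytic_on {z} \<and> deriv f z = 0)}"
  have "\<forall>\<^sub>\<approx>z\<in>UNIV. f analytic_on {z} \<and> deriv f z = 0"
    using meromorphic_on_imp_analytic_cosparse[OF f] d by eventually_elim simp
  hence sp: "D sparse_in UNIV" unfolding D_def by (simp add: eventually_cosparse)
  have op: "open (UNIV - D)" using sparse_in_UNIV_imp_closed[OF sp] by blast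
  have con: "connected (UNIV - D)" using sp by (intro sparse_imp_connected) auto
  have an: "f analytic_on UNIV - D" by (subst analytic_on_analytic_at) (auto simp: D_def)
  have "(f has_field_derivative 0) (at x)" if "x \<in> UNIV - D" for x
  proof -
    have "f analytic_on {x}" "deriv f x = 0" using that by (auto simp: D_def)
    thus ?thesis by (metis analytic_on_imp_differentiable_at field_differentiable_derivI insertI1)
  qed
  hence "f constant_on UNIV - D"
    using con op an by (intro has_field_derivative_0_imp_constant_on) auto
  then obtain k where k: "\<And>x. x \<notin> D \<Longrightarrow> f x = k" by (auto simp: constant_on_def)
  have "ratfun_eval (Fract [:k:] 1) z = k" for z by (subst ratfun_eval_Fract) auto
  moreover have "\<forall>\<^sub>\<approx>z\<in>UNIV. z \<notin> D" using sp by (simp add: eventually_cosparse)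
  ultimately have "\<forall>\<^sub>\<approx>z\<in>UNIV. f z = ratfun_eval (Fract [:k:] 1) z" by (auto elim!: eventually_mono simp: k)
  thus ?thesis by blast
qed

theorem theorem3:
  fixes a b1 :: ratfun
    and P Q Qhat :: "ratfun poly"
    and f :: "complex \<Rightarrow> complex"
  assumes "coprime P Q"
    and "transcendental_meromorphic f"
    and "subnormal f"
    and "\<forall>\<^sub>\<approx>z\<in>UNIV. f (z + 1) * f (z - 1) + ratfun_eval a z * schwarzian f z
                     = ratpoly_eval P z (f z) / ratpoly_eval Q z (f z)"
    and "Q = [:- b1, 1:] ^ 2 * Qhat"
    and "coprime Qhat [:- b1, 1:]"
    and "(degree P = degree Q + 1 \<and> finite (zeros_of_mult 2 (\<lambda>z. f z - ratfun_eval b1 z)))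
         \<or> degree P = degree Q + 2"
  shows "infinite (zeros_of_mult 1 (\<lambda>z. f z - ratfun_eval b1 z))"
proof
  let ?g = "\<lambda>z. f z - ratfun_eval b1 z"
  assume fin1: "finite (zeros_of_mult 1 ?g)"
  have mer: "f meromorphic_on UNIV" and irrat: "\<And>q. \<not> (\<forall>\<^sub>\<approx>z\<in>UNIV. f z = ratfun_eval q z)"
    using assms(2) by (auto simp: transcendental_meromorphic_def)
  have nzf: "nzm f" using meromorphic_zero_or_nzm[OF mer] irrat[of 0] by simp
  have "\<not> (\<forall>\<^sub>\<approx>z\<in>UNIV. deriv f z = 0)" using deriv_zero_imp_rational[OF mer] irrat by blast
  moreover have "deriv f meromorphic_on UNIV" by (intro meromorphic_intros mer)
  ultimately have nzf': "nzm (deriv f)" using meromorphic_zero_or_nzm by blast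
  have "?g meromorphic_on UNIV" by (intro meromorphic_intros mer ratfun_eval_meromorphic)
  hence nzg: "nzm ?g" using meromorphic_zero_or_nzm[of ?g] irrat[of b1] by simp
  have mult: "{z. zorder ?g z = int n} \<subseteq> zeros_of_mult n ?g" if "n > 0" for n
    using that nzm_frequently_nz[OF nzg] by (auto simp: zeros_of_mult_def)
  \<comment> \<open>In the case of the smaller degree double zeros are also rare, so
    \<open>m = 3\<close> is available. In the other case only simple zeros are rare, and the larger
    \<open>d\<close> makes up for it.\<close>
  obtain d :: nat and m :: int where dm: "d = 1 \<and> m = 3 \<or> d = 2 \<and> m = 2" and deg: "degree P = degree Q + d"
    and few: "finite {z. 0 < zorder ?g z \<and> zorder ?g z < m}"
  proof -
    have z1: "finite {z. zorder ?g z = 1}" using mult[of 1] fin1 finite_subset by fastforce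
    consider "degree P = degree Q + 1" "finite (zeros_of_mult 2 ?g)" | "degree P = degree Q + 2" using assms(7) by blast
    thus ?thesis
    proof cases
      case 1
      have "finite {z. zorder ?g z = 2}" using mult[of 2] 1(2) finite_subset by fastforce
      moreover have "{z. 0 < zorder ?g z \<and> zorder ?g z < 3} \<subseteq> {z. zorder ?g z = 1} \<union> {z. zorder ?g z = 2}" by auto
      ultimately have "finite {z. 0 < zorder ?g z \<and> zorder ?g z < 3}" using z1 finite_subset by blast
      thus ?thesis using 1 that[of 1 3] by simp
    next
      case 2
      have "{z. 0 < zorder ?g z \<and> zorder ?g z < 2} \<subseteq> {z. zorder ?g z = 1}" by auto
      hence "finite {z. 0 < zorder ?g z \<and> zorder ?g z < 2}" using z1 finite_subset by blast
      thus ?thesis using 2 that[of 2 2] by simp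
    qed
  qed
  interpret delay_equation f a b1 P Qhat d m
    using assms(1,4,6) nzf nzf' nzg deg dm few unfolding assms(5) by unfold_locales
  show False using subnormal_imp_rational[OF assms(3)] irrat by blast
qed

end
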